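(* Let $\ell\le m$ be an integer. Consider instances of the Active Prefixes problem (pattern $P$ of length $m$, bit vector $U$, set $\mathcal S$ of strings of total length $N$) in which every $S\in\mathcal S$ has $|S|\in[\tfrac98\ell,\tfrac54\ell)$ and is of type 2. Such instances can be solved in $\tilde{\mathcal{O}}(m^{\omega-1}+N)$ time.
   Context: Active Prefixes (AP) problem: given a string $P$ of length $m$, a bit vector $U$ of size $m$, and a set $\mathcal S$ of strings of total length $N$, output the bit vector $V$ of size $m$ with $V[j]=1$ iff there exist $S\in\mathcal S$ and $i\in[1,m]$ with $U[i]=1$, $P[1..i]\cdot S=P[1..i+|S|]$ and $j=i+|S|$. A period of a string $X$ is an integer $p\in[1,|X|]$ with $X[i]=X[i+p]$ for all $i\le |X|-p$; $\mathrm{per}(X)$ is the smallest period. $X$ is strongly periodic if $\mathrm{per}(X)\le |X|/4$. A string $S$ is of type 2 (with respect to $\ell$) if it contains at least one length-$\ell$ substring that is not strongly periodic and at least one length-$\ell$ substring that is strongly periodic. $\omega$ is the matrix multiplication exponent; $\tilde{\mathcal{O}}$ suppresses polylogarithmic factors. *)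

theory Defs
  imports Complex_Main "HOL-Library.Sublist" "Jordan_Normal_Form.Matrix"
begin

text \<open>
  Periodicity. Positions are 0-based here, whereas the informal convention is 1-based.
  \<open>per\<close> is meaningful for nonempty strings only.
\<close>

definition is_period :: "nat \<Rightarrow> 'a list \<Rightarrow> bool" where
  "is_period p X \<longleftrightarrow> 1 \<le> p \<and> p \<le> length X \<and> (\<forall>i. i + p < length X \<longrightarrow> X ! i = X ! (i + p))"

definition per :: "'a list \<Rightarrow> nat" where
  "per X = (LEAST p. is_period p X)"

definition strongly_periodic :: "'a list \<Rightarrow> bool" where
  "strongly_periodic X \<longleftrightarrow> real (per X) \<le> real (length X) / 4"

definition type2 :: "nat \<Rightarrow> 'a list \<Rightarrow> bool" where
  "type2 l S \<longleftrightarrow>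
     (\<exists>X. sublist X S \<and> length X = l \<and> \<not> strongly_periodic X) \<and>
     (\<exists>X. sublist X S \<and> length X = l \<and> strongly_periodic X)"

text \<open>
  The output vector of Active Prefixes: for \<open>j \<in> {1..m}\<close>, its entry with 0-based
  index \<open>j - 1\<close> is \<open>V[j]\<close>; likewise \<open>U ! (i - 1)\<close> is \<open>U[i]\<close>.
\<close>

definition active_prefixes :: "'a list \<Rightarrow> bool list \<Rightarrow> 'a list set \<Rightarrow> bool list" where
  "active_prefixes P U \<S> =
     map (\<lambda>j. \<exists>S\<in>\<S>. \<exists>i\<in>{1..length P}.
            U ! (i - 1) \<and> take i P @ S = take (i + length S) P \<and> j = i + length S)
       [1..<length P + 1]"

text \<open>
  A deterministic word RAM with \<open>w\<close>-bit words and unit-cost instructions. There are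
  registers, addressed by constants of the program, and a separate memory accessed through
  addresses held in registers. \<open>Load d a\<close> is \<open>R[d] := M[R[a]]\<close>, \<open>Store a s\<close> is
  \<open>M[R[a]] := R[s]\<close>, and \<open>Jz r n\<close> jumps to instruction \<open>n\<close> if \<open>R[r] = 0\<close>.
\<close>

datatype binop = Add | Sub | Mul | Div | Mod | BAnd | BOr | BXor | Shl | Shr | Lt | Eq

datatype instr =
    Const nat nat
  | Op binop nat nat nat
  | Load nat nat
  | Store nat nat
  | Jz nat nat

text \<open>Arguments are assumed below \<open>2 ^ w\<close>, and subtraction wraps around.\<close>

fun eval_op :: "nat \<Rightarrow> binop \<Rightarrow> nat \<Rightarrow> nat \<Rightarrow> nat" where
  "eval_op w Add x y = (x + y) mod 2 ^ w"
| "eval_op w Sub x y = (x + 2 ^ w - y) mod 2 ^ w"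
| "eval_op w Mul x y = (x * y) mod 2 ^ w"
| "eval_op w Div x y = (x div y) mod 2 ^ w"
| "eval_op w Mod x y = (x mod y) mod 2 ^ w"
| "eval_op w BAnd x y = semiring_bit_operations_class.and x y mod 2 ^ w"
| "eval_op w BOr x y = semiring_bit_operations_class.or x y mod 2 ^ w"
| "eval_op w BXor x y = semiring_bit_operations_class.xor x y mod 2 ^ w"
| "eval_op w Shl x y = push_bit y x mod 2 ^ w"
| "eval_op w Shr x y = drop_bit y x mod 2 ^ w"
| "eval_op w Lt x y = of_bool (x < y) mod 2 ^ w"
| "eval_op w Eq x y = of_bool (x = y) mod 2 ^ w"

text \<open>Program counter, registers, memory.\<close>

type_synonym config = "nat \<times> (nat \<Rightarrow> nat) \<times> (nat \<Rightarrow> nat)"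

fun exec :: "nat \<Rightarrow> instr \<Rightarrow> config \<Rightarrow> config" where
  "exec w (Const d k) (pc, R, M) = (pc + 1, R(d := k mod 2 ^ w), M)"
| "exec w (Op f d a b) (pc, R, M) = (pc + 1, R(d := eval_op w f (R a) (R b)), M)"
| "exec w (Load d a) (pc, R, M) = (pc + 1, R(d := M (R a)), M)"
| "exec w (Store a s) (pc, R, M) = (pc + 1, R, M(R a := R s))"
| "exec w (Jz r n) (pc, R, M) = (if R r = 0 then n else pc + 1, R, M)"

definition step :: "nat \<Rightarrow> instr list \<Rightarrow> config \<Rightarrow> config" where
  "step w prog c = (if fst c < length prog then exec w (prog ! fst c) c else c)"

text \<open>
  The input occupies the memory from address 0 on, its length is in register 0, and
  everything else is 0. A computation halts by leaving the program; the output then is the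
  memory block whose start address is in register 0 and whose length is in register 1.
\<close>

definition initial_config :: "nat \<Rightarrow> nat list \<Rightarrow> config" where
  "initial_config w xs =
     (0, (\<lambda>_. 0)(0 := length xs mod 2 ^ w), \<lambda>a. if a < length xs then xs ! a else 0)"

definition outputs_after :: "nat \<Rightarrow> instr list \<Rightarrow> nat list \<Rightarrow> nat list \<Rightarrow> nat \<Rightarrow> bool" where
  "outputs_after w prog xs ys t \<longleftrightarrow>
     (\<exists>pc R M. (step w prog ^^ t) (initial_config w xs) = (pc, R, M) \<and>
        length prog \<le> pc \<and> R 1 = length ys \<and> (\<forall>i<length ys. M (R 0 + i) = ys ! i))"

text \<open>
  The problem that maps each \<open>x \<in> I\<close>, encoded as \<open>enc x\<close>, to \<open>out x\<close> is solved in
  time soft-O of \<open>T\<close>. One program has to work for every word length that is at least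
  logarithmic in the input size and suffices to store each number of the input and of
  the output. The polylogarithmic factor is in the input size, and the summand 1 only
  accounts for instances with \<open>T x < 1\<close>, where some constant time is still spent.
\<close>

definition solvable_in_soft_O ::
    "'i set \<Rightarrow> ('i \<Rightarrow> nat list) \<Rightarrow> ('i \<Rightarrow> nat list) \<Rightarrow> ('i \<Rightarrow> real) \<Rightarrow> bool" where
  "solvable_in_soft_O I enc out T \<longleftrightarrow>
     (\<exists>prog (c::real) (C::real) (k::nat). \<forall>x\<in>I. \<forall>w.
        c * log 2 (real (length (enc x)) + 2) \<le> real w \<and>
        (\<forall>v \<in> set (enc x) \<union> set (out x). v < 2 ^ w) \<longrightarrow>
        (\<exists>t. outputs_after w prog (enc x) (out x) t \<and>
             real t \<le> C * log 2 (real (length (enc x)) + 2) ^ k * (T x + 1)))"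

text \<open>
  Multiplication of square matrices of nonnegative integers, in row-major order. The
  exponent is the infimum of all achievable exponents; it need not be achievable itself.
\<close>

definition mm_instances :: "(nat mat \<times> nat mat) set" where
  "mm_instances = {(A, B). \<exists>n. A \<in> carrier_mat n n \<and> B \<in> carrier_mat n n}"

definition mm_encode :: "nat mat \<times> nat mat \<Rightarrow> nat list" where
  "mm_encode = (\<lambda>(A, B). dim_row A # concat (mat_to_list A) @ concat (mat_to_list B))"

definition mm_output :: "nat mat \<times> nat mat \<Rightarrow> nat list" where
  "mm_output = (\<lambda>(A, B). concat (mat_to_list (A * B)))"

definition mm_exponents :: "real set" where
  "mm_exponents =
     {\<tau>. solvable_in_soft_O mm_instances mm_encode mm_output
           (\<lambda>(A, B). real (dim_row A) powr \<tau>)}"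

definition mm_exponent :: real where
  "mm_exponent = Inf mm_exponents"

text \<open>
  Instances \<open>(l, P, U, Ss)\<close>, where the list \<open>Ss\<close> enumerates the set of strings. Letters
  are natural numbers; being part of the input, they are arbitrary machine words.
\<close>

type_synonym ap_instance = "nat \<times> nat list \<times> bool list \<times> nat list list"

definition type2_instances :: "ap_instance set" where
  "type2_instances =
     {(l, P, U, Ss). l \<le> length P \<and> length U = length P \<and> distinct Ss \<and>
        (\<forall>S\<in>set Ss. 9 / 8 * real l \<le> real (length S) \<and> real (length S) < 5 / 4 * real l \<and>
                     type2 l S)}"

definition ap_encode :: "ap_instance \<Rightarrow> nat list" where
  "ap_encode = (\<lambda>(l, P, U, Ss).
     l # length P # P @ map of_bool U @ length Ss # concat (map (\<lambda>S. length S # S) Ss))"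

definition ap_output :: "ap_instance \<Rightarrow> nat list" where
  "ap_output = (\<lambda>(l, P, U, Ss). map of_bool (active_prefixes P U (set Ss)))"

definition total_length :: "'a list list \<Rightarrow> nat" where
  "total_length Ss = sum_list (map length Ss)"

end

theory Submission
  imports Defs
begin

text \<open>
  A string of type 2 has a switch: two consecutive windows of length \<open>l\<close> exactly one of which is
  strongly periodic. Every occurrence in \<open>P\<close> aligns the first switch with a switch of \<open>P\<close>, called
  an anchor, and \<open>P\<close> has only \<open>O(m / l)\<close> anchors, because strongly periodic windows at distance at
  most \<open>l / 2\<close> share their period. A string therefore splits into a left and a right part, which
  have to be prefixes of the left and the right context of an anchor. In the trie of all contexts
  every path meets logarithmically many heavy paths; anchors and strings are grouped by a pair of
  heavy path heads, and within a group a string is just a pair of depths. For \<open>2 l\<close> anchors of a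
  group at a time, the occurrences of all strings of the group are read off the product of two
  \<open>2 l \<times> 2 l\<close> matrices: (anchor, left depth) to active start, and (left depth, right depth) to
  string. This makes \<open>O(m / l\<^sup>2)\<close> products up to logarithmic factors, so \<open>2 \<le> \<tau>\<close> gives time
  \<open>m powr (\<tau> - 1)\<close> for every achievable exponent \<open>\<tau>\<close>.
\<close>

section \<open>Running code fragments\<close>

text \<open>An achievable exponent provides nothing but an unknown program with a guarantee for
  every sufficient word length, and this program has to run next to other data. It is executed as if
  words had only \<open>w'\<close> bits, with \<open>w'\<close> logarithmic in the input length: it
  then reaches only \<open>2 ^ w'\<close> cells, polynomially many, and its memory fits into one row
  of an array. Every call gets a fresh row, because the cells behind its input must be 0 and
  clearing them would be too slow.

  The first switch of a string lands on a switch of the pattern because strong periodicity of a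
  window depends on its letters only. A pair of depths can stand for a string because a node has at
  most one heavy child and is therefore determined by its depth and the head of its heavy path.

  A group whose size is not a multiple of \<open>2 * l\<close> leaves fewer than
  \<open>2 * l\<close> anchors over. Each string of the group is compared with them directly; this
  takes \<open>O(l)\<close> steps, linear in the length of the string, which exceeds
  \<open>l\<close>.

  Letters are arbitrary words of the outer machine. They are first replaced by small names that can
  serve as array indices.\<close>

primrec code_at :: "instr list \<Rightarrow> nat \<Rightarrow> instr list \<Rightarrow> bool" where
 "code_at P p [] \<longleftrightarrow> True"
| "code_at P p (i # c) \<longleftrightarrow> p < length P & P ! p = i & code_at P (Suc p) c"

lemma code_at_append: "code_at P p (c @ d) \<longleftrightarrow> code_at P p c & code_at P (p + length c) d"
 by (induction c arbitrary: p) auto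

lemma code_at_self: "code_at (xs @ c @ ys) (length xs) c"
proof (induction c arbitrary: xs)
 case (Cons i c)
 from Cons[of "xs @ [i]"] show ?case by (simp add: nth_append)
qed simp

lemma steps_add:
 "(step w P ^^ n) s = s' ==> (step w P ^^ m) s' = s'' ==> (step w P ^^ (n + m)) s = s''"
 by (subst add.commute) (simp add: funpow_add)

lemma steps_halted: "length P <= fst s ==> (step w P ^^ n) s = s"
 by (induction n) (auto simp: step_def)

fun is_jump :: "instr \<Rightarrow> bool" where
 "is_jump (Jz _ _) = True"
| "is_jump _ = False"

type_synonym store = "(nat \<Rightarrow> nat) \<times> (nat \<Rightarrow> nat)"

text \<open>Jump-free code never looks at the program counter, so a dummy 0 is passed to
  \<open>exec\<close> and only the store is kept.\<close>

primrec straight :: "nat \<Rightarrow> instr list \<Rightarrow> store \<Rightarrow> store" where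
 "straight w [] s = s"
| "straight w (i # c) s = straight w c (snd (exec w i (0, s)))"

lemma straight_append: "straight w (c @ d) s = straight w d (straight w c s)"
 by (induction c arbitrary: s) auto

lemma step_nonjump:
 assumes "p < length P" "P ! p = i" "\<not> is_jump i"
 shows "step w P (p, s) = (Suc p, snd (exec w i (0, s)))"
 using assms by (cases i; cases s) (auto simp: step_def)

lemma steps_straight:
 assumes "code_at P p c" "list_all (Not \<circ> is_jump) c"
 shows "(step w P ^^ length c) (p, s) = (p + length c, straight w c s)"
 using assms
proof (induction c arbitrary: p s)
 case (Cons i c)
 then have "step w P (p, s) = (Suc p, snd (exec w i (0, s)))"
  by (intro step_nonjump) auto
 with Cons show ?case
  by (simp add: funpow_swap1 del: straight.simps) (simp add: funpow_swap1[symmetric])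
qed simp

section \<open>A structured language\<close>

datatype exp =
  Cn nat
 | Vr nat
 | Ar nat exp exp
 | Lo exp
 | Hi exp
 | Bin binop exp exp

text \<open>Two statements exist for one purpose each. \<open>Acc\<close> adds a product of two
  input words to a cell that may hold a full word; it serves the cubic multiplication program that
  makes \<open>mm_exponents\<close> nonempty. \<open>Call\<close> runs a fixed foreign program, in
  which the fast matrix product is hidden.\<close>

datatype com =
  Skip
 | Asg nat exp
 | St nat exp exp exp
 | StHi exp exp
 | Acc exp exp exp
 | Sq com com
 | Cond exp com com
 | For nat exp com
 | Call

type_synonym vars = "nat \<Rightarrow> nat"
type_synonym arrays = "nat \<Rightarrow> nat \<Rightarrow> nat \<Rightarrow> nat"

text \<open>Semantics over the natural numbers, without overflow. \<open>Sub\<close> is truncated,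
  which is why its compiled form needs extra instructions. Bit operations are excluded by
  \<open>wf_exp\<close>, so their default value 0 is never met.\<close>

fun ideal_op :: "binop \<Rightarrow> nat \<Rightarrow> nat \<Rightarrow> nat" where
 "ideal_op Add x y = x + y"
| "ideal_op Sub x y = x - y"
| "ideal_op Mul x y = x * y"
| "ideal_op Div x y = x div y"
| "ideal_op Mod x y = x mod y"
| "ideal_op Lt x y = of_bool (x < y)"
| "ideal_op Eq x y = of_bool (x = y)"
| "ideal_op _ x y = 0"

text \<open>
 Array 0 holds the input in its row 0. Input words are unbounded, so expressions only see
 them through their residue modulo \<open>Z\<close> (\<open>Lo\<close>) or as an index, after division by \<open>Z\<close>, into
 array 31 (\<open>Hi\<close>). Array 30 has full words as entries, too, and is only used by \<open>Acc\<close>.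
\<close>

primrec val :: "nat \<Rightarrow> exp \<Rightarrow> vars \<Rightarrow> arrays \<Rightarrow> nat" where
 "val Z (Cn k) v a = k"
| "val Z (Vr x) v a = v x"
| "val Z (Ar k e1 e2) v a = a k (val Z e1 v a) (val Z e2 v a)"
| "val Z (Lo e) v a = a 0 0 (val Z e v a) mod Z"
| "val Z (Hi e) v a = a 31 0 (a 0 0 (val Z e v a) div Z)"
| "val Z (Bin f e1 e2) v a = ideal_op f (val Z e1 v a) (val Z e2 v a)"

text \<open>A syntactic size bound: values stay below \<open>Z ^ deg e\<close>. A sum costs one more
  power, because \<open>2 <= Z\<close>; differences, quotients and remainders are at most their
  first argument, and truth values are below \<open>Z\<close>.\<close>

primrec deg :: "exp \<Rightarrow> nat" where
 "deg (Cn k) = 1"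
| "deg (Vr x) = 1"
| "deg (Ar k e1 e2) = 1"
| "deg (Lo e) = 1"
| "deg (Hi e) = 1"
| "deg (Bin f e1 e2) =
  (if f = Add then max (deg e1) (deg e2) + 1 else if f = Mul then deg e1 + deg e2 else deg e1)"

text \<open>Degree at most 4 keeps an index below \<open>Z ^ 4\<close>, the side length of an array,
  and degree at most 8 keeps a value below \<open>2 ^ w\<close>. Constants below 16 are below
  \<open>Z\<close>, and only the registers below 40 are variables.\<close>

primrec wf_exp :: "exp \<Rightarrow> bool" where
 "wf_exp (Cn k) \<longleftrightarrow> k < 16"
| "wf_exp (Vr x) \<longleftrightarrow> x < 40"
| "wf_exp (Ar k e1 e2) \<longleftrightarrow>
  1 <= k & k < 30 & wf_exp e1 & wf_exp e2 & deg e1 <= 4 & deg e2 <= 4"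
| "wf_exp (Lo e) \<longleftrightarrow> wf_exp e & deg e <= 4"
| "wf_exp (Hi e) \<longleftrightarrow> wf_exp e & deg e <= 4"
| "wf_exp (Bin f e1 e2) \<longleftrightarrow> f \<in> {Add, Sub, Mul, Div, Mod, Lt, Eq} &
  wf_exp e1 & wf_exp e2 & deg (Bin f e1 e2) <= 8"

primrec wf_com :: "com \<Rightarrow> bool" where
 "wf_com Skip \<longleftrightarrow> True"
| "wf_com (Asg x e) \<longleftrightarrow> x < 40 & wf_exp e"
| "wf_com (St k e1 e2 e3) \<longleftrightarrow> wf_exp (Ar k e1 e2) & wf_exp e3"
| "wf_com (StHi e1 e2) \<longleftrightarrow> wf_exp (Hi e1) & wf_exp e2"
| "wf_com (Acc e0 e1 e2) \<longleftrightarrow> wf_exp (Lo e0) & wf_exp (Lo e1) & wf_exp (Lo e2)"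
| "wf_com (Sq c1 c2) \<longleftrightarrow> wf_com c1 & wf_com c2"
| "wf_com (Cond e c1 c2) \<longleftrightarrow> wf_exp e & wf_com c1 & wf_com c2"
| "wf_com (For x e c) \<longleftrightarrow> x < 40 & wf_exp e & wf_com c"
| "wf_com Call \<longleftrightarrow> True"

text \<open>
 Register usage of compiled code: the variables are in the registers below 40, \<open>Z\<close> in 40,
 \<open>Z ^ 4\<close> in 41; 42 and 43 serve the subroutine, whose own registers start at 44. Scratch
 registers come after them.
\<close>

definition adr_code :: "nat \<Rightarrow> nat \<Rightarrow> instr list" where
 "adr_code h k =
  [Const (h + 2) k, Op Mul (h + 2) (h + 2) 41, Op Add h h (h + 2), Op Mul h h 41,
   Op Add h h (h + 1)]"

definition hi_code :: "nat \<Rightarrow> instr list" where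
 "hi_code h =
  [Load h h, Op Div h h 40, Const (h + 1) 31, Op Mul (h + 1) (h + 1) 41,
   Op Mul (h + 1) (h + 1) 41, Op Add h h (h + 1)]"

text \<open>Machine subtraction wraps around. The wrapped difference is multiplied by the truth
  value of \<open>\<not> x < y\<close>, which gives 0 exactly where truncation does.\<close>

definition bin_code :: "nat \<Rightarrow> binop \<Rightarrow> instr list" where
 "bin_code h f =
  (if f = Sub then
    [Op Lt (h + 2) h (h + 1), Const (h + 3) 0, Op Eq (h + 2) (h + 2) (h + 3),
    Op Sub h h (h + 1), Op Mul h h (h + 2)]
   else [Op f h h (h + 1)])"

definition mov_code :: "nat \<Rightarrow> nat \<Rightarrow> nat \<Rightarrow> instr list" where
 "mov_code d s t = [Const t 0, Op Add d s t]"

text \<open>The registers from \<open>h\<close> on are used as a stack: the value ends up in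
  \<open>h\<close>, intermediate results lie above it, and everything below \<open>h\<close>
  survives.\<close>

primrec exp_code :: "nat \<Rightarrow> exp \<Rightarrow> instr list" where
 "exp_code h (Cn k) = [Const h k]"
| "exp_code h (Vr x) = mov_code h x h"
| "exp_code h (Ar k e1 e2) = exp_code h e1 @ exp_code (h + 1) e2 @ adr_code h k @ [Load h h]"
| "exp_code h (Lo e) = exp_code h e @ [Load h h, Op Mod h h 40]"
| "exp_code h (Hi e) = exp_code h e @ hi_code h @ [Load h h]"
| "exp_code h (Bin f e1 e2) = exp_code h e1 @ exp_code (h + 1) e2 @ bin_code h f"

fun instr_regs :: "instr \<Rightarrow> nat" where
 "instr_regs (Const d k) = Suc d"
| "instr_regs (Op f d a b) = Suc (max d (max a b))"
| "instr_regs (Load d a) = Suc (max d a)"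
| "instr_regs (Store a s) = Suc (max a s)"
| "instr_regs (Jz r n) = Suc r"

text \<open>At least 1, so that register 0 of the subroutine, which carries the input length and
  later the address of the output, always has a simulated counterpart.\<close>

definition num_regs :: "instr list \<Rightarrow> nat" where
 "num_regs pr = foldr (\<lambda>i. max (instr_regs i)) pr 1"

text \<open>
 The variables of the subroutine call: the row of array 12 it runs on, its initial
 register 0, the modulus \<open>2 ^ w'\<close> of the simulated machine, and its final register 0.
\<close>

abbreviation "xrow \<equiv> 20 :: nat"
abbreviation "xlen \<equiv> 21 :: nat"
abbreviation "xmod \<equiv> 22 :: nat"
abbreviation "xres \<equiv> 23 :: nat"

text \<open>Every instruction becomes exactly two, a jump being padded by a dummy, so the code of
  instruction \<open>n\<close> starts at \<open>p + 2 * n\<close>. A jump past the end of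
  \<open>pr\<close> is redirected to its end. Results are reduced modulo \<open>2 ^ w'\<close>,
  which is kept in the register of variable \<open>xmod\<close>, and addresses are shifted by the
  base in register 42.\<close>

fun sim_code :: "nat \<Rightarrow> instr list \<Rightarrow> instr \<Rightarrow> instr list" where
 "sim_code p pr (Const d k) = [Const (44 + d) k, Op Mod (44 + d) (44 + d) xmod]"
| "sim_code p pr (Op f d a b) =
  [Op f (44 + d) (44 + a) (44 + b), Op Mod (44 + d) (44 + d) xmod]"
| "sim_code p pr (Load d a) = [Op Add 43 (44 + a) 42, Load (44 + d) 43]"
| "sim_code p pr (Store a s) = [Op Add 43 (44 + a) 42, Store 43 (44 + s)]"
| "sim_code p pr (Jz r n) = [Jz (44 + r) (p + 2 * min n (length pr)), Const 43 0]"

definition call_init :: "instr list \<Rightarrow> instr list" where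
 "call_init pr = map (\<lambda>r. Const (44 + r) 0) [0..<num_regs pr] @ mov_code 44 xlen 43 @
  [Const 42 12, Op Mul 42 42 41, Op Add 42 42 xrow, Op Mul 42 42 41]"

definition call_code :: "nat \<Rightarrow> instr list \<Rightarrow> instr list" where
 "call_code p pr = call_init pr @
  concat (map (sim_code (p + length (call_init pr)) pr) pr) @ mov_code xres 44 43"

primrec com_len :: "instr list \<Rightarrow> com \<Rightarrow> nat" where
 "com_len pr Skip = 0"
| "com_len pr (Asg x e) = length (exp_code 0 e) + 2"
| "com_len pr (St k e1 e2 e3) =
  length (exp_code 0 e1) + length (exp_code 0 e2) + 5 + length (exp_code 0 e3) + 1"
| "com_len pr (StHi e1 e2) = length (exp_code 0 e1) + 6 + length (exp_code 0 e2) + 1"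
| "com_len pr (Acc e0 e1 e2) =
  length (exp_code 0 e0) + length (exp_code 0 e1) + length (exp_code 0 e2) + 12"
| "com_len pr (Sq c1 c2) = com_len pr c1 + com_len pr c2"
| "com_len pr (Cond e c1 c2) = length (exp_code 0 e) + com_len pr c1 + com_len pr c2 + 3"
| "com_len pr (For x e c) = length (exp_code 0 e) + com_len pr c + 9"
| "com_len pr Call = length (call_code 0 pr)"

text \<open>A loop keeps its counter in \<open>h\<close> and its bound in \<open>h + 1\<close>; the
  loop variable receives only a copy. The body may therefore assign to the loop variable and to the
  variables of the bound without affecting the number of rounds. The last \<open>Jz\<close> tests a
  register just set to 0, so it is an unconditional jump.\<close>

primrec com_code :: "instr list \<Rightarrow> nat \<Rightarrow> nat \<Rightarrow> com \<Rightarrow> instr list" where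
 "com_code pr p h Skip = []"
| "com_code pr p h (Asg x e) = exp_code h e @ mov_code x h (h + 1)"
| "com_code pr p h (St k e1 e2 e3) =
  exp_code h e1 @ exp_code (h + 1) e2 @ adr_code h k @ exp_code (h + 1) e3 @
  [Store h (h + 1)]"
| "com_code pr p h (StHi e1 e2) =
  exp_code h e1 @ hi_code h @ exp_code (h + 1) e2 @ [Store h (h + 1)]"
| "com_code pr p h (Acc e0 e1 e2) =
  [Const h 0] @ exp_code (h + 1) e0 @ adr_code h 30 @
  exp_code (h + 1) e1 @ [Load (h + 1) (h + 1)] @ exp_code (h + 2) e2 @
  [Load (h + 2) (h + 2), Op Mul (h + 1) (h + 1) (h + 2), Load (h + 2) h,
   Op Add (h + 1) (h + 1) (h + 2), Store h (h + 1)]"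
| "com_code pr p h (Sq c1 c2) = com_code pr p h c1 @ com_code pr (p + com_len pr c1) h c2"
| "com_code pr p h (Cond e c1 c2) =
  (let p1 = p + length (exp_code 0 e) + 1; p2 = p1 + com_len pr c1 + 2 in
   exp_code h e @ [Jz h p2] @ com_code pr p1 h c1 @
   [Const h 0, Jz h (p2 + com_len pr c2)] @ com_code pr p2 h c2)"
| "com_code pr p h (For x e c) =
  (let q = p + length (exp_code 0 e) + 1; q1 = q + 4 + com_len pr c in
   exp_code (h + 1) e @ [Const h 0] @
   [Op Lt (h + 2) h (h + 1), Jz (h + 2) (q1 + 4)] @ mov_code x h (h + 2) @
   com_code pr (q + 4) (h + 2) c @
   [Const (h + 2) 1, Op Add h h (h + 2), Const (h + 2) 0, Jz (h + 2) q])"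
| "com_code pr p h Call = call_code p pr"

lemma length_bin_code: "length (bin_code h f) = length (bin_code 0 f)"
 by (simp add: bin_code_def)

lemma length_exp_code: "length (exp_code h e) = length (exp_code 0 e)"
proof (induction e arbitrary: h)
 case (Ar k e1 e2)
 from Ar(1)[of h] Ar(2)[of "h + 1"] Ar(2)[of 1] show ?case by (simp add: adr_code_def)
next
 case (Bin f e1 e2)
 from Bin(1)[of h] Bin(2)[of "h + 1"] Bin(2)[of 1] show ?case
  by (simp add: length_bin_code[of h])
qed (auto simp: mov_code_def hi_code_def)

lemma length_sim_code: "length (sim_code p pr i) = 2"
 by (cases i) auto

lemma length_call_code: "length (call_code p pr) = length (call_init pr) + 2 * length pr + 2"
proof -
 have "length (concat (map (sim_code q pr) xs)) = 2 * length xs" for q xs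
  by (induction xs) (auto simp: length_sim_code)
 then show ?thesis by (simp add: call_code_def mov_code_def)
qed

lemma length_com_code: "length (com_code pr p h c) = com_len pr c"
proof (induction c arbitrary: p h)
 case (St k e1 e2 e3)
 show ?case by (simp add: length_exp_code[of "Suc h"] length_exp_code[of h] adr_code_def)
next
 case (StHi e1 e2)
 show ?case by (simp add: length_exp_code[of "Suc h"] length_exp_code[of h] hi_code_def)
next
 case (Acc e0 e1 e2)
 show ?case by (simp add: length_exp_code[of "Suc h"] length_exp_code[of "Suc (Suc h)"]
   length_exp_code[of h] adr_code_def)
next
 case (For x e c)
 then show ?case by (simp add: Let_def mov_code_def length_exp_code[of "Suc h"])
next
 case (Asg x e)
 show ?case by (simp add: mov_code_def length_exp_code[of h])
next
 case (Cond e c1 c2)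
 then show ?case by (simp add: Let_def length_exp_code[of h])
qed (simp_all add: length_call_code)

section \<open>Correctness of compiled expressions\<close>

text \<open>Origin of 64 and 16: arrays 0 to 30 occupy \<open>31 * Z ^ 8\<close> cells, less than
  half of the memory, and array 31 needs about \<open>2 ^ w / Z\<close> more, at most a sixteenth.
  All addresses stay below \<open>2 ^ w\<close>.\<close>

locale word_ram =
 fixes w Z :: nat
 assumes Z_ge: "16 <= Z" and word_ge: "64 * Z ^ 8 <= 2 ^ w"
begin

definition Y :: nat where "Y = Z ^ 4"

definition adr :: "nat \<Rightarrow> nat \<Rightarrow> nat \<Rightarrow> nat" where
 "adr k i j = (k * Y + i) * Y + j"

text \<open>Array 31 is indexed by quotients of arbitrary words by \<open>Z\<close>, hence its
  single row that is longer than \<open>Y\<close>.\<close>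

definition valid :: "nat \<Rightarrow> nat \<Rightarrow> nat \<Rightarrow> bool" where
 "valid k i j \<longleftrightarrow> k < 31 & i < Y & j < Y \<or> k = 31 & i = 0 & j <= 2 ^ w div Z"

definition bounded :: "vars \<Rightarrow> arrays \<Rightarrow> bool" where
 "bounded v a \<longleftrightarrow> (\<forall>x. v x < Z) & (\<forall>k i j. k ~= 0 --> k ~= 30 --> a k i j < Z) &
  (\<forall>k i j. a k i j < 2 ^ w)"

definition rel :: "vars \<Rightarrow> arrays \<Rightarrow> store \<Rightarrow> bool" where
 "rel v a s \<longleftrightarrow> (\<forall>x<40. fst s x = v x) & fst s 40 = Z & fst s 41 = Y &
  (\<forall>k i j. valid k i j --> snd s (adr k i j) = a k i j)"

lemma Y_sq: "64 * (Y * Y) <= 2 ^ w"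
 using word_ge by (simp add: Y_def flip: power_add)

lemma Z_le_Y: "Z <= Y"
proof -
 have "Z ^ 1 <= Z ^ 4" using Z_ge by (intro power_increasing) auto
 then show ?thesis by (simp add: Y_def)
qed

lemma Y_ge: "16 <= Y"
 using Z_le_Y Z_ge by simp

lemma Y_less: "64 * Y <= 2 ^ w"
proof -
 have "Y <= Y * Y" by (rule le_square)
 then show ?thesis using Y_sq by linarith
qed

lemma adr_less: "k < 31 ==> i < Y ==> j < Y ==> adr k i j < 31 * (Y * Y)"
proof -
 assume a: "k < 31" "i < Y" "j < Y"
 have "k * Y + i < (k + 1) * Y" using a by simp
 also have "\<dots> <= 31 * Y" using a by (intro mult_right_mono) auto
 finally have "(k * Y + i + 1) * Y <= (31 * Y) * Y" by (intro mult_right_mono) auto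
 then show ?thesis using a unfolding adr_def by (simp add: algebra_simps)
qed

lemma adr_hi: "adr 31 0 j = 31 * (Y * Y) + j"
 by (simp add: adr_def)

lemma adr_less_word: "valid k i j ==> adr k i j < 2 ^ w"
proof -
 assume v: "valid k i j"
 have p: "0 < Y * Y" using Y_ge by simp
 have "16 * ((2::nat) ^ w div Z) <= Z * (2 ^ w div Z)" using Z_ge by (intro mult_right_mono) auto
 also have "\<dots> <= 2 ^ w" by simp
 finally have "16 * ((2::nat) ^ w div Z) <= 2 ^ w" .
 then have "31 * (Y * Y) + j < 2 ^ w" if "j <= 2 ^ w div Z"
  using that Y_sq p by linarith
 with v Y_sq adr_less[of k i j] p show ?thesis
  by (cases "k < 31") (force simp: valid_def adr_hi)+
qed

text \<open>Below array 31, an address is a number in base \<open>Y\<close> with digits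
  \<open>k\<close>, \<open>i\<close>, \<open>j\<close>; array 31 lies entirely above those
  addresses.\<close>

lemma adr_inj:
 assumes "valid k i j" "valid k' i' j'" "adr k i j = adr k' i' j'"
 shows "k = k' & i = i' & j = j'"
proof (cases "k < 31 & k' < 31")
 case True
 then have a: "i < Y" "j < Y" "i' < Y" "j' < Y" using assms by (auto simp: valid_def)
 have "(k * Y + i) = adr k i j div Y" "(k' * Y + i') = adr k' i' j' div Y"
  "j = adr k i j mod Y" "j' = adr k' i' j' mod Y" using a by (auto simp: adr_def)
 then have e: "k * Y + i = k' * Y + i'" "j = j'" using assms by auto
 have "k = (k * Y + i) div Y" "k' = (k' * Y + i') div Y" "i = (k * Y + i) mod Y"
  "i' = (k' * Y + i') mod Y" using a by auto
 with e show ?thesis by metis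
next
 case False
 with assms adr_less[of k i j] adr_less[of k' i' j'] show ?thesis
  by (auto simp: valid_def adr_hi)
qed

lemma deg_pos: "1 <= deg e"
 by (induction e) auto

lemma Z_pow_mono: "a <= b ==> Z ^ a <= Z ^ b"
 using Z_ge by (intro power_increasing) auto

lemma val_less: "bounded v a ==> wf_exp e ==> val Z e v a < Z ^ deg e"
proof (induction e)
 case (Bin f e1 e2)
 let ?x = "val Z e1 v a" and ?y = "val Z e2 v a"
 have x: "?x < Z ^ deg e1" and y: "?y < Z ^ deg e2" using Bin by auto
 have 1: "(of_bool b :: nat) < Z ^ deg e1" for b
 proof -
  have "Z ^ 1 <= Z ^ deg e1" by (intro Z_pow_mono deg_pos)
  then show ?thesis using Z_ge by (cases b) auto
 qed
 have add: "?x + ?y < Z ^ (max (deg e1) (deg e2) + 1)"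
 proof -
  let ?M = "Z ^ max (deg e1) (deg e2)"
  have "?x < ?M" "?y < ?M"
   using x y Z_pow_mono[of "deg e1" "max (deg e1) (deg e2)"]
    Z_pow_mono[of "deg e2" "max (deg e1) (deg e2)"] by auto
  then have "?x + ?y < 2 * ?M" by simp
  also have "\<dots> <= Z * ?M" using Z_ge by (intro mult_right_mono) auto
  finally show ?thesis by simp
 qed
 have mul: "?x * ?y < Z ^ (deg e1 + deg e2)"
  using x y by (simp only: power_add mult_strict_mono')
 have div: "?x div ?y < Z ^ deg e1" using x div_le_dividend le_less_trans by blast
 have mod: "?x mod ?y < Z ^ deg e1" using x mod_less_eq_dividend le_less_trans by blast
 have sub: "?x - ?y < Z ^ deg e1" using x by simp
 have "f \<in> {Add, Sub, Mul, Div, Mod, Lt, Eq}" using Bin.prems by simp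
 then show ?case
  unfolding insert_iff empty_iff
  by (elim disjE)
   (use add mul div mod sub 1 in \<open>simp_all only: ideal_op.simps val.simps deg.simps
    binop.distinct if_True if_False simp_thms\<close>)
qed (use Z_ge in \<open>auto simp: bounded_def\<close>)

lemma val_less_word: "bounded v a ==> wf_exp e ==> val Z e v a < 2 ^ w"
proof -
 assume b: "bounded v a" "wf_exp e"
 have "deg e <= 8" using b(2) by (cases e) auto
 with val_less[OF b] have "val Z e v a < Z ^ 8"
  using Z_pow_mono[of "deg e" 8] by simp
 then show ?thesis using word_ge by simp
qed

lemma val_less_Y: "bounded v a ==> wf_exp e ==> deg e <= 4 ==> val Z e v a < Y"
 using val_less[of v a e] Z_pow_mono[of "deg e" 4] by (simp add: Y_def)

lemma rel_cong:
 "rel v a (R, M) ==> \<forall>r<44. R' r = R r ==> rel v a (R', M)"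
 by (simp add: rel_def)

lemma adr_0 [simp]: "adr 0 0 j = j"
 by (simp add: adr_def)

lemma rel_mem: "rel v a (R, M) ==> valid k i j ==> M (adr k i j) = a k i j"
 by (simp add: rel_def)

lemma straight_adr:
 assumes "R 41 = Y" "R h < Y" "R (h + 1) < Y" "k < 31" "44 <= h"
 obtains R' where "straight w (adr_code h k) (R, M) = (R', M)"
  "R' h = adr k (R h) (R (h + 1))" "\<forall>r<h. R' r = R r"
proof -
 have l: "adr k (R h) (R (h + 1)) < 2 ^ w" using assms adr_less_word[of k] by (simp add: valid_def)
 have a: "k * Y + R h <= adr k (R h) (R (h + 1))"
 proof -
  have "x * 1 <= x * Y" for x using Y_ge by (intro mult_le_mono) auto
  from this[of "k * Y + R h"] show ?thesis unfolding adr_def by (metis mult_1_right trans_le_add1)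
 qed
 have m: "k * Y < 2 ^ w" "k * Y + R h < 2 ^ w" "(k * Y + R h) * Y < 2 ^ w"
  using a l by (auto simp: adr_def)
 have k: "k < 2 ^ w" using Y_less Y_ge assms by simp
 have "\<exists>R'. straight w (adr_code h k) (R, M) = (R', M) &
   R' h = adr k (R h) (R (h + 1)) & (\<forall>r<h. R' r = R r)"
  using assms(1,5) k m l by (simp add: adr_code_def adr_def add.commute)
 then show thesis using that by blast
qed

lemma straight_hi:
 assumes "R 41 = Y" "R 40 = Z" "M (R h) < 2 ^ w" "44 <= h"
 obtains R' where "straight w (hi_code h) (R, M) = (R', M)"
  "R' h = adr 31 0 (M (R h) div Z)" "\<forall>r<h. R' r = R r" "valid 31 0 (M (R h) div Z)"
proof -
 have v: "valid 31 0 (M (R h) div Z)" using assms by (simp add: valid_def div_le_mono)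
 have l: "31 * (Y * Y) + M (R h) div Z < 2 ^ w" using adr_less_word[OF v] by (simp add: adr_hi)
 have p: "0 < Y" "0 < Y * Y" using Y_ge by auto
 have m: "M (R h) div Z < 2 ^ w" "31 * Y < 2 ^ w" "31 * (Y * Y) < 2 ^ w" "(31::nat) < 2 ^ w"
  using l Y_less p by linarith+
 have "\<exists>R'. straight w (hi_code h) (R, M) = (R', M) &
   R' h = adr 31 0 (M (R h) div Z) & (\<forall>r<h. R' r = R r)"
  using assms(1,2,4) m l by (simp add: hi_code_def adr_hi add.commute mult.assoc)
 then show thesis using that v by blast
qed

lemma straight_bin:
 assumes "R h < 2 ^ w" "R (h + 1) < 2 ^ w" "f \<in> {Add, Sub, Mul, Div, Mod, Lt, Eq}"
  "ideal_op f (R h) (R (h + 1)) < 2 ^ w"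
 obtains R' where "straight w (bin_code h f) (R, M) = (R', M)"
  "R' h = ideal_op f (R h) (R (h + 1))" "\<forall>r<h. R' r = R r"
proof -
 have "1 < (2::nat) ^ w" using Y_less Y_ge by linarith
 then have one: "of_bool b mod (2::nat) ^ w = of_bool b" for b
  by (cases b) (simp_all only: of_bool_eq mod_less mod_0)
 have sub: "(R h + 2 ^ w - R (Suc h)) mod 2 ^ w * of_bool (\<not> R h < R (Suc h)) =
   R h - R (Suc h)"
 proof (cases "R h < R (Suc h)")
  case False
  then have "R h + 2 ^ w - R (Suc h) = (R h - R (Suc h)) + 2 ^ w" by simp
  then show ?thesis using False assms(1) by (simp only: mod_add_self2) simp
 qed simp
 have "\<exists>R'. straight w (bin_code h f) (R, M) = (R', M) &
   R' h = ideal_op f (R h) (R (h + 1)) & (\<forall>r<h. R' r = R r)"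
 proof (cases "f = Sub")
  case True
  then show ?thesis using assms sub one by (simp add: bin_code_def del: not_less)
 next
  case False
  then show ?thesis using assms one by (auto simp: bin_code_def)
 qed
 then show thesis using that by blast
qed

lemma exp_code_correct:
 assumes "bounded v a" "wf_exp e" "rel v a (R, M)" "44 <= h"
 shows "\<exists>R'. straight w (exp_code h e) (R, M) = (R', M) & R' h = val Z e v a &
  (\<forall>r<h. R' r = R r)"
 using assms
proof (induction e arbitrary: R h)
 case (Cn k)
 then show ?case using Y_less Y_ge by auto
next
 case (Vr x)
 then have "v x < Z" by (simp add: bounded_def)
 then have "v x < 2 ^ w" using Z_le_Y Y_less by linarith
 then show ?case using Vr by (auto simp: mov_code_def rel_def)
next
 case (Ar k e1 e2)
 obtain R1 where 1: "straight w (exp_code h e1) (R, M) = (R1, M)" "R1 h = val Z e1 v a"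
  "\<forall>r<h. R1 r = R r" using Ar.IH(1)[of R h] Ar.prems by auto
 have r1: "rel v a (R1, M)" using rel_cong[OF Ar.prems(3)] 1 Ar.prems by auto
 obtain R2 where 2: "straight w (exp_code (h + 1) e2) (R1, M) = (R2, M)"
  "R2 (h + 1) = val Z e2 v a" "\<forall>r<h+1. R2 r = R1 r"
  using Ar.IH(2)[of R1 "h + 1"] Ar.prems r1 by auto
 have r2: "rel v a (R2, M)" using rel_cong[OF r1] 2 Ar.prems by auto
 have b: "val Z e1 v a < Y" "val Z e2 v a < Y" using Ar.prems val_less_Y by auto
 obtain R3 where 3: "straight w (adr_code h k) (R2, M) = (R3, M)"
  "R3 h = adr k (R2 h) (R2 (h + 1))" "\<forall>r<h. R3 r = R2 r"
  by (rule straight_adr[of R2 h k]) (use r2 b 1 2 Ar.prems in \<open>auto simp: rel_def\<close>)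
 have m: "M (adr k (val Z e1 v a) (val Z e2 v a)) = a k (val Z e1 v a) (val Z e2 v a)"
  using Ar.prems b by (auto simp: rel_def valid_def)
 show ?case using 1 2 3 m by (auto simp: straight_append)
next
 case (Lo e)
 obtain R1 where 1: "straight w (exp_code h e) (R, M) = (R1, M)" "R1 h = val Z e v a"
  "\<forall>r<h. R1 r = R r" using Lo.IH[of R h] Lo.prems by auto
 have m: "M (val Z e v a) = a 0 0 (val Z e v a)"
 proof -
  have "valid 0 0 (val Z e v a)" using val_less_Y Lo.prems Y_ge by (auto simp: valid_def)
  then show ?thesis using rel_mem[OF Lo.prems(3)] by fastforce
 qed
 have "a 0 0 (val Z e v a) mod Z < 2 ^ w"
  using Lo.prems(1) unfolding bounded_def by (meson mod_less_eq_dividend le_less_trans)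
 moreover have "R1 40 = Z" using 1 Lo.prems by (simp add: rel_def)
 ultimately show ?case using 1 m Lo.prems(4) by (simp add: straight_append)
next
 case (Hi e)
 obtain R1 where 1: "straight w (exp_code h e) (R, M) = (R1, M)" "R1 h = val Z e v a"
  "\<forall>r<h. R1 r = R r" using Hi.IH[of R h] Hi.prems by auto
 have m: "M (val Z e v a) = a 0 0 (val Z e v a)"
 proof -
  have "valid 0 0 (val Z e v a)" using val_less_Y Hi.prems Y_ge by (auto simp: valid_def)
  then show ?thesis using rel_mem[OF Hi.prems(3)] by fastforce
 qed
 have r1: "rel v a (R1, M)" using rel_cong[OF Hi.prems(3)] 1 Hi.prems by auto
 obtain R2 where 2: "straight w (hi_code h) (R1, M) = (R2, M)"
  "R2 h = adr 31 0 (M (R1 h) div Z)" "\<forall>r<h. R2 r = R1 r" "valid 31 0 (M (R1 h) div Z)"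
  by (rule straight_hi[of R1 M h]) (use r1 1 m Hi.prems in \<open>auto simp: rel_def bounded_def\<close>)
 have "M (adr 31 0 (M (R1 h) div Z)) = a 31 0 (a 0 0 (val Z e v a) div Z)"
  using rel_mem[OF Hi.prems(3) 2(4)] 1 m by simp
 then show ?case using 1 2(1-3) m Hi.prems(4) by (simp add: straight_append)
next
 case (Bin f e1 e2)
 obtain R1 where 1: "straight w (exp_code h e1) (R, M) = (R1, M)" "R1 h = val Z e1 v a"
  "\<forall>r<h. R1 r = R r" using Bin.IH(1)[of R h] Bin.prems by auto
 have r1: "rel v a (R1, M)" using rel_cong[OF Bin.prems(3)] 1 Bin.prems by auto
 obtain R2 where 2: "straight w (exp_code (h + 1) e2) (R1, M) = (R2, M)"
  "R2 (h + 1) = val Z e2 v a" "\<forall>r<h+1. R2 r = R1 r"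
  using Bin.IH(2)[of R1 "h + 1"] Bin.prems r1 by auto
 have b: "val Z e1 v a < 2 ^ w" "val Z e2 v a < 2 ^ w"
  "ideal_op f (val Z e1 v a) (val Z e2 v a) < 2 ^ w"
  using Bin.prems val_less_word[of v a e1] val_less_word[of v a e2]
   val_less_word[of v a "Bin f e1 e2"] by auto
 obtain R3 where 3: "straight w (bin_code h f) (R2, M) = (R3, M)"
  "R3 h = ideal_op f (R2 h) (R2 (h + 1))" "\<forall>r<h. R3 r = R2 r"
  by (rule straight_bin[of R2 h f]) (use b 1 2 Bin.prems in auto)
 show ?case using 1 2 3 by (auto simp: straight_append)
qed

end

section \<open>Running a program for a smaller word length\<close>

lemma eval_op_less: "eval_op w f x y < 2 ^ w"
 by (cases f) auto

text \<open>Since \<open>2 ^ w'\<close> divides \<open>2 ^ w\<close>, the reduction modulo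
  \<open>2 ^ w\<close> is absorbed. Subtraction alone uses the word length also inside its formula;
  there the two summands \<open>2 ^ w\<close> and \<open>2 ^ w'\<close> differ by a multiple of
  \<open>2 ^ w'\<close>.\<close>

lemma eval_op_mod:
 assumes "w' <= w" "x < 2 ^ w'" "y < 2 ^ w'"
 shows "eval_op w f x y mod 2 ^ w' = eval_op w' f x y"
proof -
 have d: "(2::nat) ^ w' dvd 2 ^ w" using assms by (simp add: le_imp_power_dvd)
 have c: "z mod 2 ^ w mod 2 ^ w' = z mod 2 ^ w'" for z :: nat
  using mod_mod_cancel[OF d] .
 show ?thesis
 proof (cases "f = Sub")
  case True
  from d obtain q where q: "(2::nat) ^ w = 2 ^ w' * q" by blast
  have "q ~= 0" using q by (metis mult_zero_right power_not_zero zero_neq_numeral)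
  then obtain q' where q': "q = Suc q'" by (cases q) auto
  have "x + 2 ^ w - y = (x + 2 ^ w' - y) + 2 ^ w' * q'"
   using assms q q' by simp
  then show ?thesis using True c by simp
 next
  case False
  then show ?thesis using c by (cases f) auto
 qed
qed

lemma instr_regs_le: "i \<in> set pr ==> instr_regs i <= num_regs pr"
 unfolding num_regs_def by (induction pr) auto

lemma num_regs_pos: "1 <= num_regs pr"
 unfolding num_regs_def by (induction pr) auto

lemma code_at_concat:
 assumes "code_at P p (concat (map f xs))" "\<And>x. length (f x) = 2" "i < length xs"
 shows "code_at P (p + 2 * i) (f (xs ! i))"
 using assms(1,3)
proof (induction xs arbitrary: p i)
 case (Cons x xs)
 then show ?case using assms(2) by (cases i) (auto simp: code_at_append dest!: Cons.IH)
qed simp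

text \<open>As \<open>2 ^ w' <= Z <= Y\<close>, the whole address space of the subroutine fits into
  one row of an array, and its words respect the bound on array entries.\<close>

locale word_ram_sub = word_ram +
 fixes pr :: "instr list" and w' :: nat
 assumes w'_le: "w' <= w" and Z_sub: "2 ^ w' <= Z"
begin

text \<open>Memory has to agree on \<open>2 ^ w'\<close> cells only, because every simulated address
  is the value of a register and hence below that number.\<close>

definition sim :: "nat \<Rightarrow> store \<Rightarrow> store \<Rightarrow> bool" where
 "sim b s s' \<longleftrightarrow> fst s' 42 = b & fst s' xmod = 2 ^ w' & (\<forall>r<num_regs pr. fst s' (44 + r) = fst s r) &
  (\<forall>j<2 ^ w'. snd s' (b + j) = snd s j) & (\<forall>r. fst s r < 2 ^ w') & (\<forall>j. snd s j < 2 ^ w')"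

definition sim_frame :: "nat \<Rightarrow> store \<Rightarrow> store \<Rightarrow> bool" where
 "sim_frame b s s' \<longleftrightarrow>
  (\<forall>r. r ~= 43 --> r < 44 \<or> 44 + num_regs pr <= r --> fst s' r = fst s r) &
  (\<forall>x. x < b \<or> b + 2 ^ w' <= x --> snd s' x = snd s x)"

lemma sim_frame_trans: "sim_frame b s s' ==> sim_frame b s' s'' ==> sim_frame b s s''"
 by (auto simp: sim_frame_def)

lemma sim_step:
 assumes s: "sim b (S, N) (R, M)" and pc: "pc < length pr"
  and code: "code_at P (q + 2 * pc) (sim_code q pr (pr ! pc))"
  and e: "exec w' (pr ! pc) (pc, S, N) = (pc', S', N')" and b: "b + 2 ^ w' <= 2 ^ w"
 shows "\<exists>k\<le>2. \<exists>R' M'. (step w P ^^ k) (q + 2 * pc, R, M) = (q + 2 * min pc' (length pr), R', M') &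
  sim b (S', N') (R', M') & sim_frame b (R, M) (R', M') & (\<forall>j\<ge>2 ^ w'. N' j = N j)"
proof -
 have dv: "(2::nat) ^ w' dvd 2 ^ w" using w'_le by (simp add: le_imp_power_dvd)
 have c: "z mod 2 ^ w mod 2 ^ w' = z mod 2 ^ w'" for z :: nat
  using mod_mod_cancel[OF dv] .
 have le: "x < 2 ^ w' ==> x < 2 ^ w" for x :: nat
  using w'_le by (meson less_le_trans one_le_numeral power_increasing)
 have bnd: "x < 2 ^ w' ==> (x + b) mod 2 ^ w = b + x" for x
  using b by simp
 have mm: "(m mod 2 ^ w') mod 2 ^ w = m mod 2 ^ w'" for m :: nat
  by (simp add: le)
 have step1: "step w P ^^ 2 = (\<lambda>s. step w P (step w P s))"
  by (auto simp: numeral_2_eq_2)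
 have regs: "instr_regs (pr ! pc) <= num_regs pr" using pc by (intro instr_regs_le) auto
 have S: "\<And>r. S r < 2 ^ w'" and N: "\<And>j. N j < 2 ^ w'"
  and R: "R 42 = b" "R xmod = 2 ^ w'" "\<And>r. r < num_regs pr ==> R (44 + r) = S r"
  and M: "\<And>j. j < 2 ^ w' ==> M (b + j) = N j"
  using s by (auto simp: sim_def)
 show ?thesis
 proof (cases "pr ! pc")
  case (Const d k)
  then show ?thesis using code e regs R M S N pc
   by (intro exI[of _ 2]) (auto simp: step1 step_def sim_def sim_frame_def c mm)
 next
  case (Op f d a b')
  have "eval_op w f (S a) (S b') mod 2 ^ w' mod 2 ^ w = eval_op w' f (S a) (S b')"
   using eval_op_mod[OF w'_le S S] eval_op_less le by simp
  then show ?thesis using Op code e regs R M S N pc eval_op_less[of w' f "S a" "S b'"]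
   by (intro exI[of _ 2]) (auto simp: step1 step_def sim_def sim_frame_def)
 next
  case (Load d a)
  then show ?thesis using code e regs R M S N pc
   by (intro exI[of _ 2]) (auto simp: step1 step_def sim_def sim_frame_def bnd)
 next
  case (Store a s)
  have "\<And>r. \<not> 2 ^ w' <= S r" using S by (simp add: not_le)
  then show ?thesis using Store code e regs R M S N pc
   by (intro exI[of _ 2]) (auto simp: step1 step_def sim_def sim_frame_def bnd)
 next
  case (Jz r n)
  show ?thesis
  proof (cases "S r = 0")
   case True
   then have "(step w P ^^ 1) (q + 2 * pc, R, M) = (q + 2 * min pc' (length pr), R, M)"
    using Jz code e regs R by (auto simp: step_def)
   moreover have "S' = S" "N' = N" using e Jz by (auto split: if_splits)
   ultimately show ?thesis using s by (intro exI[of _ 1]) (auto simp: sim_frame_def)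
  next
   case False
   then show ?thesis using Jz code e regs R M S N pc
    by (intro exI[of _ 2]) (auto simp: step1 step_def sim_def sim_frame_def)
  qed
 qed
qed

text \<open>A computation may leave \<open>pr\<close> at any address beyond its end, all of which
  are represented by the end of the simulating code; hence the \<open>min\<close>.\<close>

lemma sim_steps:
 assumes b: "b + 2 ^ w' <= 2 ^ w"
  and code: "\<And>i. i < length pr ==> code_at P (q + 2 * i) (sim_code q pr (pr ! i))"
 shows "sim b (S, N) (R, M) ==> (step w' pr ^^ n) (pc, S, N) = (pc', S', N') ==>
  length pr <= pc' ==>
  \<exists>k\<le>2 * n. \<exists>R' M'. (step w P ^^ k) (q + 2 * min pc (length pr), R, M) = (q + 2 * length pr, R', M') &
   sim b (S', N') (R', M') & sim_frame b (R, M) (R', M') & (\<forall>j\<ge>2 ^ w'. N' j = N j)"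
proof (induction n arbitrary: pc S N R M)
 case 0
 then show ?case by (auto simp: sim_frame_def)
next
 case (Suc n)
 show ?case
 proof (cases "pc < length pr")
  case False
  then have "(step w' pr ^^ Suc n) (pc, S, N) = (pc, S, N)"
   by (intro steps_halted) auto
  with Suc.prems False show ?thesis
   by (intro exI[of _ 0]) (auto simp: sim_frame_def)
 next
  case True
  obtain pc1 S1 N1 where e: "exec w' (pr ! pc) (pc, S, N) = (pc1, S1, N1)"
   by (metis prod_cases3)
  then have st: "step w' pr (pc, S, N) = (pc1, S1, N1)" using True by (simp add: step_def)
  have "(step w' pr ^^ n) (pc1, S1, N1) = (pc', S', N')"
   using Suc.prems(2) st by (simp add: funpow_Suc_right del: funpow.simps)
  moreover obtain k R1 M1 where 1: "k <= 2"
   "(step w P ^^ k) (q + 2 * pc, R, M) = (q + 2 * min pc1 (length pr), R1, M1)"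
   "sim b (S1, N1) (R1, M1)" "sim_frame b (R, M) (R1, M1)" "\<forall>j\<ge>2 ^ w'. N1 j = N j"
   using sim_step[OF Suc.prems(1) True code[OF True] e b] by blast
  ultimately obtain l R2 M2 where 2: "l <= 2 * n"
   "(step w P ^^ l) (q + 2 * min pc1 (length pr), R1, M1) = (q + 2 * length pr, R2, M2)"
   "sim b (S', N') (R2, M2)" "sim_frame b (R1, M1) (R2, M2)" "\<forall>j\<ge>2 ^ w'. N' j = N1 j"
   using Suc.IH[OF 1(3)] Suc.prems(3) by blast
  have "(step w P ^^ (k + l)) (q + 2 * min pc (length pr), R, M) = (q + 2 * length pr, R2, M2)"
   using steps_add[OF 1(2) 2(2)] True by simp
  moreover have "k + l <= 2 * Suc n" using 1 2 by simp
  ultimately show ?thesis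
   using 1 2 sim_frame_trans[OF 1(4) 2(4)] by (intro exI[of _ "k + l"]) auto
 qed
qed

lemma call_init_correct:
 assumes code: "code_at P p (call_init pr)" and rel: "rel v a (R, M)" and bd: "bounded v a"
  and mod: "v xmod = 2 ^ w'" and len: "v xlen < 2 ^ w'"
  and W: "\<And>j. a 12 (v xrow) j < 2 ^ w'"
 shows "\<exists>R'. (step w P ^^ length (call_init pr)) (p, R, M) = (p + length (call_init pr), R', M) &
  sim (adr 12 (v xrow) 0) ((\<lambda>_. 0)(0 := v xlen), a 12 (v xrow)) (R', M) &
  (\<forall>r<42. R' r = R r) & (\<forall>r\<ge>44 + num_regs pr. R' r = R r)"
proof -
 let ?c1 = "map (\<lambda>r. Const (44 + r) 0) [0..<num_regs pr]"
 let ?c2 = "mov_code 44 xlen 43 @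
  [Const 42 12, Op Mul 42 42 41, Op Add 42 42 xrow, Op Mul 42 42 41]"
 have eq: "call_init pr = ?c1 @ ?c2" by (simp add: call_init_def)
 have z: "straight w (map (\<lambda>r. Const (44 + r) 0) [0..<n]) (R, M) =
   (\<lambda>r. if 44 <= r & r < 44 + n then 0 else R r, M)" for n
 proof (induction n)
  case (Suc n)
  show ?case by (auto simp: straight_append Suc)
 qed (simp add: fun_eq_iff)
 define R1 where "R1 = (\<lambda>r. if 44 <= r & r < 44 + num_regs pr then 0 else R r)"
 have row: "v xrow < Z" using bd by (simp add: bounded_def)
 have R1: "R1 41 = Y" "R1 xrow = v xrow" "R1 xlen = v xlen" "R1 xmod = 2 ^ w'"
  using rel mod by (auto simp: rel_def R1_def)
 have valid: "valid 12 (v xrow) j" if "j < 2 ^ w'" for j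
  using row that Z_sub Z_le_Y by (auto simp: valid_def)
 have b: "adr 12 (v xrow) 0 = (12 * Y + v xrow) * Y" by (simp add: adr_def)
 have bl: "(12 * Y + v xrow) * Y < 2 ^ w" using adr_less_word[OF valid[of 0]] b by simp
 have lw: "12 * Y + v xrow < 2 ^ w" "12 * Y < 2 ^ w" "12 < (2::nat) ^ w" "v xlen < 2 ^ w"
  using Y_less Y_ge row Z_le_Y len Z_sub by linarith+
 define R2 where "R2 = fst (straight w ?c2 (R1, M))"
 have s2: "straight w ?c2 (R1, M) = (R2, M)"
  by (simp add: R2_def mov_code_def)
 have R2: "R2 42 = (12 * Y + v xrow) * Y" "R2 44 = v xlen"
  "\<And>r. r \<notin> {42, 43, 44} ==> R2 r = R1 r"
  using lw bl by (auto simp: R2_def mov_code_def R1 mult.commute)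
 have st: "straight w (call_init pr) (R, M) = (R2, M)"
  using s2 by (simp only: eq straight_append[of w ?c1] z R1_def)
 have nj: "list_all (Not \<circ> is_jump) (call_init pr)"
  by (simp add: call_init_def mov_code_def list_all_iff)
 have steps: "(step w P ^^ length (call_init pr)) (p, R, M) = (p + length (call_init pr), R2, M)"
  using steps_straight[OF code nj, of w "(R, M)"] st by simp
 have mem: "M ((12 * Y + v xrow) * Y + j) = a 12 (v xrow) j" if "j < 2 ^ w'" for j
  using rel_mem[OF rel valid[OF that]] by (simp add: adr_def)
 have R2r: "R2 (44 + r) = ((\<lambda>_. 0)(0 := v xlen)) r" if "r < num_regs pr" for r
  using R2 that by (cases "r = 0") (auto simp: R1_def)
 have "sim (adr 12 (v xrow) 0) ((\<lambda>_. 0)(0 := v xlen), a 12 (v xrow)) (R2, M)"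
  unfolding sim_def using R2(1,3) R1(4) R2r mem W len b by auto
 moreover have "\<forall>r<42. R2 r = R r" "\<forall>r\<ge>44 + num_regs pr. R2 r = R r"
  using R2(3) num_regs_pos[of pr] by (auto simp: R1_def)
 ultimately show ?thesis using steps by blast
qed

text \<open>Cells of the row from \<open>2 ^ w'\<close> on are changed neither by the subroutine nor
  by its simulation, so the entire row, and not just its beginning, equals the final memory
  \<open>N\<close>.\<close>

lemma call_correct:
 assumes code: "code_at P p (call_code p pr)" and rel: "rel v a (R, M)" and bd: "bounded v a"
  and mod: "v xmod = 2 ^ w'" and len: "v xlen < 2 ^ w'"
  and W: "\<And>j. a 12 (v xrow) j < 2 ^ w'"
  and run: "(step w' pr ^^ n) (0, (\<lambda>_. 0)(0 := v xlen), a 12 (v xrow)) = (pc, S, N)"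
  and halt: "length pr <= pc"
 shows "\<exists>k R' M'. (step w P ^^ k) (p, R, M) = (p + length (call_code 0 pr), R', M') &
  rel (v(xres := S 0)) (a(12 := (a 12)(v xrow := N))) (R', M') &
  bounded (v(xres := S 0)) (a(12 := (a 12)(v xrow := N))) &
  k <= length (call_init pr) + 2 + 2 * n & (\<forall>r\<ge>44 + num_regs pr. R' r = R r)"
proof -
 let ?q = "p + length (call_init pr)" and ?b = "adr 12 (v xrow) 0"
 let ?cs = "concat (map (sim_code ?q pr) pr)"
 have c: "code_at P p (call_init pr)" "code_at P ?q ?cs"
  "code_at P (?q + 2 * length pr) (mov_code xres 44 43)"
 proof -
  have "length ?cs = 2 * length pr"
   using length_call_code[of p pr] by (simp add: call_code_def mov_code_def)
  then show "code_at P p (call_init pr)" "code_at P ?q ?cs"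
   "code_at P (?q + 2 * length pr) (mov_code xres 44 43)"
   using code by (auto simp: call_code_def code_at_append add.assoc)
 qed
 obtain R1 where 1: "(step w P ^^ length (call_init pr)) (p, R, M) = (?q, R1, M)"
  "sim ?b ((\<lambda>_. 0)(0 := v xlen), a 12 (v xrow)) (R1, M)"
  "\<forall>r<42. R1 r = R r" "\<forall>r\<ge>44 + num_regs pr. R1 r = R r"
  using call_init_correct[OF c(1) rel bd mod len W] by blast
 have row: "v xrow < Z" using bd by (simp add: bounded_def)
 have valid: "valid 12 (v xrow) j" if "j < 2 ^ w'" for j
  using row that Z_sub Z_le_Y by (auto simp: valid_def)
 have bj: "?b + j = adr 12 (v xrow) j" for j by (simp add: adr_def)
 have b: "?b + 2 ^ w' <= 2 ^ w"
 proof -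
  have "2 ^ w' - 1 < (2::nat) ^ w'" by simp
  from adr_less_word[OF valid[OF this]] have "?b + (2 ^ w' - 1) < 2 ^ w" by (simp only: bj)
  moreover have "(1::nat) <= 2 ^ w'" by simp
  ultimately show ?thesis by linarith
 qed
 obtain k R2 M2 where 2: "k <= 2 * n"
  "(step w P ^^ k) (?q, R1, M) = (?q + 2 * length pr, R2, M2)" "sim ?b (S, N) (R2, M2)"
  "sim_frame ?b (R1, M) (R2, M2)" "\<forall>j\<ge>2 ^ w'. N j = a 12 (v xrow) j"
  using sim_steps[OF b code_at_concat[OF c(2) length_sim_code] 1(2) run halt] by auto
 have nr: "0 < num_regs pr" using num_regs_pos[of pr] by simp
 have S: "S r < 2 ^ w'" "N j < 2 ^ w'" for r j using 2(3) by (auto simp: sim_def)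
 have R44: "R2 44 = S 0" using 2(3) nr unfolding sim_def by fastforce
 have ww: "(2::nat) ^ w' <= 2 ^ w" using w'_le by (simp add: power_increasing)
 define R3 where "R3 = R2(43 := 0, xres := S 0)"
 have 3: "(step w P ^^ 2) (?q + 2 * length pr, R2, M2) = (?q + 2 * length pr + 2, R3, M2)"
 proof -
  have "S 0 < 2 ^ w" using S(1)[of 0] ww by (rule less_le_trans)
  moreover have "step w P ^^ 2 = (\<lambda>s. step w P (step w P s))"
   by (auto simp: numeral_2_eq_2)
  ultimately show ?thesis using steps_straight[OF c(3), of w "(R2, M2)"] R44
   by (simp add: mov_code_def R3_def)
 qed
 have "(step w P ^^ (length (call_init pr) + k + 2)) (p, R, M) =
   (p + length (call_code 0 pr), R3, M2)"
  using steps_add[OF steps_add[OF 1(1) 2(2)] 3] by (simp add: length_call_code add.assoc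
    call_init_def)
 moreover have "rel (v(xres := S 0)) (a(12 := (a 12)(v xrow := N))) (R3, M2)"
 proof -
  have reg: "R3 r = R r" if "r < 42" "r ~= xres" for r
   using that 1(3) 2(4) by (auto simp: R3_def sim_frame_def)
  have "M2 (adr k i j) = (a(12 := (a 12)(v xrow := N))) k i j" if vd: "valid k i j" for k i j
  proof (cases "k = 12 & i = v xrow")
   case True
   then have ad: "adr k i j = ?b + j" by (simp only: bj)
   show ?thesis
   proof (cases "j < 2 ^ w'")
    case True
    with \<open>k = 12 & i = v xrow\<close> 2(3) show ?thesis unfolding ad by (simp add: sim_def)
   next
    case False
    then have "M2 (adr k i j) = M (adr k i j)"
     using 2(4) unfolding ad sim_frame_def snd_conv by (meson add_left_mono not_less)
    then show ?thesis using True False 2(5) rel_mem[OF rel vd] by simp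
   qed
  next
   case False
   have "adr k i j < ?b \<or> ?b + 2 ^ w' <= adr k i j"
   proof (rule ccontr)
    assume "\<not> ?thesis"
    then have "?b + (adr k i j - ?b) = adr k i j" "adr k i j - ?b < 2 ^ w'" by auto
    then show False using adr_inj[OF vd valid] False by (metis bj)
   qed
   then have "M2 (adr k i j) = M (adr k i j)"
    using 2(4) unfolding sim_frame_def snd_conv by blast
   then show ?thesis using False rel_mem[OF rel vd] by auto
  qed
  moreover have "R3 xres = S 0" by (simp add: R3_def)
  ultimately show ?thesis using rel reg by (simp add: rel_def)
 qed
 moreover have "bounded (v(xres := S 0)) (a(12 := (a 12)(v xrow := N)))"
 proof -
  have "S 0 < Z" "N j < Z" "N j < 2 ^ w" for j
   using S(1)[of 0] S(2)[of j] Z_sub ww by linarith+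
  then show ?thesis using bd unfolding bounded_def by auto
 qed
 moreover have "\<forall>r\<ge>44 + num_regs pr. R3 r = R r"
  using 1(4) 2(4) by (auto simp: R3_def sim_frame_def)
 moreover have "length (call_init pr) + k + 2 <= length (call_init pr) + 2 + 2 * n"
  using 2(1) by simp
 ultimately show ?thesis by blast
qed

section \<open>Semantics of statements and correctness of their compilation\<close>

definition upd :: "arrays \<Rightarrow> nat \<Rightarrow> nat \<Rightarrow> nat \<Rightarrow> nat \<Rightarrow> arrays" where
 "upd a k i j x = (\<lambda>k' i' j'. if k' = k & i' = i & j' = j then x else a k' i' j')"

text \<open>
 Weakest preconditions; the first component of the state is a clock that counts statements
 and the steps of the subroutine.
\<close>

primrec wp :: "com \<Rightarrow> (nat \<Rightarrow> vars \<Rightarrow> arrays \<Rightarrow> bool) \<Rightarrow> nat \<Rightarrow> vars \<Rightarrow> arrays \<Rightarrow> bool" where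
 "wp Skip Q t v a \<longleftrightarrow> Q t v a"
| "wp (Asg x e) Q t v a \<longleftrightarrow> val Z e v a < Z & Q (t + 1) (v(x := val Z e v a)) a"
| "wp (St k e1 e2 e3) Q t v a \<longleftrightarrow> val Z e3 v a < Z &
  Q (t + 1) v (upd a k (val Z e1 v a) (val Z e2 v a) (val Z e3 v a))"
| "wp (StHi e1 e2) Q t v a \<longleftrightarrow> val Z e2 v a < Z &
  Q (t + 1) v (upd a 31 0 (a 0 0 (val Z e1 v a) div Z) (val Z e2 v a))"
| "wp (Acc e0 e1 e2) Q t v a \<longleftrightarrow>
  a 30 0 (val Z e0 v a) + a 0 0 (val Z e1 v a) * a 0 0 (val Z e2 v a) < 2 ^ w &
  Q (t + 1) v (upd a 30 0 (val Z e0 v a)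
   (a 30 0 (val Z e0 v a) + a 0 0 (val Z e1 v a) * a 0 0 (val Z e2 v a)))"
| "wp (Sq c1 c2) Q t v a \<longleftrightarrow> wp c1 (wp c2 Q) t v a"
| "wp (Cond e c1 c2) Q t v a \<longleftrightarrow>
  (if val Z e v a ~= 0 then wp c1 Q (t + 1) v a else wp c2 Q (t + 1) v a)"
| "wp (For x e c) Q t v a \<longleftrightarrow> val Z e v a <= Z &
  foldr (\<lambda>i Q t v a. wp c Q (t + 1) (v(x := i)) a) [0..<val Z e v a] Q (t + 1) v a"
| "wp Call Q t v a \<longleftrightarrow> v xmod = 2 ^ w' & v xlen < 2 ^ w' & (\<forall>j. a 12 (v xrow) j < 2 ^ w') &
  (\<exists>n pc S N. (step w' pr ^^ n) (0, (\<lambda>_. 0)(0 := v xlen), a 12 (v xrow)) = (pc, S, N) &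
   length pr <= pc &
   Q (t + 1 + n) (v(xres := S 0)) (a(12 := (a 12)(v xrow := N))))"

lemma rel_upd: "rel v a (R, M) ==> valid k i j ==> rel v (upd a k i j x) (R, M(adr k i j := x))"
 using adr_inj unfolding rel_def upd_def by fastforce

lemma bounded_upd:
 "bounded v a ==> x < Z \<or> k = 0 & x < 2 ^ w \<or> k = 30 & x < 2 ^ w ==> bounded v (upd a k i j x)"
proof -
 have "Z < 2 ^ w" using Z_le_Y Y_less Y_ge by linarith
 then show "bounded v a ==> x < Z \<or> k = 0 & x < 2 ^ w \<or> k = 30 & x < 2 ^ w ==> ?thesis"
  by (auto simp: bounded_def upd_def)
qed

lemma bounded_asg: "bounded v a ==> n < Z ==> bounded (v(x := n)) a"
 by (simp add: bounded_def)

lemma rel_asg: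
 "rel v a (R, M) ==> x < 40 ==> \<forall>r<44. r ~= x --> R' r = R r ==> R' x = n ==>
  rel (v(x := n)) a (R', M)"
 by (auto simp: rel_def)

lemma exp_code_no_jump [simp]: "list_all (Not \<circ> is_jump) (exp_code h e)"
proof (induction e arbitrary: h)
 case (Bin f e1 e2)
 then show ?case by (cases f) (auto simp: bin_code_def)
qed (auto simp: adr_code_def hi_code_def mov_code_def)

lemma steps_exp:
 assumes "code_at P p (exp_code h e)" "bounded v a" "wf_exp e" "rel v a (R, M)" "44 <= h"
 shows "\<exists>R'. (step w P ^^ length (exp_code 0 e)) (p, R, M) =
   (p + length (exp_code 0 e), R', M) &
  R' h = val Z e v a & (\<forall>r<h. R' r = R r) & rel v a (R', M)"
proof -
 obtain R' where R': "straight w (exp_code h e) (R, M) = (R', M)" "R' h = val Z e v a"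
  "\<forall>r<h. R' r = R r" using exp_code_correct[OF assms(2-5)] by blast
 then show ?thesis
  using steps_straight[OF assms(1) exp_code_no_jump, of w "(R, M)"] rel_cong[OF assms(4)]
   assms(5) by (simp add: length_exp_code[of h])
qed

lemma ex6I: "P n R M t v a ==> \<exists>n R M t v a. P n R M t v a"
 by blast

lemma straight_com_correct:
 assumes "code_at P p (com_code pr p h c)" "list_all (Not \<circ> is_jump) (com_code pr p h c)"
  "straight w (com_code pr p h c) (R, M) = (R', M')" "rel v' a' (R', M')" "bounded v' a'"
  "Q (t + 1) v' a'" "com_len pr c <= F" "\<forall>r. 44 + num_regs pr <= r & r < h --> R' r = R r"
 shows "\<exists>n R' M' t' v' a'. (step w P ^^ n) (p, R, M) = (p + com_len pr c, R', M') &
  rel v' a' (R', M') & bounded v' a' & Q t' v' a' & n + F * t <= F * t' &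
  (\<forall>r. 44 + num_regs pr <= r & r < h --> R' r = R r)"
 using steps_straight[OF assms(1,2), of w "(R, M)"] assms(3-8)
 by (intro ex6I[of _ "com_len pr c" R' M'
    "t + 1" v' a']) (simp add: length_com_code)

text \<open>\<open>F\<close> machine steps are granted per clock tick. A round costs one tick and 8
  instructions besides the body, hence \<open>8 <= F\<close>. The final failing test takes 2 steps
  without a tick; this is the slack of 2 in the conclusion, which the loop statement pays from its
  own tick.\<close>

lemma com_code_loop:
 assumes IH: "\<And>R M v a t Q. bounded v a ==> rel v a (R, M) ==> wp c Q t v a ==>
  \<exists>n R' M' t' v' a'. (step w P ^^ n) (q + 4, R, M) = (q + 4 + com_len pr c, R', M') &
  rel v' a' (R', M') & bounded v' a' & Q t' v' a' & n + F * t <= F * t' &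
  (\<forall>r. 44 + num_regs pr <= r & r < h + 2 --> R' r = R r)"
  and x: "x < 40" and h: "44 + num_regs pr <= h" and F: "8 <= F" and k: "k <= Z"
  and code1: "code_at P q ([Op Lt (h + 2) h (h + 1), Jz (h + 2) (q + 4 + com_len pr c + 4)] @
   mov_code x h (h + 2))"
  and code2: "code_at P (q + 4 + com_len pr c)
   [Const (h + 2) 1, Op Add h h (h + 2), Const (h + 2) 0, Jz (h + 2) q]"
 shows "bounded v a ==> rel v a (R, M) ==> R h = i ==> R (h + 1) = k ==> i <= k ==>
  foldr (\<lambda>i Q t v a. wp c Q (t + 1) (v(x := i)) a) [i..<k] Q t v a ==>
  \<exists>n R' M' t' v' a'. (step w P ^^ n) (q, R, M) = (q + 8 + com_len pr c, R', M') &
  rel v' a' (R', M') & bounded v' a' & Q t' v' a' & n + F * t <= F * t' + 2 &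
  (\<forall>r. 44 + num_regs pr <= r & r < h --> R' r = R r)"
proof (induction "k - i" arbitrary: i R M t v a)
 case 0
 then have i: "i = k" by simp
 obtain R9 where R9: "R9 = R(h + 2 := 0)" by simp
 have "(step w P ^^ 2) (q, R, M) = (q + 8 + com_len pr c, R9, M)"
  using code1 0 i by (simp add: numeral_2_eq_2 step_def R9)
 moreover have "rel v a (R9, M)"
  by (rule rel_cong[OF \<open>rel v a (R, M)\<close>]) (use h in \<open>auto simp: R9\<close>)
 moreover have "\<forall>r<h. R9 r = R r" by (simp add: R9)
 ultimately show ?case using 0 i by (intro ex6I[of _ 2 R9 M t v a]) auto
next
 case (Suc d)
 then have i: "i < k" by simp
 have "1 < (2::nat) ^ w" "Z < 2 ^ w" using Y_less Y_ge Z_le_Y by linarith+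
 moreover from this(1) have "0 < w" by (cases w) auto
 ultimately have two: "1 < (2::nat) ^ w" "Z < 2 ^ w" "0 < w" by auto
 have iw: "i < 2 ^ w" "Suc i < 2 ^ w" using i k two by linarith+
 define R1 where "R1 = R(h + 2 := 0, x := i)"
 have s1: "(step w P ^^ 4) (q, R, M) = (q + 4, R1, M)"
 proof -
  have "step w P (q, R, M) = (q + 1, R(h + 2 := 1), M)"
   using code1 Suc.prems i two by (simp add: step_def)
  moreover have "step w P (q + 1, R(h + 2 := 1), M) = (q + 2, R(h + 2 := 1), M)"
   using code1 by (simp add: step_def)
  moreover have "step w P (q + 2, R(h + 2 := 1), M) = (q + 3, R(h + 2 := 0), M)"
   using code1 by (simp add: step_def mov_code_def numeral_3_eq_3)
  moreover have "step w P (q + 3, R(h + 2 := 0), M) = (q + 4, R1, M)"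
   using code1 Suc.prems(3) iw h
   by (simp add: step_def mov_code_def numeral_3_eq_3 R1_def)
  ultimately show ?thesis by (simp add: eval_nat_numeral)
 qed
 have rel1: "rel (v(x := i)) a (R1, M)"
  by (rule rel_asg[OF Suc.prems(2) x]) (use h in \<open>auto simp: R1_def\<close>)
 have bd1: "bounded (v(x := i)) a" using Suc.prems(1) i k by (intro bounded_asg) auto
 let ?F = "\<lambda>i Q t v a. wp c Q (t + 1) (v(x := i)) a"
 have "wp c (foldr ?F [Suc i..<k] Q) (t + 1) (v(x := i)) a"
  using Suc.prems(6) i by (simp add: upt_conv_Cons)
 from IH[OF bd1 rel1 this] obtain n2 R2 M2 t2 v2 a2 where 2:
  "(step w P ^^ n2) (q + 4, R1, M) = (q + 4 + com_len pr c, R2, M2)"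
  "rel v2 a2 (R2, M2)" "bounded v2 a2" "foldr ?F [Suc i..<k] Q t2 v2 a2"
  "n2 + F * (t + 1) <= F * t2" "\<forall>r. 44 + num_regs pr <= r & r < h + 2 --> R2 r = R1 r"
  by blast
 have R2: "R2 h = i" "R2 (h + 1) = k" using 2(6) h x Suc.prems(3,4) by (auto simp: R1_def)
 define R3 where "R3 = R2(h + 2 := 0, h := Suc i)"
 have s3: "(step w P ^^ 4) (q + 4 + com_len pr c, R2, M2) = (q, R3, M2)"
 proof -
  let ?q = "q + 4 + com_len pr c"
  have "step w P (?q, R2, M2) = (?q + 1, R2(h + 2 := 1), M2)"
   using code2 two by (simp add: step_def)
  moreover have "step w P (?q + 1, R2(h + 2 := 1), M2) = (?q + 2, R2(h + 2 := 1, h := Suc i), M2)"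
   using code2 two iw R2 by (simp add: step_def)
  moreover have "step w P (?q + 2, R2(h + 2 := 1, h := Suc i), M2) = (?q + 3, R3, M2)"
   using code2 by (simp add: step_def numeral_3_eq_3 R3_def fun_upd_twist)
  moreover have "step w P (?q + 3, R3, M2) = (q, R3, M2)"
   using code2 by (simp add: step_def numeral_3_eq_3 R3_def)
  ultimately show ?thesis by (simp add: eval_nat_numeral)
 qed
 have rel3: "rel v2 a2 (R3, M2)" by (rule rel_cong[OF 2(2)]) (use h in \<open>auto simp: R3_def\<close>)
 have "d = k - Suc i" "Suc i <= k" "R3 h = Suc i" "R3 (h + 1) = k"
  using Suc.hyps(2) i R2 by (auto simp: R3_def)
 from Suc.hyps(1)[OF this(1) 2(3) rel3 this(3,4,2) 2(4)]
 obtain n4 R4 M4 t4 v4 a4 where 4: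
  "(step w P ^^ n4) (q, R3, M2) = (q + 8 + com_len pr c, R4, M4)"
  "rel v4 a4 (R4, M4)" "bounded v4 a4" "Q t4 v4 a4" "n4 + F * t2 <= F * t4 + 2"
  "\<forall>r. 44 + num_regs pr <= r & r < h --> R4 r = R3 r"
  by blast
 have "(step w P ^^ (4 + n2 + 4 + n4)) (q, R, M) = (q + 8 + com_len pr c, R4, M4)"
  using steps_add[OF steps_add[OF steps_add[OF s1 2(1)] s3] 4(1)] .
 moreover have "4 + n2 + 4 + n4 + F * t <= F * t4 + 2"
  using 2(5) 4(5) F by (simp add: algebra_simps)
 moreover have "\<forall>r. 44 + num_regs pr <= r & r < h --> R4 r = R r"
  using 4(6) 2(6) x by (auto simp: R3_def R1_def)
 ultimately show ?case using 4(2-4) by blast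
qed

text \<open>The clock converts to machine steps with factor \<open>F\<close>: a tick pays for
  straight code, which is no longer than \<open>com_len pr c\<close>, and \<open>2 <= F\<close>
  covers the two instructions per simulated step of a call.\<close>

theorem com_code_correct:
 assumes "wf_com c" "code_at P p (com_code pr p h c)" "44 + num_regs pr <= h"
  "com_len pr c <= F" "2 <= F" "bounded v a" "rel v a (R, M)" "wp c Q t v a"
 shows "\<exists>n R' M' t' v' a'. (step w P ^^ n) (p, R, M) = (p + com_len pr c, R', M') &
  rel v' a' (R', M') & bounded v' a' & Q t' v' a' & n + F * t <= F * t' &
  (\<forall>r. 44 + num_regs pr <= r & r < h --> R' r = R r)"
 using assms
proof (induction c arbitrary: p h Q t v a R M)
 case Skip
 then show ?case by (intro exI[of _ 0]) auto
next
 case (Asg x e)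
 have b: "bounded v a" and r: "rel v a (R, M)" and h: "44 <= h" "x < 40" "wf_exp e"
  using Asg.prems by auto
 obtain R1 where 1: "straight w (exp_code h e) (R, M) = (R1, M)" "R1 h = val Z e v a"
  "\<forall>r<h. R1 r = R r" using exp_code_correct[OF b h(3) r h(1)] by blast
 have l: "val Z e v a < 2 ^ w" using val_less_word[OF b h(3)] .
 show ?case
 proof (rule straight_com_correct[OF Asg.prems(2)])
  show "straight w (com_code pr p h (Asg x e)) (R, M) = (R1(h + 1 := 0, x := val Z e v a), M)"
   using 1 l by (simp add: straight_append mov_code_def)
  show "rel (v(x := val Z e v a)) a (R1(h + 1 := 0, x := val Z e v a), M)"
   by (rule rel_asg[OF r h(2)]) (use 1 h in auto)
  show "bounded (v(x := val Z e v a)) a" using Asg.prems by (intro bounded_asg) auto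
  show "Q (t + 1) (v(x := val Z e v a)) a" using Asg.prems by (simp del: fun_upd_apply)
 qed (use Asg.prems 1 h in \<open>auto simp: mov_code_def list_all_append\<close>)
next
 case (St k e1 e2 e3)
 have b: "bounded v a" and r: "rel v a (R, M)" and h: "44 <= h"
  and wf: "wf_exp e1" "wf_exp e2" "wf_exp e3" "deg e1 <= 4" "deg e2 <= 4" "1 <= k" "k < 30"
  using St.prems by auto
 obtain R1 where 1: "straight w (exp_code h e1) (R, M) = (R1, M)" "R1 h = val Z e1 v a"
  "\<forall>r<h. R1 r = R r" using exp_code_correct[OF b wf(1) r h] by blast
 have r1: "rel v a (R1, M)" by (rule rel_cong[OF r]) (use 1 h in auto)
 obtain R2 where 2: "straight w (exp_code (h + 1) e2) (R1, M) = (R2, M)"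
  "R2 (h + 1) = val Z e2 v a" "\<forall>r<h+1. R2 r = R1 r"
  using exp_code_correct[OF b wf(2) r1, of "h + 1"] h by auto
 have r2: "rel v a (R2, M)" by (rule rel_cong[OF r1]) (use 2 h in auto)
 have y: "val Z e1 v a < Y" "val Z e2 v a < Y" using val_less_Y b wf by auto
 obtain R3 where 3: "straight w (adr_code h k) (R2, M) = (R3, M)"
  "R3 h = adr k (R2 h) (R2 (h + 1))" "\<forall>r<h. R3 r = R2 r"
  by (rule straight_adr[of R2 h k]) (use r2 y 1 2 wf h in \<open>auto simp: rel_def\<close>)
 have r3: "rel v a (R3, M)" by (rule rel_cong[OF r2]) (use 3 h in auto)
 obtain R4 where 4: "straight w (exp_code (h + 1) e3) (R3, M) = (R4, M)"
  "R4 (h + 1) = val Z e3 v a" "\<forall>r<h+1. R4 r = R3 r"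
  using exp_code_correct[OF b wf(3) r3, of "h + 1"] h by auto
 have r4: "rel v a (R4, M)" by (rule rel_cong[OF r3]) (use 4 h in auto)
 let ?ad = "adr k (val Z e1 v a) (val Z e2 v a)"
 have vd: "valid k (val Z e1 v a) (val Z e2 v a)" using y wf by (auto simp: valid_def)
 show ?case
 proof (rule straight_com_correct[OF St.prems(2)])
  show "straight w (com_code pr p h (St k e1 e2 e3)) (R, M) = (R4, M(?ad := val Z e3 v a))"
   using 1 2 3 4 by (simp add: straight_append)
  show "rel v (upd a k (val Z e1 v a) (val Z e2 v a) (val Z e3 v a)) (R4, M(?ad := val Z e3 v a))"
   by (rule rel_upd[OF r4 vd])
  show "bounded v (upd a k (val Z e1 v a) (val Z e2 v a) (val Z e3 v a))"
   using St.prems by (intro bounded_upd) auto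
 qed (use St.prems 1 2 3 4 h in \<open>auto simp: adr_code_def list_all_append\<close>)
next
 case (StHi e1 e2)
 have b: "bounded v a" and r: "rel v a (R, M)" and h: "44 <= h"
  and wf: "wf_exp e1" "wf_exp e2" "deg e1 <= 4"
  using StHi.prems by auto
 obtain R1 where 1: "straight w (exp_code h e1) (R, M) = (R1, M)" "R1 h = val Z e1 v a"
  "\<forall>r<h. R1 r = R r" using exp_code_correct[OF b wf(1) r h] by blast
 have r1: "rel v a (R1, M)" by (rule rel_cong[OF r]) (use 1 h in auto)
 have "valid 0 0 (val Z e1 v a)" using val_less_Y b wf Y_ge by (auto simp: valid_def)
 then have m: "M (R1 h) = a 0 0 (val Z e1 v a)" using rel_mem[OF r] 1 by fastforce
 obtain R2 where 2: "straight w (hi_code h) (R1, M) = (R2, M)"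
  "R2 h = adr 31 0 (M (R1 h) div Z)" "\<forall>r<h. R2 r = R1 r" "valid 31 0 (M (R1 h) div Z)"
  by (rule straight_hi[of R1 M h]) (use r1 m h b in \<open>auto simp: rel_def bounded_def\<close>)
 have r2: "rel v a (R2, M)" by (rule rel_cong[OF r1]) (use 2 h in auto)
 obtain R4 where 4: "straight w (exp_code (h + 1) e2) (R2, M) = (R4, M)"
  "R4 (h + 1) = val Z e2 v a" "\<forall>r<h+1. R4 r = R2 r"
  using exp_code_correct[OF b wf(2) r2, of "h + 1"] h by auto
 have r4: "rel v a (R4, M)" by (rule rel_cong[OF r2]) (use 4 h in auto)
 let ?j = "a 0 0 (val Z e1 v a) div Z"
 show ?case
 proof (rule straight_com_correct[OF StHi.prems(2)])
  show "straight w (com_code pr p h (StHi e1 e2)) (R, M) = (R4, M(adr 31 0 ?j := val Z e2 v a))"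
   using 1 2 4 m by (simp add: straight_append)
  show "rel v (upd a 31 0 ?j (val Z e2 v a)) (R4, M(adr 31 0 ?j := val Z e2 v a))"
   using rel_upd[OF r4] 2(4) m by simp
  show "bounded v (upd a 31 0 ?j (val Z e2 v a))"
   using StHi.prems by (intro bounded_upd) auto
 qed (use StHi.prems 1 2 4 h in \<open>auto simp: hi_code_def list_all_append\<close>)
next
 case (Acc e0 e1 e2)
 have b: "bounded v a" and r: "rel v a (R, M)" and h: "44 <= h"
  and wf: "wf_exp e0" "wf_exp e1" "wf_exp e2" "deg e0 <= 4" "deg e1 <= 4" "deg e2 <= 4"
  using Acc.prems by auto
 have y: "val Z e0 v a < Y" "val Z e1 v a < Y" "val Z e2 v a < Y" using val_less_Y b wf by auto
 have 0: "straight w [Const h 0] (R, M) = (R(h := 0), M)" by simp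
 have r0: "rel v a (R(h := 0), M)" by (rule rel_cong[OF r]) (use h in auto)
 obtain R1 where 1: "straight w (exp_code (h + 1) e0) (R(h := 0), M) = (R1, M)"
  "R1 (h + 1) = val Z e0 v a" "\<forall>r<h+1. R1 r = (R(h := 0)) r"
  using exp_code_correct[OF b wf(1) r0, of "h + 1"] h by auto
 have r1: "rel v a (R1, M)" by (rule rel_cong[OF r0]) (use 1 h in auto)
 obtain R2 where 2: "straight w (adr_code h 30) (R1, M) = (R2, M)"
  "R2 h = adr 30 (R1 h) (R1 (h + 1))" "\<forall>r<h. R2 r = R1 r"
  by (rule straight_adr[of R1 h 30]) (use r1 y 1 wf h Y_ge in \<open>auto simp: rel_def\<close>)
 have r2: "rel v a (R2, M)" by (rule rel_cong[OF r1]) (use 2 h in auto)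
 obtain R3 where 3: "straight w (exp_code (h + 1) e1) (R2, M) = (R3, M)"
  "R3 (h + 1) = val Z e1 v a" "\<forall>r<h+1. R3 r = R2 r"
  using exp_code_correct[OF b wf(2) r2, of "h + 1"] h by auto
 have inp: "M j = a 0 0 j" if "j < Y" for j
  using rel_mem[OF r, of 0 0 j] that Y_ge by (simp add: valid_def)
 define R4 where "R4 = R3(h + 1 := a 0 0 (val Z e1 v a))"
 have 4: "straight w [Load (h + 1) (h + 1)] (R3, M) = (R4, M)"
  using 3 inp y by (simp add: R4_def)
 have r4: "rel v a (R4, M)" by (rule rel_cong[OF r2]) (use 3 h in \<open>auto simp: R4_def\<close>)
 obtain R5 where 5: "straight w (exp_code (h + 2) e2) (R4, M) = (R5, M)"
  "R5 (h + 2) = val Z e2 v a" "\<forall>r<h+2. R5 r = R4 r"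
  using exp_code_correct[OF b wf(3) r4, of "h + 2"] h by auto
 have vd: "valid 30 0 (val Z e0 v a)" using y Y_ge by (auto simp: valid_def)
 let ?ad = "adr 30 0 (val Z e0 v a)"
 let ?s = "a 30 0 (val Z e0 v a) + a 0 0 (val Z e1 v a) * a 0 0 (val Z e2 v a)"
 have s: "?s < 2 ^ w" using Acc.prems by simp
 then have s2: "a 0 0 (val Z e1 v a) * a 0 0 (val Z e2 v a) < 2 ^ w" by linarith
 have R5: "R5 h = ?ad" "R5 (h + 1) = a 0 0 (val Z e1 v a)" using 5 3 2 1 by (auto simp: R4_def)
 have m: "M ?ad = a 30 0 (val Z e0 v a)" using rel_mem[OF r vd] .
 define R6 where "R6 = R5(h + 2 := a 30 0 (val Z e0 v a), h + 1 := ?s)"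
 have 6: "straight w [Load (h + 2) (h + 2), Op Mul (h + 1) (h + 1) (h + 2), Load (h + 2) h,
   Op Add (h + 1) (h + 1) (h + 2), Store h (h + 1)] (R5, M) = (R6, M(?ad := ?s))"
  using 5(2) R5 m inp y s s2 by (auto simp: R6_def add.commute fun_eq_iff)
 have r6: "rel v a (R6, M)"
  by (rule rel_cong[OF r4]) (use 5 h in \<open>auto simp: R6_def\<close>)
 show ?case
 proof (rule straight_com_correct[OF Acc.prems(2)])
  show "straight w (com_code pr p h (Acc e0 e1 e2)) (R, M) = (R6, M(?ad := ?s))"
   by (simp only: com_code.simps straight_append 0 1(1) 2(1) 3(1) 4 5(1) 6)
  show "rel v (upd a 30 0 (val Z e0 v a) ?s) (R6, M(?ad := ?s))"
   by (rule rel_upd[OF r6 vd])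
  show "bounded v (upd a 30 0 (val Z e0 v a) ?s)"
   using b s by (intro bounded_upd) auto
  show "\<forall>r. 44 + num_regs pr <= r & r < h --> R6 r = R r"
   using 1 2 3 5 by (auto simp: R6_def R4_def)
 qed (use Acc.prems in \<open>auto simp: adr_code_def list_all_append\<close>)
next
 case (Sq c1 c2)
 have l: "com_len pr c1 <= F" "com_len pr c2 <= F" using Sq.prems by auto
 obtain n1 R1 M1 t1 v1 a1 where 1: "(step w P ^^ n1) (p, R, M) = (p + com_len pr c1, R1, M1)"
  "rel v1 a1 (R1, M1)" "bounded v1 a1" "wp c2 Q t1 v1 a1" "n1 + F * t <= F * t1"
  "\<forall>r. 44 + num_regs pr <= r & r < h --> R1 r = R r"
  using Sq.IH(1)[of p h v a R M "wp c2 Q" t] Sq.prems l by (auto simp: code_at_append)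
 obtain n2 R2 M2 t2 v2 a2 where 2:
  "(step w P ^^ n2) (p + com_len pr c1, R1, M1) = (p + com_len pr c1 + com_len pr c2, R2, M2)"
  "rel v2 a2 (R2, M2)" "bounded v2 a2" "Q t2 v2 a2" "n2 + F * t1 <= F * t2"
  "\<forall>r. 44 + num_regs pr <= r & r < h --> R2 r = R1 r"
  using Sq.IH(2)[of "p + com_len pr c1" h v1 a1 R1 M1 Q t1] Sq.prems l 1
  by (auto simp: code_at_append length_com_code)
 show ?case
  using steps_add[OF 1(1) 2(1)] 1 2
  by (intro ex6I[of _ "n1 + n2" R2 M2
    t2 v2 a2])
   (auto simp: add.assoc)
next
 case (Cond e c1 c2)
 define p1 where "p1 = p + length (exp_code 0 e) + 1"
 define p2 where "p2 = p1 + com_len pr c1 + 2"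
 have l: "com_len pr c1 <= F" "com_len pr c2 <= F" "length (exp_code 0 e) + 3 <= F"
  using Cond.prems by auto
 have b: "bounded v a" and r: "rel v a (R, M)" and h: "44 <= h" and wf: "wf_exp e"
  using Cond.prems by auto
 have c: "code_at P p (exp_code h e)" "code_at P (p + length (exp_code 0 e)) [Jz h p2]"
  "code_at P p1 (com_code pr p1 h c1)"
  "code_at P (p1 + com_len pr c1) [Const h 0, Jz h (p2 + com_len pr c2)]"
  "code_at P p2 (com_code pr p2 h c2)"
  using Cond.prems(2)
  by (auto simp: Let_def code_at_append length_com_code length_exp_code[of h] p1_def p2_def
    add.assoc)
 obtain R1 where 1: "(step w P ^^ length (exp_code 0 e)) (p, R, M) =
   (p + length (exp_code 0 e), R1, M)"
  "R1 h = val Z e v a" "\<forall>r<h. R1 r = R r" "rel v a (R1, M)"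
  using steps_exp[OF c(1) b wf r h] by blast
 show ?case
 proof (cases "val Z e v a = 0")
  case True
  have s: "(step w P ^^ 1) (p + length (exp_code 0 e), R1, M) = (p2, R1, M)"
   using c(2) 1(2) True by (simp add: step_def)
  obtain n2 R2 M2 t2 v2 a2 where 2:
   "(step w P ^^ n2) (p2, R1, M) = (p2 + com_len pr c2, R2, M2)"
   "rel v2 a2 (R2, M2)" "bounded v2 a2" "Q t2 v2 a2" "n2 + F * (t + 1) <= F * t2"
   "\<forall>r. 44 + num_regs pr <= r & r < h --> R2 r = R1 r"
   using Cond.IH(2)[of p2 h v a R1 M Q "t + 1"] Cond.prems l 1 c True by auto
  have "length (exp_code 0 e) + 1 + n2 + F * t <= F * t2" using 2(5) l(3) by simp
  then show ?thesis
   using steps_add[OF steps_add[OF 1(1) s] 2(1)] 1 2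
   by (intro ex6I[of _ "length (exp_code 0 e) + 1 + n2" R2 M2
    t2 v2 a2]) (auto simp: p1_def p2_def)
 next
  case False
  have s: "(step w P ^^ 1) (p + length (exp_code 0 e), R1, M) = (p1, R1, M)"
   using c(2) 1(2) False by (simp add: step_def p1_def)
  obtain n2 R2 M2 t2 v2 a2 where 2:
   "(step w P ^^ n2) (p1, R1, M) = (p1 + com_len pr c1, R2, M2)"
   "rel v2 a2 (R2, M2)" "bounded v2 a2" "Q t2 v2 a2" "n2 + F * (t + 1) <= F * t2"
   "\<forall>r. 44 + num_regs pr <= r & r < h --> R2 r = R1 r"
   using Cond.IH(1)[of p1 h v a R1 M Q "t + 1"] Cond.prems l 1 c False by auto
  obtain R3 where R3: "R3 = R2(h := 0)" by simp
  have s3: "(step w P ^^ 2) (p1 + com_len pr c1, R2, M2) = (p2 + com_len pr c2, R3, M2)"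
   using c(4) by (simp add: numeral_2_eq_2 step_def R3)
  have r3: "rel v2 a2 (R3, M2)" "\<forall>r<h. R3 r = R2 r"
   by (rule rel_cong[OF 2(2)]) (use h in \<open>auto simp: R3\<close>)
  have "length (exp_code 0 e) + 1 + n2 + 2 + F * t <= F * t2" using 2(5) l(3) by simp
  then show ?thesis
   using steps_add[OF steps_add[OF steps_add[OF 1(1) s] 2(1)] s3] 1 2 r3
   by (intro ex6I[of _ "length (exp_code 0 e) + 1 + n2 + 2" R3 M2
    t2 v2 a2]) (auto simp: p1_def p2_def)
 qed
next
 case (For x e c)
 define q where "q = p + length (exp_code 0 e) + 1"
 have l: "com_len pr c <= F" "length (exp_code 0 e) + 9 <= F" using For.prems by auto
 have b: "bounded v a" and r: "rel v a (R, M)" and h: "44 <= h" "44 + num_regs pr <= h"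
  and wf: "wf_exp e" "x < 40" using For.prems by auto
 have c: "code_at P p (exp_code (h + 1) e)" "code_at P (p + length (exp_code 0 e)) [Const h 0]"
  "code_at P q ([Op Lt (h + 2) h (h + 1), Jz (h + 2) (q + 4 + com_len pr c + 4)] @
   mov_code x h (h + 2))"
  "code_at P (q + 4) (com_code pr (q + 4) (h + 2) c)"
  "code_at P (q + 4 + com_len pr c)
   [Const (h + 2) 1, Op Add h h (h + 2), Const (h + 2) 0, Jz (h + 2) q]"
  using For.prems(2)
  by (auto simp: Let_def code_at_append length_com_code length_exp_code[of "Suc h"] q_def
    mov_code_def eval_nat_numeral)
 obtain R1 where 1: "(step w P ^^ length (exp_code 0 e)) (p, R, M) =
   (p + length (exp_code 0 e), R1, M)"
  "R1 (h + 1) = val Z e v a" "\<forall>r<h+1. R1 r = R r" "rel v a (R1, M)"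
  using steps_exp[OF c(1) b wf(1) r] h by auto
 have s: "(step w P ^^ 1) (p + length (exp_code 0 e), R1, M) = (q, R1(h := 0), M)"
  using c(2) by (simp add: step_def q_def)
 have r2: "rel v a (R1(h := 0), M)" by (rule rel_cong[OF 1(4)]) (use h in auto)
 let ?k = "val Z e v a"
 have "\<exists>n R' M' t' v' a'. (step w P ^^ n) (q, R1(h := 0), M) = (q + 8 + com_len pr c, R', M') &
  rel v' a' (R', M') & bounded v' a' & Q t' v' a' & n + F * (t + 1) <= F * t' + 2 &
  (\<forall>r. 44 + num_regs pr <= r & r < h --> R' r = (R1(h := 0)) r)"
 proof (rule com_code_loop[where k = ?k and i = 0, OF _ wf(2) h(2) _ _ c(3) c(5) b r2])
  fix R M v a t Q
  assume "bounded v a" "rel v a (R, M)" "wp c Q t v a"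
  then show "\<exists>n R' M' t' v' a'. (step w P ^^ n) (q + 4, R, M) = (q + 4 + com_len pr c, R', M') &
   rel v' a' (R', M') & bounded v' a' & Q t' v' a' & n + F * t <= F * t' &
   (\<forall>r. 44 + num_regs pr <= r & r < h + 2 --> R' r = R r)"
   using For.IH[of "q + 4" "h + 2" v a R M Q t] For.prems c(4) l by auto
 qed (use For.prems l 1 in auto)
 then obtain n2 R2 M2 t2 v2 a2 where 2:
  "(step w P ^^ n2) (q, R1(h := 0), M) = (q + 8 + com_len pr c, R2, M2)"
  "rel v2 a2 (R2, M2)" "bounded v2 a2" "Q t2 v2 a2" "n2 + F * (t + 1) <= F * t2 + 2"
  "\<forall>r. 44 + num_regs pr <= r & r < h --> R2 r = (R1(h := 0)) r" by blast
 have "length (exp_code 0 e) + 1 + n2 + F * t <= F * t2" using 2(5) l(2) by simp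
 then show ?case
  using steps_add[OF steps_add[OF 1(1) s] 2(1)] 1 2
  by (intro ex6I[of _ "length (exp_code 0 e) + 1 + n2" R2 M2
    t2 v2 a2]) (simp add: q_def add_ac)
next
 case Call
 obtain n pc S N where run:
  "(step w' pr ^^ n) (0, (\<lambda>_. 0)(0 := v xlen), a 12 (v xrow)) = (pc, S, N)" "length pr <= pc"
  "Q (t + 1 + n) (v(xres := S 0)) (a(12 := (a 12)(v xrow := N)))"
  and pre: "v xmod = 2 ^ w'" "v xlen < 2 ^ w'" "\<forall>j. a 12 (v xrow) j < 2 ^ w'"
  using Call.prems by auto
 have code: "code_at P p (call_code p pr)" using Call.prems by simp
 obtain k R' M' where 1:
  "(step w P ^^ k) (p, R, M) = (p + length (call_code 0 pr), R', M')"
  "rel (v(xres := S 0)) (a(12 := (a 12)(v xrow := N))) (R', M')"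
  "bounded (v(xres := S 0)) (a(12 := (a 12)(v xrow := N)))"
  "k <= length (call_init pr) + 2 + 2 * n" "\<forall>r\<ge>44 + num_regs pr. R' r = R r"
  using call_correct[OF code \<open>rel v a (R, M)\<close> \<open>bounded v a\<close> pre(1,2) _ run(1,2)] pre(3)
  by blast
 have "2 * n <= F * n" using \<open>2 <= F\<close> by (rule mult_le_mono1)
 moreover have "length (call_init pr) + 2 <= F" using Call.prems(4) by (simp add: length_call_code)
 moreover have "F * (t + 1 + n) = F * t + F + F * n" by (simp add: distrib_left)
 ultimately have "k + F * t <= F * (t + 1 + n)" using 1(4) by linarith
 then show ?case using 1 run(3)
  by (intro ex6I[of _ k R' M'
    "t + 1 + n" "v(xres := S 0)" "a(12 := (a 12)(v xrow := N))"])
   (simp del: fun_upd_apply)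
qed

end

section \<open>Reasoning about structured programs\<close>

primrec mod_vars :: "com \<Rightarrow> nat set" where
 "mod_vars Skip = {}"
| "mod_vars (Asg x e) = {x}"
| "mod_vars (St k e1 e2 e3) = {}"
| "mod_vars (StHi e1 e2) = {}"
| "mod_vars (Acc e0 e1 e2) = {}"
| "mod_vars (Sq c1 c2) = mod_vars c1 \<union> mod_vars c2"
| "mod_vars (Cond e c1 c2) = mod_vars c1 \<union> mod_vars c2"
| "mod_vars (For x e c) = insert x (mod_vars c)"
| "mod_vars Call = {xres}"

primrec mod_arrays :: "com \<Rightarrow> nat set" where
 "mod_arrays Skip = {}"
| "mod_arrays (Asg x e) = {}"
| "mod_arrays (St k e1 e2 e3) = {k}"
| "mod_arrays (StHi e1 e2) = {31}"
| "mod_arrays (Acc e0 e1 e2) = {30}"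
| "mod_arrays (Sq c1 c2) = mod_arrays c1 \<union> mod_arrays c2"
| "mod_arrays (Cond e c1 c2) = mod_arrays c1 \<union> mod_arrays c2"
| "mod_arrays (For x e c) = mod_arrays c"
| "mod_arrays Call = {12}"

lemma steps_less:
 "(step w pr ^^ n) (pc, S, N) = (pc', S', N') ==> \<forall>r. S r < 2 ^ w ==> \<forall>j. N j < 2 ^ w ==>
  (\<forall>r. S' r < 2 ^ w) & (\<forall>j. N' j < 2 ^ w)"
proof (induction n arbitrary: pc S N)
 case (Suc n)
 obtain pc1 S1 N1 where e: "step w pr (pc, S, N) = (pc1, S1, N1)" by (metis prod_cases3)
 have "(\<forall>r. S1 r < 2 ^ w) & (\<forall>j. N1 j < 2 ^ w)"
 proof (cases "pc < length pr")
  case True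
  then show ?thesis using e Suc.prems(2,3) eval_op_less
   by (cases "pr ! pc") (auto simp: step_def)
 qed (use e Suc.prems in \<open>auto simp: step_def\<close>)
 moreover have "(step w pr ^^ n) (pc1, S1, N1) = (pc', S', N')"
  using Suc.prems(1) e by (simp add: funpow_Suc_right del: funpow.simps)
 ultimately show ?case using Suc.IH by blast
qed simp

context word_ram_sub
begin

definition frame :: "com \<Rightarrow> vars \<Rightarrow> arrays \<Rightarrow> vars \<Rightarrow> arrays \<Rightarrow> bool" where
 "frame c v a v' a' \<longleftrightarrow> (\<forall>x. x \<notin> mod_vars c --> v' x = v x) & (\<forall>k. k \<notin> mod_arrays c --> a' k = a k)"

lemma frame_var: "frame c v a v' a' ==> x \<notin> mod_vars c ==> v' x = v x"
 and frame_array: "frame c v a v' a' ==> k \<notin> mod_arrays c ==> a' k = a k"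
 by (auto simp: frame_def)

lemma wp_mono:
 "wp c Q t v a ==> (\<And>t v a. Q t v a ==> Q' t v a) ==> wp c Q' t v a"
proof (induction c arbitrary: Q Q' t v a)
 case (For x e c)
 have "foldr (\<lambda>i Q t v a. wp c Q (t + 1) (v(x := i)) a) is Q t v a ==>
   foldr (\<lambda>i Q t v a. wp c Q (t + 1) (v(x := i)) a) is Q' t v a" for "is" t v a
 proof (induction "is" arbitrary: t v a)
  case (Cons i "is")
  show ?case using Cons.prems For.IH[OF _ Cons.IH] by simp
 qed (use For.prems in auto)
 then show ?case using For.prems(1) by auto
next
 case (Sq c1 c2)
 then show ?case by (metis wp.simps(6))
next
 case (Cond e c1 c2)
 then show ?case by (auto split: if_splits)
next
 case Call
 then show ?case by fastforce
qed auto

lemma wp_loop_mono: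
 "foldr (\<lambda>i Q t v a. wp c Q (t + 1) (v(x := i)) a) is Q t v a ==>
  (\<And>t v a. Q t v a ==> Q' t v a) ==>
  foldr (\<lambda>i Q t v a. wp c Q (t + 1) (v(x := i)) a) is Q' t v a"
 by (induction "is" arbitrary: t v a) (auto intro: wp_mono)

text \<open>Boundedness, the frame and monotonicity of the clock hold after every run, whatever the
  postcondition. They are added here once, so that specifications need not state them.\<close>

lemma wp_frame_aux:
 "wp c Q t v a ==> bounded v a ==>
  wp c (\<lambda>t' v' a'. Q t' v' a' & t <= t' & bounded v' a' & frame c v a v' a') t v a"
proof (induction c arbitrary: Q t v a)
 case (Asg x e)
 then show ?case using bounded_asg by (simp add: frame_def)
next
 case (St k e1 e2 e3)
 then show ?case using bounded_upd by (simp add: frame_def upd_def)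
next
 case (StHi e1 e2)
 then show ?case using bounded_upd by (simp add: frame_def upd_def)
next
 case (Acc e0 e1 e2)
 then show ?case using bounded_upd by (simp add: frame_def upd_def)
next
 case (Sq c1 c2)
 from Sq.IH(1)[OF _ Sq.prems(2)] Sq.prems(1)
 have "wp c1 (\<lambda>t' v' a'. wp c2 Q t' v' a' & t <= t' & bounded v' a' & frame c1 v a v' a') t v a"
  by simp
 then have "wp c1 (wp c2 (\<lambda>t' v' a'. Q t' v' a' & t <= t' & bounded v' a' &
   frame (Sq c1 c2) v a v' a')) t v a"
 proof (rule wp_mono)
  fix t1 v1 a1
  assume 1: "wp c2 Q t1 v1 a1 & t <= t1 & bounded v1 a1 & frame c1 v a v1 a1"
  then have "wp c2 (\<lambda>t' v' a'. Q t' v' a' & t1 <= t' & bounded v' a' & frame c2 v1 a1 v' a') t1 v1 a1"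
   using Sq.IH(2) by blast
  then show "wp c2 (\<lambda>t' v' a'. Q t' v' a' & t <= t' & bounded v' a' &
    frame (Sq c1 c2) v a v' a') t1 v1 a1"
   by (rule wp_mono) (use 1 in \<open>auto simp: frame_def\<close>)
 qed
 then show ?case by simp
next
 case (Cond e c1 c2)
 show ?case
 proof (cases "val Z e v a ~= 0")
  case True
  then have "wp c1 (\<lambda>t' v' a'. Q t' v' a' & t + 1 <= t' & bounded v' a' & frame c1 v a v' a')
    (t + 1) v a"
   using Cond.IH(1)[of Q "t + 1"] Cond.prems by auto
  then have "wp c1 (\<lambda>t' v' a'. Q t' v' a' & t <= t' & bounded v' a' &
    frame (Cond e c1 c2) v a v' a') (t + 1) v a"
   by (rule wp_mono) (auto simp: frame_def)
  then show ?thesis using True by simp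
 next
  case False
  then have "wp c2 (\<lambda>t' v' a'. Q t' v' a' & t + 1 <= t' & bounded v' a' & frame c2 v a v' a')
    (t + 1) v a"
   using Cond.IH(2)[of Q "t + 1"] Cond.prems by auto
  then have "wp c2 (\<lambda>t' v' a'. Q t' v' a' & t <= t' & bounded v' a' &
    frame (Cond e c1 c2) v a v' a') (t + 1) v a"
   by (rule wp_mono) (auto simp: frame_def)
  then show ?thesis using False by simp
 qed
next
 case (For x e c)
 let ?F = "\<lambda>i Q t v a. wp c Q (t + 1) (v(x := i)) a"
 have "set is \<subseteq> {..<Z} ==> bounded v a ==> foldr ?F is Q t v a ==>
   foldr ?F is (\<lambda>t' v' a'. Q t' v' a' & t <= t' & bounded v' a' & frame (For x e c) v a v' a') t v a"
  for "is" t v a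
 proof (induction "is" arbitrary: t v a)
  case (Cons i "is")
  have b: "bounded (v(x := i)) a" using Cons.prems by (intro bounded_asg) auto
  have "wp c (\<lambda>t' v' a'. foldr ?F is Q t' v' a' & t + 1 <= t' & bounded v' a' &
    frame c (v(x := i)) a v' a') (t + 1) (v(x := i)) a"
   by (rule For.IH[OF _ b]) (use Cons.prems in \<open>simp del: fun_upd_apply\<close>)
  then have "wp c (foldr ?F is (\<lambda>t' v' a'. Q t' v' a' & t <= t' & bounded v' a' &
    frame (For x e c) v a v' a')) (t + 1) (v(x := i)) a"
  proof (rule wp_mono)
   fix t1 v1 a1
   assume 1: "foldr ?F is Q t1 v1 a1 & t + 1 <= t1 & bounded v1 a1 &
    frame c (v(x := i)) a v1 a1"
   then have "foldr ?F is (\<lambda>t' v' a'. Q t' v' a' & t1 <= t' & bounded v' a' &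
     frame (For x e c) v1 a1 v' a') t1 v1 a1"
    by (intro Cons.IH) (use 1 Cons.prems(1) in \<open>simp_all del: fun_upd_apply\<close>)
   then show "foldr ?F is (\<lambda>t' v' a'. Q t' v' a' & t <= t' & bounded v' a' &
     frame (For x e c) v a v' a') t1 v1 a1"
    by (rule wp_loop_mono) (use 1 in \<open>auto simp: frame_def\<close>)
  qed
  then show ?case by (simp del: fun_upd_apply)
 qed (auto simp: frame_def)
 moreover have "set [0..<val Z e v a] \<subseteq> {..<Z}" using For.prems by auto
 ultimately
 have "val Z e v a <= Z & foldr ?F [0..<val Z e v a] (\<lambda>t' v' a'. Q t' v' a' & t + 1 <= t' &
   bounded v' a' & frame (For x e c) v a v' a') (t + 1) v a"
  using For.prems by (simp del: set_upt)
 then show ?case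
  unfolding wp.simps by (elim conjE, intro conjI) (assumption, erule wp_loop_mono, simp)
next
 case Call
 then obtain n pc S N where 1: "(step w' pr ^^ n) (0, (\<lambda>_. 0)(0 := v xlen), a 12 (v xrow)) = (pc, S, N)"
  "length pr <= pc" "Q (t + 1 + n) (v(xres := S 0)) (a(12 := (a 12)(v xrow := N)))"
  and 2: "v xmod = 2 ^ w'" "v xlen < 2 ^ w'" "\<forall>j. a 12 (v xrow) j < 2 ^ w'" by auto
 have "(\<forall>r. S r < 2 ^ w') & (\<forall>j. N j < 2 ^ w')"
  by (rule steps_less[OF 1(1)]) (use 2 in auto)
 moreover have "Z < 2 ^ w" using Z_le_Y Y_less Y_ge by linarith
 ultimately have "S 0 < Z" "\<And>j. N j < Z" "\<And>j. N j < 2 ^ w"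
  using Z_sub by (meson less_le_trans less_trans)+
 then have "bounded (v(xres := S 0)) (a(12 := (a 12)(v xrow := N)))"
  using Call.prems(2) by (auto simp: bounded_def)
 moreover have "frame Call v a (v(xres := S 0)) (a(12 := (a 12)(v xrow := N)))"
  by (simp add: frame_def)
 ultimately show ?case using 1 2 unfolding wp.simps
  by (intro conjI exI[of _ n] exI[of _ pc] exI[of _ S] exI[of _ N]) auto
qed (auto simp: frame_def)

lemma wp_conseq:
 assumes "wp c Q t v a" "bounded v a"
  "\<And>t' v' a'. Q t' v' a' ==> t <= t' ==> bounded v' a' ==> frame c v a v' a' ==> Q' t' v' a'"
 shows "wp c Q' t v a"
 using wp_frame_aux[OF assms(1,2)] by (rule wp_mono) (use assms(3) in blast)

text \<open>Invariant rule with costs that may depend on the round. The body may assume the frame of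
  the whole loop, so an invariant mentions only what the loop changes; the summand 1 per round is
  the tick of the loop itself.\<close>

lemma wp_For:
 assumes n: "val Z e v0 a0 = n" "n <= Z" and b0: "bounded v0 a0" and I0: "I 0 v0 a0"
  and body: "\<And>i t v a. i < n ==> I i v a ==> bounded v a ==> frame (For x e c) v0 a0 v a ==>
   wp c (\<lambda>t' v' a'. t' <= t + T i & I (Suc i) v' a') t (v(x := i)) a"
  and fin: "\<And>t' v a. t' <= t0 + 1 + (\<Sum>i<n. T i + 1) ==> I n v a ==> bounded v a ==>
   frame (For x e c) v0 a0 v a ==> Q t' v a"
 shows "wp (For x e c) Q t0 v0 a0"
proof -
 let ?F = "\<lambda>i Q t v a. wp c Q (t + 1) (v(x := i)) a"
 have "i <= n ==> I i v a ==> bounded v a ==> frame (For x e c) v0 a0 v a ==>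
   t <= t0 + 1 + (\<Sum>i<i. T i + 1) ==> foldr ?F [i..<n] Q t v a" for i t v a
 proof (induction "n - i" arbitrary: i t v a)
  case 0
  then show ?case using fin by simp
 next
  case (Suc d)
  then have i: "i < n" by simp
  have b: "bounded (v(x := i)) a" using Suc.prems i n by (intro bounded_asg) auto
  have "wp c (foldr ?F [Suc i..<n] Q) (t + 1) (v(x := i)) a"
  proof (rule wp_conseq[OF body[OF i Suc.prems(2-4)] b])
   fix t' v' a'
   assume 1: "t' <= t + 1 + T i & I (Suc i) v' a'" "t + 1 <= t'" "bounded v' a'"
    "frame c (v(x := i)) a v' a'"
   have "frame (For x e c) v0 a0 v' a'" using 1(4) Suc.prems(4) by (auto simp: frame_def)
   then show "foldr ?F [Suc i..<n] Q t' v' a'"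
    using Suc.hyps(1)[of "Suc i" v' a' t'] Suc.hyps(2) 1 Suc.prems(5) i by auto
  qed
  then show ?case using i by (simp add: upt_conv_Cons del: fun_upd_apply)
 qed
 from this[of 0 v0 a0 "t0 + 1"] I0 b0 n show ?thesis
  by (simp add: frame_def)
qed

lemma wp_For_const:
 assumes n: "val Z e v0 a0 = n" "n <= Z" and b0: "bounded v0 a0" and I0: "I 0 v0 a0"
  and body: "\<And>i t v a. i < n ==> I i v a ==> bounded v a ==> frame (For x e c) v0 a0 v a ==>
   wp c (\<lambda>t' v' a'. t' <= t + T & I (Suc i) v' a') t (v(x := i)) a"
  and fin: "\<And>t' v a. t' <= t0 + 1 + n * (T + 1) ==> I n v a ==> bounded v a ==>
   frame (For x e c) v0 a0 v a ==> Q t' v a"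
 shows "wp (For x e c) Q t0 v0 a0"
 by (rule wp_For[where I = I and T = "\<lambda>_. T", OF n b0 I0 body])
  (use fin in auto)

end

text \<open>
 A complete program computes \<open>Z = (2 L + 8) ^ d\<close> for inputs of length \<open>L\<close>, runs the compiled
 statement, and outputs row 0 of array \<open>k\<close>, with the length in variable \<open>x\<close>.
\<close>

definition init_code :: "nat \<Rightarrow> instr list" where
 "init_code d = [Const 42 8, Op Add 43 0 0, Op Add 43 43 42, Const 40 1] @
  replicate d (Op Mul 40 40 43) @ [Op Mul 41 40 40, Op Mul 41 41 41]"

definition fin_code :: "nat \<Rightarrow> nat \<Rightarrow> instr list" where
 "fin_code k x = mov_code 1 x 42 @ [Const 0 k, Op Mul 0 0 41, Op Mul 0 0 41]"

definition program :: "nat \<Rightarrow> instr list \<Rightarrow> com \<Rightarrow> nat \<Rightarrow> nat \<Rightarrow> instr list" where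
 "program d pr c k x =
  init_code d @ com_code pr (length (init_code d)) (44 + num_regs pr) c @ fin_code k x"

definition input_vars :: "nat list \<Rightarrow> vars" where
 "input_vars xs = (\<lambda>_. 0)(0 := length xs)"

definition input_arrays :: "nat list \<Rightarrow> arrays" where
 "input_arrays xs = (\<lambda>k i j. if k = 0 & i = 0 & j < length xs then xs ! j else 0)"

text \<open>The additive term counts the code around the statement: \<open>d + 6\<close>
  instructions that compute \<open>Z\<close> and \<open>Z ^ 4\<close>, and 5 that set the output
  registers.\<close>

lemma program_correct:
 assumes ram: "word_ram_sub w Z w'"
  and Z: "Z = (2 * length xs + 8) ^ d" and d: "1 <= d"
  and xs: "\<forall>v\<in>set xs. v < 2 ^ w"
  and c: "wf_com c" and k: "k < 31" and x: "x < 40"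
  and wp: "word_ram_sub.wp w Z pr w' c
   (\<lambda>t v a. t <= T & v x = length ys & (\<forall>i<length ys. a k 0 i = ys ! i)) 0
   (input_vars xs) (input_arrays xs)"
 shows "\<exists>t. outputs_after w (program d pr c k x) xs ys t &
  t <= (com_len pr c + 2) * T + (d + 11)"
proof -
 interpret word_ram_sub w Z pr w' by (rule ram)
 let ?L = "length xs" and ?P = "program d pr c k x" and ?F = "com_len pr c + 2"
 have ZL: "2 * ?L + 8 <= Z" using self_le_power[of "2 * ?L + 8" d] d Z by simp
 have zw: "Z < 2 ^ w" "Y < 2 ^ w" "0 < w"
 proof -
  show "Z < 2 ^ w" "Y < 2 ^ w" using Z_le_Y Y_less Y_ge by linarith+
  then show "0 < w" using Z_ge by (cases w) auto
 qed
 have code: "code_at ?P 0 (init_code d)"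
  "code_at ?P (length (init_code d)) (com_code pr (length (init_code d)) (44 + num_regs pr) c)"
  "code_at ?P (length (init_code d) + com_len pr c) (fin_code k x)"
  using code_at_self[of "[]" ?P "[]"]
  by (auto simp: program_def code_at_append length_com_code)
 define R0 where "R0 = ((\<lambda>_. 0)(0 := ?L) :: nat \<Rightarrow> nat)"
 define M0 where "M0 = (\<lambda>a. if a < ?L then xs ! a else 0)"
 have init: "initial_config w xs = (0, R0, M0)"
  using ZL zw by (simp add: initial_config_def R0_def M0_def)
 have pw: "straight w (replicate n (Op Mul 40 40 43)) (R(43 := b, 40 := b ^ m), M) =
   (R(43 := b, 40 := b ^ (m + n)), M)" if "b ^ (m + n) < 2 ^ w" "1 <= b" for n b m R M
  using that
 proof (induction n arbitrary: m)
  case (Suc n)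
  have "b ^ Suc m <= b ^ (m + Suc n)" using Suc.prems by (intro power_increasing) auto
  then have "b ^ Suc m < 2 ^ w" using Suc.prems by linarith
  then have s: "b ^ m * b mod 2 ^ w = b ^ Suc m" by (simp add: mult.commute)
  have "straight w (replicate (Suc n) (Op Mul 40 40 43)) (R(43 := b, 40 := b ^ m), M) =
    straight w (replicate n (Op Mul 40 40 43)) (R(43 := b, 40 := b ^ Suc m), M)"
   by (simp add: s del: power_Suc)
  also have "\<dots> = (R(43 := b, 40 := b ^ (Suc m + n)), M)"
   using Suc.IH[of "Suc m"] Suc.prems by (simp del: fun_upd_apply)
  finally show ?case by (simp del: fun_upd_apply)
 qed simp
 let ?b = "2 * ?L + 8"
 define R1 where "R1 = R0(42 := 8, 43 := ?b, 40 := Z, 41 := Y)"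
 have i1: "straight w (init_code d) (R0, M0) = (R1, M0)"
 proof -
  have "?L + ?L < 2 ^ w" "?b < 2 ^ w" "8 < (2::nat) ^ w" "1 < (2::nat) ^ w"
   using ZL zw by linarith+
  then have l: "(?L + ?L) mod 2 ^ w = 2 * ?L" "?b mod 2 ^ w = ?b" "8 mod (2::nat) ^ w = 8"
   "1 mod (2::nat) ^ w = 1"
   by (simp_all only: mod_less mult_2)
  have a: "straight w [Const 42 8, Op Add 43 0 0, Op Add 43 43 42, Const 40 1] (R0, M0) =
    (R0(42 := 8, 43 := ?b, 40 := ?b ^ 0), M0)"
   using zw(3) by (auto simp: R0_def l)
  have b: "straight w (replicate d (Op Mul 40 40 43)) (R0(42 := 8, 43 := ?b, 40 := ?b ^ 0), M0) =
    (R0(42 := 8, 43 := ?b, 40 := Z), M0)"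
   using pw[of ?b 0 d "R0(42 := 8)" M0] Z zw by simp
  have zz: "Z * Z < 2 ^ w"
  proof -
   have "Z * Z <= Y * Y" using Z_le_Y by (intro mult_le_mono)
   moreover have "0 < Y * Y" using Y_ge by simp
   ultimately show ?thesis using Y_sq by linarith
  qed
  have y: "Y = Z * Z * (Z * Z)" by (simp add: Y_def eval_nat_numeral)
  have c: "straight w [Op Mul 41 40 40, Op Mul 41 41 41] (R0(42 := 8, 43 := ?b, 40 := Z), M0) =
    (R1, M0)"
   using zz zw(2) unfolding R1_def y by (simp add: fun_eq_iff)
  show ?thesis unfolding init_code_def by (simp only: straight_append a b c)
 qed
 have s1: "(step w ?P ^^ length (init_code d)) (0, R0, M0) = (length (init_code d), R1, M0)"
  using steps_straight[OF code(1), of w "(R0, M0)"] i1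
  by (simp add: init_code_def list_all_append list_all_iff)
 have r1: "rel (input_vars xs) (input_arrays xs) (R1, M0)"
 proof -
  have "M0 (adr k i j) = input_arrays xs k i j" for k i j
  proof (cases "k = 0 & i = 0")
   case False
   then have "1 <= k * Y + i" using Y_ge by (cases "k = 0") (auto simp: Suc_le_eq)
   then have "1 * Y <= (k * Y + i) * Y" by (rule mult_le_mono1)
   then have "?L <= adr k i j" using ZL Z_le_Y unfolding adr_def by linarith
   then show ?thesis using False by (auto simp: M0_def input_arrays_def)
  qed (simp add: M0_def input_arrays_def)
  then show ?thesis by (simp add: rel_def R1_def R0_def input_vars_def)
 qed
 have b1: "bounded (input_vars xs) (input_arrays xs)"
  using ZL Z_ge xs zw by (simp add: bounded_def input_vars_def input_arrays_def)
 obtain n R M t v a where 2: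
  "(step w ?P ^^ n) (length (init_code d), R1, M0) = (length (init_code d) + com_len pr c, R, M)"
  "rel v a (R, M)" "bounded v a" "t <= T" "v x = length ys" "\<forall>i<length ys. a k 0 i = ys ! i"
  "n <= ?F * t"
  using com_code_correct[OF c code(2) order_refl _ _ b1 r1 wp, of ?F] by auto
 define R2 where "R2 = R(42 := 0, 1 := length ys, 0 := k * Y * Y)"
 have "k * Y * Y < 2 ^ w"
  using adr_less_word[of k 0 0] k Y_ge by (simp add: adr_def valid_def)
 moreover have "k * Y * 1 <= k * Y * Y" using Y_ge by (intro mult_le_mono) auto
 ultimately have kw: "k * Y * Y < 2 ^ w" "k * Y < 2 ^ w" by linarith+
 have ys: "length ys < Z" using 2(3,5) by (metis bounded_def)
 have i2: "straight w (fin_code k x) (R, M) = (R2, M)"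
  using 2(2,5) kw ys zw k x Y_less Y_ge
  by (simp add: fin_code_def mov_code_def R2_def rel_def)
 have s3: "(step w ?P ^^ length (fin_code k x)) (length (init_code d) + com_len pr c, R, M) =
   (length ?P, R2, M)"
  using steps_straight[OF code(3), of w "(R, M)"] i2
  by (simp add: fin_code_def mov_code_def program_def length_com_code)
 have "(step w ?P ^^ (length (init_code d) + n + length (fin_code k x))) (initial_config w xs) =
   (length ?P, R2, M)"
  unfolding init using steps_add[OF steps_add[OF s1 2(1)] s3] .
 moreover have "\<forall>i<length ys. M (R2 0 + i) = ys ! i"
 proof (intro allI impI)
  fix i assume "i < length ys"
  then show "M (R2 0 + i) = ys ! i"
   using rel_mem[OF 2(2), of k 0 i] k ys Z_le_Y 2(6) Y_ge
   by (simp add: valid_def adr_def R2_def)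
 qed
 moreover have "R2 1 = length ys" by (simp add: R2_def)
 ultimately have "outputs_after w ?P xs ys (length (init_code d) + n + length (fin_code k x))"
  unfolding outputs_after_def by blast
 moreover have "n <= ?F * T" using 2(4,7) by (meson le_trans mult_le_mono2)
 then have "length (init_code d) + n + length (fin_code k x) <= ?F * T + (d + 11)"
  by (simp add: init_code_def fin_code_def mov_code_def)
 ultimately show ?thesis by blast
qed

section \<open>The program\<close>

abbreviation eadd (infixl "[+]" 65) where "e [+] f \<equiv> Bin Add e f"
abbreviation esub (infixl "[-]" 65) where "e [-] f \<equiv> Bin Sub e f"
abbreviation emul (infixl "[*]" 70) where "e [*] f \<equiv> Bin Mul e f"
abbreviation ediv (infixl "[div]" 70) where "e [div] f \<equiv> Bin Div e f"
abbreviation emod (infixl "[mod]" 70) where "e [mod] f \<equiv> Bin Mod e f"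
abbreviation eless (infix "[<]" 50) where "e [<] f \<equiv> Bin Lt e f"
abbreviation eeq (infix "[=]" 50) where "e [=] f \<equiv> Bin Eq e f"
abbreviation arr1 :: "nat \<Rightarrow> exp \<Rightarrow> exp" where "arr1 k e \<equiv> Ar k (Cn 0) e"
abbreviation st1 :: "nat \<Rightarrow> exp \<Rightarrow> exp \<Rightarrow> com" where "st1 k e f \<equiv> St k (Cn 0) e f"
abbreviation seq (infixr ";;" 60) where "c ;; d \<equiv> Sq c d"
abbreviation provided :: "exp \<Rightarrow> com \<Rightarrow> com" where "provided e c \<equiv> Cond e c Skip"

text \<open>Roles of the variables: 0 is the input length, 2 to 5 are \<open>l\<close>,
  \<open>m\<close>, \<open>k\<close>, \<open>2 * l\<close>, 6 is the last name given out, 7 to 9 are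
  arguments and result of naming, 10 and 11 are the block length and its exponent, 12 is the number
  of anchors, 24 to 28 describe the current string (address, length, first switch, names of its two
  parts). Roles of the arrays: 1 naming table, 2 letter names, 3 block names, 4 next occurrence of a
  block name, 5 strong periodicity, 6 anchors, 7 active prefixes, 8 node names of the contexts, 9
  weights, 10 heads, 11 and 13 members and sizes of the groups, 14 and 15 their pairs of heads, 16
  depth pairs of strings, 17 output. Array 12 holds the memories of the subroutine calls.\<close>

definition "name_code =
 provided (Ar 1 (Vr 7) (Vr 8) [=] Cn 0) (Asg 6 (Vr 6 [+] Cn 1);; St 1 (Vr 7) (Vr 8) (Vr 6));;
 Asg 9 (Ar 1 (Vr 7) (Vr 8))"

definition "read_code =
 Asg 2 (Lo (Cn 0));; Asg 3 (Lo (Cn 1));; Asg 4 (Lo (Cn 2 [+] Cn 2 [*] Vr 3));;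
 Asg 5 (Cn 2 [*] Vr 2);; Asg 6 (Cn 1)"

text \<open>Variable 33 becomes the least power of 2 that is at least the input length plus 3, and
  variable 22 its \<open>d\<close>-th power, which will be \<open>2 ^ w'\<close>. The number
  \<open>d\<close> is known when the program is built, so these products are unrolled.\<close>

definition "pow_code d =
 Asg 33 (Cn 1);;
 For 13 (Vr 0) (provided (Vr 33 [<] Vr 0 [+] Cn 3) (Asg 33 (Cn 2 [*] Vr 33)));;
 Asg 22 (Cn 1);;
 foldr (\<lambda>_. Sq (Asg 22 (Vr 22 [*] Vr 33))) [0..<d] Skip"

definition "half_code =
 Asg 10 (Cn 1);; Asg 11 (Cn 0);;
 For 13 (Vr 0) (provided (Cn 4 [*] Vr 10 [<] Vr 2 [+] Cn 1)
  (Asg 10 (Cn 2 [*] Vr 10);; Asg 11 (Vr 11 [+] Cn 1)))"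

text \<open>An input word may be too large for an index. Its quotient by \<open>Z\<close> is named
  through array 31, and the pair of that name and the remainder through the naming table; both keys
  are small.\<close>

definition "letter_code =
 For 13 (Vr 0) (
  provided (Hi (Vr 13) [=] Cn 0) (Asg 6 (Vr 6 [+] Cn 1);; StHi (Vr 13) (Vr 6));;
  Asg 7 (Hi (Vr 13));; Asg 8 (Lo (Vr 13));; name_code;;
  st1 2 (Vr 13) (Vr 9);; st1 3 (Vr 13) (Vr 9))"

text \<open>Naming by doubling in the style of Karp, Miller and Rosenberg: a block of length
  \<open>2 * h\<close> is named by the pair of names of its halves.\<close>

definition "double_code =
 Asg 10 (Cn 1);;
 For 14 (Vr 11) (
  For 13 (Vr 0) (
   Asg 7 (arr1 3 (Vr 13));; Asg 8 (arr1 3 (Vr 13 [+] Vr 10));; name_code;;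
   st1 3 (Vr 13) (Vr 9));;
  Asg 10 (Cn 2 [*] Vr 10))"

text \<open>Injective naming tables with a common supply of names; 1 is the name of the empty word.\<close>

definition names :: "(nat \<Rightarrow> nat \<Rightarrow> nat) \<Rightarrow> (nat \<Rightarrow> nat) \<Rightarrow> nat \<Rightarrow> bool" where
 "names T H c \<longleftrightarrow> (\<forall>p q r s. T p q = T r s --> T p q ~= 0 --> p = r & q = s) &
  (\<forall>p q. T p q <= c) & (\<forall>p q. T p q ~= 1) & (\<forall>q. T 0 q = 0) &
  (\<forall>x y. H x = H y --> H x ~= 0 --> x = y) & (\<forall>x. H x <= c) & 1 <= c"

text \<open>The naming table only ever grows, so a word named early keeps its name while later
  phases go on naming.\<close>

definition ext :: "(nat \<Rightarrow> nat \<Rightarrow> nat) \<Rightarrow> (nat \<Rightarrow> nat \<Rightarrow> nat) \<Rightarrow> bool" where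
 "ext T T' \<longleftrightarrow> (\<forall>p q. T p q ~= 0 --> T' p q = T p q)"

lemma ext_refl [simp]: "ext T T"
 by (simp add: ext_def)

lemma ext_trans: "ext T T' ==> ext T' T'' ==> ext T T''"
 unfolding ext_def by metis

lemma extD: "ext T T' ==> T p q ~= 0 ==> T' p q = T p q"
 by (simp add: ext_def)

lemma names_inj: "names T H c ==> T p q = T r s ==> T p q ~= 0 ==> p = r & q = s"
 unfolding names_def by blast

lemma names_le: "names T H c ==> T p q <= c"
 by (simp add: names_def)

text \<open>\<open>p ~= 0\<close> protects row 0: the name 0 stands for unnamed, and an extension of
  an unnamed word must not obtain a name.\<close>

lemma names_new:
 assumes n: "names T H c" and 0: "T p q = 0" and p: "p ~= 0"
 shows "names (T(p := (T p)(q := Suc c))) H (Suc c)"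
proof -
 have le: "T r s <= c" "H x <= c" for r s x using n by (auto simp: names_def)
 have ne: "T r s ~= Suc c" for r s using le(1)[of r s] by simp
 have T': "(T(p := (T p)(q := Suc c))) r s = (if r = p & s = q then Suc c else T r s)" for r s
  by auto
 have inj: "T p q = T r s ==> T p q ~= 0 ==> p = r & q = s" for p q r s
  using n names_inj by blast
 have c: "1 <= c" "\<And>p q. T p q ~= 1" "\<And>q. T 0 q = 0"
  "\<And>x y. H x = H y ==> H x ~= 0 ==> x = y" using n unfolding names_def by blast+
 show ?thesis
  unfolding names_def T'
 proof (intro conjI allI impI)
  fix p1 q1 r s
  assume "(if p1 = p & q1 = q then Suc c else T p1 q1) = (if r = p & s = q then Suc c else T r s)"
   "(if p1 = p & q1 = q then Suc c else T p1 q1) ~= 0"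
  then have "p1 = r & q1 = s" using ne[of r s] ne[of p1 q1] inj[of p1 q1 r s]
   by (auto split: if_splits)
  then show "p1 = r" "q1 = s" by auto
  next
  fix x y assume "H x = H y" "H x ~= 0"
  then show "x = y" by (rule c(4))
 qed (use c(1-3) p le in \<open>auto intro: le_SucI\<close>)
qed

lemma names_new_hi:
 assumes n: "names T H c" and 0: "H x = 0"
 shows "names T (H(x := Suc c)) (Suc c)"
proof -
 have le: "T r s <= c" "H x <= c" for r s x using n by (auto simp: names_def)
 have ne: "H y ~= Suc c" for y using le(2)[of y] by simp
 have c: "1 <= c" "\<And>p q. T p q ~= 1" "\<And>q. T 0 q = 0"
  "\<And>x y. H x = H y ==> H x ~= 0 ==> x = y" using n unfolding names_def by blast+
 show ?thesis
  unfolding names_def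
 proof (intro conjI allI impI)
  fix y z
  assume "(H(x := Suc c)) y = (H(x := Suc c)) z" "(H(x := Suc c)) y ~= 0"
  then show "y = z" using ne[of y] ne[of z] c(4)[of y z] by (auto split: if_splits)
 next
  fix p q r s assume "T p q = T r s" "T p q ~= 0"
  then show "p = r" "q = s" using names_inj[OF n] by blast+
 next
  fix y show "(H(x := Suc c)) y <= Suc c" using le(2)[of y] by simp
 next
  fix p q show "T p q <= Suc c" using le(1)[of p q] by simp
 qed (use c(1-3) in \<open>simp_all\<close>)
qed

context word_ram_sub
begin

lemmas wps = wp.simps(1-7)

lemma upd_same: "upd a k i j x k' i' j' = (if k' = k & i' = i & j' = j then x else a k' i' j')"
 by (simp add: upd_def)

lemma upd_array: "k' ~= k ==> upd a k i j x k' = a k'"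
 by (simp add: upd_def)

lemma upd_row: "k' ~= k \<or> i' ~= i ==> upd a k i j x k' i' = a k' i'"
 by (auto simp: upd_def)

lemma upd_row_same: "upd a k i j x k i = (a k i)(j := x)"
 by (auto simp: upd_def)

lemma upd_conv: "upd a k i j x = a(k := (a k)(i := (a k i)(j := x)))"
 by (auto simp: upd_def fun_eq_iff)

lemma wp_name:
 assumes n: "names (a 1) (a 31 0) (v 6)" and c: "v 6 + 1 < Z" and p: "v 7 ~= 0" and b: "bounded v a"
  and Q: "\<And>t' c' T'. t' <= t + 4 ==> names T' (a 31 0) c' ==> ext (a 1) T' ==> v 6 <= c' ==>
   c' <= v 6 + 1 ==> T' (v 7) (v 8) ~= 0 ==>
   Q t' (v(6 := c', 9 := T' (v 7) (v 8))) (a(1 := T'))"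
 shows "wp name_code Q t v a"
proof (cases "a 1 (v 7) (v 8) = 0")
 case True
 let ?T = "(a 1)(v 7 := (a 1 (v 7))(v 8 := Suc (v 6)))"
 have "names ?T (a 31 0) (Suc (v 6))" using names_new[OF n True p] .
 moreover have "ext (a 1) ?T" using True by (auto simp: ext_def)
 ultimately have "Q (Suc (Suc (Suc (Suc t)))) (v(6 := Suc (v 6), 9 := ?T (v 7) (v 8))) (a(1 := ?T))"
  using Q[of "Suc (Suc (Suc (Suc t)))" ?T "Suc (v 6)"] by simp
 then show ?thesis using True c by (simp add: name_code_def upd_conv)
next
 case False
 have "a 1 (v 7) (v 8) < Z" using b by (simp add: bounded_def)
 moreover have "Q (t + 2) v' a" if "v' = v(9 := a 1 (v 7) (v 8))" for v'
  using Q[of "t + 2" "a 1" "v 6"] n False that by (simp del: fun_upd_apply)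
 ultimately show ?thesis using False by (simp add: name_code_def)
qed

end

text \<open>An input of the algorithm, given by its memory image \<open>X\<close> of length \<open>L\<close>.\<close>

locale input_ram = word_ram_sub +
 fixes X :: "nat \<Rightarrow> nat" and L l m k :: nat
 assumes X_less: "X j < 2 ^ w" and X_out: "L <= j ==> X j = 0"
  and Z_big: "64 * (L + 4) ^ 3 <= Z" and L_ge: "3 + 2 * m <= L" and l_le: "l <= m"
  and k_le: "k <= L" and X_l: "X 0 = l" and X_m: "X 1 = m" and X_k: "X (2 + 2 * m) = k"
begin

text \<open>\<open>Z_big\<close> expanded into monomials, so that linear arithmetic can bound all
  counters. The largest ones, the number of names and the total size of the groups, are cubic in
  \<open>L\<close>.\<close>

lemma Z_cube: "64 * (L * L * L) + 768 * (L * L) + 3072 * L + 4096 <= Z"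
 using Z_big by (simp add: power3_eq_cube algebra_simps)

lemma Z_lin: "3072 * L + 4096 <= Z"
 using Z_cube by linarith

definition base :: "vars \<Rightarrow> arrays \<Rightarrow> bool" where
 "base v a \<longleftrightarrow> v 0 = L & v 2 = l & v 3 = m & v 4 = k & v 5 = 2 * l & a 0 0 = X"

lemma read_correct:
 assumes "v 0 = L" "a 0 0 = X"
 shows "wp read_code (\<lambda>t' v' a'. t' = t + 5 & base v' a' & v' 6 = 1 & a' = a) t v a"
proof -
 have "l < Z" "m < Z" "k < Z" "2 * l < Z" "1 < Z" using Z_lin L_ge l_le k_le by linarith+
 then show ?thesis using X_l X_m X_k assms
  by (simp add: read_code_def base_def)
qed

lemma pow_correct:
 assumes "base v a" "bounded v a" "(2 * L + 6) ^ d <= Z"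
 shows "wp (pow_code d) (\<lambda>t' v' a'. t' <= t + 5 * L + d + 10 & a' = a &
  (\<exists>e. L + 3 <= 2 ^ e & 2 ^ e < 2 * L + 6 & v' 22 = (2 ^ e) ^ d)) t v a"
proof -
 have z: "1 < Z" "0 < Z" "L <= Z" "2 * L + 6 < Z" using Z_lin by linarith+
 have b: "v 0 = L" using assms by (auto simp: base_def)
 \<comment> \<open>As long as the threshold is not reached, every round has doubled the value, so
   the exponent equals the round number. After \<open>L\<close> rounds the threshold is passed
   because \<open>L + 3 <= 2 ^ L\<close>.\<close>
 let ?I = "\<lambda>i v' a'. a' = a & (\<exists>e. v' 33 = 2 ^ e & v' 33 < 2 * L + 6 & (v' 33 < L + 3 --> e = i))"
 have pow: "x < 2 * L + 6 ==> v 33 = x ==> v 22 = x ^ n ==> n + length is = d ==>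
   (\<And>t' v'. t' <= t + length is ==> v' 33 = x ==> v' 22 = x ^ d ==> Q t' v' a) ==>
   wp (foldr (\<lambda>_. Sq (Asg 22 (Vr 22 [*] Vr 33))) is Skip) Q t v a" for x n Q t v "is"
 proof (induction "is" arbitrary: n t v)
  case (Cons i "is")
  have "x ^ Suc n < Z"
  proof (cases "x <= 1")
   case True
   then have "x ^ Suc n <= 1" by (intro power_le_one) auto
   then show ?thesis using z by linarith
  next
   case False
   have "x ^ Suc n <= x ^ d" using Cons.prems False by (intro power_increasing) auto
   also have "\<dots> < (2 * L + 6) ^ d" using Cons.prems by (intro power_strict_mono) auto
   finally show ?thesis using assms by linarith
  qed
  moreover have "wp (foldr (\<lambda>_. Sq (Asg 22 (Vr 22 [*] Vr 33))) is Skip) Q (t + 1)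
    (v(22 := x ^ Suc n)) a"
  proof (rule Cons.IH)
   show "(v(22 := x ^ Suc n)) 22 = x ^ Suc n" by simp
  qed (use Cons.prems in auto)
  ultimately show ?case using Cons.prems(2,3) by (simp add: mult.commute)
 qed simp
 have "x + 3 <= 2 ^ x" if "3 <= x" for x :: nat
  using that by (induction x rule: nat_induct_at_least) auto
 then have LL: "L + 3 <= 2 ^ L" using L_ge by simp
 show ?thesis
  unfolding pow_code_def wps
  apply (intro conjI)
  using z apply simp
  apply (rule wp_For_const[where I = ?I and T = 3 and n = L])
  using b z assms bounded_asg apply simp_all[3]
  subgoal by (auto intro: exI[of _ 0])
  subgoal premises p for i t v1 a1
  proof -
   have v0: "v1 0 = L" using frame_var[OF p(4), of 0] b by simp
   from p(2) obtain e where e: "a1 = a" "v1 33 = 2 ^ e" "v1 33 < 2 * L + 6"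
    "v1 33 < L + 3 --> e = i" by blast
   show ?thesis
   proof (cases "v1 33 < L + 3")
    case True
    then show ?thesis using e v0 z by (simp add: wps exI[of _ "Suc i"])
   next
    case False
    then show ?thesis using e v0 by (simp add: wps)
   qed
  qed
  subgoal premises p for t1 v1 a1
  proof -
   from p(2) obtain e where e: "a1 = a" "v1 33 = 2 ^ e" "v1 33 < 2 * L + 6"
    "v1 33 < L + 3 --> e = L" by blast
   then have "L + 3 <= 2 ^ e" using LL by (cases "v1 33 < L + 3") auto
   then show ?thesis
    using p(1) z e by (simp, intro pow[of "2 ^ e" _ 0]) auto
  qed
  done
qed

lemma half_correct:
 assumes "base v a" "bounded v a"
 shows "wp half_code (\<lambda>t' v' a'. t' <= t + 5 * L + 10 & a' = a &
  (\<exists>e. v' 11 = e & l < 4 * 2 ^ e & (2 <= l --> 2 * 2 ^ e <= l) & 2 ^ e <= l + 1)) t v a"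
proof -
 have z: "1 < Z" "0 < Z" "L <= Z" using Z_lin by linarith+
 have b: "v 0 = L" "v 2 = l" using assms by (auto simp: base_def)
 have lL: "l < 2 ^ L" using L_ge l_le less_exp[of L] by linarith
 let ?I = "\<lambda>i v' a'. a' = a & (\<exists>e\<le>i. v' 11 = e & v' 10 = 2 ^ e & (4 * 2 ^ e <= l --> e = i) &
  (2 <= l --> 2 * 2 ^ e <= l) & 2 ^ e <= l + 1)"
 show ?thesis
  unfolding half_code_def wps
  apply (intro conjI)
  using z apply simp
  using z apply simp
  apply (rule wp_For_const[where I = ?I and T = 4 and n = L])
  using b z assms bounded_asg apply simp_all[3]
  subgoal by simp
  subgoal premises p for i t v1 a1
  proof -
   have v0: "v1 2 = l" using frame_var[OF p(4), of 2] b by simp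
   from p(2) obtain e where e: "a1 = a" "e <= i" "v1 11 = e" "v1 10 = 2 ^ e"
    "4 * 2 ^ e <= l --> e = i" "2 <= l --> 2 * 2 ^ e <= l" "2 ^ e <= l + 1" by blast
   have "e < Z" using e(2) p(1) z by linarith
   show ?thesis
   proof (cases "4 * 2 ^ e <= l")
    case True
    have "2 * 2 ^ e < Z" "Suc i < Z" using True Z_lin L_ge l_le p(1) by linarith+
    then show ?thesis using e v0 True by (simp add: wps)
   next
    case False
    then show ?thesis using e v0 by (simp add: wps)
   qed
  qed
  subgoal premises p for t1 v1 a1
  proof -
   from p(2) obtain e where e: "a1 = a" "v1 11 = e" "4 * 2 ^ e <= l --> e = L"
    "2 <= l --> 2 * 2 ^ e <= l" "2 ^ e <= l + 1" by blast
   then have "l < 4 * 2 ^ e" using lL by (cases "4 * 2 ^ e <= l") auto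
   then show ?thesis using e p(1) by auto
  qed
  done
qed

text \<open>A round consumes at most two names, one for the quotient and one for the pair, which
  gives \<open>1 + 2 * L\<close>. Names reflect equality because a word is recovered from its
  quotient and remainder.\<close>

lemma letter_correct:
 assumes base: "base v a" and bd: "bounded v a" and v6: "v 6 = 1"
  and z: "\<And>i j. a 1 i j = 0" "\<And>j. a 31 0 j = 0" "\<And>j. a 2 0 j = 0" "\<And>j. a 3 0 j = 0"
 shows "wp letter_code (\<lambda>t' v' a'. t' <= t + 1 + L * 12 & names (a' 1) (a' 31 0) (v' 6) &
  v' 6 <= 1 + 2 * L & (\<forall>i<L. a' 2 0 i ~= 0) & (\<forall>i\<ge>L. a' 2 0 i = 0) &
  (\<forall>i<L. \<forall>j<L. a' 2 0 i = a' 2 0 j \<longleftrightarrow> X i = X j) & a' 3 0 = a' 2 0) t v a"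
proof -
 define I where "I i v' a' \<longleftrightarrow> names (a' 1) (a' 31 0) (v' 6) & v' 6 <= 1 + 2 * i &
  (\<forall>j<i. a' 31 0 (X j div Z) ~= 0 & a' 1 (a' 31 0 (X j div Z)) (X j mod Z) ~= 0 &
   a' 2 0 j = a' 1 (a' 31 0 (X j div Z)) (X j mod Z)) &
  (\<forall>j\<ge>i. a' 2 0 j = 0) & a' 3 0 = a' 2 0" for i and v' :: vars and a' :: arrays
 have b: "v 0 = L" "a 0 0 = X" using base by (auto simp: base_def)
 have LZ: "L <= Z" using Z_lin by linarith
 show ?thesis
  unfolding letter_code_def
 proof (rule wp_For_const[where I = I and T = 11 and n = L])
  show "I 0 v a" using z v6 by (auto simp: I_def names_def)
 next
  fix i t1 v1 a1
  assume i: "i < L" and I: "I i v1 a1" and bd1: "bounded v1 a1"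
   and fr: "frame (For 13 (Vr 0) (
  provided (Hi (Vr 13) [=] Cn 0) (Asg 6 (Vr 6 [+] Cn 1);; StHi (Vr 13) (Vr 6));;
  Asg 7 (Hi (Vr 13));; Asg 8 (Lo (Vr 13));; name_code;;
  st1 2 (Vr 13) (Vr 9);; st1 3 (Vr 13) (Vr 9))) v a v1 a1"
  have X1: "a1 0 0 = X" using frame_array[OF fr, of 0] b by (simp add: name_code_def)
  let ?h = "X i div Z"
  have rest: "wp (Asg 7 (Hi (Vr 13));; Asg 8 (Lo (Vr 13));; name_code;;
    st1 2 (Vr 13) (Vr 9);; st1 3 (Vr 13) (Vr 9)) (\<lambda>t' v' a'. t' <= t1 + 11 & I (Suc i) v' a') t2 v2 a2"
   if t2: "t2 <= t1 + 3" and bd2: "bounded v2 a2" and v2: "v2 13 = i"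
    and n2: "names (a2 1) (a2 31 0) (v2 6)" "v2 6 <= 2 + 2 * i" and h: "a2 31 0 ?h ~= 0"
    and eq: "a2 0 = a1 0" "a2 1 = a1 1" "a2 2 = a1 2" "a2 3 = a1 3"
    and ex: "\<And>x. a1 31 0 x ~= 0 ==> a2 31 0 x = a1 31 0 x"
   for t2 v2 a2
  proof -
   have Zs: "a2 31 0 ?h < Z" "X i mod Z < Z" "v2 6 + 1 < Z"
    using bd2 Z_ge n2(2) i Z_lin by (auto simp: bounded_def)
   let ?v = "v2(7 := a2 31 0 ?h, 8 := X i mod Z)"
   have bd3: "bounded ?v a2" using bd2 Zs by (intro bounded_asg) auto
   have "wp name_code (wp (st1 2 (Vr 13) (Vr 9);; st1 3 (Vr 13) (Vr 9))
     (\<lambda>t' v' a'. t' <= t1 + 11 & I (Suc i) v' a')) (t2 + 2) ?v a2"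
   proof (rule wp_name)
    fix t' c' T'
    assume t': "t' <= t2 + 2 + 4" and T': "names T' (a2 31 0) c'" "ext (a2 1) T'"
     "?v 6 <= c'" "c' <= ?v 6 + 1" "T' (?v 7) (?v 8) ~= 0"
    let ?x = "T' (a2 31 0 ?h) (X i mod Z)"
    have xz: "?x < Z" using names_le[OF T'(1), of "a2 31 0 ?h" "X i mod Z"] T'(4) Zs by simp
    have old: "T' (a2 31 0 (X j div Z)) (X j mod Z) = a1 2 0 j & a1 2 0 j ~= 0 &
     a2 31 0 (X j div Z) ~= 0" if "j < i" for j
     using I that ex[of "X j div Z"] extD[OF T'(2)] eq by (auto simp: I_def)
    have "I (Suc i) (?v(6 := c', 9 := ?x)) (upd (upd (a2(1 := T')) 2 0 i ?x) 3 0 i ?x)"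
    proof -
     have "c' <= 1 + 2 * Suc i" using T'(4) n2(2) by simp
     moreover have "\<forall>j\<ge>Suc i. ((a1 2 0)(i := ?x)) j = 0" "a1 3 0 = a1 2 0"
      using I by (auto simp: I_def)
     moreover have "\<forall>j<Suc i. a2 31 0 (X j div Z) ~= 0 &
       T' (a2 31 0 (X j div Z)) (X j mod Z) ~= 0 &
       ((a1 2 0)(i := ?x)) j = T' (a2 31 0 (X j div Z)) (X j mod Z)"
      using old h T'(5) by (auto simp: less_Suc_eq)
     ultimately show ?thesis
      unfolding I_def using T'(1) eq by (simp add: upd_array upd_row_same)
    qed
    then show "wp (st1 2 (Vr 13) (Vr 9);; st1 3 (Vr 13) (Vr 9))
     (\<lambda>t' v' a'. t' <= t1 + 11 & I (Suc i) v' a') t' (?v(6 := c', 9 := T' (?v 7) (?v 8)))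
     (a2(1 := T'))"
     using t' t2 v2 xz by (simp add: wps)
   qed (use n2 Zs h bd3 in auto)
   then show ?thesis using v2 Zs eq X1 by (simp add: wps numeral_2_eq_2)
  qed
  have H1: "names (a1 1) (a1 31 0) (v1 6)" "v1 6 <= 1 + 2 * i" using I by (auto simp: I_def)
  show "wp (provided (Hi (Vr 13) [=] Cn 0) (Asg 6 (Vr 6 [+] Cn 1);; StHi (Vr 13) (Vr 6));;
    Asg 7 (Hi (Vr 13));; Asg 8 (Lo (Vr 13));; name_code;;
    st1 2 (Vr 13) (Vr 9);; st1 3 (Vr 13) (Vr 9))
    (\<lambda>t' v' a'. t' <= t1 + 11 & I (Suc i) v' a') t1 (v1(13 := i)) a1"
  proof (cases "a1 31 0 ?h = 0")
   case True
   have z: "Suc (v1 6) < Z" using H1(2) i Z_lin by linarith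
   have "wp (Asg 7 (Hi (Vr 13));; Asg 8 (Lo (Vr 13));; name_code;;
    st1 2 (Vr 13) (Vr 9);; st1 3 (Vr 13) (Vr 9)) (\<lambda>t' v' a'. t' <= t1 + 11 & I (Suc i) v' a')
    (t1 + 3) (v1(13 := i, 6 := Suc (v1 6))) (upd a1 31 0 ?h (Suc (v1 6)))"
    by (rule rest) (use True H1 z bd1 i LZ names_new_hi[OF H1(1) True] in
     \<open>auto simp: upd_array upd_row_same intro!: bounded_upd bounded_asg\<close>)
   then show ?thesis using True X1 z
    by (simp only: wps) (simp add: numeral_3_eq_3)
  next
   case False
   have "wp (Asg 7 (Hi (Vr 13));; Asg 8 (Lo (Vr 13));; name_code;;
    st1 2 (Vr 13) (Vr 9);; st1 3 (Vr 13) (Vr 9)) (\<lambda>t' v' a'. t' <= t1 + 11 & I (Suc i) v' a')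
    (t1 + 1) (v1(13 := i)) a1"
    by (rule rest) (use False H1 bd1 i LZ in \<open>auto intro!: bounded_asg\<close>)
   then show ?thesis using False X1 by (simp only: wps) simp
  qed
 next
  fix t' v' a'
  assume t': "t' <= t + 1 + L * (11 + 1)" and I: "I L v' a'" and bd': "bounded v' a'"
  have eqs: "a' 2 0 i = a' 2 0 j \<longleftrightarrow> X i = X j" if "i < L" "j < L" for i j
  proof
   assume e: "a' 2 0 i = a' 2 0 j"
   have "a' 31 0 (X i div Z) = a' 31 0 (X j div Z) & X i mod Z = X j mod Z"
    by (rule names_inj[where T = "a' 1"]) (use I that e in \<open>auto simp: I_def\<close>)
   moreover have "a' 31 0 (X i div Z) ~= 0" using I that by (auto simp: I_def)
   ultimately have "X i div Z = X j div Z & X i mod Z = X j mod Z"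
    using I unfolding I_def names_def by metis
   then show "X i = X j" by (metis div_mult_mod_eq)
  qed (use I that in \<open>auto simp: I_def\<close>)
  show "t' <= t + 1 + L * 12 & names (a' 1) (a' 31 0) (v' 6) &
   v' 6 <= 1 + 2 * L & (\<forall>i<L. a' 2 0 i ~= 0) & (\<forall>i\<ge>L. a' 2 0 i = 0) &
   (\<forall>i<L. \<forall>j<L. a' 2 0 i = a' 2 0 j \<longleftrightarrow> X i = X j) & a' 3 0 = a' 2 0"
   using t' I eqs unfolding I_def by auto
 qed (use b LZ bd in auto)
qed

end

section \<open>Naming blocks by doubling and testing windows for strong periodicity\<close>

definition "round_code =
 For 13 (Vr 0) (
  Asg 7 (arr1 3 (Vr 13));; Asg 8 (arr1 3 (Vr 13 [+] Vr 10));; name_code;;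
  st1 3 (Vr 13) (Vr 9))"

lemma double_code_eq: "double_code = Asg 10 (Cn 1);; For 14 (Vr 11) (round_code;; Asg 10 (Cn 2 [*] Vr 10))"
 by (simp add: double_code_def round_code_def)

text \<open>Four blocks longer than \<open>l / 4\<close> cover a window. Blocks that would stick out
  are moved left, so that they and their copies at the distance in variable 31 stay inside.\<close>

definition "block_code =
 For 16 (Cn 4) (
  Asg 33 (Vr 16 [*] Vr 10);; Asg 34 (Vr 2 [-] Vr 31 [-] Vr 10);;
  provided (Vr 34 [<] Vr 33) (Asg 33 (Vr 34));;
  Cond (arr1 3 (Vr 13 [+] Vr 33) [=] arr1 3 (Vr 13 [+] Vr 33 [+] Vr 31)) Skip (Asg 32 (Cn 0)))"

text \<open>Positions are scanned from right to left, and array 4 maps a block name to 1 plus the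
  position of its nearest occurrence to the right. Only the distance to that occurrence has to be
  tested as a period.\<close>

definition "sp_code =
 For 14 (Vr 0) (
  Asg 13 (Vr 0 [-] Cn 1 [-] Vr 14);; Asg 7 (arr1 3 (Vr 13));;
  Asg 31 (arr1 4 (Vr 7));; st1 4 (Vr 7) (Vr 13 [+] Cn 1);;
  provided (Vr 31) (
   Asg 31 (Vr 31 [-] Cn 1 [-] Vr 13);;
   provided (Cn 4 [*] Vr 31 [<] Vr 2 [+] Cn 1) (
    Asg 32 (Cn 1);; block_code;; st1 5 (Vr 13) (Vr 32))))"

definition periodic_at :: "nat \<Rightarrow> (nat \<Rightarrow> nat) \<Rightarrow> nat \<Rightarrow> nat \<Rightarrow> bool" where
 "periodic_at l f i p \<longleftrightarrow> (\<forall>j. j + p < l --> f (i + j) = f (i + j + p))"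

definition sper_at :: "nat \<Rightarrow> (nat \<Rightarrow> nat) \<Rightarrow> nat \<Rightarrow> bool" where
 "sper_at l f i \<longleftrightarrow> (\<exists>p\<ge>1. 4 * p <= l & periodic_at l f i p)"

definition same_block :: "nat \<Rightarrow> (nat \<Rightarrow> nat) \<Rightarrow> nat \<Rightarrow> nat \<Rightarrow> bool" where
 "same_block h f i j \<longleftrightarrow> (\<forall>r<h. f (i + r) = f (j + r))"

lemma same_block_double:
 "same_block (2 * h) f i j \<longleftrightarrow> same_block h f i j & same_block h f (i + h) (j + h)"
proof -
 have "(\<forall>r<2 * h. P r) \<longleftrightarrow> (\<forall>r<h. P r) & (\<forall>r<h. P (h + r))" for P :: "nat \<Rightarrow> bool"
 proof safe
  fix r assume a: "\<forall>r<h. P r" "\<forall>r<h. P (h + r)" "r < 2 * h"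
  show "P r"
  proof (cases "r < h")
   case False
   then show ?thesis using a(2,3) spec[OF a(2), of "r - h"] by simp
  qed (use a in auto)
 qed auto
 then show ?thesis by (simp add: same_block_def add.assoc)
qed

text \<open>
 The distance to the next occurrence of the leading block of length \<open>h > l / 4\<close> is a period
 whenever the window has some period at most \<open>l / 4\<close>.
\<close>

lemma periodic_at_next:
 assumes h: "2 * h <= l" "l < 4 * h" and p: "1 <= p" "4 * p <= l" "periodic_at l f i p"
  and d: "d <= p" "same_block h f i (i + d)"
 shows "periodic_at l f i d"
proof -
 have "j + d < l ==> f (i + j) = f (i + j + d)" for j
 proof (induction j rule: less_induct)
  case (less j)
  show ?case
  proof (cases "j < h")
   case True
   then have "f (i + j) = f (i + d + j)" using d(2) by (simp add: same_block_def)
   moreover have "i + d + j = i + j + d" by simp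
   ultimately show ?thesis by (simp only:)
  next
   case False
   \<comment> \<open>A position beyond the leading block is moved left by the period
     \<open>p\<close>, which is at most \<open>l / 4 < h <= j\<close>; there the induction
     hypothesis applies, and the result is moved back.\<close>
   then have jp: "p <= j" using h p by linarith
   have "j - p + p < l" using jp less.prems by simp
   then have "f (i + (j - p)) = f (i + (j - p) + p)"
    using p(3) unfolding periodic_at_def by blast
   then have "f (i + j) = f (i + (j - p))" using jp by simp
   also have "f (i + (j - p)) = f (i + (j - p) + d)" using less.IH[of "j - p"] jp p less.prems by simp
   also have "f (i + (j - p) + d) = f (i + ((j - p) + d) + p)"
   proof -
    have "j - p + d + p < l" using jp less.prems by simp
    then have "f (i + (j - p + d)) = f (i + (j - p + d) + p)"
     using p(3) unfolding periodic_at_def by blast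
    then show ?thesis by (simp only: add.assoc)
   qed
   also have "i + ((j - p) + d) + p = i + j + d" using jp by simp
   finally show ?thesis .
  qed
 qed
 then show ?thesis by (simp add: periodic_at_def)
qed

lemma sper_at_same_block:
 assumes "2 * h <= l" "1 <= p" "4 * p <= l" "periodic_at l f i p"
 shows "same_block h f i (i + p)"
 using assms by (auto simp: same_block_def periodic_at_def add_ac)

text \<open>Since \<open>l < 4 * h\<close>, the block that covers a compared position has index
  \<open>j div h < 4\<close>. The clamp at \<open>l - d - h\<close> loses nothing, as a clamped
  block ends exactly where the compared range does.\<close>

lemma periodic_at_blocks:
 assumes h: "2 * h <= l" "l < 4 * h" and d: "4 * d <= l"
 shows "periodic_at l f i d \<longleftrightarrow>
  (\<forall>x<4. same_block h f (i + min (x * h) (l - d - h)) (i + min (x * h) (l - d - h) + d))"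
proof
 assume p: "periodic_at l f i d"
 show "\<forall>x<4. same_block h f (i + min (x * h) (l - d - h)) (i + min (x * h) (l - d - h) + d)"
 proof (intro allI impI)
  fix x :: nat
  let ?o = "min (x * h) (l - d - h)"
  define s where "s = ?o"
  have "f (i + s + r) = f (i + s + d + r)" if "r < h" for r
  proof -
   have "s + r + d < l" using that h d unfolding s_def by linarith
   then have "f (i + (s + r)) = f (i + (s + r) + d)" using p unfolding periodic_at_def by blast
   moreover have "i + (s + r) = i + s + r" "i + (s + r) + d = i + s + d + r" by simp_all
   ultimately show ?thesis by (simp only:)
  qed
  then show "same_block h f (i + ?o) (i + ?o + d)"
   unfolding same_block_def s_def by blast
 qed
next
 assume b: "\<forall>x<4. same_block h f (i + min (x * h) (l - d - h)) (i + min (x * h) (l - d - h) + d)"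
 show "periodic_at l f i d"
  unfolding periodic_at_def
 proof (intro allI impI)
  fix j assume j: "j + d < l"
  define x where "x = j div h"
  have hp: "0 < h" using h by simp
  have x4: "x < 4" using j h hp unfolding x_def by (simp add: less_mult_imp_div_less)
  have xj: "x * h <= j" "j < x * h + h"
   using hp by (auto simp: x_def) (metis add.commute dividend_less_div_times mult.commute)
  define s where "s = min (x * h) (l - d - h)"
  have sj: "s <= j" "j - s < h" using xj j h d unfolding s_def by linarith+
  have "same_block h f (i + s) (i + s + d)" using b x4 unfolding s_def by blast
  then have "f (i + s + (j - s)) = f (i + s + d + (j - s))"
   using sj(2) unfolding same_block_def by blast
  moreover have "i + s + (j - s) = i + j" "i + s + d + (j - s) = i + j + d" using sj(1) by simp_all
  ultimately show "f (i + j) = f (i + j + d)" by (simp only:)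
 qed
qed

context word_ram_sub
begin

lemma bounded_array: "bounded v a ==> k ~= 0 ==> k ~= 30 ==> a k i j < Z"
 by (simp add: bounded_def)

lemma bounded_var: "bounded v a ==> v x < Z"
 by (simp add: bounded_def)

end

context input_ram
begin

text \<open>Array 3 is overwritten in place from left to right; as \<open>1 <= h\<close>, the
  entries at \<open>i\<close> and \<open>i + h\<close> still belong to the previous round when they
  are read. Entries from \<open>L\<close> on remain 0, so blocks that run over the end of the input
  get meaningful names, too.\<close>

lemma round_correct:
 assumes v0: "v 0 = L" and bd: "bounded v a" and n: "names (a 1) (a 31 0) (v 6)" "v 6 + L < Z"
  and nz: "\<forall>i<L. a 3 0 i ~= 0" "\<forall>i\<ge>L. a 3 0 i = 0" and h: "v 10 = h" "1 <= h"
 shows "wp round_code (\<lambda>t' v' a'. t' <= t + 1 + L * 8 & names (a' 1) (a' 31 0) (v' 6) &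
  v' 6 <= v 6 + L & (\<forall>i<L. a' 3 0 i ~= 0) & (\<forall>i\<ge>L. a' 3 0 i = 0) &
  (\<forall>i j. a' 3 0 i = a' 3 0 j \<longleftrightarrow> a 3 0 i = a 3 0 j & a 3 0 (i + h) = a 3 0 (j + h))) t v a"
proof -
 define I where "I i v' a' \<longleftrightarrow> names (a' 1) (a' 31 0) (v' 6) & v' 6 <= v 6 + i &
  (\<forall>j<i. a' 1 (a 3 0 j) (a 3 0 (j + h)) ~= 0 & a' 3 0 j = a' 1 (a 3 0 j) (a 3 0 (j + h))) &
  (\<forall>j\<ge>i. a' 3 0 j = a 3 0 j)" for i and v' :: vars and a' :: arrays
 have LZ: "L <= Z" using Z_lin by linarith
 show ?thesis
  unfolding round_code_def
 proof (rule wp_For_const[where I = I and T = 7 and n = L])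
  fix i t1 v1 a1
  assume i: "i < L" and I: "I i v1 a1" and bd1: "bounded v1 a1"
   and fr: "frame (For 13 (Vr 0) (Asg 7 (arr1 3 (Vr 13));; Asg 8 (arr1 3 (Vr 13 [+] Vr 10));;
    name_code;; st1 3 (Vr 13) (Vr 9))) v a v1 a1"
  have h1: "v1 10 = h" using frame_var[OF fr, of 10] h by (simp add: name_code_def)
  let ?p = "a 3 0 i" and ?q = "a 3 0 (i + h)"
  have pq: "a1 3 0 i = ?p" "a1 3 0 (i + h) = ?q" using I by (auto simp: I_def)
  have lt: "a1 3 0 j < Z" for j using bd1 by (simp add: bounded_def)
  have Zs: "?p < Z" "?q < Z" using lt[of i] lt[of "i + h"] pq by simp_all
  let ?v = "v1(13 := i, 7 := ?p, 8 := ?q)"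
  have n1: "names (a1 1) (a1 31 0) (v1 6)" "v1 6 + 1 < Z" "v1 6 <= v 6 + i"
   using I n i by (auto simp: I_def)
  have "wp name_code (wp (st1 3 (Vr 13) (Vr 9)) (\<lambda>t' v' a'. t' <= t1 + 7 & I (Suc i) v' a'))
    (t1 + 2) ?v a1"
  proof (rule wp_name)
   show "bounded ?v a1" using bd1 Zs i LZ by (auto intro!: bounded_asg)
  next
   fix t' c' T'
   assume t': "t' <= t1 + 2 + 4" and T': "names T' (a1 31 0) c'" "ext (a1 1) T'"
    "?v 6 <= c'" "c' <= ?v 6 + 1" "T' (?v 7) (?v 8) ~= 0"
   let ?x = "T' ?p ?q"
   have xz: "?x < Z" using names_le[OF T'(1), of ?p ?q] T'(4) n1 by simp
   have old: "T' (a 3 0 j) (a 3 0 (j + h)) = a1 3 0 j & a1 3 0 j ~= 0" if "j < i" for j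
    using I that extD[OF T'(2)] by (auto simp: I_def)
   have "I (Suc i) (?v(6 := c', 9 := ?x)) (upd (a1(1 := T')) 3 0 i ?x)"
   proof -
    have "c' <= v 6 + Suc i" using T'(4) n1(3) by simp
    moreover have "\<forall>j\<ge>Suc i. ((a1 3 0)(i := ?x)) j = a 3 0 j" using I by (auto simp: I_def)
    moreover have "\<forall>j<Suc i. T' (a 3 0 j) (a 3 0 (j + h)) ~= 0 &
      ((a1 3 0)(i := ?x)) j = T' (a 3 0 j) (a 3 0 (j + h))"
     using old T'(5) by (auto simp: less_Suc_eq)
    ultimately show ?thesis
     unfolding I_def using T'(1) by (simp add: upd_array upd_row_same)
   qed
   then show "wp (st1 3 (Vr 13) (Vr 9)) (\<lambda>t' v' a'. t' <= t1 + 7 & I (Suc i) v' a') t'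
     (?v(6 := c', 9 := T' (?v 7) (?v 8))) (a1(1 := T'))"
    using t' xz by (simp add: wps)
  qed (use n1 nz i in auto)
  then show "wp (Asg 7 (arr1 3 (Vr 13));; Asg 8 (arr1 3 (Vr 13 [+] Vr 10));; name_code;;
    st1 3 (Vr 13) (Vr 9)) (\<lambda>t' v' a'. t' <= t1 + 7 & I (Suc i) v' a') t1 (v1(13 := i)) a1"
   using Zs pq h1 by (simp add: wps numeral_2_eq_2)
 next
  fix t' v' a'
  assume t': "t' <= t + 1 + L * (7 + 1)" and I: "I L v' a'"
  have z: "a' 3 0 i ~= 0" if "i < L" for i using I that by (auto simp: I_def)
  have zz: "a' 3 0 i = 0" if "L <= i" for i using I nz that by (auto simp: I_def)
  have "a' 3 0 i = a' 3 0 j \<longleftrightarrow> a 3 0 i = a 3 0 j & a 3 0 (i + h) = a 3 0 (j + h)" for i j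
  proof (cases "i < L & j < L")
   case True
   then have e: "a' 1 (a 3 0 i) (a 3 0 (i + h)) ~= 0" "a' 3 0 i = a' 1 (a 3 0 i) (a 3 0 (i + h))"
    "a' 3 0 j = a' 1 (a 3 0 j) (a 3 0 (j + h))" using I by (auto simp: I_def)
   have "names (a' 1) (a' 31 0) (v' 6)" using I by (simp add: I_def)
   from names_inj[OF this, of "a 3 0 i" "a 3 0 (i + h)" "a 3 0 j" "a 3 0 (j + h)"] e
   show ?thesis by (metis (no_types))
  next
   case False
   then show ?thesis using z[of i] z[of j] zz[of i] zz[of j] nz
    by (cases "i < L"; cases "j < L") auto
  qed
  then show "t' <= t + 1 + L * 8 & names (a' 1) (a' 31 0) (v' 6) &
   v' 6 <= v 6 + L & (\<forall>i<L. a' 3 0 i ~= 0) & (\<forall>i\<ge>L. a' 3 0 i = 0) &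
   (\<forall>i j. a' 3 0 i = a' 3 0 j \<longleftrightarrow> a 3 0 i = a 3 0 j & a 3 0 (i + h) = a 3 0 (j + h))"
   using t' I z zz by (simp add: I_def)
 qed (use v0 bd LZ n in \<open>auto simp: I_def\<close>)
qed

lemma double_correct:
 assumes v0: "v 0 = L" and bd: "bounded v a" and n: "names (a 1) (a 31 0) (v 6)" "v 6 + e * L < Z"
  and nz: "\<forall>i<L. a 3 0 i ~= 0" "\<forall>i\<ge>L. a 3 0 i = 0" and e: "v 11 = e" "2 ^ e <= l + 1"
 shows "wp double_code (\<lambda>t' v' a'. t' <= t + 2 + e * (L * 8 + 3) & names (a' 1) (a' 31 0) (v' 6) &
  v' 6 <= v 6 + e * L & v' 10 = 2 ^ e & (\<forall>i<L. a' 3 0 i ~= 0) & (\<forall>i\<ge>L. a' 3 0 i = 0) &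
  (\<forall>i j. a' 3 0 i = a' 3 0 j \<longleftrightarrow> same_block (2 ^ e) (a 3 0) i j)) t v a"
proof -
 define I where "I r v' a' \<longleftrightarrow> names (a' 1) (a' 31 0) (v' 6) &
  v' 6 <= v 6 + r * L & v' 10 = 2 ^ r & (\<forall>i<L. a' 3 0 i ~= 0) & (\<forall>i\<ge>L. a' 3 0 i = 0) &
  (\<forall>i j. a' 3 0 i = a' 3 0 j \<longleftrightarrow> same_block (2 ^ r) (a 3 0) i j)"
  for r and v' :: vars and a' :: arrays
 have z: "1 < Z" "l + 1 < Z" using Z_lin l_le L_ge by linarith+
 have eZ: "e <= Z" using bd e by (auto simp: bounded_def intro: less_imp_le)
 have "wp (For 14 (Vr 11) (round_code;; Asg 10 (Cn 2 [*] Vr 10)))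
  (\<lambda>t' v' a'. t' <= t + 2 + e * (L * 8 + 3) & I e v' a') (t + 1) (v(10 := 1)) a"
 proof (rule wp_For_const[where I = I and T = "L * 8 + 2" and n = e])
  show "I 0 (v(10 := 1)) a" using n nz by (simp add: I_def same_block_def)
 next
  fix r t1 v1 a1
  assume r: "r < e" and I: "I r v1 a1" and bd1: "bounded v1 a1"
   and fr: "frame (For 14 (Vr 11) (round_code;; Asg 10 (Cn 2 [*] Vr 10))) (v(10 := 1)) a v1 a1"
  have "wp round_code (\<lambda>t' v' a'. t' <= t1 + 1 + L * 8 & names (a' 1) (a' 31 0) (v' 6) &
   v' 6 <= (v1(14 := r)) 6 + L & (\<forall>i<L. a' 3 0 i ~= 0) & (\<forall>i\<ge>L. a' 3 0 i = 0) &
   (\<forall>i j. a' 3 0 i = a' 3 0 j \<longleftrightarrow> a1 3 0 i = a1 3 0 j & a1 3 0 (i + 2 ^ r) = a1 3 0 (j + 2 ^ r)))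
   t1 (v1(14 := r)) a1"
  proof (rule round_correct)
   have "r * L + L <= e * L" using r by (metis Suc_leI add.commute mult_Suc mult_le_mono1)
   then show "(v1(14 := r)) 6 + L < Z" using I n(2) by (simp add: I_def)
   show "(v1(14 := r)) 0 = L"
    using frame_var[OF fr, of 0] v0 by (simp add: round_code_def name_code_def)
   show "bounded (v1(14 := r)) a1" using bd1 r eZ by (intro bounded_asg) auto
  qed (use I in \<open>auto simp: I_def\<close>)
  then have "wp round_code (wp (Asg 10 (Cn 2 [*] Vr 10))
    (\<lambda>t' v' a'. t' <= t1 + (L * 8 + 2) & I (Suc r) v' a')) t1 (v1(14 := r)) a1"
  proof (rule wp_conseq)
   show "bounded (v1(14 := r)) a1" using bd1 r eZ by (intro bounded_asg) auto
   fix t' v' a'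
   assume p: "t' <= t1 + 1 + L * 8 & names (a' 1) (a' 31 0) (v' 6) &
    v' 6 <= (v1(14 := r)) 6 + L & (\<forall>i<L. a' 3 0 i ~= 0) & (\<forall>i\<ge>L. a' 3 0 i = 0) &
    (\<forall>i j. a' 3 0 i = a' 3 0 j \<longleftrightarrow> a1 3 0 i = a1 3 0 j & a1 3 0 (i + 2 ^ r) = a1 3 0 (j + 2 ^ r))"
    and fr2: "frame round_code (v1(14 := r)) a1 v' a'"
   have v10: "v' 10 = 2 ^ r"
    using frame_var[OF fr2, of 10] I by (simp add: I_def round_code_def name_code_def)
   have "2 ^ Suc r <= (2::nat) ^ e" using r by (intro power_increasing) auto
   then have pz: "2 * 2 ^ r < Z" using e(2) z by simp
   have "I (Suc r) (v'(10 := 2 * 2 ^ r)) a'"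
    using p I by (auto simp: I_def same_block_double)
   then show "wp (Asg 10 (Cn 2 [*] Vr 10)) (\<lambda>t' v' a'. t' <= t1 + (L * 8 + 2) & I (Suc r) v' a')
     t' v' a'"
    using v10 pz p by (simp add: wps)
  qed
  then show "wp (round_code;; Asg 10 (Cn 2 [*] Vr 10))
    (\<lambda>t' v' a'. t' <= t1 + (L * 8 + 2) & I (Suc r) v' a') t1 (v1(14 := r)) a1" by (simp add: wps)
 next
  fix t' v' a'
  assume "t' <= t + 1 + 1 + e * (L * 8 + 2 + 1)" "I e v' a'"
  then show "t' <= t + 2 + e * (L * 8 + 3) & I e v' a'" by (simp add: algebra_simps)
 qed (use e eZ bd z in \<open>auto intro!: bounded_asg\<close>)
 then show ?thesis using z unfolding double_code_eq by (simp add: wps I_def)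
qed

lemma block_correct:
 assumes v: "v 2 = l" "v 10 = h" "v 13 = i" "v 31 = d" "v 32 = 1" and bd: "bounded v a"
  and h: "4 * h <= 2 * l"
 shows "wp block_code (\<lambda>t' v' a'. t' <= t + 33 & a' = a &
  v' 32 = of_bool (\<forall>x<4. a 3 0 (i + min (x * h) (l - d - h)) =
   a 3 0 (i + min (x * h) (l - d - h) + d))) t v a"
proof -
 let ?e = "\<lambda>x. a 3 0 (i + min (x * h) (l - d - h)) = a 3 0 (i + min (x * h) (l - d - h) + d)"
 define I where "I x v' a' \<longleftrightarrow> a' = a & v' 32 = of_bool (\<forall>y<x. ?e y)"
  for x and v' :: vars and a' :: arrays
 have z: "4 <= Z" "2 * l < Z" using Z_lin l_le L_ge by linarith+
 show ?thesis
  unfolding block_code_def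
 proof (rule wp_For_const[where I = I and T = 6 and n = 4])
  fix x t1 v1 a1
  assume x: "x < 4" and I: "I x v1 a1"
   and fr: "frame (For 16 (Cn 4) (Asg 33 (Vr 16 [*] Vr 10);; Asg 34 (Vr 2 [-] Vr 31 [-] Vr 10);;
  provided (Vr 34 [<] Vr 33) (Asg 33 (Vr 34));;
  Cond (arr1 3 (Vr 13 [+] Vr 33) [=] arr1 3 (Vr 13 [+] Vr 33 [+] Vr 31)) Skip (Asg 32 (Cn 0)))) v a v1 a1"
  have w: "v1 2 = l" "v1 10 = h" "v1 13 = i" "v1 31 = d" "a1 = a"
   using frame_var[OF fr, of 2] frame_var[OF fr, of 10] frame_var[OF fr, of 13]
    frame_var[OF fr, of 31] v I by (auto simp: I_def)
  have "x * h <= 4 * h" using x by simp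
  then have xz: "x * h < Z" "l - d - h < Z" "0 < Z" using z h by linarith+
  have s: "(\<forall>y<Suc x. ?e y) \<longleftrightarrow> (\<forall>y<x. ?e y) & ?e x" by (auto simp: less_Suc_eq)
  show "wp (Asg 33 (Vr 16 [*] Vr 10);; Asg 34 (Vr 2 [-] Vr 31 [-] Vr 10);;
  provided (Vr 34 [<] Vr 33) (Asg 33 (Vr 34));;
  Cond (arr1 3 (Vr 13 [+] Vr 33) [=] arr1 3 (Vr 13 [+] Vr 33 [+] Vr 31)) Skip (Asg 32 (Cn 0)))
   (\<lambda>t' v' a'. t' <= t1 + 6 & I (Suc x) v' a') t1 (v1(16 := x)) a1"
  proof (cases "l - d - h < x * h")
   case True
   then show ?thesis using I w xz s by (simp add: wps I_def)
  next
   case False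
   then show ?thesis using I w xz s by (simp add: wps I_def)
  qed
 next
  fix t' v' a'
  assume "t' <= t + 1 + 4 * (6 + 1)" "I 4 v' a'"
  then show "t' <= t + 33 & a' = a & v' 32 = of_bool (\<forall>x<4. ?e x)" by (simp add: I_def)
 qed (use v bd z in \<open>auto simp: I_def\<close>)
qed

lemma sp_correct:
 assumes v: "v 0 = L" "v 2 = l" "v 10 = h" and bd: "bounded v a"
  and h: "2 <= l --> 2 * h <= l" "l < 4 * h"
  and id: "\<forall>i j. a 3 0 i = a 3 0 j \<longleftrightarrow> same_block h f i j" and f: "\<forall>i<L. f i ~= 0" "\<forall>i\<ge>L. f i = 0"
  and z: "\<And>j. a 4 0 j = 0" "\<And>j. a 5 0 j = 0"
 shows "wp sp_code (\<lambda>t' v' a'. t' <= t + 1 + L * 60 & (\<forall>i<L. a' 5 0 i = of_bool (sper_at l f i))) t v a"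
proof -
 have idb: "(a 3 0 i = a 3 0 j) = same_block h f i j" for i j using id by simp
 \<comment> \<open>\<open>x = 0\<close> encodes that \<open>n\<close> does not occur from
   \<open>i\<close> on; otherwise \<open>x - 1\<close> is its first occurrence there.\<close>
 define last_ok where "last_ok i n x \<longleftrightarrow> (x = 0 --> (\<forall>j. i <= j --> j < L --> a 3 0 j ~= n)) &
  (x ~= 0 --> i <= x - 1 & x - 1 < L & a 3 0 (x - 1) = n &
   (\<forall>j. i <= j --> j < x - 1 --> a 3 0 j ~= n))" for i n x
 define I where "I r v' a' \<longleftrightarrow> (\<forall>n. last_ok (L - r) n (a' 4 0 n)) &
  (\<forall>j. L - r <= j --> j < L --> a' 5 0 j = of_bool (sper_at l f j)) &
  (\<forall>j<L - r. a' 5 0 j = 0)" for r and v' :: vars and a' :: arrays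
 have LZ: "Suc L < Z" "l < Z" "1 < Z" using Z_lin L_ge l_le by linarith+
 \<comment> \<open>A strongly periodic window repeats its leading block inside the input: the letter
   at distance \<open>p\<close> equals the nonzero letter at \<open>i\<close>, whereas
   \<open>f\<close> is 0 beyond the input.\<close>
 have not_sper: "\<not> sper_at l f i" if "i < L" "\<forall>j. i < j --> j < L --> a 3 0 j ~= a 3 0 i" for i
 proof
  assume "sper_at l f i"
  then obtain p where p: "1 <= p" "4 * p <= l" "periodic_at l f i p" by (auto simp: sper_at_def)
  have "0 + p < l" using p by linarith
  then have "f (i + 0) = f (i + 0 + p)" using p unfolding periodic_at_def by blast
  then have "i + p < L" using f that(1) by (metis add_0_right not_le)
  moreover have "a 3 0 i = a 3 0 (i + p)"
   unfolding idb by (rule sper_at_same_block[OF _ p]) (use h p in linarith)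
  moreover have "i < i + p" using p(1) by simp
  ultimately show False using that(2) by metis
 qed
 \<comment> \<open>No smaller distance repeats the leading block, so \<open>d\<close> is at most any
   admissible period, and \<open>periodic_at_next\<close> turns \<open>d\<close> itself into
   one.\<close>
 have sper: "sper_at l f i \<longleftrightarrow> (\<forall>x<4. a 3 0 (i + min (x * h) (l - d - h)) =
   a 3 0 (i + min (x * h) (l - d - h) + d))"
  if i: "i < L" and d: "1 <= d" "4 * d <= l" and j: "a 3 0 (i + d) = a 3 0 i"
   "\<forall>j. i < j --> j < i + d --> a 3 0 j ~= a 3 0 i" for i d
 proof -
  have h2: "2 * h <= l" using h d by linarith
  have "sper_at l f i \<longleftrightarrow> periodic_at l f i d"
  proof
   assume "sper_at l f i"
   then obtain p where p: "1 <= p" "4 * p <= l" "periodic_at l f i p" by (auto simp: sper_at_def)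
   have "a 3 0 i = a 3 0 (i + p)" unfolding idb by (rule sper_at_same_block[OF h2 p])
   moreover have "i < i + p" using p(1) by simp
   ultimately have "\<not> i + p < i + d" using j(2) by metis
   then have "d <= p" by simp
   then show "periodic_at l f i d"
    using periodic_at_next[OF h2 h(2) p] j(1) idb by metis
  qed (use d in \<open>auto simp: sper_at_def\<close>)
  then show ?thesis unfolding idb by (simp only: periodic_at_blocks[OF h2 h(2) d(2)])
 qed
 have not_sper2: "\<not> sper_at l f i"
  if i: "i < L" and d: "l < 4 * d" and j: "\<forall>j. i < j --> j < i + d --> a 3 0 j ~= a 3 0 i" for i d
 proof
  assume "sper_at l f i"
  then obtain p where p: "1 <= p" "4 * p <= l" "periodic_at l f i p" by (auto simp: sper_at_def)
  have "a 3 0 i = a 3 0 (i + p)"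
   unfolding idb by (rule sper_at_same_block[OF _ p]) (use h p in linarith)
  moreover have "i < i + p" "i + p < i + d" using p d by linarith+
  ultimately show False using j by metis
 qed
 let ?body = "Asg 13 (Vr 0 [-] Cn 1 [-] Vr 14);; Asg 7 (arr1 3 (Vr 13));;
  Asg 31 (arr1 4 (Vr 7));; st1 4 (Vr 7) (Vr 13 [+] Cn 1);;
  provided (Vr 31) (
   Asg 31 (Vr 31 [-] Cn 1 [-] Vr 13);;
   provided (Cn 4 [*] Vr 31 [<] Vr 2 [+] Cn 1) (
    Asg 32 (Cn 1);; block_code;; st1 5 (Vr 13) (Vr 32)))"
 show ?thesis
  unfolding sp_code_def
 proof (rule wp_For_const[where I = I and T = 59 and n = L])
  show "I 0 v a" using z by (simp add: I_def last_ok_def)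
 next
  fix r t1 v1 a1
  assume r: "r < L" and I: "I r v1 a1" and bd1: "bounded v1 a1"
   and fr: "frame (For 14 (Vr 0) ?body) v a v1 a1"
  have w: "v1 0 = L" "v1 2 = l" "v1 10 = h" "a1 3 = a 3"
   using frame_var[OF fr, of 0] frame_var[OF fr, of 2] frame_var[OF fr, of 10]
    frame_array[OF fr, of 3] v by (auto simp: block_code_def)
  define i where "i = L - Suc r"
  have i: "i < L" "L - r = Suc i" "L - Suc 0 - r = i" "i < Z" "Suc i < Z"
   using r LZ by (auto simp: i_def)
  let ?n = "a 3 0 i"
  define x where "x = a1 4 0 ?n"
  define a2 where "a2 = upd a1 4 0 ?n (Suc i)"
  have lo: "last_ok (Suc i) n (a1 4 0 n)" for n using I i by (simp add: I_def)
  have lo2: "last_ok i n (a2 4 0 n)" for n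
  proof (cases "n = ?n")
   case True
   then show ?thesis using i by (auto simp: last_ok_def a2_def upd_same)
  next
   case False
   then have "a2 4 0 n = a1 4 0 n" by (simp add: a2_def upd_same)
   then show ?thesis using lo[of n] False unfolding last_ok_def
    by (metis Suc_leD Suc_leI le_neq_implies_less)
  qed
  have Isuc: "I (Suc r) v' a'"
   if "a' 4 = a2 4" "a' 5 0 i = of_bool (sper_at l f i)" "\<And>j. j ~= i ==> a' 5 0 j = a1 5 0 j"
   for v' a'
  proof -
   have e: "L - Suc r = i" by (simp add: i_def)
   have "a' 5 0 j = of_bool (sper_at l f j)" if "i <= j" "j < L" for j
    using I that i \<open>a' 5 0 i = _\<close> \<open>\<And>j. j ~= i ==> _\<close>[of j]
    by (cases "j = i") (auto simp: I_def)
   moreover have "a' 5 0 j = 0" if "j < i" for j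
    using I that i \<open>\<And>j. j ~= i ==> _\<close>[of j] by (auto simp: I_def)
   ultimately show ?thesis using lo2 \<open>a' 4 = a2 4\<close> unfolding I_def e by simp
  qed
  have a5: "a2 5 = a1 5" "a1 5 0 i = 0" using I i by (auto simp: a2_def upd_array I_def)
  have ZZ: "?n < Z" "x < Z"
   using bounded_array[OF bd1, where k = 3 and i = 0 and j = i]
    bounded_array[OF bd1, where k = 4 and i = 0 and j = "?n"] w(4)
   by (simp_all add: x_def)
  show "wp ?body (\<lambda>t' v' a'. t' <= t1 + 59 & I (Suc r) v' a') t1 (v1(14 := r)) a1"
  proof (cases "x = 0")
   case True
   have "\<not> sper_at l f i" using not_sper[of i] lo[of ?n] True i by (auto simp: last_ok_def x_def)
   then have "I (Suc r) v' a2" for v' using Isuc a5 by simp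
   then show ?thesis using True w i ZZ
    by (simp add: wps x_def[symmetric] a2_def)
  next
   case False
   define d where "d = x - Suc i"
   have x: "Suc i <= x - 1" "x - 1 < L" "a 3 0 (x - 1) = ?n"
    "\<forall>j. Suc i <= j --> j < x - 1 --> a 3 0 j ~= ?n"
    using lo[of ?n] False by (auto simp: last_ok_def x_def)
   have d: "1 <= d" "i + d = x - 1" "d < Z" using x ZZ by (auto simp: d_def)
   show ?thesis
   proof (cases "4 * d < Suc l")
    case False
    have "\<not> sper_at l f i" by (rule not_sper2[of i d]) (use False x d i in auto)
    then have "I (Suc r) v' a2" for v' using Isuc a5 by simp
    then show ?thesis using \<open>x ~= 0\<close> False w i ZZ d
     by (simp add: wps x_def[symmetric] a2_def d_def[symmetric])
   next
    case True
    let ?v = "v1(14 := r, 13 := i, 7 := ?n, 31 := d, 32 := 1)"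
    have bd2: "bounded ?v a2" using bd1 i r LZ ZZ d unfolding a2_def
     by (auto intro!: bounded_asg bounded_upd)
    have bc: "wp block_code (\<lambda>t' v' a'. t' <= t1 + 8 + 33 & a' = a2 &
      v' 32 = of_bool (\<forall>x<4. a2 3 0 (i + min (x * h) (l - d - h)) =
      a2 3 0 (i + min (x * h) (l - d - h) + d))) tt ?v a2"
     if "tt <= t1 + 8" for tt
     by (rule wp_mono[OF block_correct[of ?v h i d a2 tt]]) (use that w bd2 h True d in auto)
    have "wp block_code (wp (st1 5 (Vr 13) (Vr 32))
      (\<lambda>t' v' a'. t' <= t1 + 59 & I (Suc r) v' a')) tt ?v a2" if "tt <= t1 + 8" for tt
    proof (rule wp_conseq[OF bc[OF that] bd2])
     fix t' v' a'
     assume p: "t' <= t1 + 8 + 33 & a' = a2 &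
      v' 32 = of_bool (\<forall>x<4. a2 3 0 (i + min (x * h) (l - d - h)) =
      a2 3 0 (i + min (x * h) (l - d - h) + d))" and fr2: "frame block_code ?v a2 v' a'"
     have 3: "a2 3 = a 3" using w by (simp add: a2_def upd_array)
     have "v' 32 = of_bool (sper_at l f i)"
      using sper[of i d] i d True x p 3 by simp
     moreover have "v' 13 = i" using frame_var[OF fr2, of 13] by (simp add: block_code_def)
     moreover have "I (Suc r) v' (upd a2 5 0 i (of_bool (sper_at l f i)))"
      by (rule Isuc) (auto simp: upd_array upd_same a5)
     ultimately show "wp (st1 5 (Vr 13) (Vr 32)) (\<lambda>t' v' a'. t' <= t1 + 59 & I (Suc r) v' a') t' v' a'"
      using p LZ by (simp add: wps)
    qed
    then show ?thesis using \<open>x ~= 0\<close> True w i ZZ d LZ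
     by (simp add: wps x_def[symmetric] a2_def[symmetric] d_def[symmetric])
   qed
  qed
 next
  fix t' v' a'
  assume "t' <= t + 1 + L * (59 + 1)" "I L v' a'"
  then show "t' <= t + 1 + L * 60 & (\<forall>i<L. a' 5 0 i = of_bool (sper_at l f i))"
   by (simp add: I_def)
 qed (use v bd LZ in auto)
qed

end

section \<open>Heavy paths in the trie of a family of words\<close>

locale word_family =
 fixes ctx :: "nat \<Rightarrow> nat list" and n :: nat
begin

definition weight :: "nat list \<Rightarrow> nat" where
 "weight s = card {q. q < n & prefix s (ctx q)}"

text \<open>Recursion on the reversed word, as nodes of the trie grow at their end. An edge is heavy
  if the child has more than half of the weight of its parent; the head is reached by going up along
  heavy edges.\<close>

primrec head_rev :: "nat list \<Rightarrow> nat list" where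
 "head_rev [] = []"
| "head_rev (c # r) = (if weight (rev r) < 2 * weight (rev (c # r)) then head_rev r else c # r)"

definition head :: "nat list \<Rightarrow> nat list" where
 "head s = rev (head_rev (rev s))"

lemma head_Nil [simp]: "head [] = []"
 by (simp add: head_def)

lemma head_snoc:
 "head (s @ [c]) = (if weight s < 2 * weight (s @ [c]) then head s else s @ [c])"
 by (simp add: head_def)

lemma prefix_head: "prefix (head s) s"
 by (induction s rule: rev_induct) (auto simp: head_snoc)

lemma head_head [simp]: "head (head s) = head s"
 by (induction s rule: rev_induct) (auto simp: head_snoc)

lemma weight_pos: "q < n ==> prefix s (ctx q) ==> 0 < weight s"
 unfolding weight_def by (subst card_gt_0_iff) auto

lemma weight_mono: "prefix s s' ==> weight s' <= weight s"
 unfolding weight_def by (intro card_mono) (auto intro: prefix_order.order_trans)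

lemma weight_Nil [simp]: "weight [] = n"
 by (simp add: weight_def)

lemma weight_children:
 assumes "c ~= d"
 shows "weight (s @ [c]) + weight (s @ [d]) <= weight s"
proof -
 have "{q. q < n & prefix (s @ [c]) (ctx q)} \<inter> {q. q < n & prefix (s @ [d]) (ctx q)} = {}"
  using assms by (auto simp: prefix_def)
 then have "weight (s @ [c]) + weight (s @ [d]) =
   card ({q. q < n & prefix (s @ [c]) (ctx q)} \<union> {q. q < n & prefix (s @ [d]) (ctx q)})"
  unfolding weight_def by (subst card_Un_disjoint) auto
 also have "\<dots> <= weight s"
  unfolding weight_def by (intro card_mono) (auto simp: prefix_def)
 finally show ?thesis .
qed

text \<open>Two heavy children of one node would together outweigh it. Going down a heavy path
  therefore leaves no choice, which lets depths stand for strings inside a group.\<close>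

lemma head_eqD:
 "length s = length s' ==> head s = head s' ==> s = s'"
proof (induction s arbitrary: s' rule: rev_induct)
 case (snoc c s)
 then obtain d u where s': "s' = u @ [d]" by (metis length_0_conv rev_exhaust append_is_Nil_conv list.distinct(1))
 have len: "length (head x) <= length x" for x by (simp add: prefix_head prefix_length_le)
 show ?case
 proof (cases "weight s < 2 * weight (s @ [c])")
  case heavy: True
  then have h: "head s = head s'" using snoc.prems(2) by (simp add: head_snoc)
  have heavy': "weight u < 2 * weight (u @ [d])"
  proof (rule ccontr)
   assume "\<not> ?thesis"
   then have "head s = u @ [d]" using h s' by (simp add: head_snoc)
   then show False using len[of s] snoc.prems(1) s' by simp
  qed
  then have "s = u" using snoc.IH[of u] h s' snoc.prems(1) by (simp add: head_snoc)
  moreover have "c = d"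
  proof (rule ccontr)
   assume "c ~= d"
   from weight_children[OF this, of s] heavy heavy' \<open>s = u\<close> show False by simp
  qed
  ultimately show ?thesis using s' by simp
 next
  case False
  then have "s @ [c] = head s'" using snoc.prems(2) by (simp add: head_snoc)
  moreover have "prefix (head s') s'" by (rule prefix_head)
  ultimately show ?thesis using snoc.prems(1) by (metis prefix_order.eq_iff prefix_length_prefix
     order_refl prefix_order.refl)
 qed
qed simp

text \<open>Every head below the root is entered through a light edge, which at least halves the
  weight, and the root has weight \<open>n\<close>.\<close>

lemma heads_pow:
 "prefix s (ctx q) ==> q < n ==>
  2 ^ card {x. 1 <= x & x <= length s & head (take x s) = take x s} * weight s <= n"
proof (induction s rule: rev_induct)
 case Nil
 have e: "{x. 1 <= x & x <= length [] & head (take x []) = take x []} = {}" by auto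
 show ?case unfolding e by simp
next
 case (snoc c s)
 let ?A = "\<lambda>s. {x. 1 <= x & x <= length s & head (take x s) = take x s}"
 have p: "prefix s (ctx q)" using snoc.prems(1) by (meson append_prefixD)
 have fin: "finite (?A s)" by (rule finite_subset[of _ "{..length s}"]) auto
 have w: "weight (s @ [c]) <= weight s" by (intro weight_mono) auto
 show ?case
 proof (cases "weight s < 2 * weight (s @ [c])")
  case True
  have "length (head s) <= length s" by (simp add: prefix_head prefix_length_le)
  then have "head (s @ [c]) ~= s @ [c]" using True by (auto simp: head_snoc)
  then have "?A (s @ [c]) = ?A s" by (auto simp: le_Suc_eq)
  then show ?thesis using snoc.IH[OF p snoc.prems(2)] w
   by (metis (no_types, lifting) le_trans mult_le_mono2)
 next
  case False
  then have "?A (s @ [c]) \<subseteq> insert (Suc (length s)) (?A s)" by (auto simp: le_Suc_eq)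
  then have "card (?A (s @ [c])) <= card (insert (Suc (length s)) (?A s))"
   using fin by (intro card_mono) auto
  also have "\<dots> <= Suc (card (?A s))" using fin by (simp add: card_insert_if)
  finally have "2 ^ card (?A (s @ [c])) * weight (s @ [c]) <= 2 ^ Suc (card (?A s)) * weight (s @ [c])"
   by (intro mult_right_mono power_increasing) auto
  also have "\<dots> = 2 ^ card (?A s) * (2 * weight (s @ [c]))" by simp
  also have "\<dots> <= 2 ^ card (?A s) * weight s" using False by (intro mult_left_mono) auto
  also have "\<dots> <= n" using snoc.IH[OF p snoc.prems(2)] .
  finally show ?thesis .
 qed
qed

text \<open>\<open>heads_pow\<close> leaves fewer than \<open>e\<close> heads of positive depth; the
  root, which is always a head, makes up the difference.\<close>

lemma card_heads:
 assumes "q < n" "n < 2 ^ e"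
 shows "card {x. x <= length (ctx q) & head (take x (ctx q)) = take x (ctx q)} <= e"
proof -
 let ?B = "{x. 1 <= x & x <= length (ctx q) & head (take x (ctx q)) = take x (ctx q)}"
 have w: "0 < weight (ctx q)" using weight_pos[OF assms(1)] by simp
 have "2 ^ card ?B * 1 <= 2 ^ card ?B * weight (ctx q)" using w by (intro mult_left_mono) auto
 also have "\<dots> <= n" using heads_pow[of "ctx q" q] assms(1) by simp
 finally have "2 ^ card ?B <= n" by simp
 then have "2 ^ card ?B < (2::nat) ^ e" using assms(2) by (rule le_less_trans)
 then have "card ?B < e" by (rule power_less_imp_less_exp[rotated]) simp
 moreover have "{x. x <= length (ctx q) & head (take x (ctx q)) = take x (ctx q)} \<subseteq> insert 0 ?B"
  by auto
 then have "card {x. x <= length (ctx q) & head (take x (ctx q)) = take x (ctx q)} \<le>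
   card (insert 0 ?B)" by (intro card_mono) auto
 moreover have "card (insert 0 ?B) <= Suc (card ?B)" by (simp add: card_insert_if)
 ultimately show ?thesis by linarith
qed

end

section \<open>Names of words\<close>

text \<open>The naming table read as a trie: 1 is the root, \<open>T p c\<close> is the child of
  \<open>p\<close> along \<open>c\<close>, and 0, which is absorbing in valid tables, means that the
  path has not been entered.\<close>

definition word_name :: "(nat \<Rightarrow> nat \<Rightarrow> nat) \<Rightarrow> nat list \<Rightarrow> nat" where
 "word_name T s = foldl T 1 s"

lemma word_name_Nil [simp]: "word_name T [] = 1"
 and word_name_snoc [simp]: "word_name T (s @ [c]) = T (word_name T s) c"
 by (simp_all add: word_name_def)

lemma names_0: "names T H c ==> T 0 q = 0"
 by (simp add: names_def)

lemma names_1: "names T H c ==> T p q ~= 1"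
 by (simp add: names_def)

lemma word_name_prefix:
 assumes "names T H c" "prefix s s'" "word_name T s' ~= 0"
 shows "word_name T s ~= 0"
 using assms(2,3)
proof (induction s' rule: rev_induct)
 case (snoc d s')
 have "word_name T s' ~= 0" using snoc.prems(2) names_0[OF assms(1), of d] by (metis word_name_snoc)
 then show ?case using snoc by (auto simp: prefix_snoc)
qed simp

lemma word_name_ext:
 assumes "names T H c" "ext T T'" "word_name T s ~= 0"
 shows "word_name T' s = word_name T s"
 using assms(3)
proof (induction s rule: rev_induct)
 case (snoc d s)
 have "word_name T s ~= 0" using snoc.prems names_0[OF assms(1), of d] by (metis word_name_snoc)
 then show ?case using snoc extD[OF assms(2)] by simp
qed simp

text \<open>Letters are peeled off the end by injectivity of the table; as no entry is 1, an empty
  and a nonempty word never share a name.\<close>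

lemma word_name_inj:
 assumes "names T H c"
 shows "word_name T s = word_name T s' ==> word_name T s ~= 0 ==> s = s'"
proof (induction s arbitrary: s' rule: rev_induct)
 case Nil
 show ?case
 proof (cases s' rule: rev_cases)
  case (snoc u d)
  then have "T (word_name T u) d = 1" using Nil by simp
  then show ?thesis using names_1[OF assms] by metis
 qed simp
next
 case (snoc d s)
 show ?case
 proof (cases s' rule: rev_cases)
  case Nil
  then have "T (word_name T s) d = 1" using snoc by simp
  then show ?thesis using names_1[OF assms] by metis
 next
  case (snoc u d')
  have "T (word_name T s) d = T (word_name T u) d'" "T (word_name T s) d ~= 0"
   using snoc.prems \<open>s' = u @ [d']\<close> by simp_all
  from names_inj[OF assms this] have e: "word_name T s = word_name T u" "d = d'" by auto
  moreover have "word_name T s ~= 0"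
   using \<open>T (word_name T s) d ~= 0\<close> names_0[OF assms, of d] by metis
  ultimately show ?thesis using snoc.IH \<open>s' = u @ [d']\<close> by simp
 qed
qed

text \<open>The names of the prefixes of a word; 0 marks lengths beyond the length of the word.\<close>

definition prefix_names :: "(nat \<Rightarrow> nat \<Rightarrow> nat) \<Rightarrow> nat list \<Rightarrow> nat \<Rightarrow> nat" where
 "prefix_names T s x = (if x <= length s then word_name T (take x s) else 0)"

lemma prefix_names_ext:
 assumes "names T H c" "ext T T'" "word_name T s ~= 0"
 shows "prefix_names T' s = prefix_names T s"
proof -
 have "word_name T (take x s) ~= 0" for x
  using word_name_prefix[OF assms(1) take_is_prefix assms(3)] .
 then show ?thesis using word_name_ext[OF assms(1,2)] by (auto simp: prefix_names_def)
qed

section \<open>Anchors and contexts\<close>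

text \<open>The pattern starts at address 2, hence the offsets 2 and 3. Array 7 is shifted by one,
  so that its index is the length of a prefix; its entry 0 stays 0, so a truncated difference that
  ends there finds no active prefix.\<close>

definition "anchor_code =
 For 13 (Vr 3) (
  provided (Vr 13 [+] Vr 2 [<] Vr 3) (
   Cond (arr1 5 (Cn 2 [+] Vr 13) [=] arr1 5 (Cn 3 [+] Vr 13)) Skip (
    st1 6 (Vr 12) (Vr 13);; Asg 12 (Vr 12 [+] Cn 1)));;
  st1 7 (Vr 13 [+] Cn 1) (Lo (Cn 2 [+] Vr 3 [+] Vr 13)))"

text \<open>Variable 33 is 1 plus the position of the next letter in the pattern, going left from
  the anchor in even rows and right in odd ones; 0 signals that the pattern is exhausted.\<close>

definition "walk_code =
 For 16 (Vr 5) (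
  Cond (Vr 15 [mod] Cn 2)
   (Cond (Vr 30 [+] Vr 16 [<] Vr 3) (Asg 33 (Vr 30 [+] Vr 16 [+] Cn 1)) (Asg 33 (Cn 0)))
   (Cond (Vr 16 [<] Vr 30) (Asg 33 (Vr 30 [-] Vr 16)) (Asg 33 (Cn 0)));;
  provided (Vr 33) (
   Asg 8 (arr1 2 (Vr 33 [+] Cn 1));; name_code;; Asg 7 (Vr 9);;
   St 8 (Vr 15) (Vr 16 [+] Cn 1) (Vr 9)))"

definition "ctx_code =
 For 15 (Cn 2 [*] Vr 12) (
  Asg 30 (arr1 6 (Vr 15 [div] Cn 2));; Asg 7 (Cn 1);; St 8 (Vr 15) (Cn 0) (Cn 1);; walk_code)"

context input_ram
begin

definition is_anchor :: "(nat \<Rightarrow> nat) \<Rightarrow> nat \<Rightarrow> bool" where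
 "is_anchor f i \<longleftrightarrow> i + l < m & sper_at l f (2 + i) ~= sper_at l f (3 + i)"

lemma anchor_correct:
 assumes base: "base v a" and bd: "bounded v a" and K0: "v 12 = 0"
  and sp: "\<forall>i<L. a 5 0 i = of_bool (sper_at l f i)" and z: "\<And>j. a 7 0 j = 0"
  and U: "\<forall>i<m. X (2 + m + i) <= 1"
 shows "wp anchor_code (\<lambda>t' v' a'. t' <= t + 1 + m * 7 & v' 12 <= m &
  (\<forall>j<v' 12. is_anchor f (a' 6 0 j)) & (\<forall>j<v' 12. \<forall>j'<j. a' 6 0 j' < a' 6 0 j) &
  (\<forall>i<m. is_anchor f i --> (\<exists>j<v' 12. a' 6 0 j = i)) &
  a' 7 0 0 = 0 & (\<forall>i<m. a' 7 0 (i + 1) = X (2 + m + i))) t v a"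
proof -
 define I where "I i v' a' \<longleftrightarrow> v' 12 <= i & (\<forall>j<v' 12. is_anchor f (a' 6 0 j) & a' 6 0 j < i) &
  (\<forall>j<v' 12. \<forall>j'<j. a' 6 0 j' < a' 6 0 j) &
  (\<forall>p<i. is_anchor f p --> (\<exists>j<v' 12. a' 6 0 j = p)) &
  a' 7 0 0 = 0 & (\<forall>j<i. a' 7 0 (j + 1) = X (2 + m + j))" for i and v' :: vars and a' :: arrays
 have b: "v 2 = l" "v 3 = m" "a 0 0 = X" using base by (auto simp: base_def)
 have mZ: "m <= Z" "m < Z" "1 < Z" using Z_lin L_ge by linarith+
 let ?body = "provided (Vr 13 [+] Vr 2 [<] Vr 3) (
   Cond (arr1 5 (Cn 2 [+] Vr 13) [=] arr1 5 (Cn 3 [+] Vr 13)) Skip (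
    st1 6 (Vr 12) (Vr 13);; Asg 12 (Vr 12 [+] Cn 1)));;
  st1 7 (Vr 13 [+] Cn 1) (Lo (Cn 2 [+] Vr 3 [+] Vr 13))"
 show ?thesis
  unfolding anchor_code_def
 proof (rule wp_For_const[where I = I and T = 6 and n = m])
  fix i t1 v1 a1
  assume i: "i < m" and I: "I i v1 a1" and bd1: "bounded v1 a1"
   and fr: "frame (For 13 (Vr 3) ?body) v a v1 a1"
  have w: "v1 2 = l" "v1 3 = m" "a1 0 0 = X" "a1 5 = a 5"
   using frame_var[OF fr, of 2] frame_var[OF fr, of 3] frame_array[OF fr, of 0]
    frame_array[OF fr, of 5] b by auto
  have s: "a 5 0 (2 + i) = of_bool (sper_at l f (2 + i))" "a 5 0 (3 + i) = of_bool (sper_at l f (3 + i))"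
   using sp i L_ge by auto
  have cond: "is_anchor f i \<longleftrightarrow> i + l < m & a 5 0 (2 + i) ~= a 5 0 (3 + i)"
   unfolding is_anchor_def s by simp
  have x: "X (2 + m + i) mod Z = X (2 + m + i)" "X (2 + m + i) < Z"
   using U i mZ by (auto intro!: mod_less intro: le_less_trans)
  have iv: "i < Z" "Suc (v1 12) < Z" using i I mZ Z_lin L_ge by (auto simp: I_def)
  show "wp ?body (\<lambda>t' v' a'. t' <= t1 + 6 & I (Suc i) v' a') t1 (v1(13 := i)) a1"
  proof (cases "is_anchor f i")
   case True
   define a2 where "a2 = upd (upd a1 6 0 (v1 12) i) 7 0 (Suc i) (X (2 + m + i))"
   have a2: "a2 6 0 j = (if j = v1 12 then i else a1 6 0 j)"
    "a2 7 0 j = (if j = Suc i then X (2 + m + i) else a1 7 0 j)" for j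
    by (auto simp: a2_def upd_def)
   have "I (Suc i) (v1(13 := i, 12 := Suc (v1 12))) a2"
    using I True unfolding I_def a2
    by (auto simp: less_Suc_eq) (metis less_irrefl)+
   then show ?thesis using True w x iv unfolding a2_def cond by (simp add: wps upd_array)
  next
   case False
   define a2 where "a2 = upd a1 7 0 (Suc i) (X (2 + m + i))"
   have a2: "a2 6 = a1 6" "a2 7 0 j = (if j = Suc i then X (2 + m + i) else a1 7 0 j)" for j
    by (auto simp: a2_def upd_def)
   have "I (Suc i) (v1(13 := i)) a2"
    using I False unfolding I_def a2 by (auto simp: less_Suc_eq)
   then show ?thesis using False w x iv unfolding a2_def cond by (auto simp: wps)
  qed
 next
  fix t' v' a'
  assume t': "t' <= t + 1 + m * (6 + 1)" and I: "I m v' a'"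
  then show "t' <= t + 1 + m * 7 & v' 12 <= m &
  (\<forall>j<v' 12. is_anchor f (a' 6 0 j)) & (\<forall>j<v' 12. \<forall>j'<j. a' 6 0 j' < a' 6 0 j) &
  (\<forall>i<m. is_anchor f i --> (\<exists>j<v' 12. a' 6 0 j = i)) &
  a' 7 0 0 = 0 & (\<forall>i<m. a' 7 0 (i + 1) = X (2 + m + i))" by (simp add: I_def)
 qed (use b bd mZ K0 z in \<open>auto simp: I_def\<close>)
qed

end

text \<open>\<open>f\<close> stands for the letter names, \<open>anc\<close> for the anchors and
  \<open>ub\<close> for the activity bits indexed by prefix length. They are parameters here and
  become the contents of arrays once the program has computed them.\<close>

locale anchored_ram = input_ram +
 fixes f anc ub :: "nat \<Rightarrow> nat" and K :: nat
 assumes f_nz: "i < L ==> f i ~= 0" and anc_less: "j < K ==> anc j < m" and K_le: "K <= m"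
  and ub_le: "ub b <= 1" and ub_0: "ub 0 = 0"
begin

definition pat :: "nat list" where "pat = map (\<lambda>i. f (2 + i)) [0..<m]"

text \<open>Left contexts are read backwards, so that a string aligned at an anchor is a matter of
  prefixes on both sides. Length \<open>2 * l\<close> suffices, as all strings are shorter.\<close>

definition ctx :: "nat \<Rightarrow> nat list" where
 "ctx q = (if even q then take (2 * l) (rev (take (anc (q div 2)) pat))
   else take (2 * l) (drop (anc (q div 2)) pat))"

sublocale word_family ctx "2 * K" .

lemma length_pat: "length pat = m"
 by (simp add: pat_def)

lemma length_ctx: "q < 2 * K ==> length (ctx q) =
  (if even q then min (2 * l) (anc (q div 2)) else min (2 * l) (m - anc (q div 2)))"
 using anc_less[of "q div 2"] by (auto simp: ctx_def length_pat)

lemma length_ctx_le: "length (ctx q) <= 2 * l"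
 by (simp add: ctx_def)

lemma ctx_nth: "q < 2 * K ==> x < length (ctx q) ==>
  ctx q ! x = (if even q then f (1 + (anc (q div 2) - x)) else f (2 + (anc (q div 2) + x)))"
proof -
 assume q: "q < 2 * K" and x: "x < length (ctx q)"
 let ?a = "anc (q div 2)"
 have a: "?a < m" using anc_less[of "q div 2"] q by auto
 show ?thesis
 proof (cases "even q")
  case True
  then have xa: "x < ?a" "x < 2 * l" using x q by (auto simp: length_ctx)
  have "ctx q ! x = rev (take ?a pat) ! x" using True xa by (simp add: ctx_def)
  also have "\<dots> = take ?a pat ! (?a - Suc x)" using xa a by (subst rev_nth) (auto simp: length_pat)
  also have "\<dots> = f (2 + (?a - Suc x))"
  proof -
   have "?a - Suc x < m" "?a - Suc x < ?a" using xa a by linarith+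
   then show ?thesis by (simp add: pat_def)
  qed
  also have "2 + (?a - Suc x) = 1 + (?a - x)" using xa by simp
  finally show ?thesis using True by simp
 next
  case False
  then have xa: "?a + x < m" "x < 2 * l" using x q a by (auto simp: length_ctx)
  then show ?thesis using False by (simp add: ctx_def pat_def)
 qed
qed

definition state :: "vars \<Rightarrow> arrays \<Rightarrow> bool" where
 "state v a \<longleftrightarrow> base v a & a 2 0 = f & v 12 = K & (\<forall>j<K. a 6 0 j = anc j) & (\<forall>b\<le>m. a 7 0 b = ub b) &
  names (a 1) (a 31 0) (v 6)"

lemma D_less: "2 * l < Z" "Suc (2 * l) < Z" "2 * l <= L" "2 * K <= L" "2 * K < Z"
 using Z_lin L_ge l_le K_le by linarith+

lemma walk_correct:
 assumes st: "state v a" and bd: "bounded v a" and q: "q < 2 * K" "v 15 = q" "v 30 = anc (q div 2)"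
  and c: "v 6 + 2 * l < Z" and v7: "v 7 = 1" and row: "\<And>x. a 8 q x = (if x = 0 then 1 else 0)"
 shows "wp walk_code (\<lambda>t' v' a'. t' <= t + 1 + 2 * l * 12 & names (a' 1) (a' 31 0) (v' 6) &
  ext (a 1) (a' 1) & v' 6 <= v 6 + 2 * l & word_name (a' 1) (ctx q) ~= 0 &
  (\<forall>x. a' 8 q x = prefix_names (a' 1) (ctx q) x) & (\<forall>q' x. q' ~= q --> a' 8 q' x = a 8 q' x)) t v a"
proof -
 let ?s = "ctx q" and ?a = "anc (q div 2)"
 define I where "I x v' a' \<longleftrightarrow> names (a' 1) (a' 31 0) (v' 6) &
  ext (a 1) (a' 1) & v' 6 <= v 6 + x & v' 7 = word_name (a' 1) (take x ?s) & v' 7 ~= 0 &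
  (\<forall>y. a' 8 q y = (if y <= x then prefix_names (a' 1) ?s y else 0)) &
  (\<forall>q' x. q' ~= q --> a' 8 q' x = a 8 q' x)" for x and v' :: vars and a' :: arrays
 have b: "v 3 = m" "v 5 = 2 * l" "a 2 0 = f" "names (a 1) (a 31 0) (v 6)"
  using st by (auto simp: state_def base_def)
 have am: "?a < m" using anc_less[of "q div 2"] q by auto
 have mZ: "m < Z" "0 < Z" using Z_lin L_ge by linarith+
 let ?body = "Cond (Vr 15 [mod] Cn 2)
   (Cond (Vr 30 [+] Vr 16 [<] Vr 3) (Asg 33 (Vr 30 [+] Vr 16 [+] Cn 1)) (Asg 33 (Cn 0)))
   (Cond (Vr 16 [<] Vr 30) (Asg 33 (Vr 30 [-] Vr 16)) (Asg 33 (Cn 0)));;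
  provided (Vr 33) (
   Asg 8 (arr1 2 (Vr 33 [+] Cn 1));; name_code;; Asg 7 (Vr 9);;
   St 8 (Vr 15) (Vr 16 [+] Cn 1) (Vr 9))"
 show ?thesis
  unfolding walk_code_def
 proof (rule wp_For_const[where I = I and T = 11 and n = "2 * l"])
  show "I 0 v a" using b(4) v7 row by (auto simp: I_def prefix_names_def)
 next
  fix x t1 v1 a1
  assume x: "x < 2 * l" and I: "I x v1 a1" and bd1: "bounded v1 a1"
   and fr: "frame (For 16 (Vr 5) ?body) v a v1 a1"
  have w: "v1 3 = m" "v1 15 = q" "v1 30 = ?a" "a1 2 = a 2"
   using frame_var[OF fr, of 3] frame_var[OF fr, of 15] frame_var[OF fr, of 30]
    frame_array[OF fr, of 2] b q by (auto simp: name_code_def)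
  have n1: "names (a1 1) (a1 31 0) (v1 6)" "v1 6 + 1 < Z" "v1 7 ~= 0" "v1 6 <= v 6 + x"
   using I c x by (auto simp: I_def)
  show "wp ?body (\<lambda>t' v' a'. t' <= t1 + 11 & I (Suc x) v' a') t1 (v1(16 := x)) a1"
  proof (cases "x < length ?s")
   case False
   have e: "take (Suc x) ?s = take x ?s" using False by simp
   have "I (Suc x) v' a1" if "v' 6 = v1 6" "v' 7 = v1 7" for v'
    using I that False unfolding I_def e by (auto simp: prefix_names_def le_Suc_eq)
   moreover have "q mod 2 ~= 0 ==> \<not> ?a + x < m" "q mod 2 = 0 ==> \<not> x < ?a"
    using False q x by (auto simp: length_ctx even_iff_mod_2_eq_zero split: if_splits)
   ultimately show ?thesis using w mZ by (cases "q mod 2 = 0") (simp_all add: wps)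
  next
   case True
   define p where "p = (if odd q then ?a + x + 1 else ?a - x)"
   have p: "p ~= 0" "f (p + 1) = ?s ! x" "p < Z"
    using True q x am mZ by (auto simp: p_def length_ctx ctx_nth)
   define ch where "ch = ?s ! x"
   have ch: "ch < Z" using bounded_array[OF bd1, of 2 0 "p + 1"] p w b by (simp add: ch_def)
   let ?v = "v1(16 := x, 33 := p, 8 := ch)"
   have bd2: "bounded ?v a1" using bd1 p(3) ch x D_less by (auto intro!: bounded_asg)
   have nm: "wp name_code (wp (Asg 7 (Vr 9);; St 8 (Vr 15) (Vr 16 [+] Cn 1) (Vr 9))
     (\<lambda>t' v' a'. t' <= t1 + 11 & I (Suc x) v' a')) tt ?v a1" if tt: "tt <= t1 + 5" for tt
   proof (rule wp_name)
    fix t' c' T'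
    assume t': "t' <= tt + 4" and T': "names T' (a1 31 0) c'" "ext (a1 1) T'"
     "?v 6 <= c'" "c' <= ?v 6 + 1" "T' (?v 7) (?v 8) ~= 0"
    let ?y = "T' (v1 7) ch"
    have yz: "?y < Z" using names_le[OF T'(1), of "v1 7" ch] T'(4) n1 by simp
    have wn: "word_name T' (take x ?s) = v1 7"
     using word_name_ext[OF n1(1) T'(2)] I by (auto simp: I_def)
    have tk: "take (Suc x) ?s = take x ?s @ [ch]" using True by (simp add: take_Suc_conv_app_nth ch_def)
    have pn: "prefix_names T' ?s y = prefix_names (a1 1) ?s y" if "y <= x" for y
    proof -
     have "prefix (take y ?s) (take x ?s)" using that by (metis min.absorb1 take_is_prefix take_take)
     then have "word_name (a1 1) (take y ?s) ~= 0"
      using word_name_prefix[OF n1(1)] I by (auto simp: I_def)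
     then show ?thesis using word_name_ext[OF n1(1) T'(2)] by (simp add: prefix_names_def)
    qed
    have "I (Suc x) (?v(6 := c', 9 := ?y, 7 := ?y)) (upd (a1(1 := T')) 8 q (Suc x) ?y)"
     unfolding I_def
    proof (intro conjI allI impI)
     fix y show "upd (a1(1 := T')) 8 q (Suc x) ?y 8 q y = (if y <= Suc x
      then prefix_names (upd (a1(1 := T')) 8 q (Suc x) ?y 1) ?s y else 0)"
      using I pn[of y] wn tk True
      by (auto simp: upd_same upd_array I_def prefix_names_def le_Suc_eq)
    next
     show "ext (a 1) (upd (a1(1 := T')) 8 q (Suc x) ?y 1)"
      using I T'(2) ext_trans by (simp add: upd_array I_def) blast
    next
     show "(?v(6 := c', 9 := ?y, 7 := ?y)) 6 <= v 6 + Suc x" using T'(4) n1(4) by simp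
    next
     fix q' z assume "q' ~= q"
     then show "upd (a1(1 := T')) 8 q (Suc x) ?y 8 q' z = a 8 q' z"
      using I by (simp add: upd_same I_def)
    qed (use T'(1,5) wn tk in \<open>simp_all add: upd_array\<close>)
    then show "wp (Asg 7 (Vr 9);; St 8 (Vr 15) (Vr 16 [+] Cn 1) (Vr 9))
     (\<lambda>t' v' a'. t' <= t1 + 11 & I (Suc x) v' a') t'
     (?v(6 := c', 9 := T' (?v 7) (?v 8))) (a1(1 := T'))"
     using t' tt yz w by (simp add: wps)
   qed (use n1 bd2 in auto)
   have cond: "q mod 2 ~= 0 ==> ?a + x < m & p = ?a + x + 1" "q mod 2 = 0 ==> x < ?a & p = ?a - x"
    using True q x
    by (auto simp: length_ctx even_iff_mod_2_eq_zero p_def split: if_splits)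
   have "a1 2 0 (Suc p) = ch" using p w b by (simp add: ch_def)
   then show ?thesis
    using nm w p mZ cond ch by (cases "q mod 2 = 0") (simp_all add: wps)
  qed
 next
  fix t' v' a'
  assume t': "t' <= t + 1 + 2 * l * (11 + 1)" and I: "I (2 * l) v' a'"
  have "a' 8 q x = prefix_names (a' 1) ?s x" for x
   using I length_ctx_le[of q] by (auto simp: I_def prefix_names_def)
  then show "t' <= t + 1 + 2 * l * 12 & names (a' 1) (a' 31 0) (v' 6) &
  ext (a 1) (a' 1) & v' 6 <= v 6 + 2 * l & word_name (a' 1) (ctx q) ~= 0 &
  (\<forall>x. a' 8 q x = prefix_names (a' 1) (ctx q) x) & (\<forall>q' x. q' ~= q --> a' 8 q' x = a 8 q' x)"
   using t' I length_ctx_le[of q] by (simp add: I_def)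
 qed (use b bd D_less in auto)
qed

lemma ctx_correct:
 assumes st: "state v a" and bd: "bounded v a" and c: "v 6 + 2 * K * (2 * l) < Z"
  and z: "\<And>q x. a 8 q x = 0"
 shows "wp ctx_code (\<lambda>t' v' a'. t' <= t + 1 + 2 * K * (2 * l * 12 + 5) & state v' a' &
  ext (a 1) (a' 1) & v' 6 <= v 6 + 2 * K * (2 * l) &
  (\<forall>q<2 * K. word_name (a' 1) (ctx q) ~= 0 & a' 8 q = prefix_names (a' 1) (ctx q))) t v a"
proof -
 define I where "I q v' a' \<longleftrightarrow> state v' a' & ext (a 1) (a' 1) & v' 6 <= v 6 + q * (2 * l) &
  (\<forall>q'<q. word_name (a' 1) (ctx q') ~= 0 & (\<forall>x. a' 8 q' x = prefix_names (a' 1) (ctx q') x)) &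
  (\<forall>q'\<ge>q. \<forall>x. a' 8 q' x = 0)" for q and v' :: vars and a' :: arrays
 have b: "v 12 = K" using st by (auto simp: state_def)
 have z1: "1 < Z" using Z_lin by linarith
 let ?body = "Asg 30 (arr1 6 (Vr 15 [div] Cn 2));; Asg 7 (Cn 1);; St 8 (Vr 15) (Cn 0) (Cn 1);; walk_code"
 show ?thesis
  unfolding ctx_code_def
 proof (rule wp_For_const[where I = I and T = "2 * l * 12 + 4" and n = "2 * K"])
  fix q t1 v1 a1
  assume q: "q < 2 * K" and I: "I q v1 a1" and bd1: "bounded v1 a1"
  have w: "state v1 a1" "a1 6 0 (q div 2) = anc (q div 2)" "names (a1 1) (a1 31 0) (v1 6)"
   using I q by (auto simp: I_def state_def)
  have az: "anc (q div 2) < Z" using bounded_array[OF bd1, of 6 0 "q div 2"] w by simp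
  let ?v = "v1(15 := q, 30 := anc (q div 2), 7 := 1)" and ?a = "upd a1 8 q 0 1"
  have bd2: "bounded ?v ?a" using bd1 az q D_less z1 by (auto intro!: bounded_asg bounded_upd)
  have st2: "state ?v ?a" using w(1) by (simp add: state_def base_def upd_array)
  have cq: "q * (2 * l) + 2 * l <= 2 * K * (2 * l)"
   using mult_le_mono1[of "Suc q" "2 * K" "2 * l"] q by simp
  have wk: "wp walk_code (\<lambda>t' v' a'. t' <= tt + 1 + 2 * l * 12 & names (a' 1) (a' 31 0) (v' 6) &
   ext (?a 1) (a' 1) & v' 6 <= ?v 6 + 2 * l & word_name (a' 1) (ctx q) ~= 0 &
   (\<forall>x. a' 8 q x = prefix_names (a' 1) (ctx q) x) & (\<forall>q' x. q' ~= q --> a' 8 q' x = ?a 8 q' x))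
   tt ?v ?a" for tt
   by (rule walk_correct[OF st2 bd2 q])
    (use I c cq in \<open>auto simp: upd_same I_def\<close>)
  have "wp walk_code (\<lambda>t' v' a'. t' <= t1 + (2 * l * 12 + 4) & I (Suc q) v' a') tt ?v ?a"
   if "tt <= t1 + 3" for tt
  proof (rule wp_conseq[OF wk bd2])
   fix t' v' a'
   assume p: "t' <= tt + 1 + 2 * l * 12 & names (a' 1) (a' 31 0) (v' 6) &
    ext (?a 1) (a' 1) & v' 6 <= ?v 6 + 2 * l & word_name (a' 1) (ctx q) ~= 0 &
    (\<forall>x. a' 8 q x = prefix_names (a' 1) (ctx q) x) & (\<forall>q' x. q' ~= q --> a' 8 q' x = ?a 8 q' x)"
    and fr2: "frame walk_code ?v ?a v' a'"
   have st': "state v' a'"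
    using st2 p frame_var[OF fr2] frame_array[OF fr2]
    by (simp add: state_def base_def walk_code_def name_code_def)
   have ex: "ext (a1 1) (a' 1)" using p by (simp add: upd_array)
   have "word_name (a' 1) (ctx q') ~= 0 & a' 8 q' x = prefix_names (a' 1) (ctx q') x"
    if "q' < Suc q" for q' x
   proof (cases "q' = q")
    case False
    then have 1: "word_name (a1 1) (ctx q') ~= 0" "a1 8 q' x = prefix_names (a1 1) (ctx q') x"
     using I that by (auto simp: I_def)
    moreover have "a' 8 q' x = a1 8 q' x" using p False by (simp add: upd_same)
    ultimately show ?thesis
     using prefix_names_ext[OF w(3) ex 1(1)] word_name_ext[OF w(3) ex 1(1)] by simp
   qed (use p in simp)
   moreover have "a' 8 q' x = 0" if "Suc q <= q'" for q' x
    using p I that by (simp add: upd_same I_def)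
   moreover have "v' 6 <= v 6 + Suc q * (2 * l)" using p I by (simp add: I_def)
   ultimately have "I (Suc q) v' a'"
    using st' I ex unfolding I_def by (auto intro: ext_trans)
   then show "t' <= t1 + (2 * l * 12 + 4) & I (Suc q) v' a'" using p that by simp
  qed
  then show "wp ?body (\<lambda>t' v' a'. t' <= t1 + (2 * l * 12 + 4) & I (Suc q) v' a') t1 (v1(15 := q)) a1"
   using w az z1 by (simp add: wps)
 next
  fix t' v' a'
  assume "t' <= t + 1 + 2 * K * (2 * l * 12 + 4 + 1)" and I: "I (2 * K) v' a'"
  then have "t' <= t + 1 + 2 * K * (2 * l * 12 + 5)" by (simp add: algebra_simps)
  with I show "t' <= t + 1 + 2 * K * (2 * l * 12 + 5) & state v' a' &
  ext (a 1) (a' 1) & v' 6 <= v 6 + 2 * K * (2 * l) &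
  (\<forall>q<2 * K. word_name (a' 1) (ctx q) ~= 0 & a' 8 q = prefix_names (a' 1) (ctx q))"
   unfolding I_def by (simp add: fun_eq_iff)
 qed (use b bd D_less z st in \<open>auto simp: I_def\<close>)
qed

end

section \<open>Weights, heads and groups\<close>

definition "count_row =
 For 16 (Vr 5 [+] Cn 1) (
  Asg 7 (Ar 8 (Vr 15) (Vr 16));; provided (Vr 7) (st1 9 (Vr 7) (arr1 9 (Vr 7) [+] Cn 1)))"

definition "count_code = For 15 (Cn 2 [*] Vr 12) count_row"

definition "head_row =
 For 16 (Vr 5) (
  Asg 7 (Ar 8 (Vr 15) (Vr 16));; Asg 8 (Ar 8 (Vr 15) (Vr 16 [+] Cn 1));;
  provided (Vr 8) (
   Cond (arr1 9 (Vr 7) [<] Cn 2 [*] arr1 9 (Vr 8))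
    (st1 10 (Vr 8) (arr1 10 (Vr 7))) (st1 10 (Vr 8) (Vr 8))))"

definition "head_code = st1 10 (Cn 1) (Cn 1);; For 15 (Cn 2 [*] Vr 12) head_row"

text \<open>Groups are named through the same table as the nodes of the trie. A group may thus share
  its name with an entry made for an edge; this does no harm, because only injectivity matters: the
  name determines the pair of heads.\<close>

definition "group_inner =
 For 17 (Vr 5) (
  Asg 8 (Ar 8 (Cn 2 [*] Vr 14 [+] Cn 1) (Vr 17));;
  provided (Vr 8) (
   provided (arr1 10 (Vr 8) [=] Vr 8) (
    name_code;; st1 14 (Vr 9) (Vr 7);; st1 15 (Vr 9) (Vr 8);;
    St 11 (Vr 9) (arr1 13 (Vr 9)) (Vr 14);; st1 13 (Vr 9) (arr1 13 (Vr 9) [+] Cn 1))))"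

definition "group_row =
 For 16 (Vr 5) (
  Asg 7 (Ar 8 (Cn 2 [*] Vr 14) (Vr 16));;
  provided (Vr 7) (provided (arr1 10 (Vr 7) [=] Vr 7) group_inner))"

definition "group_code = For 14 (Vr 12) group_row"

lemma sum_fun_upd_Suc:
 "finite A ==> x \<in> A ==> sum (g(x := Suc (g x))) A = Suc (sum g A)" for g :: "'a \<Rightarrow> nat"
 by (simp add: sum.remove[of A x])

text \<open>\<open>T0\<close> is the naming table at the moment when all contexts have been entered.
  Later tables extend it, but node names always refer to \<open>T0\<close>.\<close>

locale trie_ram = anchored_ram +
 fixes T0 :: "nat \<Rightarrow> nat \<Rightarrow> nat" and H0 :: "nat \<Rightarrow> nat" and c0 :: nat
 assumes names0: "names T0 H0 c0" and ctx_named: "q < 2 * K ==> word_name T0 (ctx q) ~= 0"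
begin

definition node :: "nat \<Rightarrow> nat \<Rightarrow> nat" where "node q = prefix_names T0 (ctx q)"

definition node_state :: "vars \<Rightarrow> arrays \<Rightarrow> bool" where
 "node_state v a \<longleftrightarrow> state v a & ext T0 (a 1) & (\<forall>q<2 * K. a 8 q = node q)"

lemma node_eq: "x <= length (ctx q) ==> node q x = word_name T0 (take x (ctx q))"
 and node_0: "length (ctx q) < x ==> node q x = 0"
 by (auto simp: node_def prefix_names_def)

lemma node_nz: "q < 2 * K ==> node q x ~= 0 \<longleftrightarrow> x <= length (ctx q)"
 using word_name_prefix[OF names0 take_is_prefix ctx_named] by (auto simp: node_def prefix_names_def)

lemma prefix_named: "q < 2 * K ==> prefix s (ctx q) ==> word_name T0 s ~= 0"
 using word_name_prefix[OF names0 _ ctx_named] by blast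

text \<open>Strings are named with a later table \<open>T\<close>, contexts with \<open>T0\<close>.
  As \<open>T\<close> preserves the old names and is injective, comparing numbers means comparing
  words, even for words outside the trie.\<close>

lemma word_name_eq_node:
 assumes "names T H c" "ext T0 T" "q < 2 * K"
 shows "word_name T s = node q x & node q x ~= 0 \<longleftrightarrow> x <= length (ctx q) & s = take x (ctx q)"
proof (cases "x <= length (ctx q)")
 case True
 have n: "word_name T0 (take x (ctx q)) ~= 0" using node_nz[OF assms(3), of x] True node_eq by simp
 have e: "word_name T (take x (ctx q)) = node q x"
  using word_name_ext[OF names0 assms(2) n] True by (simp add: node_eq)
 then show ?thesis using word_name_inj[OF assms(1), of "take x (ctx q)" s] n True node_nz[OF assms(3), of x]
  by metis
qed (simp add: node_0)

definition occurrences :: "nat \<Rightarrow> nat" where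
 "occurrences p = (\<Sum>q<2 * K. \<Sum>x<Suc (2 * l). of_bool (node q x = p))"

text \<open>A name can occur in a context at one depth only, the length of its word, so the inner
  sum is 0 or 1.\<close>

lemma occurrences_word:
 assumes T: "names T H c" "ext T0 T" and s: "word_name T s ~= 0"
 shows "occurrences (word_name T s) = weight s"
proof -
 have "(\<Sum>x<Suc (2 * l). of_bool (node q x = word_name T s)) = (of_bool (prefix s (ctx q)) :: nat)"
  if q: "q < 2 * K" for q
 proof -
  have e: "node q x = word_name T s \<longleftrightarrow> x = length s & prefix s (ctx q)" for x
  proof -
   have "node q x = word_name T s \<longleftrightarrow> word_name T s = node q x & node q x ~= 0" using s by auto
   also have "\<dots> \<longleftrightarrow> x <= length (ctx q) & s = take x (ctx q)"
    by (rule word_name_eq_node[OF T q])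
   also have "\<dots> \<longleftrightarrow> x = length s & prefix s (ctx q)"
    by (auto elim!: prefixE simp: take_is_prefix)
   finally show ?thesis .
  qed
  have "prefix s (ctx q) ==> length s < Suc (2 * l)"
   using prefix_length_le[of s "ctx q"] length_ctx_le[of q] by simp
  then show ?thesis unfolding e
   by (cases "prefix s (ctx q)") (auto simp: of_bool_def if_distrib sum.delta cong: if_cong)
 qed
 then have "occurrences (word_name T s) = (\<Sum>q<2 * K. of_bool (prefix s (ctx q)))"
  unfolding occurrences_def by (intro sum.cong) auto
 also have "\<dots> = card ({..<2 * K} \<inter> {q. prefix s (ctx q)})"
  by (subst sum_of_bool_eq) auto
 also have "\<dots> = weight s" unfolding weight_def by (rule arg_cong[of _ _ card]) auto
 finally show ?thesis .
qed

lemma count_row_correct: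
 assumes v: "v 5 = 2 * l" "v 15 = q" and bd: "bounded v a" and nd: "a 8 q = node q"
  and c: "\<And>p. p ~= 0 ==> a 9 0 p + Suc (2 * l) < Z"
 shows "wp count_row (\<lambda>t' v' a'. t' <= t + 1 + Suc (2 * l) * 4 &
  (\<forall>p. p ~= 0 --> a' 9 0 p = a 9 0 p + (\<Sum>x<Suc (2 * l). of_bool (node q x = p)))) t v a"
proof -
 define I where "I x v' a' \<longleftrightarrow>
  (\<forall>p. p ~= 0 --> a' 9 0 p = a 9 0 p + (\<Sum>y<x. of_bool (node q y = p)))"
  for x and v' :: vars and a' :: arrays
 let ?body = "Asg 7 (Ar 8 (Vr 15) (Vr 16));; provided (Vr 7) (st1 9 (Vr 7) (arr1 9 (Vr 7) [+] Cn 1))"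
 show ?thesis
  unfolding count_row_def
 proof (rule wp_For_const[where I = I and T = 3 and n = "Suc (2 * l)"])
  fix x t1 v1 a1
  assume x: "x < Suc (2 * l)" and I: "I x v1 a1" and bd1: "bounded v1 a1"
   and fr: "frame (For 16 (Vr 5 [+] Cn 1) ?body) v a v1 a1"
  have w: "v1 15 = q" "a1 8 q x = node q x"
   using frame_var[OF fr, of 15] frame_array[OF fr, of 8] v nd by auto
  have nz: "node q x < Z" using bounded_array[OF bd1, of 8 q x] w by simp
  have le: "(\<Sum>y<x. of_bool (node q y = p)) <= x" for p
   using sum_bounded_above[of "{..<x}" "\<lambda>y. of_bool (node q y = p)" "1::nat"] by simp
  have b: "Suc (a1 9 0 (node q x)) < Z" if "node q x ~= 0"
  proof -
   have "a1 9 0 (node q x) = a 9 0 (node q x) + (\<Sum>y<x. of_bool (node q y = node q x))"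
    using I that by (simp add: I_def)
   then show ?thesis using c[OF that] le[of "node q x"] x by linarith
  qed
  show "wp ?body (\<lambda>t' v' a'. t' <= t1 + 3 & I (Suc x) v' a') t1 (v1(16 := x)) a1"
  proof (cases "node q x = 0")
   case True
   then show ?thesis using w nz I by (simp add: wps I_def)
  next
   case False
   then show ?thesis using w nz I b by (auto simp: wps I_def upd_same)
  qed
 next
  fix t' v' a'
  assume "t' <= t + 1 + Suc (2 * l) * (3 + 1)" "I (Suc (2 * l)) v' a'"
  then show "t' <= t + 1 + Suc (2 * l) * 4 &
   (\<forall>p. p ~= 0 --> a' 9 0 p = a 9 0 p + (\<Sum>x<Suc (2 * l). of_bool (node q x = p)))"
   unfolding I_def by simp
 qed (use v bd D_less in \<open>auto simp: I_def\<close>)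
qed

lemma count_correct:
 assumes v: "node_state v a" and bd: "bounded v a" and z: "\<And>p. a 9 0 p = 0"
 shows "wp count_code (\<lambda>t' v' a'. t' <= t + 1 + 2 * K * (10 + 8 * l) &
  (\<forall>p. p ~= 0 --> a' 9 0 p = occurrences p)) t v a"
proof -
 define I where "I q v' a' \<longleftrightarrow>
  (\<forall>p. p ~= 0 --> a' 9 0 p = (\<Sum>r<q. \<Sum>y<Suc (2 * l). of_bool (node r y = p)))"
  for q and v' :: vars and a' :: arrays
 have b: "v 12 = K" "v 5 = 2 * l" "\<And>q. q < 2 * K ==> a 8 q = node q"
  using v by (auto simp: node_state_def state_def base_def)
 show ?thesis
  unfolding count_code_def
 proof (rule wp_For_const[where I = I and T = "1 + Suc (2 * l) * 4" and n = "2 * K"])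
  fix q t1 v1 a1
  assume q: "q < 2 * K" and I: "I q v1 a1" and bd1: "bounded v1 a1"
   and fr: "frame (For 15 (Cn 2 [*] Vr 12) count_row) v a v1 a1"
  have w: "v1 5 = 2 * l" "a1 8 q = node q"
   using frame_var[OF fr, of 5] frame_array[OF fr, of 8] b q by (auto simp: count_row_def)
  have bd2: "bounded (v1(15 := q)) a1" using bd1 q D_less by (intro bounded_asg) auto
  have le: "a1 9 0 p + Suc (2 * l) < Z" if "p ~= 0" for p
  proof -
   have i: "(\<Sum>y<Suc (2 * l). of_bool (node r y = p)) <= Suc (2 * l)" for r
    using sum_bounded_above[of "{..<Suc (2 * l)}" "\<lambda>y. of_bool (node r y = p)" "1::nat"] by simp
   have "a1 9 0 p = (\<Sum>r<q. \<Sum>y<Suc (2 * l). of_bool (node r y = p))"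
    using I that unfolding I_def by blast
   also have "\<dots> <= q * Suc (2 * l)"
    using sum_bounded_above[of "{..<q}", OF i] by simp
   also have "\<dots> <= L * Suc L" using q D_less by (intro mult_le_mono) auto
   finally have "a1 9 0 p <= L * L + L" by simp
   moreover have "Suc (2 * l) <= Suc L" using D_less by simp
   ultimately show ?thesis using Z_cube by linarith
  qed
  show "wp count_row (\<lambda>t' v' a'. t' <= t1 + (1 + Suc (2 * l) * 4) & I (Suc q) v' a') t1 (v1(15 := q)) a1"
  proof (rule wp_mono[OF count_row_correct[OF _ _ bd2 w(2) le]])
   fix t' and v' :: vars and a' :: arrays
   assume p: "t' <= t1 + 1 + Suc (2 * l) * 4 &
    (\<forall>p. p ~= 0 --> a' 9 0 p = a1 9 0 p + (\<Sum>x<Suc (2 * l). of_bool (node q x = p)))"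
   have "I (Suc q) v' a'"
    using p I unfolding I_def by (simp add: sum.lessThan_Suc[of _ q] del: sum.lessThan_Suc)
   then show "t' <= t1 + (1 + Suc (2 * l) * 4) & I (Suc q) v' a'" using p by simp
  qed (use w in auto)
 next
  fix t' v' a'
  assume t': "t' <= t + 1 + 2 * K * (1 + Suc (2 * l) * 4 + 1)" and I: "I (2 * K) v' a'"
  have "1 + Suc (2 * l) * 4 + 1 <= 10 + 8 * l" by simp
  then have "2 * K * (1 + Suc (2 * l) * 4 + 1) <= 2 * K * (10 + 8 * l)" by (rule mult_le_mono2)
  then have "t' <= t + 1 + 2 * K * (10 + 8 * l)" using t' by linarith
  moreover have "\<forall>p. p ~= 0 --> a' 9 0 p = occurrences p"
   using I unfolding I_def occurrences_def .
  ultimately show "t' <= t + 1 + 2 * K * (10 + 8 * l) &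
   (\<forall>p. p ~= 0 --> a' 9 0 p = occurrences p)" by blast
 qed (use b bd D_less z in \<open>auto simp: I_def\<close>)
qed

definition heads_ok :: "nat list set \<Rightarrow> arrays \<Rightarrow> bool" where
 "heads_ok S a \<longleftrightarrow> (\<forall>s\<in>S. a 10 0 (word_name T0 s) = word_name T0 (head s))"

lemma head_row_correct:
 assumes v: "v 5 = 2 * l" "v 15 = q" and bd: "bounded v a" and nd: "a 8 q = node q"
  and c: "\<And>p. p ~= 0 ==> a 9 0 p = occurrences p" and q: "q < 2 * K"
  and S: "heads_ok S a" "\<forall>s\<in>S. word_name T0 s ~= 0" "[] \<in> S"
 shows "wp head_row (\<lambda>t' v' a'. t' <= t + 1 + 2 * l * 6 &
  heads_ok (S \<union> {s. prefix s (ctx q)}) a') t v a"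
proof -
 define W where "W x = S \<union> {take y (ctx q) | y. y <= x}" for x
 define I where "I x v' a' \<longleftrightarrow> heads_ok (W x) a'" for x and v' :: vars and a' :: arrays
 let ?body = "Asg 7 (Ar 8 (Vr 15) (Vr 16));; Asg 8 (Ar 8 (Vr 15) (Vr 16 [+] Cn 1));;
  provided (Vr 8) (
   Cond (arr1 9 (Vr 7) [<] Cn 2 [*] arr1 9 (Vr 8))
    (st1 10 (Vr 8) (arr1 10 (Vr 7))) (st1 10 (Vr 8) (Vr 8)))"
 have WSuc: "W (Suc x) = insert (take (Suc x) (ctx q)) (W x)" for x
  by (auto simp: W_def le_Suc_eq)
 have Wn: "word_name T0 s ~= 0" if "s \<in> W x" for s x
  using that S(2) prefix_named[OF q take_is_prefix] by (auto simp: W_def)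
 show ?thesis
  unfolding head_row_def
 proof (rule wp_For_const[where I = I and T = 5 and n = "2 * l"])
  show "I 0 v a" using S by (auto simp: I_def W_def heads_ok_def)
 next
  fix x t1 v1 a1
  assume x: "x < 2 * l" and I: "I x v1 a1" and bd1: "bounded v1 a1"
   and fr: "frame (For 16 (Vr 5) ?body) v a v1 a1"
  have w: "v1 15 = q" "a1 8 q = node q" "a1 9 = a 9"
   using frame_var[OF fr, of 15] frame_array[OF fr, of 8] frame_array[OF fr, of 9] v nd by auto
  have nz: "node q x < Z" "node q (Suc x) < Z" "a1 10 0 p < Z" for p
   using bounded_array[OF bd1, of 8 q x] bounded_array[OF bd1, of 8 q "Suc x"]
    bounded_array[OF bd1, of 10 0 p] w by auto
  let ?s = "take x (ctx q)" and ?s' = "take (Suc x) (ctx q)"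
  show "wp ?body (\<lambda>t' v' a'. t' <= t1 + 5 & I (Suc x) v' a') t1 (v1(16 := x)) a1"
  proof (cases "Suc x <= length (ctx q)")
   case False
   then have "take (Suc x) (ctx q) = take x (ctx q)" by simp
   then have "W (Suc x) = W x" unfolding WSuc by (auto simp: W_def)
   moreover have "node q (Suc x) = 0" using False by (simp add: node_0)
   ultimately show ?thesis using w nz I by (simp add: wps I_def)
  next
   case True
   have n: "node q x = word_name T0 ?s" "node q (Suc x) = word_name T0 ?s'"
    using True by (auto simp: node_eq)
   have n0: "word_name T0 ?s ~= 0" "word_name T0 ?s' ~= 0"
    using prefix_named[OF q take_is_prefix] by blast+
   have wt: "a 9 0 (node q x) = weight ?s" "a 9 0 (node q (Suc x)) = weight ?s'"
    using c n n0 occurrences_word[OF names0 ext_refl] by auto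
   have tk: "?s' = ?s @ [ctx q ! x]" using True by (simp add: take_Suc_conv_app_nth)
   have hs: "a1 10 0 (node q x) = word_name T0 (head ?s)"
    using I n by (auto simp: I_def heads_ok_def W_def)
   have hz: "word_name T0 (head ?s) < Z" using nz(3)[of "node q x"] hs by metis
   have val: "I (Suc x) v' (upd a1 10 0 (node q (Suc x)) (word_name T0 (head ?s')))" for v'
    unfolding I_def heads_ok_def
   proof
    fix s assume s: "s \<in> W (Suc x)"
    show "upd a1 10 0 (node q (Suc x)) (word_name T0 (head ?s')) 10 0 (word_name T0 s) =
      word_name T0 (head s)"
    proof (cases "s = ?s'")
     case False
     then have "word_name T0 s ~= node q (Suc x)"
      using word_name_inj[OF names0, of s ?s'] n Wn[OF s] by auto
     moreover have "s \<in> W x" using s False by (auto simp: WSuc)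
     ultimately show ?thesis using I by (simp add: upd_same I_def heads_ok_def)
    qed (simp add: n upd_same)
   qed
   show ?thesis
   proof (cases "weight ?s < 2 * weight ?s'")
    case heavy: True
    then have "head ?s' = head ?s" using tk by (simp add: head_snoc)
    then show ?thesis using w nz val heavy wt hs n n0 hz by (simp add: wps)
   next
    case False
    then have "head ?s' = ?s'" using tk by (simp add: head_snoc)
    then show ?thesis using w nz val False wt hs n n0 by (simp add: wps)
   qed
  qed
 next
  fix t' v' a'
  assume t': "t' <= t + 1 + 2 * l * (5 + 1)" and I: "I (2 * l) v' a'"
  have "S \<union> {s. prefix s (ctx q)} \<subseteq> W (2 * l)"
  proof -
   have "prefix s (ctx q) ==> s = take (length s) (ctx q) & length s <= 2 * l" for s
    using length_ctx_le[of q] prefix_length_le[of s "ctx q"] by (auto simp: prefix_def)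
   then show ?thesis unfolding W_def by blast
  qed
  then show "t' <= t + 1 + 2 * l * 6 & heads_ok (S \<union> {s. prefix s (ctx q)}) a'"
   using t' I by (auto simp: I_def heads_ok_def)
 qed (use v bd D_less in auto)
qed

lemma head_correct:
 assumes v: "node_state v a" and bd: "bounded v a" and c: "\<And>p. p ~= 0 ==> a 9 0 p = occurrences p"
 shows "wp head_code (\<lambda>t' v' a'. t' <= t + 2 + 2 * K * (12 * l + 2) &
  heads_ok {s. \<exists>q<2 * K. prefix s (ctx q)} a') t v a"
proof -
 define W where "W q = insert [] {s. \<exists>r<q. prefix s (ctx r)}" for q
 define I where "I q v' a' \<longleftrightarrow> heads_ok (W q) a'" for q and v' :: vars and a' :: arrays
 have b: "v 12 = K" "v 5 = 2 * l" "\<And>q. q < 2 * K ==> a 8 q = node q"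
  using v by (auto simp: node_state_def state_def base_def)
 have z1: "1 < Z" using Z_lin by linarith
 have bd0: "bounded v (upd a 10 0 1 1)" using bd z1 by (intro bounded_upd) auto
 have "wp (For 15 (Cn 2 [*] Vr 12) head_row) (\<lambda>t' v' a'. t' <= t + 2 + 2 * K * (12 * l + 2) &
  heads_ok {s. \<exists>q<2 * K. prefix s (ctx q)} a') (t + 1) v (upd a 10 0 1 1)"
 proof (rule wp_For_const[where I = I and T = "1 + 2 * l * 6" and n = "2 * K"])
  show "I 0 v (upd a 10 0 1 1)" by (simp add: I_def W_def heads_ok_def upd_same)
 next
  fix q t1 v1 a1
  assume q: "q < 2 * K" and I: "I q v1 a1" and bd1: "bounded v1 a1"
   and fr: "frame (For 15 (Cn 2 [*] Vr 12) head_row) v (upd a 10 0 1 1) v1 a1"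
  have w: "v1 5 = 2 * l" "a1 8 q = node q" "a1 9 = a 9"
   using frame_var[OF fr, of 5] frame_array[OF fr, of 8] frame_array[OF fr, of 9] b q
   by (auto simp: head_row_def upd_array)
  have bd2: "bounded (v1(15 := q)) a1" using bd1 q D_less by (intro bounded_asg) auto
  have WSuc: "W (Suc q) = W q \<union> {s. prefix s (ctx q)}" by (auto simp: W_def less_Suc_eq)
  have W0: "[] \<in> W q" by (simp add: W_def)
  have nW: "\<forall>s\<in>W q. word_name T0 s ~= 0"
  proof
   fix s assume "s \<in> W q"
   then consider "s = []" | r where "r < 2 * K" "prefix s (ctx r)"
    using q less_trans by (auto simp: W_def)
   then show "word_name T0 s ~= 0" using prefix_named by cases auto
  qed
  show "wp head_row (\<lambda>t' v' a'. t' <= t1 + (1 + 2 * l * 6) & I (Suc q) v' a') t1 (v1(15 := q)) a1"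
   by (rule wp_mono[OF head_row_correct[OF _ _ bd2 w(2) _ q, of "W q"]])
    (use w I nW c W0 in \<open>auto simp: I_def WSuc\<close>)
 next
  fix t' v' a'
  assume t': "t' <= t + 1 + 1 + 2 * K * (1 + 2 * l * 6 + 1)" and I: "I (2 * K) v' a'"
  have "1 + 2 * l * 6 + 1 = 12 * l + 2" by simp
  with t' have "t' <= t + 2 + 2 * K * (12 * l + 2)" by simp
  then show "t' <= t + 2 + 2 * K * (12 * l + 2) &
    heads_ok {s. \<exists>q<2 * K. prefix s (ctx q)} a'"
   using I by (auto simp: I_def heads_ok_def W_def)
 qed (use b bd0 D_less in \<open>auto\<close>)
 then show ?thesis using z1 by (simp add: head_code_def wps)
qed

text \<open>Depth \<open>2 * l\<close> is left out, in accordance with the loops of the program.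
  Both parts of a string are shorter, so their heads are not lost.\<close>

definition head_set :: "nat \<Rightarrow> nat set" where
 "head_set q = {x. x < 2 * l & x <= length (ctx q) & head (take x (ctx q)) = take x (ctx q)}"

definition in_group :: "arrays \<Rightarrow> nat \<Rightarrow> nat \<Rightarrow> nat \<Rightarrow> bool" where
 "in_group a j x y \<longleftrightarrow> (let g = a 1 (node (2 * j) x) (node (2 * j + 1) y) in
  g ~= 0 & (\<exists>i<a 13 0 g. a 11 g i = j))"

definition groups_ok :: "arrays \<Rightarrow> bool" where
 "groups_ok a \<longleftrightarrow> (\<forall>g. a 13 0 g ~= 0 --> g ~= 0 & a 1 (a 14 0 g) (a 15 0 g) = g &
  (\<forall>i<a 13 0 g. a 11 g i < K))"

definition group_sum :: "arrays \<Rightarrow> nat" where "group_sum a = (\<Sum>g<Z. a 13 0 g)"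

text \<open>The last conjunct confines the groups to names below \<open>Z\<close>, so that the
  finite sum \<open>group_sum\<close> accounts for all memberships.\<close>

definition group_state :: "vars \<Rightarrow> arrays \<Rightarrow> bool" where
 "group_state v a \<longleftrightarrow> node_state v a & groups_ok a & heads_ok {s. \<exists>q<2 * K. prefix s (ctx q)} a &
  (\<forall>g\<ge>Z. a 13 0 g = 0)"

lemma finite_head_set [simp]: "finite (head_set q)"
 by (rule finite_subset[of _ "{..<2 * l}"]) (auto simp: head_set_def)

lemma head_test:
 assumes "group_state v a" "q < 2 * K" "x < 2 * l" "node q x ~= 0"
 shows "a 10 0 (node q x) = node q x \<longleftrightarrow> x \<in> head_set q"
proof -
 have x: "x <= length (ctx q)" using assms node_nz by blast
 let ?s = "take x (ctx q)"
 have "prefix ?s (ctx q)" by (rule take_is_prefix)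
 then have "a 10 0 (node q x) = word_name T0 (head ?s)"
  using assms x by (auto simp: group_state_def heads_ok_def node_eq)
 moreover have "word_name T0 (head ?s) = word_name T0 ?s \<longleftrightarrow> head ?s = ?s"
  using word_name_inj[OF names0, of ?s "head ?s"] assms(4) x by (auto simp: node_eq)
 ultimately show ?thesis using x assms by (auto simp: head_set_def node_eq)
qed

lemma node_state_cong:
 "node_state v a ==> (\<And>x. x \<in> {0, 2, 3, 4, 5, 12} ==> v' x = v x) ==>
  (\<And>i. i \<in> {0, 2, 6, 7, 8, 31} ==> a' i = a i) ==>
  names (a' 1) (a' 31 0) (v' 6) ==> ext (a 1) (a' 1) ==> node_state v' a'"
 unfolding node_state_def state_def base_def using ext_trans by auto

lemma group_state_less:
 assumes "group_state v a" shows "a 13 0 g <= group_sum a"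
proof (cases "g < Z")
 case True
 then show ?thesis unfolding group_sum_def by (intro member_le_sum) auto
next
 case False
 then show ?thesis using assms by (simp add: group_state_def)
qed

definition add_group :: "arrays \<Rightarrow> (nat \<Rightarrow> nat \<Rightarrow> nat) \<Rightarrow> nat \<Rightarrow> nat \<Rightarrow> nat \<Rightarrow> nat \<Rightarrow> arrays" where
 "add_group a T g p r j = upd (upd (upd (upd (a(1 := T)) 14 0 g p) 15 0 g r)
  11 g (a 13 0 g) j) 13 0 g (Suc (a 13 0 g))"

lemma add_group_simps:
 "i \<notin> {1, 11, 13, 14, 15} ==> add_group a T g p r j i = a i"
 "add_group a T g p r j 1 = T"
 "add_group a T g p r j 13 0 = (a 13 0)(g := Suc (a 13 0 g))"
 "add_group a T g p r j 14 0 = (a 14 0)(g := p)"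
 "add_group a T g p r j 15 0 = (a 15 0)(g := r)"
 "add_group a T g p r j 11 h i = (if h = g & i = a 13 0 g then j else a 11 h i)"
 "add_group a T g p r j (Suc 0) = T"
 by (auto simp: add_group_def upd_def fun_eq_iff)

text \<open>Members are appended and never moved, and the naming table only grows; therefore earlier
  memberships persist.\<close>

lemma add_group_correct:
 assumes gs: "group_state v a" and T: "names T (a 31 0) c" "ext (a 1) T" "c < Z"
  and g: "g = T p r" "g ~= 0" and j: "j < K"
  and v': "\<forall>x\<in>{0, 2, 3, 4, 5, 12}. v' x = v x" "v' 6 = c"
 shows "group_state v' (add_group a T g p r j)"
  "group_sum (add_group a T g p r j) = Suc (group_sum a)"
  "in_group a i x y ==> in_group (add_group a T g p r j) i x y"
  "p = node (2 * j) x ==> r = node (2 * j + 1) y ==> in_group (add_group a T g p r j) j x y"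
proof -
 let ?a = "add_group a T g p r j"
 have gZ: "g < Z" using names_le[OF T(1), of p r] g T(3) by simp
 have ns: "node_state v a" and go: "groups_ok a"
  and ho: "heads_ok {s. \<exists>q<2 * K. prefix s (ctx q)} a" and z: "\<forall>g\<ge>Z. a 13 0 g = 0"
  using gs by (auto simp: group_state_def)
 have "node_state v' ?a"
 proof (rule node_state_cong[OF ns])
  fix i :: nat assume "i \<in> {0, 2, 6, 7, 8, 31}"
  then have "i \<notin> {1, 11, 13, 14, 15}" by auto
  then show "?a i = a i" by (rule add_group_simps(1))
 next
  have "?a 31 = a 31" by (rule add_group_simps(1)) simp
  then show "names (?a 1) (?a 31 0) (v' 6)" using T(1) v'(2) by (simp only: add_group_simps(2))
  show "ext (a 1) (?a 1)" using T(2) by (simp only: add_group_simps(2))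
 qed (use v'(1) in blast)
 moreover have "groups_ok ?a"
  unfolding groups_ok_def
 proof (intro allI impI)
  fix h assume h: "?a 13 0 h ~= 0"
  show "h ~= 0 & ?a 1 (?a 14 0 h) (?a 15 0 h) = h & (\<forall>i<?a 13 0 h. ?a 11 h i < K)"
  proof (cases "h = g")
   case True
   have "a 11 g i < K" if "i < a 13 0 g" for i using go that by (auto simp: groups_ok_def)
   then show ?thesis using True g j by (auto simp: add_group_simps less_Suc_eq)
  next
   case False
   then have "a 13 0 h ~= 0" using h by (simp add: add_group_simps)
   then have 1: "h ~= 0" "a 1 (a 14 0 h) (a 15 0 h) = h" "\<forall>i<a 13 0 h. a 11 h i < K"
    using go by (auto simp: groups_ok_def)
   then have "T (a 14 0 h) (a 15 0 h) = h" using extD[OF T(2), of "a 14 0 h" "a 15 0 h"] by simp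
   then show ?thesis using False 1 by (simp add: add_group_simps)
  qed
 qed
 moreover have "heads_ok {s. \<exists>q<2 * K. prefix s (ctx q)} ?a"
  using ho by (simp add: heads_ok_def add_group_simps)
 moreover have "\<forall>h\<ge>Z. ?a 13 0 h = 0" using z gZ by (auto simp: add_group_simps)
 ultimately show "group_state v' ?a" by (simp add: group_state_def)
 show "group_sum ?a = Suc (group_sum a)"
  unfolding group_sum_def add_group_simps(3) using gZ by (intro sum_fun_upd_Suc) auto
 show "in_group a i x y ==> in_group ?a i x y"
 proof -
  assume i: "in_group a i x y"
  let ?h = "a 1 (node (2 * i) x) (node (2 * i + 1) y)"
  obtain n where n: "?h ~= 0" "n < a 13 0 ?h" "a 11 ?h n = i" using i by (auto simp: in_group_def Let_def)
  have "T (node (2 * i) x) (node (2 * i + 1) y) = ?h" using extD[OF T(2)] n(1) by simp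
  then show ?thesis unfolding in_group_def Let_def add_group_simps(2)
   using n by (auto simp: add_group_simps intro!: exI[of _ n])
 qed
 show "p = node (2 * j) x ==> r = node (2 * j + 1) y ==> in_group ?a j x y"
  unfolding in_group_def Let_def add_group_simps(2)
  using g by (auto simp: add_group_simps intro!: exI[of _ "a 13 0 g"])
qed

lemma group_inner_correct:
 assumes gs: "group_state v a" and bd: "bounded v a" and j: "v 14 = j" "j < K"
  and v7: "v 7 = node (2 * j) x" "node (2 * j) x ~= 0" and c: "v 6 + card (head_set (2 * j + 1)) < Z"
  and sum: "group_sum a + card (head_set (2 * j + 1)) < Z"
 shows "wp group_inner (\<lambda>t' v' a'. t' <= t + 1 + 2 * l * 14 & group_state v' a' & v' 6 <= v 6 + card (head_set (2 * j + 1)) &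
  group_sum a' <= group_sum a + card (head_set (2 * j + 1)) &
  (\<forall>y\<in>head_set (2 * j + 1). in_group a' j x y) &
  (\<forall>i x y. in_group a i x y --> in_group a' i x y)) t v a"
proof -
 let ?hs = "head_set (2 * j + 1)"
 define I where "I y v' a' \<longleftrightarrow> group_state v' a' & v' 6 <= v 6 + card (?hs \<inter> {..<y}) &
  group_sum a' <= group_sum a + card (?hs \<inter> {..<y}) &
  (\<forall>z\<in>?hs. z < y --> in_group a' j x z) &
  (\<forall>i x y. in_group a i x y --> in_group a' i x y)" for y and v' :: vars and a' :: arrays
 have b: "v 5 = 2 * l" using gs by (auto simp: group_state_def node_state_def state_def base_def)
 let ?inner = "name_code;; st1 14 (Vr 9) (Vr 7);; st1 15 (Vr 9) (Vr 8);;
    St 11 (Vr 9) (arr1 13 (Vr 9)) (Vr 14);; st1 13 (Vr 9) (arr1 13 (Vr 9) [+] Cn 1)"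
 let ?body = "Asg 8 (Ar 8 (Cn 2 [*] Vr 14 [+] Cn 1) (Vr 17));;
  provided (Vr 8) (provided (arr1 10 (Vr 8) [=] Vr 8) ?inner)"
 show ?thesis
  unfolding group_inner_def
 proof (rule wp_For_const[where I = I and T = 13 and n = "2 * l"])
  fix y t1 v1 a1
  assume y: "y < 2 * l" and I: "I y v1 a1" and bd1: "bounded v1 a1"
   and fr: "frame (For 17 (Vr 5) ?body) v a v1 a1"
  have gs1: "group_state v1 a1" using I by (simp add: I_def)
  have w: "v1 14 = j" "v1 7 = node (2 * j) x" "a1 8 (Suc (2 * j)) = node (Suc (2 * j))"
   "names (a1 1) (a1 31 0) (v1 6)"
   using frame_var[OF fr, of 14] frame_var[OF fr, of 7] j v7 gs1
   by (auto simp: name_code_def group_state_def node_state_def state_def)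
  let ?r = "node (Suc (2 * j)) y"
  have rz: "?r < Z" using bounded_array[OF bd1, of 8 "Suc (2 * j)" y] w by simp
  have hs: "node (2 * j + 1) y ~= 0 ==> a1 10 0 ?r = ?r \<longleftrightarrow> y \<in> ?hs"
   using head_test[OF gs1, of "2 * j + 1" y] j y by simp
  have hs0: "y \<in> ?hs ==> ?r ~= 0"
   using node_nz[of "2 * j + 1" y] j by (simp add: head_set_def)
  have cS: "?hs \<inter> {..<Suc y} = (if y \<in> ?hs then insert y (?hs \<inter> {..<y}) else ?hs \<inter> {..<y})"
   by (auto simp: less_Suc_eq)
  have cS': "card (?hs \<inter> {..<Suc y}) = card (?hs \<inter> {..<y}) + (if y \<in> ?hs then 1 else 0)"
   unfolding cS by simp
  show "wp ?body (\<lambda>t' v' a'. t' <= t1 + 13 & I (Suc y) v' a') t1 (v1(17 := y)) a1"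
  proof (cases "y \<in> ?hs")
   case False
   have gsv: "group_state (v1(17 := y, 8 := ?r)) a1"
    using gs1 by (auto simp: group_state_def node_state_def state_def base_def)
   have "I (Suc y) (v1(17 := y, 8 := ?r)) a1"
    using I False cS' gsv by (auto simp: I_def less_Suc_eq)
   then show ?thesis using False hs w rz by (auto simp: wps)
  next
   case True
   let ?v = "v1(17 := y, 8 := ?r)"
   have bd2: "bounded ?v a1" using bd1 rz y D_less by (auto intro!: bounded_asg)
   have cl: "card (?hs \<inter> {..<y}) < card ?hs" by (rule psubset_card_mono) (use True in auto)
   have nm: "wp name_code (wp (st1 14 (Vr 9) (Vr 7);; st1 15 (Vr 9) (Vr 8);;
    St 11 (Vr 9) (arr1 13 (Vr 9)) (Vr 14);; st1 13 (Vr 9) (arr1 13 (Vr 9) [+] Cn 1))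
    (\<lambda>t' v' a'. t' <= t1 + 13 & I (Suc y) v' a')) tt ?v a1" if tt: "tt <= t1 + 4" for tt
   proof (rule wp_name)
    fix t' c' T'
    assume t': "t' <= tt + 4" and T': "names T' (a1 31 0) c'" "ext (a1 1) T'"
     "?v 6 <= c'" "c' <= ?v 6 + 1" "T' (?v 7) (?v 8) ~= 0"
    let ?g = "T' (node (2 * j) x) ?r"
    have cz: "c' < Z" using cl T'(4) I c y by (simp add: I_def)
    have gz: "?g < Z" using names_le[OF T'(1), of "node (2 * j) x" ?r] cz by simp
    have g0: "?g ~= 0" using T'(5) w by simp
    let ?v2 = "?v(6 := c', 9 := ?g)" and ?a2 = "add_group a1 T' ?g (node (2 * j) x) ?r j"
    have gc: "Suc (a1 13 0 ?g) < Z"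
     using group_state_less[OF gs1, of ?g] I sum cl by (simp add: I_def)
    have v2: "\<forall>x\<in>{0, 2, 3, 4, 5, 12}. ?v2 x = v1 x" "?v2 6 = c'" by auto
    note A = add_group_correct[OF gs1 T'(1,2) cz refl g0 j(2) v2]
    have "I (Suc y) ?v2 ?a2"
     unfolding I_def
    proof (intro conjI ballI impI allI)
     show "group_state ?v2 ?a2" by (rule A(1))
     show "?v2 6 <= v 6 + card (?hs \<inter> {..<Suc y})" using T'(4) I True cS' by (simp add: I_def)
     show "group_sum ?a2 <= group_sum a + card (?hs \<inter> {..<Suc y})"
      using A(2) I True cS' by (simp add: I_def)
    next
     fix z assume z: "z \<in> ?hs" "z < Suc y"
     show "in_group ?a2 j x z"
     proof (cases "z = y")
      case True
      show ?thesis by (rule A(4)) (simp_all add: True)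
     next
      case False
      then have "in_group a1 j x z" using z I by (simp add: I_def)
      then show ?thesis by (rule A(3))
     qed
    next
     fix i x' y' assume "in_group a i x' y'"
     then have "in_group a1 i x' y'" using I by (simp add: I_def)
     then show "in_group ?a2 i x' y'" by (rule A(3))
    qed
    moreover have "node (2 * j) x < Z" "j < Z"
     using bounded_var[OF bd1, of 7] bounded_var[OF bd1, of 14] w by auto
    ultimately show "wp (st1 14 (Vr 9) (Vr 7);; st1 15 (Vr 9) (Vr 8);;
      St 11 (Vr 9) (arr1 13 (Vr 9)) (Vr 14);; st1 13 (Vr 9) (arr1 13 (Vr 9) [+] Cn 1))
      (\<lambda>t' v' a'. t' <= t1 + 13 & I (Suc y) v' a') t'
      (?v(6 := c', 9 := T' (?v 7) (?v 8))) (a1(1 := T'))"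
     using t' tt w gz rz gc by (simp add: wps add_group_def upd_array upd_same)
   qed (use w v7 bd2 I c cl in \<open>auto simp: I_def\<close>)
   then show ?thesis using True hs hs0 w rz by (simp add: wps)
  qed
 next
  fix t' v' a'
  assume "t' <= t + 1 + 2 * l * (13 + 1)" and I: "I (2 * l) v' a'"
  moreover have "?hs \<inter> {..<2 * l} = ?hs" "\<And>y. y \<in> ?hs ==> y < 2 * l" by (auto simp: head_set_def)
  ultimately show "t' <= t + 1 + 2 * l * 14 & group_state v' a' & v' 6 <= v 6 + card (head_set (2 * j + 1)) &
  group_sum a' <= group_sum a + card (head_set (2 * j + 1)) &
  (\<forall>y\<in>head_set (2 * j + 1). in_group a' j x y) &
  (\<forall>i x y. in_group a i x y --> in_group a' i x y)" by (simp add: I_def)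
 qed (use b bd D_less gs in \<open>auto simp: I_def\<close>)
qed

text \<open>The inner loop costs \<open>O(l)\<close> but runs only at heads of the left context, of
  which there are at most \<open>e\<close>. This is why the cost \<open>T x\<close> depends on the
  round and why the total is \<open>O(e * l)\<close> rather than quadratic in
  \<open>l\<close>.\<close>

lemma group_row_correct:
 assumes gs: "group_state v a" and bd: "bounded v a" and j: "v 14 = j" "j < K"
  and c: "v 6 + e * e < Z" and e: "card (head_set (2 * j)) <= e" "card (head_set (2 * j + 1)) <= e"
  and sum: "group_sum a + e * e < Z"
 shows "wp group_row (\<lambda>t' v' a'. t' <= t + 1 + 10 * l + e * (28 * l + 4) & group_state v' a' &
  v' 6 <= v 6 + e * e & group_sum a' <= group_sum a + e * e &
  (\<forall>x\<in>head_set (2 * j). \<forall>y\<in>head_set (2 * j + 1). in_group a' j x y) &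
  (\<forall>i x y. in_group a i x y --> in_group a' i x y)) t v a"
proof -
 let ?hs = "head_set (2 * j)"
 define I where "I x v' a' \<longleftrightarrow> group_state v' a' & v' 6 <= v 6 + card (?hs \<inter> {..<x}) * e &
  group_sum a' <= group_sum a + card (?hs \<inter> {..<x}) * e &
  (\<forall>z\<in>?hs. z < x --> (\<forall>y\<in>head_set (2 * j + 1). in_group a' j z y)) &
  (\<forall>i x y. in_group a i x y --> in_group a' i x y)" for x and v' :: vars and a' :: arrays
 define T where "T x = 4 + (if x \<in> ?hs then 28 * l + 4 else 0)" for x
 have b: "v 5 = 2 * l" using gs by (auto simp: group_state_def node_state_def state_def base_def)
 let ?body = "Asg 7 (Ar 8 (Cn 2 [*] Vr 14) (Vr 16));;
  provided (Vr 7) (provided (arr1 10 (Vr 7) [=] Vr 7) group_inner)"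
 show ?thesis
  unfolding group_row_def
 proof (rule wp_For[where I = I and T = T and n = "2 * l"])
  fix x t1 v1 a1
  assume x: "x < 2 * l" and I: "I x v1 a1" and bd1: "bounded v1 a1"
   and fr: "frame (For 16 (Vr 5) ?body) v a v1 a1"
  have gs1: "group_state v1 a1" using I by (simp add: I_def)
  have w: "v1 14 = j" "a1 8 (2 * j) = node (2 * j)"
   using frame_var[OF fr, of 14] j gs1
   by (auto simp: name_code_def group_inner_def group_state_def node_state_def)
  let ?r = "node (2 * j) x"
  have rz: "?r < Z" using bounded_array[OF bd1, of 8 "2 * j" x] w by simp
  have hs: "?r ~= 0 ==> a1 10 0 ?r = ?r \<longleftrightarrow> x \<in> ?hs"
   using head_test[OF gs1, of "2 * j" x] j x by simp
  have hs0: "x \<in> ?hs ==> ?r ~= 0"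
   using node_nz[of "2 * j" x] j by (simp add: head_set_def)
  have "?hs \<inter> {..<Suc x} = (if x \<in> ?hs then insert x (?hs \<inter> {..<x}) else ?hs \<inter> {..<x})"
   by (auto simp: less_Suc_eq)
  then have cS: "card (?hs \<inter> {..<Suc x}) = card (?hs \<inter> {..<x}) + (if x \<in> ?hs then 1 else 0)"
   by simp
  let ?v = "v1(16 := x, 7 := ?r)"
  have gsv: "group_state ?v a1"
   using gs1 by (auto simp: group_state_def node_state_def state_def base_def)
  have bd2: "bounded ?v a1" using bd1 rz x D_less by (auto intro!: bounded_asg)
  show "wp ?body (\<lambda>t' v' a'. t' <= t1 + T x & I (Suc x) v' a') t1 (v1(16 := x)) a1"
  proof (cases "x \<in> ?hs")
   case False
   have "I (Suc x) ?v a1" using I False cS gsv by (auto simp: I_def less_Suc_eq)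
   then show ?thesis using False hs w rz by (auto simp: wps T_def)
  next
   case True
   have "?hs \<inter> {..<x} \<subset> ?hs" using True by auto
   then have "Suc (card (?hs \<inter> {..<x})) <= e" using psubset_card_mono[of ?hs "?hs \<inter> {..<x}"] e by simp
   then have "Suc (card (?hs \<inter> {..<x})) * e <= e * e" by (rule mult_le_mono1)
   then have sm: "group_sum a1 + card (head_set (2 * j + 1)) < Z" using I sum e by (simp add: I_def)
   have c1: "v1 6 + card (head_set (2 * j + 1)) < Z"
    using I c e \<open>Suc (card (?hs \<inter> {..<x})) * e <= e * e\<close> by (simp add: I_def)
   have "wp group_inner (\<lambda>t' v' a'. t' <= t1 + T x & I (Suc x) v' a') tt ?v a1"
    if tt: "tt <= t1 + 3" for tt
   proof (rule wp_mono[OF group_inner_correct[OF gsv bd2 _ j(2), of x]])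
    fix t' and v' :: vars and a' :: arrays
    assume p: "t' <= tt + 1 + 2 * l * 14 & group_state v' a' & v' 6 <= ?v 6 + card (head_set (2 * j + 1)) &
     group_sum a' <= group_sum a1 + card (head_set (2 * j + 1)) &
     (\<forall>y\<in>head_set (2 * j + 1). in_group a' j x y) &
     (\<forall>i x y. in_group a1 i x y --> in_group a' i x y)"
    then have "I (Suc x) v' a'"
     using I True cS e(2) unfolding I_def by (auto simp: less_Suc_eq)
    then show "t' <= t1 + T x & I (Suc x) v' a'" using p tt True by (simp add: T_def)
   qed (use w hs0 True c1 sm in auto)
   then show ?thesis using True hs hs0 w rz by (simp add: wps)
  qed
 next
  fix t' v' a'
  assume t': "t' <= t + 1 + (\<Sum>i<2 * l. T i + 1)" and I: "I (2 * l) v' a'"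
  have i: "?hs \<inter> {..<2 * l} = ?hs" "{..<2 * l} \<inter> ?hs = ?hs" "\<And>y. y \<in> ?hs ==> y < 2 * l"
   by (auto simp: head_set_def)
  have "(\<Sum>i<2 * l. T i + 1) = (\<Sum>i<2 * l. 5) + (\<Sum>i<2 * l. if i \<in> ?hs then 28 * l + 4 else 0)"
   unfolding sum.distrib[symmetric] by (intro sum.cong) (auto simp: T_def)
  also have "(\<Sum>i<2 * l. if i \<in> ?hs then 28 * l + 4 else 0) = card ?hs * (28 * l + 4)"
   by (subst sum.inter_restrict[symmetric]) (simp_all add: i)
  finally have "(\<Sum>i<2 * l. T i + 1) <= 10 * l + e * (28 * l + 4)"
   using mult_le_mono1[OF e(1), of "28 * l + 4"] by simp
  moreover have "group_sum a' <= group_sum a + card ?hs * e" "v' 6 <= v 6 + card ?hs * e"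
   using I i by (simp_all add: I_def)
  then have "group_sum a' <= group_sum a + e * e" "v' 6 <= v 6 + e * e"
   using mult_le_mono1[OF e(1), of e] by linarith+
  ultimately show "t' <= t + 1 + 10 * l + e * (28 * l + 4) & group_state v' a' &
  v' 6 <= v 6 + e * e & group_sum a' <= group_sum a + e * e &
  (\<forall>x\<in>head_set (2 * j). \<forall>y\<in>head_set (2 * j + 1). in_group a' j x y) &
  (\<forall>i x y. in_group a i x y --> in_group a' i x y)" using t' I i by (simp add: I_def)
 qed (use b bd D_less gs in \<open>auto simp: I_def\<close>)
qed

lemma group_correct:
 assumes gs: "group_state v a" and bd: "bounded v a" and c: "v 6 + K * (e * e) < Z"
  and e: "\<And>q. q < 2 * K ==> card (head_set q) <= e" and sum: "K * (e * e) < Z" and z: "\<And>g. a 13 0 g = 0"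
 shows "wp group_code (\<lambda>t' v' a'. t' <= t + 1 + K * (2 + 10 * l + e * (28 * l + 4)) & group_state v' a' &
  v' 6 <= v 6 + K * (e * e) & group_sum a' <= K * (e * e) &
  (\<forall>j<K. \<forall>x\<in>head_set (2 * j). \<forall>y\<in>head_set (2 * j + 1). in_group a' j x y)) t v a"
proof -
 define I where "I j v' a' \<longleftrightarrow> group_state v' a' & v' 6 <= v 6 + j * (e * e) &
  group_sum a' <= j * (e * e) &
  (\<forall>i<j. \<forall>x\<in>head_set (2 * i). \<forall>y\<in>head_set (2 * i + 1). in_group a' i x y)"
  for j and v' :: vars and a' :: arrays
 have b: "v 12 = K" using gs by (auto simp: group_state_def node_state_def state_def)
 show ?thesis
  unfolding group_code_def
 proof (rule wp_For_const[where I = I and T = "1 + 10 * l + e * (28 * l + 4)" and n = K])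
  fix j t1 v1 a1
  assume j: "j < K" and I: "I j v1 a1" and bd1: "bounded v1 a1"
  let ?v = "v1(14 := j)"
  have gs1: "group_state ?v a1"
   using I by (auto simp: I_def group_state_def node_state_def state_def base_def)
  have bd2: "bounded ?v a1" using bd1 j D_less by (intro bounded_asg) auto
  have "Suc j * (e * e) <= K * (e * e)" "Suc j * (e * e) <= K * (e * e)"
   using j by (intro mult_le_mono1; simp)+
  then have cs: "?v 6 + e * e < Z" "group_sum a1 + e * e < Z"
   using I c sum by (simp_all add: I_def)
  show "wp group_row (\<lambda>t' v' a'. t' <= t1 + (1 + 10 * l + e * (28 * l + 4)) & I (Suc j) v' a') t1 ?v a1"
  proof (rule wp_mono[OF group_row_correct[OF gs1 bd2 _ j cs(1) _ _ cs(2)]])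
   fix t' and v' :: vars and a' :: arrays
   assume "t' <= t1 + 1 + 10 * l + e * (28 * l + 4) & group_state v' a' &
    v' 6 <= ?v 6 + e * e & group_sum a' <= group_sum a1 + e * e &
    (\<forall>x\<in>head_set (2 * j). \<forall>y\<in>head_set (2 * j + 1). in_group a' j x y) &
    (\<forall>i x y. in_group a1 i x y --> in_group a' i x y)"
   then show "t' <= t1 + (1 + 10 * l + e * (28 * l + 4)) & I (Suc j) v' a'"
    using I by (auto simp: I_def less_Suc_eq)
  qed (use j e in auto)
 next
  fix t' v' a'
  assume "t' <= t + 1 + K * (1 + 10 * l + e * (28 * l + 4) + 1)" "I K v' a'"
  moreover have "1 + 10 * l + e * (28 * l + 4) + 1 = 2 + 10 * l + e * (28 * l + 4)" by simp
  ultimately show "t' <= t + 1 + K * (2 + 10 * l + e * (28 * l + 4)) & group_state v' a' &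
  v' 6 <= v 6 + K * (e * e) & group_sum a' <= K * (e * e) &
  (\<forall>j<K. \<forall>x\<in>head_set (2 * j). \<forall>y\<in>head_set (2 * j + 1). in_group a' j x y)"
   by (simp add: I_def)
 qed (use b bd D_less gs z in \<open>auto simp: I_def group_sum_def\<close>)
qed

end

section \<open>Processing the strings\<close>

definition "find_code =
 Asg 26 (Cn 0);; Asg 29 (Cn 0);;
 For 13 (Vr 25) (Cond (Vr 29) Skip (provided (Vr 13 [+] Vr 2 [<] Vr 25) (
  Cond (arr1 5 (Vr 24 [+] Vr 13) [=] arr1 5 (Vr 24 [+] Vr 13 [+] Cn 1)) Skip
   (Asg 29 (Cn 1);; Asg 26 (Vr 13)))))"

definition "word_code e p = For 16 e (Asg 8 (arr1 2 p);; name_code;; Asg 7 (Vr 9))"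

text \<open>Treats the members of a group behind its last full batch, counted from the end of the
  list.\<close>

definition "check_code =
 For 13 (arr1 13 (Vr 9) [mod] Vr 5) (
  Asg 14 (Ar 11 (Vr 9) (arr1 13 (Vr 9) [-] Cn 1 [-] Vr 13));;
  provided (Ar 8 (Cn 2 [*] Vr 14) (Vr 26) [=] Vr 27) (
   provided (Ar 8 (Cn 2 [*] Vr 14 [+] Cn 1) (Vr 17) [=] Vr 28) (
    provided (arr1 7 (arr1 6 (Vr 14) [-] Vr 26)) (
     st1 17 (arr1 6 (Vr 14) [+] Vr 17 [-] Cn 1) (Cn 1)))))"

text \<open>A part of weight 0 is not a node of the trie of contexts; its string cannot be aligned
  with any anchor and is dropped, and array 10 has no meaningful entry for it.\<close>

definition "link_code =
 provided (arr1 9 (Vr 27)) (provided (arr1 9 (Vr 28)) (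
  Asg 7 (arr1 10 (Vr 27));; Asg 8 (arr1 10 (Vr 28));; name_code;;
  St 16 (Vr 9) (Vr 26 [*] Vr 5 [+] Vr 17) (Cn 1);; check_code))"

text \<open>The left part is named backwards from the cut, in the reading direction of the left
  contexts.\<close>

definition "string_row =
 Asg 25 (Lo (Vr 24));; Asg 24 (Vr 24 [+] Cn 1);; find_code;;
 Asg 7 (Cn 1);; word_code (Vr 26) (Vr 24 [+] Vr 26 [-] Cn 1 [-] Vr 16);; Asg 27 (Vr 7);;
 Asg 7 (Cn 1);; word_code (Vr 25 [-] Vr 26) (Vr 24 [+] Vr 26 [+] Vr 16);; Asg 28 (Vr 7);;
 Asg 17 (Vr 25 [-] Vr 26);; link_code;; Asg 24 (Vr 24 [+] Vr 25)"

definition "string_code = Asg 24 (Cn 3 [+] Cn 2 [*] Vr 3);; For 15 (Vr 4) string_row"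

context word_ram_sub
begin

text \<open>The position \<open>p\<close> is evaluated anew in each round. The assumption about it
  therefore ranges over all states that differ only in the naming table and the variables touched by
  the loop.\<close>

lemma word_correct:
 assumes bd: "bounded v a" and n: "names (a 1) (a 31 0) (v 6)" and e: "val Z e v a = length u" "length u <= Z"
  and c: "v 6 + length u < Z" and v7: "v 7 = 1"
  and p: "\<And>x v' a'. x < length u ==> v' 16 = x ==> \<forall>y. y \<notin> {6, 7, 8, 9, 16} --> v' y = v y ==>
   \<forall>i. i ~= 1 --> a' i = a i ==> a' 2 0 (val Z p v' a') = u ! x"
 shows "wp (word_code e p) (\<lambda>t' v' a'. t' <= t + 1 + length u * 7 & names (a' 1) (a' 31 0) (v' 6) &
  ext (a 1) (a' 1) & v' 6 <= v 6 + length u & v' 7 = word_name (a' 1) u & v' 7 ~= 0) t v a"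
proof -
 define I where "I x v' a' \<longleftrightarrow> names (a' 1) (a' 31 0) (v' 6) & ext (a 1) (a' 1) &
  v' 6 <= v 6 + x & v' 7 = word_name (a' 1) (take x u) & v' 7 ~= 0"
  for x and v' :: vars and a' :: arrays
 show ?thesis
  unfolding word_code_def
 proof (rule wp_For_const[where I = I and T = 6 and n = "length u"])
  fix x t1 v1 a1
  assume x: "x < length u" and I: "I x v1 a1" and bd1: "bounded v1 a1"
   and fr: "frame (For 16 e (Asg 8 (arr1 2 p);; name_code;; Asg 7 (Vr 9))) v a v1 a1"
  have pe: "a1 2 0 (val Z p (v1(16 := x)) a1) = u ! x"
  proof (rule p[OF x])
   show "\<forall>y. y \<notin> {6, 7, 8, 9, 16} --> (v1(16 := x)) y = v y" "\<forall>i. i ~= 1 --> a1 i = a i"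
    using fr by (auto simp: frame_def name_code_def)
  qed simp
  have uz: "u ! x < Z" using bounded_array[OF bd1, of 2 0 "val Z p (v1(16 := x)) a1"] pe by simp
  have n1: "names (a1 1) (a1 31 0) (v1 6)" "v1 6 <= v 6 + x" "v1 7 = word_name (a1 1) (take x u)" "v1 7 ~= 0"
   "ext (a 1) (a1 1)" using I by (auto simp: I_def)
  let ?v = "v1(16 := x, 8 := u ! x)"
  have bd2: "bounded ?v a1" using bd1 uz x e(2) by (intro bounded_asg) auto
  have "wp name_code (wp (Asg 7 (Vr 9)) (\<lambda>t' v' a'. t' <= t1 + 6 & I (Suc x) v' a')) tt ?v a1"
   if tt: "tt <= t1 + 1" for tt
  proof (rule wp_name)
   fix t' c' T'
   assume t': "t' <= tt + 4" and T': "names T' (a1 31 0) c'" "ext (a1 1) T'"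
    "?v 6 <= c'" "c' <= ?v 6 + 1" "T' (?v 7) (?v 8) ~= 0"
   let ?g = "T' (v1 7) (u ! x)"
   have gz: "?g < Z" using names_le[OF T'(1), of "v1 7" "u ! x"] T'(4) n1(2) c x by simp
   have wn: "word_name T' (take x u) = v1 7"
    using word_name_ext[OF n1(1) T'(2)] n1(3,4) by simp
   have tk: "take (Suc x) u = take x u @ [u ! x]" using x by (rule take_Suc_conv_app_nth)
   have "I (Suc x) (?v(6 := c', 9 := ?g, 7 := ?g)) (a1(1 := T'))"
    unfolding I_def tk
    using T'(1,4,5) n1(2) wn ext_trans[OF n1(5) T'(2)] by simp
   then show "wp (Asg 7 (Vr 9)) (\<lambda>t' v' a'. t' <= t1 + 6 & I (Suc x) v' a') t'
     (?v(6 := c', 9 := T' (?v 7) (?v 8))) (a1(1 := T'))"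
    using t' tt gz by (simp add: wps)
  qed (use n1 bd2 c x in auto)
  then show "wp (Asg 8 (arr1 2 p);; name_code;; Asg 7 (Vr 9))
    (\<lambda>t' v' a'. t' <= t1 + 6 & I (Suc x) v' a') t1 (v1(16 := x)) a1"
   using pe uz by (simp add: wps)
 next
  fix t' v' a'
  assume "t' <= t + 1 + length u * (6 + 1)" "I (length u) v' a'"
  then show "t' <= t + 1 + length u * 7 & names (a' 1) (a' 31 0) (v' 6) &
   ext (a 1) (a' 1) & v' 6 <= v 6 + length u & v' 7 = word_name (a' 1) u & v' 7 ~= 0"
   by (simp add: I_def)
 qed (use bd n e v7 in \<open>auto simp: I_def\<close>)
qed

end

text \<open>\<open>off s\<close> is the address of the length entry of string \<open>s\<close>,
  whose letters follow; \<open>off k\<close> is the end of the input.\<close>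

locale string_ram = trie_ram +
 fixes off len :: "nat \<Rightarrow> nat"
 assumes off_0: "off 0 = 3 + 2 * m" and off_Suc: "s < k ==> off (Suc s) = off s + 1 + len s"
  and off_k: "off k = L" and X_off: "s < k ==> X (off s) = len s"
  and len_less: "s < k ==> len s < 2 * l"
  and switch_ex: "s < k ==> \<exists>i. i + l < len s & sper_at l f (off s + 1 + i) ~= sper_at l f (off s + 1 + i + 1)"
  and f_out: "L <= i ==> f i = 0"
begin

definition is_switch :: "nat \<Rightarrow> nat \<Rightarrow> bool" where
 "is_switch s i \<longleftrightarrow> i + l < len s & sper_at l f (off s + 1 + i) ~= sper_at l f (off s + 1 + i + 1)"

definition cut :: "nat \<Rightarrow> nat" where "cut s = (LEAST i. is_switch s i)"

definition rest :: "nat \<Rightarrow> nat" where "rest s = len s - cut s"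

definition left :: "nat \<Rightarrow> nat list" where
 "left s = map (\<lambda>x. f (off s + cut s - x)) [0..<cut s]"

definition right :: "nat \<Rightarrow> nat list" where
 "right s = map (\<lambda>x. f (off s + 1 + cut s + x)) [0..<rest s]"

definition live :: "nat \<Rightarrow> bool" where "live s \<longleftrightarrow> weight (left s) ~= 0 & weight (right s) ~= 0"

definition group_of :: "(nat \<Rightarrow> nat \<Rightarrow> nat) \<Rightarrow> nat \<Rightarrow> nat" where
 "group_of T s = T (word_name T0 (head (left s))) (word_name T0 (head (right s)))"

text \<open>String \<open>s\<close> occurs with its first switch at anchor \<open>j\<close> behind
  an active prefix. The prefix has length \<open>anc j - cut s\<close>, and \<open>ub 0 = 0\<close>
  rules out the empty one.\<close>

definition hit :: "nat \<Rightarrow> nat \<Rightarrow> bool" where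
 "hit s j \<longleftrightarrow> j < K & prefix (left s) (ctx (2 * j)) & prefix (right s) (ctx (2 * j + 1)) &
  ub (anc j - cut s) ~= 0"

text \<open>The 0-based output index of the end of the occurrence, hence the subtraction of
  1.\<close>

definition target :: "nat \<Rightarrow> nat \<Rightarrow> nat" where "target s j = anc j + rest s - 1"

lemma cut_switch: "s < k ==> is_switch s (cut s)"
 unfolding cut_def by (rule LeastI_ex) (use switch_ex[of s] in \<open>simp add: is_switch_def\<close>)

lemma cut_less: "s < k ==> cut s + l < len s"
 using cut_switch by (simp add: is_switch_def)

lemma rest_pos: "s < k ==> 0 < rest s" "s < k ==> cut s + rest s = len s"
 using cut_less[of s] by (auto simp: rest_def)

lemma length_left [simp]: "length (left s) = cut s" and length_right [simp]: "length (right s) = rest s"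
 by (simp_all add: left_def right_def)

lemma off_mono: "s <= s' ==> s' <= k ==> off s <= off s'"
proof (induction s' rule: dec_induct)
 case (step n)
 then show ?case using off_Suc[of n] by simp
qed simp

lemma off_less: "s < k ==> off s + 1 + len s <= L"
 using off_mono[of "Suc s" k] off_Suc off_k by simp

definition pstate :: "vars \<Rightarrow> arrays \<Rightarrow> bool" where
 "pstate v a \<longleftrightarrow> group_state v a & (\<forall>i<L. a 5 0 i = of_bool (sper_at l f i)) &
  (\<forall>p. p ~= 0 --> a 9 0 p = occurrences p) &
  (\<forall>j<K. \<forall>x\<in>head_set (2 * j). \<forall>y\<in>head_set (2 * j + 1). in_group a j x y)"

lemma pstate_cong:
 assumes p: "pstate v a" and v: "\<forall>x\<in>{0, 2, 3, 4, 5, 12}. v' x = v x"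
  and a: "\<forall>i\<in>{0, 2, 5, 6, 7, 8, 9, 10, 11, 13, 14, 15, 31}. a' i = a i"
  and n: "names (a' 1) (a' 31 0) (v' 6)" "ext (a 1) (a' 1)"
 shows "pstate v' a'"
proof -
 have gs: "group_state v a" using p by (simp add: pstate_def)
 have eq: "a' 5 = a 5" "a' 9 = a 9" "a' 10 = a 10" "a' 11 = a 11" "a' 13 = a 13" "a' 14 = a 14" "a' 15 = a 15"
  using a by simp_all
 have "node_state v' a'"
  by (rule node_state_cong[of v a]) (use gs v a n in \<open>auto simp: group_state_def\<close>)
 moreover have "groups_ok a'"
  using gs extD[OF n(2)] unfolding groups_ok_def group_state_def eq by metis
 ultimately have "group_state v' a'"
  using gs eq by (simp add: group_state_def heads_ok_def)
 moreover have "in_group a i x y ==> in_group a' i x y" for i x y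
  using extD[OF n(2)] unfolding in_group_def Let_def eq by metis
 ultimately show ?thesis using p eq by (simp add: pstate_def)
qed

lemma find_correct:
 assumes p: "pstate v a" and bd: "bounded v a" and s: "s < k" and v: "v 24 = off s + 1" "v 25 = len s"
 shows "wp find_code (\<lambda>t' v' a'. t' <= t + 3 + len s * 6 & a' = a & v' 26 = cut s) t v a"
proof -
 define I where "I i v' a' \<longleftrightarrow> a' = a & (v' 29 = 0 & v' 26 = 0 & (\<forall>j<i. \<not> is_switch s j) \<or>
  v' 29 = 1 & v' 26 = cut s)" for i and v' :: vars and a' :: arrays
 have z: "1 < Z" "len s <= Z" using Z_lin len_less[OF s] L_ge l_le by linarith+
 have b: "v 2 = l" using p by (auto simp: pstate_def group_state_def node_state_def state_def base_def)
 have sp: "\<And>i. i < L ==> a 5 0 i = of_bool (sper_at l f i)" using p by (simp add: pstate_def)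
 let ?v = "v(26 := 0, 29 := 0)"
 let ?body = "Cond (Vr 29) Skip (provided (Vr 13 [+] Vr 2 [<] Vr 25) (
  Cond (arr1 5 (Vr 24 [+] Vr 13) [=] arr1 5 (Vr 24 [+] Vr 13 [+] Cn 1)) Skip
   (Asg 29 (Cn 1);; Asg 26 (Vr 13))))"
 have "wp (For 13 (Vr 25) ?body) (\<lambda>t' v' a'. t' <= t + 3 + len s * 6 & a' = a & v' 26 = cut s) tt ?v a"
  if tt: "tt <= t + 2" for tt
 proof (rule wp_For_const[where I = I and T = 5 and n = "len s"])
  fix i t1 v1 a1
  assume i: "i < len s" and I: "I i v1 a1" and bd1: "bounded v1 a1"
   and fr: "frame (For 13 (Vr 25) ?body) ?v a v1 a1"
  have w: "v1 2 = l" "v1 24 = off s + 1" "v1 25 = len s" "a1 = a"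
   using frame_var[OF fr, of 2] frame_var[OF fr, of 24] frame_var[OF fr, of 25] b v I
   by (auto simp: I_def)
  have sw: "is_switch s i \<longleftrightarrow> i + l < len s & a 5 0 (off s + 1 + i) ~= a 5 0 (off s + 1 + i + 1)"
  proof (cases "i + l < len s")
   case True
   have "0 < l" using True len_less[OF s] by simp
   then have "off s + 1 + i + 1 < L" using True off_less[OF s] by simp
   then have "a 5 0 (off s + 1 + i) = of_bool (sper_at l f (off s + 1 + i))"
    "a 5 0 (off s + 1 + i + 1) = of_bool (sper_at l f (off s + 1 + i + 1))"
    by (intro sp; simp)+
   then show ?thesis using True by (simp only: is_switch_def of_bool_eq_iff)
  qed (simp add: is_switch_def)
  show "wp ?body (\<lambda>t' v' a'. t' <= t1 + 5 & I (Suc i) v' a') t1 (v1(13 := i)) a1"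
  proof (cases "v1 29 = 0")
   case False
   then show ?thesis using I by (auto simp: wps I_def)
  next
   case True
   then have no: "\<forall>j<i. \<not> is_switch s j" "v1 26 = 0" using I by (auto simp: I_def)
   show ?thesis
   proof (cases "is_switch s i")
    case sw1: True
    have "cut s = i" unfolding cut_def
     by (rule Least_equality) (use sw1 no not_less in blast)+
    then have "I (Suc i) (v1(13 := i, 29 := 1, 26 := i)) a" by (simp add: I_def)
    then show ?thesis using sw1 True w z i unfolding sw by (simp add: wps)
   next
    case False
    then have "I (Suc i) (v1(13 := i)) a" using no True by (auto simp: I_def less_Suc_eq)
    then show ?thesis using False True w z i unfolding sw by (auto simp: wps)
   qed
  qed
 next
  fix t' v' a'
  assume t': "t' <= tt + 1 + len s * (5 + 1)" and I: "I (len s) v' a'"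
  have "cut s < len s" using cut_less[OF s] by simp
  then show "t' <= t + 3 + len s * 6 & a' = a & v' 26 = cut s"
   using t' tt I cut_switch[OF s] by (auto simp: I_def)
 qed (use v bd z in \<open>auto simp: I_def intro!: bounded_asg\<close>)
 then show ?thesis using z v by (simp add: find_code_def wps)
qed

lemma node_match:
 assumes "pstate v a" "q < 2 * K" "word_name (a 1) u ~= 0"
 shows "node q (length u) = word_name (a 1) u \<longleftrightarrow> prefix u (ctx q)"
proof -
 have n: "names (a 1) (a 31 0) (v 6)" "ext T0 (a 1)"
  using assms(1) by (auto simp: pstate_def group_state_def node_state_def state_def)
 have "node q (length u) = word_name (a 1) u \<longleftrightarrow>
   word_name (a 1) u = node q (length u) & node q (length u) ~= 0" using assms(3) by auto
 also have "\<dots> \<longleftrightarrow> length u <= length (ctx q) & u = take (length u) (ctx q)"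
  by (rule word_name_eq_node[OF n assms(2)])
 also have "\<dots> \<longleftrightarrow> prefix u (ctx q)"
  by (metis append_eq_conv_conj prefixE prefix_length_le take_is_prefix)
 finally show ?thesis .
qed

lemma check_correct:
 assumes p: "pstate v a" and bd: "bounded v a" and s: "s < k" and v: "v 9 = g" "v 26 = cut s" "v 17 = rest s"
  "v 27 = word_name (a 1) (left s)" "v 28 = word_name (a 1) (right s)" "v 27 ~= 0" "v 28 ~= 0" and l: "0 < l"
 shows "wp check_code (\<lambda>t' v' a'. t' <= t + 1 + 2 * l * 6 &
  (\<forall>i. a' 17 0 i = (if \<exists>x<a 13 0 g mod (2 * l). hit s (a 11 g (a 13 0 g - 1 - x)) &
   i = target s (a 11 g (a 13 0 g - 1 - x)) then 1 else a 17 0 i))) t v a"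
proof -
 let ?j = "\<lambda>x. a 11 g (a 13 0 g - 1 - x)"
 define E where "E x i \<longleftrightarrow> (\<exists>y<x. hit s (?j y) & i = target s (?j y))" for x i
 define I where "I x v' a' \<longleftrightarrow> (\<forall>i. a' 17 0 i = (if E x i then 1 else a 17 0 i))"
  for x and v' :: vars and a' :: arrays
 have z: "1 < Z" "m < Z" using Z_lin L_ge by linarith+
 have gs: "group_state v a" using p by (simp add: pstate_def)
 have b: "v 5 = 2 * l" using gs by (auto simp: group_state_def node_state_def state_def base_def)
 have jK: "?j x < K" if "x < a 13 0 g mod (2 * l)" for x
 proof -
  have "x < a 13 0 g" using that mod_less_eq_dividend less_le_trans by blast
  then have "a 13 0 g ~= 0" "a 13 0 g - 1 - x < a 13 0 g" by auto
  moreover have "groups_ok a" using gs by (simp add: group_state_def)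
  ultimately show ?thesis unfolding groups_ok_def by blast
 qed
 have st: "state v a" "\<forall>q<2 * K. a 8 q = node q"
  using gs by (auto simp: group_state_def node_state_def)
 have md: "a 13 0 g mod (2 * l) < 2 * l" using l by simp
 let ?body = "Asg 14 (Ar 11 (Vr 9) (arr1 13 (Vr 9) [-] Cn 1 [-] Vr 13));;
  provided (Ar 8 (Cn 2 [*] Vr 14) (Vr 26) [=] Vr 27) (
   provided (Ar 8 (Cn 2 [*] Vr 14 [+] Cn 1) (Vr 17) [=] Vr 28) (
    provided (arr1 7 (arr1 6 (Vr 14) [-] Vr 26)) (
     st1 17 (arr1 6 (Vr 14) [+] Vr 17 [-] Cn 1) (Cn 1))))"
 show ?thesis
  unfolding check_code_def
 proof (rule wp_For_const[where I = I and T = 5 and n = "a 13 0 g mod (2 * l)"])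
  fix x t1 v1 a1
  assume x: "x < a 13 0 g mod (2 * l)" and I: "I x v1 a1"
   and fr: "frame (For 13 (arr1 13 (Vr 9) [mod] Vr 5) ?body) v a v1 a1"
  have w: "v1 9 = g" "v1 26 = cut s" "v1 17 = rest s" "v1 27 = word_name (a 1) (left s)"
   "v1 28 = word_name (a 1) (right s)" "a1 11 = a 11" "a1 13 = a 13" "a1 8 = a 8" "a1 7 = a 7" "a1 6 = a 6"
   using frame_var[OF fr, of 9] frame_var[OF fr, of 26] frame_var[OF fr, of 17] frame_var[OF fr, of 27]
    frame_var[OF fr, of 28] frame_array[OF fr, of 11] frame_array[OF fr, of 13] frame_array[OF fr, of 8]
    frame_array[OF fr, of 7] frame_array[OF fr, of 6] v by auto
  define j where "j = ?j x"
  have j: "j < K" using jK[OF x] by (simp add: j_def)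
  have jr: "a 11 g (a 13 0 g - Suc x) = j" by (simp add: j_def)
  have nl: "a 8 (2 * j) = node (2 * j)" "a 8 (Suc (2 * j)) = node (Suc (2 * j))" using st(2) j by auto
  have ml: "node (2 * j) (cut s) = word_name (a 1) (left s) \<longleftrightarrow> prefix (left s) (ctx (2 * j))"
   using node_match[OF p, of "2 * j" "left s"] j v by simp
  have mr: "node (Suc (2 * j)) (rest s) = word_name (a 1) (right s) \<longleftrightarrow> prefix (right s) (ctx (2 * j + 1))"
   using node_match[OF p, of "2 * j + 1" "right s"] j v by simp
  have an: "a 6 0 j = anc j" "a 7 0 (anc j - cut s) = ub (anc j - cut s)" "anc j < m"
   using st(1) j anc_less[OF j] by (auto simp: state_def)
  have jZ: "j < Z" using j K_le z by simp
  have ht: "hit s j \<longleftrightarrow> node (2 * j) (cut s) = word_name (a 1) (left s) &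
    node (Suc (2 * j)) (rest s) = word_name (a 1) (right s) & ub (anc j - cut s) ~= 0"
   using ml mr j by (auto simp: hit_def)
  have ex: "E (Suc x) i \<longleftrightarrow> E x i \<or> hit s j & i = target s j" for i
   by (auto simp: less_Suc_eq j_def E_def)
  show "wp ?body (\<lambda>t' v' a'. t' <= t1 + 5 & I (Suc x) v' a') t1 (v1(13 := x)) a1"
  proof (cases "hit s j")
   case True
   have "I (Suc x) v' (upd a1 17 0 (target s j) 1)" for v'
    using I True unfolding I_def ex by (simp add: upd_same)
   then show ?thesis
    using True w jr nl an jZ z unfolding ht by (simp add: wps target_def)
  next
   case False
   have "I (Suc x) v' a1" for v'
    using I False unfolding I_def ex by simp
   then show ?thesis
    using False w jr nl an jZ z unfolding ht by (auto simp: wps)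
  qed
 next
  fix t' v' a'
  assume t': "t' <= t + 1 + (a 13 0 g mod (2 * l)) * (5 + 1)" and I: "I (a 13 0 g mod (2 * l)) v' a'"
  have "(a 13 0 g mod (2 * l)) * (5 + 1) <= 2 * l * (5 + 1)" using md by (intro mult_le_mono1) simp
  then show "t' <= t + 1 + 2 * l * 6 &
  (\<forall>i. a' 17 0 i = (if \<exists>x<a 13 0 g mod (2 * l). hit s (?j x) & i = target s (?j x) then 1 else a 17 0 i))"
   using t' I by (simp add: I_def E_def)
 qed (use v b bd md D_less in \<open>auto simp: I_def E_def\<close>)
qed

section \<open>The invariant of the string phase\<close>

definition table_sound :: "nat \<Rightarrow> arrays \<Rightarrow> bool" where
 "table_sound n a \<longleftrightarrow> (\<forall>g z. a 16 g z ~= 0 -->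
  (\<exists>s<n. live s & z = cut s * (2 * l) + rest s & g = group_of (a 1) s & g ~= 0))"

definition table_complete :: "nat \<Rightarrow> arrays \<Rightarrow> bool" where
 "table_complete n a \<longleftrightarrow> (\<forall>s<n. live s --> group_of (a 1) s ~= 0 &
  a 16 (group_of (a 1) s) (cut s * (2 * l) + rest s) ~= 0)"

definition out_sound :: "nat \<Rightarrow> arrays \<Rightarrow> bool" where
 "out_sound n a \<longleftrightarrow> (\<forall>i. a 17 0 i ~= 0 --> a 17 0 i = 1 & (\<exists>s<n. \<exists>j. hit s j & i = target s j))"

text \<open>Hits in full batches are left to the matrix products; only those among the leftover
  members of a group have to be marked already.\<close>

definition out_rest :: "nat \<Rightarrow> arrays \<Rightarrow> bool" where
 "out_rest n a \<longleftrightarrow> (\<forall>s<n. \<forall>j. hit s j --> (let g = group_of (a 1) s in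
  \<forall>i<a 13 0 g. a 13 0 g - a 13 0 g mod (2 * l) <= i --> a 11 g i = j --> a 17 0 (target s j) ~= 0))"

definition sstate :: "nat \<Rightarrow> vars \<Rightarrow> arrays \<Rightarrow> bool" where
 "sstate n v a \<longleftrightarrow> pstate v a & table_sound n a & table_complete n a & out_sound n a & out_rest n a"

lemma hit_live: "hit s j ==> live s"
 using weight_pos[of "2 * j" "left s"] weight_pos[of "2 * j + 1" "right s"] by (auto simp: hit_def live_def)

lemma group_of_ext: "ext T T' ==> group_of T s ~= 0 ==> group_of T' s = group_of T s"
 by (simp add: group_of_def extD)

text \<open>Growth of the naming table is harmless: the groups of all live strings processed so far
  are named already, so their names and the recorded entries persist.\<close>

lemma sstate_cong:
 assumes p: "sstate n v a" and v: "\<forall>x\<in>{0, 2, 3, 4, 5, 12}. v' x = v x"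
  and a: "\<forall>i. i ~= 1 --> a' i = a i"
  and n: "names (a' 1) (a' 31 0) (v' 6)" "ext (a 1) (a' 1)"
 shows "sstate n v' a'"
proof -
 have ps: "pstate v' a'" by (rule pstate_cong[of v a]) (use p v a n in \<open>auto simp: sstate_def\<close>)
 have eq: "a' 16 = a 16" "a' 17 = a 17" "a' 13 = a 13" "a' 11 = a 11" using a by simp_all
 have g: "group_of (a' 1) s = group_of (a 1) s" if "group_of (a 1) s ~= 0" for s
  using group_of_ext[OF n(2) that] .
 have gl: "group_of (a 1) s ~= 0" if "s < n" "live s" for s
  using p that by (auto simp: sstate_def table_complete_def)
 have "table_sound n a'" using p g unfolding sstate_def table_sound_def eq by metis
 moreover have "table_complete n a'" using p g gl unfolding sstate_def table_complete_def eq by metis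
 moreover have "out_sound n a'" using p unfolding sstate_def out_sound_def eq by blast
 moreover have "out_rest n a'"
  using p g gl hit_live unfolding sstate_def out_rest_def eq Let_def by metis
 ultimately show ?thesis using ps by (simp add: sstate_def)
qed

lemma link_correct:
 assumes p: "sstate s v a" and bd: "bounded v a" and s: "s < k" and v: "v 26 = cut s" "v 17 = rest s"
  "v 27 = word_name (a 1) (left s)" "v 28 = word_name (a 1) (right s)" "v 27 ~= 0" "v 28 ~= 0" and l: "0 < l"
  and c: "v 6 + 1 < Z"
 shows "wp link_code (\<lambda>t' v' a'. t' <= t + 20 + 2 * l * 6 & sstate (Suc s) v' a' & v' 6 <= v 6 + 1) t v a"
proof -
 have z: "1 < Z" using Z_lin by linarith
 have ps: "pstate v a" and gs: "group_state v a" using p by (simp_all add: sstate_def pstate_def)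
 have st: "state v a" using gs by (simp add: group_state_def node_state_def)
 have n: "names (a 1) (a 31 0) (v 6)" "ext T0 (a 1)" "v 5 = 2 * l"
  using gs st by (simp_all add: group_state_def node_state_def state_def base_def)
 have wt: "a 9 0 (v 27) = weight (left s)" "a 9 0 (v 28) = weight (right s)"
  using ps v occurrences_word[OF n(1,2)] by (auto simp: pstate_def)
 show ?thesis
 proof (cases "live s")
  case False
  have "\<not> hit s j" for j using hit_live False by blast
  then have lt: "x < Suc s ==> live x ==> x < s" "x < Suc s ==> hit x j ==> x < s"
   "x < s ==> x < Suc s" for x j using False by (auto simp: less_Suc_eq)
  have "table_sound (Suc s) a" using p lt(3) unfolding sstate_def table_sound_def by meson
  moreover have "table_complete (Suc s) a" using p lt(1) unfolding sstate_def table_complete_def by blast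
  moreover have "out_sound (Suc s) a" using p lt(3) unfolding sstate_def out_sound_def by meson
  moreover have "out_rest (Suc s) a" using p lt(2) unfolding sstate_def out_rest_def by blast
  ultimately have "sstate (Suc s) v a" using ps by (simp add: sstate_def)
  then show ?thesis using False wt by (auto simp: link_code_def wps live_def)
 next
  case True
  let ?p = "word_name T0 (head (left s))" and ?r = "word_name T0 (head (right s))"
  have pre: "\<exists>q<2 * K. prefix u (ctx q)" if "weight u ~= 0" for u
   using that unfolding weight_def by (metis (mono_tags, lifting) Collect_empty_eq card.empty)
  \<comment> \<open>A word of positive weight is a node of the trie, hence named in
    \<open>T0\<close>, and the current table gives it the same name. So array 10 really holds the
    name of its head.\<close>
  have hd: "a 10 0 (word_name (a 1) u) = word_name T0 (head u) & word_name T0 (head u) ~= 0"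
   if u: "weight u ~= 0" for u
  proof -
   obtain q where q: "q < 2 * K" "prefix u (ctx q)" using pre[OF u] by blast
   have "prefix (head u) (ctx q)" using prefix_head q(2) prefix_order.order_trans by blast
   then have "word_name T0 (head u) ~= 0" using prefix_named q(1) by blast
   moreover have "word_name (a 1) u = word_name T0 u"
    using word_name_ext[OF names0 n(2)] prefix_named[OF q] by simp
   ultimately show ?thesis using gs q unfolding group_state_def heads_ok_def by auto
  qed
  have h: "a 10 0 (v 27) = ?p" "a 10 0 (v 28) = ?r" "?p ~= 0" "?r ~= 0"
   using hd[of "left s"] hd[of "right s"] True v by (auto simp: live_def)
  have hz: "?p < Z" "?r < Z"
   using bounded_array[OF bd, of 10 0 "v 27"] bounded_array[OF bd, of 10 0 "v 28"] h by auto
  let ?v = "v(7 := ?p, 8 := ?r)"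
  have bd2: "bounded ?v a" using bd hz by (intro bounded_asg)
  have "wp name_code (wp (St 16 (Vr 9) (Vr 26 [*] Vr 5 [+] Vr 17) (Cn 1);; check_code)
    (\<lambda>t' v' a'. t' <= t + 20 + 2 * l * 6 & sstate (Suc s) v' a' & v' 6 <= v 6 + 1)) tt ?v a"
   if tt: "tt <= t + 4" for tt
  proof (rule wp_name)
   fix t' c' T'
   assume t': "t' <= tt + 4" and T': "names T' (a 31 0) c'" "ext (a 1) T'"
    "?v 6 <= c'" "c' <= ?v 6 + 1" "T' (?v 7) (?v 8) ~= 0"
   let ?g = "T' ?p ?r" and ?z = "cut s * (2 * l) + rest s"
   have g0: "?g ~= 0" "group_of T' s = ?g" using T'(5) by (auto simp: group_of_def)
   have cz: "c' < Z" using T'(4) c by simp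
   have gz: "?g < Z" using names_le[OF T'(1), of ?p ?r] cz by simp
   let ?v2 = "?v(6 := c', 9 := ?g)" and ?a1 = "a(1 := T')"
   let ?a2 = "upd ?a1 16 ?g ?z 1"
   have s1: "sstate s ?v2 ?a1" by (rule sstate_cong[OF p]) (use T' in auto)
   have ps2: "pstate ?v2 ?a2"
    by (rule pstate_cong[of ?v2 ?a1]) (use s1 T' in \<open>auto simp: sstate_def upd_array\<close>)
   have bd3: "bounded ?v2 ?a2"
   proof -
    have "T' i j < 2 ^ w" "T' i j < Z" for i j
     using names_le[OF T'(1), of i j] cz Z_le_Y Y_less by (linarith+)
    then have "bounded ?v ?a1" using bd2 by (auto simp: bounded_def)
    moreover have "bounded v ?a1" using bd \<open>bounded ?v ?a1\<close> by (auto simp: bounded_def)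
    ultimately show ?thesis using cz gz z hz by (intro bounded_upd bounded_asg) auto
   qed
   have wn: "word_name T' (left s) = v 27" "word_name T' (right s) = v 28"
    using word_name_ext[OF n(1) T'(2)] v by auto
   have ck: "wp check_code (\<lambda>t' v' a'. t' <= ttt + 1 + 2 * l * 6 &
    (\<forall>i. a' 17 0 i = (if \<exists>x<?a2 13 0 ?g mod (2 * l). hit s (?a2 11 ?g (?a2 13 0 ?g - 1 - x)) &
    i = target s (?a2 11 ?g (?a2 13 0 ?g - 1 - x)) then 1 else ?a2 17 0 i))) ttt ?v2 ?a2" for ttt
    by (rule check_correct[OF ps2 bd3 s]) (use v l wn in \<open>auto simp: upd_array\<close>)
   have fin: "wp check_code (\<lambda>t' v' a'. t' <= t + 20 + 2 * l * 6 & sstate (Suc s) v' a' & v' 6 <= v 6 + 1)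
     ttt ?v2 ?a2" if ttt: "ttt <= t + 9" for ttt
   proof (rule wp_conseq[OF ck bd3])
    fix t3 v3 a3
    assume A: "t3 <= ttt + 1 + 2 * l * 6 &
    (\<forall>i. a3 17 0 i = (if \<exists>x<?a2 13 0 ?g mod (2 * l). hit s (?a2 11 ?g (?a2 13 0 ?g - 1 - x)) &
    i = target s (?a2 11 ?g (?a2 13 0 ?g - 1 - x)) then 1 else ?a2 17 0 i))"
     and fr: "frame check_code ?v2 ?a2 v3 a3"
    have e: "a3 i = ?a2 i" if "i ~= 17" for i
     using frame_array[OF fr, of i] that by (simp add: check_code_def)
    have e3: "a3 1 = T'" "a3 13 = a 13" "a3 11 = a 11" "a3 16 = ?a2 16"
     using e[of 1] e[of 13] e[of 11] e[of 16] by (simp_all add: upd_array)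
    have v3: "v3 x = ?v2 x" if "x \<notin> {13, 14}" for x
     using frame_var[OF fr, of x] that by (simp add: check_code_def)
    have ps3: "pstate v3 a3"
     by (rule pstate_cong[OF ps2])
      (use T' e v3 in \<open>auto simp: upd_array\<close>)
    let ?gc = "a 13 0 ?g"
    have o: "a3 17 0 i = (if \<exists>x<?gc mod (2 * l). hit s (a 11 ?g (?gc - 1 - x)) &
      i = target s (a 11 ?g (?gc - 1 - x)) then 1 else a 17 0 i)" for i
    proof -
     have q: "?a2 13 = a 13" "?a2 11 = a 11" "?a2 17 = a 17" by (simp_all add: upd_array)
     show ?thesis using A unfolding q by blast
    qed
    have ts: "table_sound (Suc s) a3"
     unfolding table_sound_def e3
    proof (intro allI impI)
     fix h y assume hy: "?a2 16 h y ~= 0"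
     show "\<exists>s'<Suc s. live s' & y = cut s' * (2 * l) + rest s' & h = group_of T' s' & h ~= 0"
     proof (cases "h = ?g & y = ?z")
      case True
      then show ?thesis using \<open>live s\<close> g0 by (intro exI[of _ s]) simp
     next
      case False
      then have "?a1 16 h y ~= 0" using hy by (simp add: upd_same split: if_splits)
      then obtain s' where "s' < s" "live s'" "y = cut s' * (2 * l) + rest s'" "h = group_of (?a1 1) s'" "h ~= 0"
       using s1 unfolding sstate_def table_sound_def by blast
      then show ?thesis by (intro exI[of _ s']) simp
     qed
    qed
    have tc: "table_complete (Suc s) a3"
     unfolding table_complete_def e3
    proof (intro allI impI)
     fix s' assume s': "s' < Suc s" "live s'"
     show "group_of T' s' ~= 0 & ?a2 16 (group_of T' s') (cut s' * (2 * l) + rest s') ~= 0"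
     proof (cases "s' = s")
      case False
      then have "group_of (?a1 1) s' ~= 0 & ?a1 16 (group_of (?a1 1) s') (cut s' * (2 * l) + rest s') ~= 0"
       using s1 s' unfolding sstate_def table_complete_def by auto
      then show ?thesis by (simp add: upd_same)
     qed (use g0 in \<open>simp add: upd_same\<close>)
    qed
    have os: "out_sound (Suc s) a3"
     unfolding out_sound_def
    proof (intro allI impI)
     fix i assume "a3 17 0 i ~= 0"
     show "a3 17 0 i = 1 & (\<exists>s'<Suc s. \<exists>j. hit s' j & i = target s' j)"
     proof (cases "\<exists>x<?gc mod (2 * l). hit s (a 11 ?g (?gc - 1 - x)) & i = target s (a 11 ?g (?gc - 1 - x))")
      case True
      then show ?thesis using o[of i] by auto
     next
      case False
      have e: "a3 17 0 i = a 17 0 i" using o[of i] unfolding if_not_P[OF False] .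
      then have "a 17 0 i ~= 0" using \<open>a3 17 0 i ~= 0\<close> by simp
      then have "a 17 0 i = 1 & (\<exists>s'<s. \<exists>j. hit s' j & i = target s' j)"
       using p unfolding sstate_def out_sound_def by blast
      then show ?thesis using e less_SucI by metis
     qed
    qed
    have orr: "out_rest (Suc s) a3"
     unfolding out_rest_def e3 Let_def
    proof (intro allI impI)
     fix s' j i
     assume s': "s' < Suc s" "hit s' j" "i < a 13 0 (group_of T' s')"
      "a 13 0 (group_of T' s') - a 13 0 (group_of T' s') mod (2 * l) <= i" "a 11 (group_of T' s') i = j"
     show "a3 17 0 (target s' j) ~= 0"
     proof (cases "s' = s")
      case True
      \<comment> \<open>Member \<open>i\<close> is met in round \<open>x\<close> of the checking
        loop, which counts from the end of the list.\<close>
      define x where "x = ?gc - 1 - i"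
      have ig: "i < ?gc" "?gc - ?gc mod (2 * l) <= i" "a 11 ?g i = j" using s' True g0 by auto
      then have "x < ?gc mod (2 * l)" "?gc - 1 - x = i"
       using mod_less_eq_dividend[of ?gc "2 * l"] unfolding x_def by linarith+
      then have "\<exists>x<?gc mod (2 * l). hit s (a 11 ?g (?gc - 1 - x)) & target s' j = target s (a 11 ?g (?gc - 1 - x))"
       using s' True ig by (intro exI[of _ x]) simp
      then show ?thesis using o[of "target s' j"] by simp
     next
      case False
      have "a 17 0 (target s' j) ~= 0"
       using s1 s' False unfolding sstate_def out_rest_def Let_def by auto
      then show ?thesis using o[of "target s' j"] by simp
     qed
    qed
    have "v3 6 <= v 6 + 1" using v3[of 6] T'(4) by simp
    then show "t3 <= t + 20 + 2 * l * 6 & sstate (Suc s) v3 a3 & v3 6 <= v 6 + 1"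
     using A ttt ps3 ts tc os orr by (simp add: sstate_def)
   qed
   show "wp (St 16 (Vr 9) (Vr 26 [*] Vr 5 [+] Vr 17) (Cn 1);; check_code)
    (\<lambda>t' v' a'. t' <= t + 20 + 2 * l * 6 & sstate (Suc s) v' a' & v' 6 <= v 6 + 1) t'
    (?v(6 := c', 9 := T' (?v 7) (?v 8))) (a(1 := T'))"
    using fin[of "t' + 1"] t' tt z v n(3) by (simp add: wps)
  qed (use n c h bd2 in auto)
  then show ?thesis using True wt h hz by (simp add: link_code_def wps live_def)
 qed
qed

lemma named_state: "sstate s v a ==> state v a & names (a 1) (a 31 0) (v 6)"
 by (simp add: sstate_def pstate_def group_state_def node_state_def state_def)

lemma string_row_correct:
 assumes p: "sstate s v a" and bd: "bounded v a" and s: "s < k" and v: "v 24 = off s"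
  and c: "v 6 + len s + 1 < Z"
 shows "wp string_row (\<lambda>t' v' a'. t' <= t + 40 + len s * 25 & sstate (Suc s) v' a' & v' 24 = off (Suc s) &
  v' 6 <= v 6 + len s + 1) t v a"
proof -
 have lens: "cut s + l < len s" "len s < 2 * l" "off s + 1 + len s <= L" "0 < l" "rest s = len s - cut s"
  "cut s + rest s = len s"
  using cut_less[OF s] len_less[OF s] off_less[OF s] rest_pos[OF s] by (auto simp: rest_def)
 have z: "1 < Z" "off s + 1 + len s < Z" "off s + 1 < Z" "len s < Z" "len s <= Z" "off s < Z"
  using Z_lin lens by linarith+
 have st: "state v a" using named_state[OF p] by simp
 have f: "a 2 0 = f" using st by (simp add: state_def)
 have lo: "a 0 0 (off s) = len s" using st X_off[OF s] by (simp add: state_def base_def)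
 let ?Q = "\<lambda>t' v' a'. t' <= t + 40 + len s * 25 & sstate (Suc s) v' a' & v' 24 = off (Suc s) &
  v' 6 <= v 6 + len s + 1"
 let ?c6 = "link_code;; Asg 24 (Vr 24 [+] Vr 25)"
 let ?c5 = "Asg 28 (Vr 7);; Asg 17 (Vr 25 [-] Vr 26);; ?c6"
 let ?c4 = "word_code (Vr 25 [-] Vr 26) (Vr 24 [+] Vr 26 [+] Vr 16);; ?c5"
 let ?c3 = "Asg 27 (Vr 7);; Asg 7 (Cn 1);; ?c4"
 let ?c2 = "word_code (Vr 26) (Vr 24 [+] Vr 26 [-] Cn 1 [-] Vr 16);; ?c3"
 have s6: "wp ?c6 ?Q tt v6 a6"
  if tt: "tt <= t + 15 + len s * 13" and a6: "sstate s v6 a6" "bounded v6 a6" "v6 26 = cut s" "v6 17 = rest s"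
   "v6 27 = word_name (a6 1) (left s)" "v6 28 = word_name (a6 1) (right s)" "v6 27 ~= 0" "v6 28 ~= 0"
   "v6 6 <= v 6 + len s" "v6 24 = off s + 1" "v6 25 = len s" for tt v6 a6
 proof -
  have "wp link_code (wp (Asg 24 (Vr 24 [+] Vr 25)) ?Q) tt v6 a6"
  proof (rule wp_conseq)
   show "wp link_code (\<lambda>t' v' a'. t' <= tt + 20 + 2 * l * 6 & sstate (Suc s) v' a' & v' 6 <= v6 6 + 1) tt v6 a6"
    by (rule link_correct) (use a6 s lens c in auto)
  next
   fix t' and v' :: vars and a' :: arrays
   assume A: "t' <= tt + 20 + 2 * l * 6 & sstate (Suc s) v' a' & v' 6 <= v6 6 + 1"
    and fr: "frame link_code v6 a6 v' a'"
   have e: "v' 24 = off s + 1" "v' 25 = len s"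
    using frame_var[OF fr, of 24] frame_var[OF fr, of 25] a6
    by (auto simp: link_code_def check_code_def name_code_def)
   \<comment> \<open>The time for checking leftover anchors is charged to the string, which is
     longer than \<open>l\<close>.\<close>
   have "2 * l * 6 <= len s * 12" using lens by simp
   moreover have "sstate (Suc s) (v'(24 := off (Suc s))) a'"
    by (rule sstate_cong[of _ v' a']) (use A named_state[of "Suc s" v' a'] in auto)
   ultimately show "wp (Asg 24 (Vr 24 [+] Vr 25)) ?Q t' v' a'"
    using A e tt z a6(9) off_Suc[OF s] by (simp add: wps)
  qed (rule a6)
  then show ?thesis by (simp add: wps)
 qed
 have s4: "wp ?c4 ?Q tt v4 a4"
  if tt: "tt <= t + 11 + len s * 6 + cut s * 7" and a4: "sstate s v4 a4" "bounded v4 a4" "v4 26 = cut s" "v4 7 = 1"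
   "v4 27 = word_name (a4 1) (left s)" "v4 27 ~= 0"
   "v4 6 <= v 6 + cut s" "v4 24 = off s + 1" "v4 25 = len s" for tt v4 a4
 proof -
  have n4: "names (a4 1) (a4 31 0) (v4 6)" and f4: "a4 2 0 = f"
   using named_state[OF a4(1)] by (auto simp: state_def)
  have "wp (word_code (Vr 25 [-] Vr 26) (Vr 24 [+] Vr 26 [+] Vr 16)) (wp ?c5 ?Q) tt v4 a4"
  proof (rule wp_conseq)
   show "wp (word_code (Vr 25 [-] Vr 26) (Vr 24 [+] Vr 26 [+] Vr 16))
    (\<lambda>t' v' a'. t' <= tt + 1 + length (right s) * 7 & names (a' 1) (a' 31 0) (v' 6) &
     ext (a4 1) (a' 1) & v' 6 <= v4 6 + length (right s) & v' 7 = word_name (a' 1) (right s) & v' 7 ~= 0) tt v4 a4"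
   proof (rule word_correct)
    fix x v' a' assume x: "x < length (right s)" "v' 16 = x"
     and v': "\<forall>y. y \<notin> {6, 7, 8, 9, 16} --> v' y = v4 y" and a': "\<forall>i. i ~= 1 --> a' i = a4 i"
    then show "a' 2 0 (val Z (Vr 24 [+] Vr 26 [+] Vr 16) v' a') = right s ! x"
     using a4 f4 by (simp add: right_def)
   qed (use a4 n4 lens z c in auto)
  next
   fix t' and v' :: vars and a' :: arrays
   assume A: "t' <= tt + 1 + length (right s) * 7 & names (a' 1) (a' 31 0) (v' 6) &
     ext (a4 1) (a' 1) & v' 6 <= v4 6 + length (right s) & v' 7 = word_name (a' 1) (right s) & v' 7 ~= 0"
    and bd': "bounded v' a'"
    and fr: "frame (word_code (Vr 25 [-] Vr 26) (Vr 24 [+] Vr 26 [+] Vr 16)) v4 a4 v' a'"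
   have fv: "v' y = v4 y" if "y \<notin> {6, 7, 8, 9, 16}" for y
    using frame_var[OF fr, of y] that by (simp add: word_code_def name_code_def)
   have fa: "a' y = a4 y" if "y ~= 1" for y
    using frame_array[OF fr, of y] that by (simp add: word_code_def name_code_def)
   let ?v = "v'(28 := v' 7, 17 := rest s)"
   have v7: "v' 7 < Z" "rest s < Z" using bounded_var[OF bd', of 7] z lens by auto
   have ss: "sstate s ?v a'" by (rule sstate_cong[OF a4(1)]) (use A fv fa in auto)
   have wn: "word_name (a' 1) (left s) = v4 27"
    using word_name_ext[OF n4, of "a' 1" "left s"] A a4(5,6) by simp
   have "wp ?c6 ?Q ttt ?v a'" if "ttt <= t' + 2" for ttt
   proof (rule s6)
    show "ttt <= t + 15 + len s * 13" using that A tt lens(6) by simp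
    show "bounded ?v a'" using bd' v7 by (intro bounded_asg)
   qed (use ss A fv wn a4 lens in auto)
   then show "wp ?c5 ?Q t' v' a'" using fv[of 25] fv[of 26] a4 v7 lens(5) by (simp add: wps)
  qed (rule a4)
  then show ?thesis by (simp add: wps)
 qed
 have s2: "wp ?c2 ?Q tt v2 a2"
  if tt: "tt <= t + 6 + len s * 6" and a2: "sstate s v2 a2" "bounded v2 a2" "v2 26 = cut s" "v2 7 = 1"
   "v2 6 = v 6" "v2 24 = off s + 1" "v2 25 = len s" for tt v2 a2
 proof -
  have n2: "names (a2 1) (a2 31 0) (v2 6)" and f2: "a2 2 0 = f"
   using named_state[OF a2(1)] by (auto simp: state_def)
  have "wp (word_code (Vr 26) (Vr 24 [+] Vr 26 [-] Cn 1 [-] Vr 16)) (wp ?c3 ?Q) tt v2 a2"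
  proof (rule wp_conseq)
   show "wp (word_code (Vr 26) (Vr 24 [+] Vr 26 [-] Cn 1 [-] Vr 16))
    (\<lambda>t' v' a'. t' <= tt + 1 + length (left s) * 7 & names (a' 1) (a' 31 0) (v' 6) &
     ext (a2 1) (a' 1) & v' 6 <= v2 6 + length (left s) & v' 7 = word_name (a' 1) (left s) & v' 7 ~= 0) tt v2 a2"
   proof (rule word_correct)
    fix x v' a' assume x: "x < length (left s)" "v' 16 = x"
     and v': "\<forall>y. y \<notin> {6, 7, 8, 9, 16} --> v' y = v2 y" and a': "\<forall>i. i ~= 1 --> a' i = a2 i"
    then show "a' 2 0 (val Z (Vr 24 [+] Vr 26 [-] Cn 1 [-] Vr 16) v' a') = left s ! x"
     using a2 f2 by (simp add: left_def)
   qed (use a2 n2 lens z c in auto)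
  next
   fix t' and v' :: vars and a' :: arrays
   assume A: "t' <= tt + 1 + length (left s) * 7 & names (a' 1) (a' 31 0) (v' 6) &
     ext (a2 1) (a' 1) & v' 6 <= v2 6 + length (left s) & v' 7 = word_name (a' 1) (left s) & v' 7 ~= 0"
    and bd': "bounded v' a'"
    and fr: "frame (word_code (Vr 26) (Vr 24 [+] Vr 26 [-] Cn 1 [-] Vr 16)) v2 a2 v' a'"
   have fv: "v' y = v2 y" if "y \<notin> {6, 7, 8, 9, 16}" for y
    using frame_var[OF fr, of y] that by (simp add: word_code_def name_code_def)
   have fa: "a' y = a2 y" if "y ~= 1" for y
    using frame_array[OF fr, of y] that by (simp add: word_code_def name_code_def)
   let ?v = "v'(27 := v' 7, 7 := 1)"
   have v7: "v' 7 < Z" using bounded_var[OF bd', of 7] .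
   have ss: "sstate s ?v a'" by (rule sstate_cong[OF a2(1)]) (use A fv fa in auto)
   have "wp ?c4 ?Q ttt ?v a'" if "ttt <= t' + 2" for ttt
   proof (rule s4)
    show "ttt <= t + 11 + len s * 6 + cut s * 7" using that A tt by simp
    show "bounded ?v a'" using bd' v7 z by (intro bounded_asg) auto
   qed (use ss A fv a2 in auto)
   then show "wp ?c3 ?Q t' v' a'" using v7 z by (simp add: wps)
  qed (rule a2)
  then show ?thesis by (simp add: wps)
 qed
 let ?v = "v(25 := len s, 24 := off s + 1)"
 have bd1: "bounded ?v a" using bd z by (intro bounded_asg) auto
 have "wp find_code (wp (Asg 7 (Cn 1);; ?c2) ?Q) tt ?v a" if tt: "tt <= t + 2" for tt
 proof (rule wp_conseq)
  have "sstate s ?v a" by (rule sstate_cong[OF p]) (use named_state[OF p] in auto)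
  then show "wp find_code (\<lambda>t' v' a'. t' <= tt + 3 + len s * 6 & a' = a & v' 26 = cut s) tt ?v a"
   by (intro find_correct) (use bd1 s in \<open>auto simp: sstate_def\<close>)
 next
  fix t' and v' :: vars and a' :: arrays
  assume A: "t' <= tt + 3 + len s * 6 & a' = a & v' 26 = cut s" and bd': "bounded v' a'"
   and fr: "frame find_code ?v a v' a'"
  have fv: "v' y = ?v y" if "y \<notin> {13, 26, 29}" for y
   using frame_var[OF fr, of y] that by (simp add: find_code_def)
  let ?v2 = "v'(7 := 1)"
  have ss: "sstate s ?v2 a'" by (rule sstate_cong[OF p]) (use A fv named_state[OF p] in auto)
  have "wp ?c2 ?Q ttt ?v2 a'" if "ttt <= t' + 1" for ttt
  proof (rule s2)
   show "ttt <= t + 6 + len s * 6" using that A tt by simp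
   show "bounded ?v2 a'" using bd' z by (intro bounded_asg) auto
  qed (use ss A fv in auto)
  then show "wp (Asg 7 (Cn 1);; ?c2) ?Q t' v' a'" using z by (simp add: wps)
 qed (rule bd1)
 then show ?thesis using v lo z by (simp add: string_row_def wps)
qed

text \<open>A round costs at most 41 ticks per input cell of its string, the length entry included.
  Summation along \<open>off\<close> telescopes to \<open>41 * L\<close>.\<close>

lemma string_correct:
 assumes p: "sstate 0 v a" and bd: "bounded v a" and c: "v 6 + L < Z"
 shows "wp string_code (\<lambda>t' v' a'. t' <= t + 2 + L * 41 & sstate k v' a' & v' 6 <= v 6 + L) t v a"
proof -
 define I where "I s v' a' \<longleftrightarrow> sstate s v' a' & v' 24 = off s & v' 6 + off 0 <= v 6 + off s"
  for s and v' :: vars and a' :: arrays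
 have z: "off 0 < Z" "k <= Z" using Z_lin L_ge k_le off_0 by linarith+
 have b: "v 3 = m" "v 4 = k" using named_state[OF p] by (auto simp: state_def base_def)
 have sum: "n <= k ==> (\<Sum>i<n. 40 + len i * 25 + 1) + 41 * off 0 <= 41 * off n" for n
 proof (induction n)
  case (Suc n)
  then show ?case using off_Suc[of n] by simp
 qed simp
 let ?v = "v(24 := off 0)"
 have bd1: "bounded ?v a" using bd z by (intro bounded_asg)
 have p1: "sstate 0 ?v a" by (rule sstate_cong[OF p]) (use named_state[OF p] in auto)
 have "wp (For 15 (Vr 4) string_row) (\<lambda>t' v' a'. t' <= t + 2 + L * 41 & sstate k v' a' & v' 6 <= v 6 + L) tt ?v a"
  if tt: "tt <= t + 1" for tt
 proof (rule wp_For[where I = I and n = k and T = "\<lambda>s. 40 + len s * 25"])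
  fix s t1 v1 a1
  assume s: "s < k" and I: "I s v1 a1" and bd2: "bounded v1 a1"
  let ?v = "v1(15 := s)"
  have n: "state v1 a1" "names (a1 1) (a1 31 0) (v1 6)" using named_state I by (auto simp: I_def)
  have ss: "sstate s ?v a1" by (rule sstate_cong[of s v1 a1]) (use I n in \<open>auto simp: I_def\<close>)
  have os: "off (Suc s) = off s + 1 + len s" "off (Suc s) <= L" using off_Suc[OF s] off_less[OF s] by auto
  have bd3: "bounded ?v a1" using bd2 s z by (intro bounded_asg) auto
  show "wp string_row (\<lambda>t' v' a'. t' <= t1 + (40 + len s * 25) & I (Suc s) v' a') t1 ?v a1"
  proof (rule wp_mono[OF string_row_correct[OF ss bd3 s]])
   show "?v 24 = off s" using I by (simp add: I_def)
   show "?v 6 + len s + 1 < Z" using I c os by (simp add: I_def)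
  next
   fix t' and v' :: vars and a' :: arrays
   assume "t' <= t1 + 40 + len s * 25 & sstate (Suc s) v' a' & v' 24 = off (Suc s) & v' 6 <= ?v 6 + len s + 1"
   then show "t' <= t1 + (40 + len s * 25) & I (Suc s) v' a'"
    using I os by (auto simp: I_def)
  qed
 next
  fix t' v' a'
  assume "t' <= tt + 1 + (\<Sum>i<k. 40 + len i * 25 + 1)" "I k v' a'"
  then show "t' <= t + 2 + L * 41 & sstate k v' a' & v' 6 <= v 6 + L"
   using tt off_k sum[of k] by (auto simp: I_def)
 qed (use p1 bd1 b z in \<open>auto simp: I_def\<close>)
 then show ?thesis using b z off_0 by (simp add: string_code_def wps)
qed

end

section \<open>Batches and matrix products\<close>

text \<open>Rows are the anchors of the batch, columns are left depths. An entry is the activity bit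
  of the prefix that precedes a left part of this depth, and 0 if the node at this depth is not on
  the left heavy path of the group.\<close>

definition "left_matrix_code =
 For 13 (Vr 5 [*] Vr 5) (
  Asg 14 (Ar 11 (Vr 18) (Vr 34 [*] Vr 5 [+] Vr 13 [div] Vr 5));; Asg 16 (Vr 13 [mod] Vr 5);;
  Asg 7 (Ar 8 (Cn 2 [*] Vr 14) (Vr 16));;
  provided (Vr 7) (provided (arr1 10 (Vr 7) [=] arr1 14 (Vr 18)) (
   St 12 (Vr 20) (Cn 1 [+] Vr 13) (arr1 7 (arr1 6 (Vr 14) [-] Vr 16)))))"

definition "right_matrix_code =
 For 13 (Vr 5 [*] Vr 5)
  (St 12 (Vr 20) (Cn 1 [+] Vr 5 [*] Vr 5 [+] Vr 13) (Cn 0 [<] Ar 16 (Vr 18) (Vr 13)))"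

text \<open>An entry of the product counts only at right depths whose node lies on the right heavy
  path of the group; this test is made when the result is read.\<close>

definition "product_code =
 For 13 (Vr 5 [*] Vr 5) (
  Asg 14 (Ar 11 (Vr 18) (Vr 34 [*] Vr 5 [+] Vr 13 [div] Vr 5));; Asg 17 (Vr 13 [mod] Vr 5);;
  Asg 8 (Ar 8 (Cn 2 [*] Vr 14 [+] Cn 1) (Vr 17));;
  provided (Vr 8) (provided (arr1 10 (Vr 8) [=] arr1 15 (Vr 18)) (
   provided (Ar 12 (Vr 20) (Vr 23 [+] Vr 13)) (
    st1 17 (arr1 6 (Vr 14) [+] Vr 17 [-] Cn 1) (Cn 1)))))"

text \<open>Variable 20 moves on to an untouched row for every call, as a computation has to start
  with 0 in all cells behind its input.\<close>

definition "batch_row =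
 St 12 (Vr 20) (Cn 0) (Vr 5);; left_matrix_code;; right_matrix_code;;
 Asg 21 (Cn 1 [+] Cn 2 [*] Vr 5 [*] Vr 5);; Call;; product_code;; Asg 20 (Vr 20 [+] Cn 1)"

definition "batch_code =
 Asg 20 (Cn 0);; For 18 (Vr 6 [+] Cn 1) (For 34 (arr1 13 (Vr 18) [div] Vr 5) batch_row)"

text \<open>Matrices are given as functions of the flattened index, which keeps the matrix type out
  of all proofs about the program.\<close>

definition mm_input :: "nat \<Rightarrow> (nat \<Rightarrow> nat) \<Rightarrow> (nat \<Rightarrow> nat) \<Rightarrow> nat list" where
 "mm_input n \<alpha> \<beta> = n # map \<alpha> [0..<n * n] @ map \<beta> [0..<n * n]"

definition mm_result :: "nat \<Rightarrow> (nat \<Rightarrow> nat) \<Rightarrow> (nat \<Rightarrow> nat) \<Rightarrow> nat list" where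
 "mm_result n \<alpha> \<beta> = map (\<lambda>i. \<Sum>x<n. \<alpha> (i div n * n + x) * \<beta> (x * n + i mod n)) [0..<n * n]"

lemma length_mm_input [simp]: "length (mm_input n \<alpha> \<beta>) = 1 + 2 * n * n"
 by (simp add: mm_input_def)

lemma length_mm_result [simp]: "length (mm_result n \<alpha> \<beta>) = n * n"
 by (simp add: mm_result_def)

lemma mm_result_nz: "i < n * n ==> mm_result n \<alpha> \<beta> ! i ~= 0 \<longleftrightarrow>
  (\<exists>x<n. \<alpha> (i div n * n + x) ~= 0 & \<beta> (x * n + i mod n) ~= 0)"
 by (auto simp: mm_result_def)

context word_ram_sub
begin

lemma wp_St_seq:
 "\<lbrakk>val Z e1 v a = i; val Z e2 v a = j; val Z e3 v a = x; x < Z; wp c Q (t + 1) v (upd a k i j x)\<rbrakk> \<Longrightarrow>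
  wp (St k e1 e2 e3;; c) Q t v a"
 by simp

end

context string_ram
begin

definition grid :: "arrays \<Rightarrow> nat \<Rightarrow> nat \<Rightarrow> nat \<Rightarrow> nat" where
 "grid a g b i = a 11 g (b * (2 * l) + i div (2 * l))"

definition left_entry :: "arrays \<Rightarrow> nat \<Rightarrow> nat \<Rightarrow> nat \<Rightarrow> nat" where
 "left_entry a g b i = (let p = node (2 * grid a g b i) (i mod (2 * l)) in
  if p ~= 0 & a 10 0 p = a 14 0 g then ub (anc (grid a g b i) - i mod (2 * l)) else 0)"

definition right_entry :: "arrays \<Rightarrow> nat \<Rightarrow> nat \<Rightarrow> nat" where
 "right_entry a g i = of_bool (a 16 g i ~= 0)"

definition out_mark :: "arrays \<Rightarrow> nat \<Rightarrow> nat \<Rightarrow> (nat \<Rightarrow> nat) \<Rightarrow> nat \<Rightarrow> nat \<Rightarrow> bool" where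
 "out_mark a g b N i p \<longleftrightarrow> (let q = node (2 * grid a g b i + 1) (i mod (2 * l)) in
  q ~= 0 & a 10 0 q = a 15 0 g & N i ~= 0 & p = anc (grid a g b i) + i mod (2 * l) - 1)"

lemma sstate_parts:
 assumes "sstate s v a"
 shows "state v a" "\<forall>q<2 * K. a 8 q = node q" "ext T0 (a 1)" "groups_ok a"
  "heads_ok {s. \<exists>q<2 * K. prefix s (ctx q)} a" "v 5 = 2 * l" "names (a 1) (a 31 0) (v 6)"
  "\<forall>j<K. a 6 0 j = anc j" "\<forall>b\<le>m. a 7 0 b = ub b"
 using assms by (simp_all add: sstate_def pstate_def group_state_def node_state_def state_def base_def)

lemma grid_less:
 assumes "groups_ok a" "b < a 13 0 g div (2 * l)" "i < 2 * l * (2 * l)"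
 shows "grid a g b i < K" "b * (2 * l) + i div (2 * l) < a 13 0 g" "0 < l"
proof -
 show l: "0 < l" using assms(3) by (cases l) auto
 have "i div (2 * l) < 2 * l" using assms(3) l by (simp add: less_mult_imp_div_less)
 then have "b * (2 * l) + i div (2 * l) < Suc b * (2 * l)" by simp
 also have "\<dots> <= a 13 0 g div (2 * l) * (2 * l)" using assms(2) by (intro mult_le_mono1) simp
 also have "\<dots> <= a 13 0 g" by simp
 finally show *: "b * (2 * l) + i div (2 * l) < a 13 0 g" .
 then have "a 13 0 g ~= 0" by simp
 then show "grid a g b i < K" using assms(1) * unfolding groups_ok_def grid_def by blast
qed

lemma left_matrix_correct:
 assumes p: "sstate s v a" and bd: "bounded v a" and b: "v 34 = b" "b < a 13 0 g div (2 * l)" "v 18 = g"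
  and z: "\<forall>i\<ge>1. a 12 (v 20) i = 0" and D: "2 * l * (2 * l) <= Z"
 shows "wp left_matrix_code (\<lambda>t' v' a'. t' <= t + 1 + 2 * l * (2 * l) * 7 &
  (\<forall>r i. a' 12 r i = (if r = v 20 & 1 <= i & i <= 2 * l * (2 * l) then left_entry a g b (i - 1)
   else a 12 r i))) t v a"
proof -
 define I where "I n v' a' \<longleftrightarrow>
  (\<forall>r i. a' 12 r i = (if r = v 20 & 1 <= i & i <= n then left_entry a g b (i - 1) else a 12 r i))"
  for n and v' :: vars and a' :: arrays
 note sp = sstate_parts[OF p]
 have z1: "1 < Z" "m < Z" "2 * l < Z" using Z_lin L_ge l_le by linarith+
 let ?body = "Asg 14 (Ar 11 (Vr 18) (Vr 34 [*] Vr 5 [+] Vr 13 [div] Vr 5));; Asg 16 (Vr 13 [mod] Vr 5);;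
  Asg 7 (Ar 8 (Cn 2 [*] Vr 14) (Vr 16));;
  provided (Vr 7) (provided (arr1 10 (Vr 7) [=] arr1 14 (Vr 18)) (
   St 12 (Vr 20) (Cn 1 [+] Vr 13) (arr1 7 (arr1 6 (Vr 14) [-] Vr 16))))"
 show ?thesis
  unfolding left_matrix_code_def
 proof (rule wp_For_const[where I = I and T = 6 and n = "2 * l * (2 * l)"])
  fix i t1 v1 a1
  assume i: "i < 2 * l * (2 * l)" and I: "I i v1 a1" and bd1: "bounded v1 a1"
   and fr: "frame (For 13 (Vr 5 [*] Vr 5) ?body) v a v1 a1"
  have w: "v1 5 = 2 * l" "v1 18 = g" "v1 34 = b" "v1 20 = v 20" "a1 11 = a 11" "a1 8 = a 8" "a1 10 = a 10"
   "a1 14 = a 14" "a1 7 = a 7" "a1 6 = a 6"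
   using frame_var[OF fr, of 5] frame_var[OF fr, of 18] frame_var[OF fr, of 34] frame_var[OF fr, of 20]
    frame_array[OF fr, of 11] frame_array[OF fr, of 8] frame_array[OF fr, of 10] frame_array[OF fr, of 14]
    frame_array[OF fr, of 7] frame_array[OF fr, of 6] b sp by auto
  let ?j = "grid a g b i" and ?x = "i mod (2 * l)"
  let ?p = "node (2 * ?j) ?x"
  have j: "?j < K" "0 < l" using grid_less[OF sp(4) b(2) i] by auto
  have nd: "a 8 (2 * ?j) = node (2 * ?j)" using sp(2) j by simp
  have jz: "?j < Z" "2 * ?j < Z" using j D_less by auto
  have xz: "?x < 2 * l" "?x < Z" using j z1 less_trans[of ?x "2 * l" Z] by auto
  have pz: "?p < Z" using bounded_array[OF bd, of 8 "2 * ?j" ?x] nd by simp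
  have an: "a 6 0 ?j = anc ?j" "a 7 0 (anc ?j - ?x) = ub (anc ?j - ?x)"
   using sp(8,9) j anc_less[OF j(1)] by auto
  have uz: "ub (anc ?j - ?x) < Z" using ub_le[of "anc ?j - ?x"] z1 by simp
  have g: "a 11 g (b * (2 * l) + i div (2 * l)) = ?j" by (simp add: grid_def)
  show "wp ?body (\<lambda>t' v' a'. t' <= t1 + 6 & I (Suc i) v' a') t1 (v1(13 := i)) a1"
  proof (cases "?p ~= 0 & a 10 0 ?p = a 14 0 g")
   case True
   have "I (Suc i) v' (upd a1 12 (v 20) (Suc i) (ub (anc ?j - ?x)))" for v'
    using I True unfolding I_def by (auto simp: upd_same left_entry_def Let_def le_Suc_eq)
   then show ?thesis using True w nd jz xz pz an uz g by (simp add: wps)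
  next
   case False
   have "left_entry a g b i = 0" using False by (auto simp: left_entry_def Let_def)
   then have "I (Suc i) v' a1" for v'
    using I z unfolding I_def by (auto simp: le_Suc_eq)
   then show ?thesis using False w nd jz xz pz an uz g by (auto simp: wps)
  qed
 next
  fix t' v' a'
  assume "t' <= t + 1 + 2 * l * (2 * l) * (6 + 1)" "I (2 * l * (2 * l)) v' a'"
  then show "t' <= t + 1 + 2 * l * (2 * l) * 7 &
  (\<forall>r i. a' 12 r i = (if r = v 20 & 1 <= i & i <= 2 * l * (2 * l) then left_entry a g b (i - 1)
   else a 12 r i))" unfolding I_def by simp
 next
  show "I 0 v a" unfolding I_def by auto
 qed (use bd sp D in auto)
qed

lemma right_matrix_correct:
 assumes v: "v 5 = 2 * l" "v 18 = g" and bd: "bounded v a" and D: "2 * l * (2 * l) <= Z"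
 shows "wp right_matrix_code (\<lambda>t' v' a'. t' <= t + 1 + 2 * l * (2 * l) * 2 &
  (\<forall>r i. a' 12 r i = (if r = v 20 & 1 + 2 * l * (2 * l) <= i & i < 1 + 2 * l * (2 * l) + 2 * l * (2 * l)
   then right_entry a g (i - 1 - 2 * l * (2 * l)) else a 12 r i))) t v a"
proof -
 define E where "E = 2 * l * (2 * l)"
 define I where "I n v' a' \<longleftrightarrow>
  (\<forall>r i. a' 12 r i = (if r = v 20 & 1 + E <= i & i < 1 + E + n then right_entry a g (i - 1 - E) else a 12 r i))"
  for n and v' :: vars and a' :: arrays
 have z1: "1 < Z" using Z_lin by linarith
 let ?body = "St 12 (Vr 20) (Cn 1 [+] Vr 5 [*] Vr 5 [+] Vr 13) (Cn 0 [<] Ar 16 (Vr 18) (Vr 13))"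
 show ?thesis
  unfolding right_matrix_code_def
 proof (rule wp_For_const[where I = I and T = 1 and n = "E"])
  fix i t1 v1 a1
  assume i: "i < E" and I: "I i v1 a1" and bd1: "bounded v1 a1"
   and fr: "frame (For 13 (Vr 5 [*] Vr 5) ?body) v a v1 a1"
  have w: "v1 5 = 2 * l" "v1 18 = g" "v1 20 = v 20" "a1 16 = a 16"
   using frame_var[OF fr, of 5] frame_var[OF fr, of 18] frame_var[OF fr, of 20]
    frame_array[OF fr, of 16] v by auto
  have e: "v1 5 * v1 5 = E" using w by (simp add: E_def)
  have re: "of_bool (0 < a 16 g i) = right_entry a g i" "right_entry a g i < Z"
   using z1 by (simp_all add: right_entry_def)
  have "I (Suc i) v' (upd a1 12 (v 20) (1 + E + i) (right_entry a g i))" for v'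
   using I unfolding I_def by (auto simp: upd_same)
  then show "wp ?body (\<lambda>t' v' a'. t' <= t1 + 1 & I (Suc i) v' a') t1 (v1(13 := i)) a1"
   using w(2-) z1 re by (simp add: wps e)
 next
  fix t' v' a'
  assume "t' <= t + 1 + E * (1 + 1)" "I E v' a'"
  then show "t' <= t + 1 + 2 * l * (2 * l) * 2 &
  (\<forall>r i. a' 12 r i = (if r = v 20 & 1 + 2 * l * (2 * l) <= i & i < 1 + 2 * l * (2 * l) + 2 * l * (2 * l)
   then right_entry a g (i - 1 - 2 * l * (2 * l)) else a 12 r i))"
   unfolding I_def E_def[symmetric] by simp
 next
  show "I 0 v a" unfolding I_def by auto
 qed (use bd v D in \<open>auto simp: E_def\<close>)
qed

lemma product_correct:
 assumes p: "sstate s v a" and bd: "bounded v a" and b: "v 34 = b" "b < a 13 0 g div (2 * l)" "v 18 = g"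
  and N: "\<forall>i<2 * l * (2 * l). a 12 (v 20) (v 23 + i) = N i" and D: "2 * l * (2 * l) <= Z"
 shows "wp product_code (\<lambda>t' v' a'. t' <= t + 1 + 2 * l * (2 * l) * 8 &
  (\<forall>r. a' 17 0 r = (if \<exists>i<2 * l * (2 * l). out_mark a g b N i r then 1 else a 17 0 r))) t v a"
proof -
 define M where "M n r \<longleftrightarrow> (\<exists>i<n. out_mark a g b N i r)" for n r
 define I where "I n v' a' \<longleftrightarrow> (\<forall>r. a' 17 0 r = (if M n r then 1 else a 17 0 r))"
  for n and v' :: vars and a' :: arrays
 note sp = sstate_parts[OF p]
 have MS: "M (Suc n) r \<longleftrightarrow> M n r \<or> out_mark a g b N n r" for n r
  unfolding M_def by (auto simp: less_Suc_eq)
 have z1: "1 < Z" "m < Z" "2 * l < Z" using Z_lin L_ge l_le by linarith+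
 let ?body = "Asg 14 (Ar 11 (Vr 18) (Vr 34 [*] Vr 5 [+] Vr 13 [div] Vr 5));; Asg 17 (Vr 13 [mod] Vr 5);;
  Asg 8 (Ar 8 (Cn 2 [*] Vr 14 [+] Cn 1) (Vr 17));;
  provided (Vr 8) (provided (arr1 10 (Vr 8) [=] arr1 15 (Vr 18)) (
   provided (Ar 12 (Vr 20) (Vr 23 [+] Vr 13)) (
    st1 17 (arr1 6 (Vr 14) [+] Vr 17 [-] Cn 1) (Cn 1))))"
 show ?thesis
  unfolding product_code_def
 proof (rule wp_For_const[where I = I and T = 7 and n = "2 * l * (2 * l)"])
  fix i t1 v1 a1
  assume i: "i < 2 * l * (2 * l)" and I: "I i v1 a1" and bd1: "bounded v1 a1"
   and fr: "frame (For 13 (Vr 5 [*] Vr 5) ?body) v a v1 a1"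
  have w: "v1 5 = 2 * l" "v1 18 = g" "v1 34 = b" "v1 20 = v 20" "v1 23 = v 23"
   using frame_var[OF fr, of 5] frame_var[OF fr, of 18] frame_var[OF fr, of 34] frame_var[OF fr, of 20]
    frame_var[OF fr, of 23] b sp by auto
  have u: "a1 11 = a 11" "a1 8 = a 8" "a1 10 = a 10" "a1 15 = a 15" "a1 12 = a 12" "a1 6 = a 6"
   using frame_array[OF fr, of 11] frame_array[OF fr, of 8] frame_array[OF fr, of 10]
    frame_array[OF fr, of 15] frame_array[OF fr, of 12] frame_array[OF fr, of 6] by auto
  let ?j = "grid a g b i" and ?x = "i mod (2 * l)"
  let ?p = "node (Suc (2 * ?j)) ?x"
  have j: "?j < K" "0 < l" using grid_less[OF sp(4) b(2) i] by auto
  have nd: "a 8 (Suc (2 * ?j)) = node (Suc (2 * ?j))" using sp(2) j by simp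
  have jz: "?j < Z" using j D_less by auto
  have xz: "?x < 2 * l" "?x < Z" using j z1 less_trans[of ?x "2 * l" Z] by auto
  have pz: "?p < Z" using bounded_array[OF bd, of 8 "Suc (2 * ?j)" ?x] nd by simp
  have an: "a 6 0 ?j = anc ?j" using sp(8) j by auto
  have g: "a 11 g (b * (2 * l) + i div (2 * l)) = ?j" by (simp add: grid_def)
  have n: "a 12 (v 20) (v 23 + i) = N i" using N i by simp
  have om: "out_mark a g b N i r \<longleftrightarrow> ?p ~= 0 & a 10 0 ?p = a 15 0 g & N i ~= 0 & r = anc ?j + ?x - 1" for r
   by (simp add: out_mark_def Let_def)
  show "wp ?body (\<lambda>t' v' a'. t' <= t1 + 7 & I (Suc i) v' a') t1 (v1(13 := i)) a1"
  proof (cases "?p ~= 0 & a 10 0 ?p = a 15 0 g & N i ~= 0")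
   case True
   have "I (Suc i) v' (upd a1 17 0 (anc ?j + ?x - 1) 1)" for v'
    using I True unfolding I_def MS om by (simp add: upd_same)
   then show ?thesis using True w u nd jz xz pz an g n z1 by (simp add: wps)
  next
   case False
   then have "I (Suc i) v' a1" for v' using I unfolding I_def MS om by auto
   then show ?thesis using False w u nd jz xz pz an g n by (auto simp: wps)
  qed
 next
  fix t' v' a'
  assume "t' <= t + 1 + 2 * l * (2 * l) * (7 + 1)" "I (2 * l * (2 * l)) v' a'"
  then show "t' <= t + 1 + 2 * l * (2 * l) * 8 &
   (\<forall>r. a' 17 0 r = (if \<exists>i<2 * l * (2 * l). out_mark a g b N i r then 1 else a 17 0 r))"
   unfolding I_def M_def by simp
 next
  show "I 0 v a" unfolding I_def M_def by auto
 qed (use bd sp D in auto)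
qed

text \<open>Both matrices are nonnegative, so an entry of the product is nonzero exactly if some
  left depth \<open>x\<close> witnesses it. Together with the right depth, \<open>x\<close> leads to
  a string in the table of the group, and by \<open>head_eqD\<close> the nodes of the two contexts
  at these depths are the parts of that string.\<close>

lemma out_mark_iff:
 assumes p: "sstate k v a" and b: "b < a 13 0 g div (2 * l)"
  and N: "\<forall>i<2 * l * (2 * l). N i = mm_result (2 * l) (left_entry a g b) (right_entry a g) ! i"
 shows "i < 2 * l * (2 * l) ==> out_mark a g b N i r ==> \<exists>s<k. hit s (grid a g b i) & r = target s (grid a g b i)"
  and "\<lbrakk>s < k; hit s j; group_of (a 1) s = g; d < 2 * l; a 11 g (b * (2 * l) + d) = j\<rbrakk> \<Longrightarrow>
   \<exists>i<2 * l * (2 * l). out_mark a g b N i (target s j)"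
proof -
 note sp = sstate_parts[OF p]
 have ts: "table_sound k a" and tc: "table_complete k a" using p by (auto simp: sstate_def)
 have hd: "a 10 0 (node q x) = word_name T0 (head (take x (ctx q)))"
  if "q < 2 * K" "x <= length (ctx q)" for q x
  using sp(5) that take_is_prefix node_eq unfolding heads_ok_def by auto
 have live_heads: "word_name T0 (head (left s)) ~= 0 & word_name T0 (head (right s)) ~= 0" if "live s" for s
 proof -
  have pre: "\<exists>q<2 * K. prefix u (ctx q)" if "weight u ~= 0" for u
   using that unfolding weight_def by (metis (mono_tags, lifting) Collect_empty_eq card.empty)
  have "word_name T0 (head u) ~= 0" if u: "weight u ~= 0" for u
   using pre[OF u] prefix_named prefix_head prefix_order.order_trans by blast
  then show ?thesis using that by (auto simp: live_def)
 qed
 have match: "x = length u & x <= length (ctx q) ==> word_name T0 (head (take x (ctx q))) = word_name T0 (head u) ==>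
   word_name T0 (head u) ~= 0 ==> prefix u (ctx q)" for x u q
  using word_name_inj[OF names0, of "head (take x (ctx q))" "head u"] head_eqD[of "take x (ctx q)" u]
   take_is_prefix[of x "ctx q"] by auto
 {
  fix i r assume i: "i < 2 * l * (2 * l)" and om: "out_mark a g b N i r"
  let ?j = "grid a g b i" and ?y = "i mod (2 * l)"
  have j: "?j < K" "0 < l" "a 13 0 g ~= 0" using grid_less[OF sp(4) b i] by auto
  have om': "node (2 * ?j + 1) ?y ~= 0" "a 10 0 (node (2 * ?j + 1) ?y) = a 15 0 g" "N i ~= 0"
   "r = anc ?j + ?y - 1" using om by (auto simp: out_mark_def Let_def)
  obtain x where x: "x < 2 * l" "left_entry a g b (i div (2 * l) * (2 * l) + x) ~= 0"
   "right_entry a g (x * (2 * l) + ?y) ~= 0" using om'(3) N i mm_result_nz[OF i] by auto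
  have gr: "grid a g b (i div (2 * l) * (2 * l) + x) = ?j" "(i div (2 * l) * (2 * l) + x) mod (2 * l) = x"
   using x(1) j(2) by (simp_all add: grid_def)
  have le: "node (2 * ?j) x ~= 0" "a 10 0 (node (2 * ?j) x) = a 14 0 g" "ub (anc ?j - x) ~= 0"
   using x(2) gr by (auto simp: left_entry_def Let_def split: if_splits)
  obtain s where s: "s < k" "live s" "x * (2 * l) + ?y = cut s * (2 * l) + rest s" "g = group_of (a 1) s" "g ~= 0"
   using x(3) ts unfolding right_entry_def table_sound_def by (auto split: if_splits)
  have y: "?y < 2 * l" "rest s < 2 * l" using j rest_pos(2)[OF s(1)] len_less[OF s(1)] by auto
  \<comment> \<open>Both depths are below \<open>2 * l\<close>, so the table index splits
    uniquely.\<close>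
  have "?y = rest s" using arg_cong[OF s(3), of "\<lambda>u. u mod (2 * l)"] y by simp
  then have xy: "x = cut s" "?y = rest s" using s(3) j by auto
  have nm: "a 14 0 g = word_name T0 (head (left s)) & a 15 0 g = word_name T0 (head (right s))"
  proof (rule names_inj[OF sp(7)])
   have "a 1 (a 14 0 g) (a 15 0 g) = g" using sp(4) j(3) by (simp add: groups_ok_def)
   then show "a 1 (a 14 0 g) (a 15 0 g) = a 1 (word_name T0 (head (left s))) (word_name T0 (head (right s)))"
    "a 1 (a 14 0 g) (a 15 0 g) ~= 0" using s(4,5) by (auto simp: group_of_def)
  qed
  have lx: "x <= length (ctx (2 * ?j))" "?y <= length (ctx (2 * ?j + 1))"
   using node_nz[of "2 * ?j" x] node_nz[of "2 * ?j + 1" ?y] le(1) om'(1) j(1) by auto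
  have "prefix (left s) (ctx (2 * ?j))"
   by (rule match[of x]) (use lx xy hd[of "2 * ?j" x] le nm live_heads[OF s(2)] j in auto)
  moreover have "prefix (right s) (ctx (2 * ?j + 1))"
   by (rule match[of ?y]) (use lx xy hd[of "2 * ?j + 1" ?y] om' nm live_heads[OF s(2)] j in auto)
  ultimately have "hit s ?j" using j le(3) xy by (simp add: hit_def)
  moreover have "r = target s ?j" using om'(4) xy by (simp add: target_def)
  ultimately show "\<exists>s<k. hit s ?j & r = target s ?j" using s(1) by blast
 }
 {
  assume s: "s < k" and h: "hit s j" and g: "group_of (a 1) s = g" and d: "d < 2 * l"
   and j: "a 11 g (b * (2 * l) + d) = j"
  define i where "i = d * (2 * l) + rest s"
  have lv: "live s" using hit_live[OF h] .
  have y: "rest s < 2 * l" "cut s < 2 * l" using rest_pos(2)[OF s] rest_pos(1)[OF s] len_less[OF s] by auto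
  have i: "i < 2 * l * (2 * l)" "i div (2 * l) = d" "i mod (2 * l) = rest s"
  proof -
   have "i < Suc d * (2 * l)" using y by (simp add: i_def)
   also have "\<dots> <= 2 * l * (2 * l)" using d by (intro mult_le_mono1) simp
   finally show "i < 2 * l * (2 * l)" .
  qed (use y in \<open>simp_all add: i_def\<close>)
  have gj: "grid a g b i = j" using i j by (simp add: grid_def)
  have hh: "j < K" "prefix (left s) (ctx (2 * j))" "prefix (right s) (ctx (2 * j + 1))" "ub (anc j - cut s) ~= 0"
   using h by (auto simp: hit_def)
  have g0: "g ~= 0" "a 16 g (cut s * (2 * l) + rest s) ~= 0"
   using tc s lv g by (auto simp: table_complete_def)
  have a13: "a 13 0 g ~= 0" using b by (cases "a 13 0 g") auto
  have nm: "a 14 0 g = word_name T0 (head (left s)) & a 15 0 g = word_name T0 (head (right s))"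
  proof (rule names_inj[OF sp(7)])
   have "a 1 (a 14 0 g) (a 15 0 g) = g" using sp(4) a13 by (simp add: groups_ok_def)
   then show "a 1 (a 14 0 g) (a 15 0 g) = a 1 (word_name T0 (head (left s))) (word_name T0 (head (right s)))"
    "a 1 (a 14 0 g) (a 15 0 g) ~= 0" using g g0 by (auto simp: group_of_def)
  qed
  have tk: "take (cut s) (ctx (2 * j)) = left s" "take (rest s) (ctx (2 * j + 1)) = right s"
   using hh(2,3) by (auto simp: prefix_def)
  have ln: "cut s <= length (ctx (2 * j))" "rest s <= length (ctx (2 * j + 1))"
   using prefix_length_le[OF hh(2)] prefix_length_le[OF hh(3)] by auto
  have nz: "node (2 * j) (cut s) ~= 0" "node (2 * j + 1) (rest s) ~= 0"
   using node_nz[of "2 * j"] node_nz[of "2 * j + 1"] ln hh(1) by auto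
  have hd2: "a 10 0 (node (2 * j) (cut s)) = a 14 0 g" "a 10 0 (node (2 * j + 1) (rest s)) = a 15 0 g"
   using hd[of "2 * j" "cut s"] hd[of "2 * j + 1" "rest s"] ln hh(1) tk nm by auto
  have "left_entry a g b (d * (2 * l) + cut s) ~= 0"
   using nz hd2 hh(4) j y by (simp add: left_entry_def Let_def grid_def)
  moreover have "right_entry a g (cut s * (2 * l) + rest s) ~= 0" using g0 by (simp add: right_entry_def)
  ultimately have "N i ~= 0"
   using N i mm_result_nz[OF i(1)] y(2) by (metis (no_types, lifting))
  then have "out_mark a g b N i (target s j)"
   using nz hd2 gj i by (simp add: out_mark_def Let_def target_def)
  then show "\<exists>i<2 * l * (2 * l). out_mark a g b N i (target s j)" using i(1) by blast
 }
qed

lemma sstate_out: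
 assumes p: "sstate k v a" and v: "\<forall>x\<in>{0, 2, 3, 4, 5, 6, 12}. v' x = v x"
  and a: "\<forall>i. i \<notin> {12, 17} --> a' i = a i"
  and o: "\<forall>i. a' 17 0 i = a 17 0 i \<or> a' 17 0 i = 1 & a 17 0 i = 0 & (\<exists>s<k. \<exists>j. hit s j & i = target s j)"
 shows "sstate k v' a'"
proof -
 have ps: "pstate v' a'"
  by (rule pstate_cong[of v a]) (use p v a sstate_parts(7)[OF p] in \<open>auto simp: sstate_def\<close>)
 have eq: "a' 16 = a 16" "a' 13 = a 13" "a' 11 = a 11" "a' 1 = a 1" using a by simp_all
 have nz: "a' 17 0 i ~= 0" if "a 17 0 i ~= 0" for i using o[rule_format, of i] that by auto
 have "table_sound k a'" "table_complete k a'"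
  using p unfolding sstate_def table_sound_def table_complete_def eq by blast+
 moreover have "out_sound k a'"
  unfolding out_sound_def
 proof (intro allI impI)
  fix i assume "a' 17 0 i ~= 0"
  then show "a' 17 0 i = 1 & (\<exists>s<k. \<exists>j. hit s j & i = target s j)"
   using o[rule_format, of i] p unfolding sstate_def out_sound_def by metis
 qed
 moreover have "out_rest k a'"
  unfolding out_rest_def eq Let_def
 proof (intro allI impI)
  fix s j i
  assume "s < k" "hit s j" "i < a 13 0 (group_of (a 1) s)"
   "a 13 0 (group_of (a 1) s) - a 13 0 (group_of (a 1) s) mod (2 * l) <= i" "a 11 (group_of (a 1) s) i = j"
  then have "a 17 0 (target s j) ~= 0" using p unfolding sstate_def out_rest_def Let_def by blast
  then show "a' 17 0 (target s j) ~= 0" by (rule nz)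
 qed
 ultimately show ?thesis using ps by (simp add: sstate_def)
qed

lemma batch_row_correct:
 assumes p: "sstate k v a" and bd: "bounded v a" and b: "v 34 = b" "b < a 13 0 g div (2 * l)" "v 18 = g"
  and z: "\<forall>r\<ge>v 20. \<forall>i. a 12 r i = 0" and Q: "v 22 = 2 ^ w'" and r: "v 20 + 1 < Z"
  and D: "1 + 2 * (2 * l) * (2 * l) < 2 ^ w'"
  and mm: "\<And>\<alpha> \<beta>. (\<forall>i. \<alpha> i <= 1) ==> (\<forall>i. \<beta> i <= 1) ==>
   \<exists>t\<le>Tm. outputs_after w' pr (mm_input (2 * l) \<alpha> \<beta>) (mm_result (2 * l) \<alpha> \<beta>) t"
 shows "wp batch_row (\<lambda>t' v' a'. t' <= t + (10 + 2 * l * (2 * l) * 17 + Tm) & sstate k v' a' &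
  (\<forall>r\<ge>v' 20. \<forall>i. a' 12 r i = 0) & v' 20 = v 20 + 1 & (\<forall>r. a 17 0 r ~= 0 --> a' 17 0 r ~= 0) &
  (\<forall>s<k. \<forall>j. hit s j --> group_of (a 1) s = g -->
   (\<forall>d<2 * l. a 11 g (b * (2 * l) + d) = j --> a' 17 0 (target s j) ~= 0))) t v a"
proof -
 let ?n = "2 * l" and ?r = "v 20"
 let ?E = "?n * ?n"
 let ?\<alpha> = "left_entry a g b" and ?\<beta> = "right_entry a g"
 have QZ: "2 ^ w' <= Z" using Z_sub .
 have E: "?E <= Z" "1 + 2 * ?n * ?n < Z" "?n < Z" "?n < 2 ^ w'" "1 < (2::nat) ^ w'"
 proof -
  have "?E <= 1 + 2 * ?n * ?n" by simp
  then show "?E <= Z" "1 + 2 * ?n * ?n < Z" using D QZ by linarith+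
  have "?n <= ?E" by (cases l) auto
  with \<open>?E <= 1 + 2 * ?n * ?n\<close> show "?n < 2 ^ w'" "?n < Z" "1 < (2::nat) ^ w'" using D QZ by linarith+
 qed
 have ab: "?\<alpha> i <= 1" "?\<beta> i <= 1" for i
  using ub_le[of "anc (grid a g b i) - i mod (2 * l)"] by (auto simp: left_entry_def Let_def right_entry_def)
 define xs where "xs = mm_input ?n ?\<alpha> ?\<beta>"
 define ys where "ys = mm_result ?n ?\<alpha> ?\<beta>"
 obtain tm where tm: "tm <= Tm" "outputs_after w' pr xs ys tm"
  using mm[of ?\<alpha> ?\<beta>] ab unfolding xs_def ys_def by blast
 have xsl: "length xs = 1 + 2 * ?n * ?n" by (simp add: xs_def)
 let ?P = "\<lambda>t' v' a'. t' <= t + (10 + ?E * 17 + Tm) & sstate k v' a' &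
  (\<forall>r\<ge>v' 20. \<forall>i. a' 12 r i = 0) & v' 20 = v 20 + 1 & (\<forall>r. a 17 0 r ~= 0 --> a' 17 0 r ~= 0) &
  (\<forall>s<k. \<forall>j. hit s j --> group_of (a 1) s = g -->
   (\<forall>d<2 * l. a 11 g (b * (2 * l) + d) = j --> a' 17 0 (target s j) ~= 0))"
 \<comment> \<open>Describes all states inside the row up to the call: only scratch variables and
   row \<open>?r\<close> of array 12 differ from the start, so every quantity that defines the
   matrices is unchanged.\<close>
 define C where "C v' a' \<longleftrightarrow> (\<forall>x. x \<notin> {7, 8, 13, 14, 16, 17, 21, 23} --> v' x = v x) &
  (\<forall>i. i ~= 12 --> a' i = a i) & (\<forall>r>?r. a' 12 r = a 12 r) & bounded v' a'" for v' :: vars and a' :: arrays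
 have Cs: "sstate k v' a'" if "C v' a'" for v' a'
  by (rule sstate_out[OF p]) (use that in \<open>auto simp: C_def\<close>)
 have le: "left_entry a' g b = ?\<alpha>" "right_entry a' g = ?\<beta>" "b < a' 13 0 g div (2 * l)" "a' 1 = a 1" "a' 11 = a 11"
  "a' 17 = a 17" if "C v' a'" for v' a'
 proof -
  have eq: "a' 11 = a 11" "a' 10 = a 10" "a' 14 = a 14" "a' 16 = a 16" "a' 13 = a 13" "a' 1 = a 1" "a' 17 = a 17"
   using that by (auto simp: C_def)
  show "left_entry a' g b = ?\<alpha>" "right_entry a' g = ?\<beta>"
   by (rule ext, simp only: left_entry_def right_entry_def grid_def eq)+
  show "b < a' 13 0 g div (2 * l)" "a' 1 = a 1" "a' 11 = a 11" "a' 17 = a 17" using b eq by auto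
 qed
 have Cv: "v' 34 = b" "v' 18 = g" "v' 20 = ?r" "v' 5 = ?n" "v' 22 = 2 ^ w'" if "C v' a'" for v' a'
  using that b Q sstate_parts(6)[OF p] by (auto simp: C_def)
 have s6: "wp (product_code;; Asg 20 (Vr 20 [+] Cn 1)) ?P tt v6 a6"
  if tt: "tt <= t + 5 + ?E * 9 + Tm" and C: "C v6 a6" and N: "\<forall>i<?E. a6 12 ?r (v6 23 + i) = ys ! i" for tt v6 a6
 proof -
  have bd6: "bounded v6 a6" using C by (simp add: C_def)
  have "wp product_code (wp (Asg 20 (Vr 20 [+] Cn 1)) ?P) tt v6 a6"
  proof (rule wp_conseq)
   show "wp product_code (\<lambda>t' v' a'. t' <= tt + 1 + ?E * 8 &
    (\<forall>r. a' 17 0 r = (if \<exists>i<?E. out_mark a6 g b (nth ys) i r then 1 else a6 17 0 r))) tt v6 a6"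
    by (rule product_correct) (use Cs[OF C] bd6 C Cv[OF C] le[OF C] N E in auto)
  next
   fix t' and v' :: vars and a' :: arrays
   assume A: "t' <= tt + 1 + ?E * 8 &
    (\<forall>r. a' 17 0 r = (if \<exists>i<?E. out_mark a6 g b (nth ys) i r then 1 else a6 17 0 r))"
    and fr: "frame product_code v6 a6 v' a'"
   have fv: "v' x = v6 x" if "x \<notin> {13, 14, 17, 8}" for x
    using frame_var[OF fr, of x] that by (simp add: product_code_def)
   have fa: "a' x = a6 x" if "x ~= 17" for x
    using frame_array[OF fr, of x] that by (simp add: product_code_def)
   have o: "a' 17 0 r = (if \<exists>i<?E. out_mark a6 g b (nth ys) i r then 1 else a6 17 0 r)" for r
    using A by blast
   have yN: "\<forall>i<2 * l * (2 * l). ys ! i = mm_result (2 * l) (left_entry a6 g b) (right_entry a6 g) ! i"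
    unfolding le[OF C] ys_def by simp
   note om = out_mark_iff[OF Cs[OF C] le(3)[OF C] yN]
   let ?v = "v'(20 := ?r + 1)"
   have ss: "sstate k ?v a'"
   proof (rule sstate_out[OF Cs[OF C]])
    show "\<forall>i. a' 17 0 i = a6 17 0 i \<or> a' 17 0 i = 1 & a6 17 0 i = 0 & (\<exists>s<k. \<exists>j. hit s j & i = target s j)"
    proof
     fix i
     have s17: "a6 17 0 i = 0 \<or> a6 17 0 i = 1"
      using Cs[OF C] unfolding sstate_def out_sound_def by blast
     show "a' 17 0 i = a6 17 0 i \<or> a' 17 0 i = 1 & a6 17 0 i = 0 & (\<exists>s<k. \<exists>j. hit s j & i = target s j)"
     proof (cases "\<exists>x<?E. out_mark a6 g b (nth ys) x i")
      case True
      then have "\<exists>s<k. \<exists>j. hit s j & i = target s j" using om(1) by blast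
      then show ?thesis using True o[of i] s17 by auto
     next
      case False
      show ?thesis using o[of i] unfolding if_not_P[OF False] by simp
     qed
    qed
   qed (use fv fa in auto)
   have zz: "a' 12 x i = 0" if "?r + 1 <= x" for x i
    using that fa[of 12] C z by (simp add: C_def)
   have mon: "a' 17 0 x ~= 0" if "a 17 0 x ~= 0" for x
    using o[of x] that le(6)[OF C] by auto
   have hits: "a' 17 0 (target s j) ~= 0"
    if "s < k" "hit s j" "group_of (a 1) s = g" "d < ?n" "a 11 g (b * ?n + d) = j" for s j d
   proof -
    have "\<exists>i<?E. out_mark a6 g b (nth ys) i (target s j)"
     by (rule om(2)) (use that le[OF C] in auto)
    then show ?thesis using o[of "target s j"] by simp
   qed
   have P: "?P tt' ?v a'" if "tt' <= t' + 1" for tt'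
    using ss zz mon hits that A tt by (simp del: neq0_conv)
   have "v' 20 = ?r" using fv[of 20] Cv[OF C] by simp
   then show "wp (Asg 20 (Vr 20 [+] Cn 1)) ?P t' v' a'" using r P[of "t' + 1"] unfolding wps by simp
  qed (rule bd6)
  then show ?thesis by (simp only: wps)
 qed
 have s5: "wp (Call;; product_code;; Asg 20 (Vr 20 [+] Cn 1)) ?P tt v5 a5"
  if tt: "tt <= t + 4 + ?E * 9" and C: "C v5 a5" "v5 21 = length xs"
   and W: "a5 12 ?r = (\<lambda>i. if i < length xs then xs ! i else 0)" for tt v5 a5
 proof -
  have lq: "length xs < 2 ^ w'" using xsl D by simp
  obtain pc S N where run: "(step w' pr ^^ tm) (initial_config w' xs) = (pc, S, N)" "length pr <= pc"
   "\<forall>i<length ys. N (S 0 + i) = ys ! i" using tm(2) unfolding outputs_after_def by blast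
  have ic: "initial_config w' xs = (0, (\<lambda>_. 0)(0 := v5 21), a5 12 (v5 20))"
   using W lq C(2) Cv[OF C(1)] by (simp add: initial_config_def)
  have "xs ! i < 2 ^ w'" if "i < length xs" for i
  proof -
   have "xs ! i \<in> set xs" using that by simp
   moreover have "?\<alpha> j < 2 ^ w'" "?\<beta> j < 2 ^ w'" for j
    using ab[of j] E(5) by linarith+
   ultimately show ?thesis using E(4) unfolding xs_def mm_input_def by auto
  qed
  then have small: "a5 12 ?r j < 2 ^ w'" for j by (simp add: W)
  have "wp Call (wp (product_code;; Asg 20 (Vr 20 [+] Cn 1)) ?P) tt v5 a5"
  proof (rule wp_conseq)
   show "wp Call (\<lambda>t' v' a'. t' = tt + 1 + tm & v' = v5(23 := S 0) & a' = a5(12 := (a5 12)(?r := N))) tt v5 a5"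
    unfolding wp.simps using run ic lq C(2) Cv[OF C(1)] small
    by (intro conjI allI exI[of _ tm] exI[of _ pc] exI[of _ S] exI[of _ N]) simp_all
  next
   fix t' and v' :: vars and a' :: arrays
   assume A: "t' = tt + 1 + tm & v' = v5(23 := S 0) & a' = a5(12 := (a5 12)(?r := N))" and bd': "bounded v' a'"
   show "wp (product_code;; Asg 20 (Vr 20 [+] Cn 1)) ?P t' v' a'"
   proof (rule s6)
    show "C v' a'" using A bd' C by (simp add: C_def)
    show "\<forall>i<?E. a' 12 ?r (v' 23 + i) = ys ! i" using A run(3) by (simp add: ys_def)
   qed (use A tt tm in auto)
  qed (use C in \<open>simp add: C_def\<close>)
  then show ?thesis by (simp only: wps)
 qed
 let ?c4 = "Asg 21 (Cn 1 [+] Cn 2 [*] Vr 5 [*] Vr 5);; Call;; product_code;; Asg 20 (Vr 20 [+] Cn 1)"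
 \<comment> \<open>The cells written by the three preparing statements, taken together, are the
   encoded input followed by zeros.\<close>
 have row: "(if 1 + ?E <= i & i < 1 + ?E + ?E then ?\<beta> (i - 1 - ?E) else if 1 <= i & i <= ?E then ?\<alpha> (i - 1)
   else if i = 0 then ?n else 0) = (if i < length xs then xs ! i else 0)" for i
 proof -
  define e where "e = ?E"
  have "length xs = 1 + e + e" "xs = ?n # map ?\<alpha> [0..<e] @ map ?\<beta> [0..<e]"
   using xsl by (simp_all add: xs_def mm_input_def e_def)
  then show ?thesis unfolding e_def[symmetric]
   by (cases i) (auto simp: nth_append)
 qed
 let ?a1 = "upd a 12 ?r 0 ?n"
 have z1: "\<forall>i\<ge>1. ?a1 12 ?r i = 0" using z by (simp add: upd_same)
 have bd1: "bounded v ?a1" using bd E by (intro bounded_upd) auto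
 have C1: "C v ?a1" using bd1 by (auto simp: C_def upd_array upd_row)
 have s2: "wp (left_matrix_code;; right_matrix_code;; ?c4) ?P tt v ?a1" if tt: "tt <= t + 1" for tt
 proof -
  have "wp left_matrix_code (wp (right_matrix_code;; ?c4) ?P) tt v ?a1"
  proof (rule wp_conseq[OF left_matrix_correct[OF Cs[OF C1] bd1 b(1) le(3)[OF C1] b(3) z1 E(1)] bd1])
   fix t2 and v2 :: vars and a2 :: arrays
   assume A: "t2 <= tt + 1 + ?E * 7 & (\<forall>x i. a2 12 x i = (if x = ?r & 1 <= i & i <= ?E
     then left_entry ?a1 g b (i - 1) else ?a1 12 x i))"
    and bd2: "bounded v2 a2" and fr: "frame left_matrix_code v ?a1 v2 a2"
   have fv: "v2 x = v x" if "x \<notin> {13, 14, 16, 7}" for x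
    using frame_var[OF fr, of x] that by (simp add: left_matrix_code_def)
   have fa: "a2 x = a x" if "x ~= 12" for x
    using frame_array[OF fr, of x] that by (simp add: left_matrix_code_def upd_array)
   have r2: "a2 12 x i = (if x = ?r & 1 <= i & i <= ?E then ?\<alpha> (i - 1) else ?a1 12 x i)" for x i
    using A le(1)[OF C1] by simp
   have C2: "C v2 a2" using bd2 fv fa by (auto simp: C_def r2 upd_same fun_eq_iff)
   have "wp right_matrix_code (wp ?c4 ?P) t2 v2 a2"
   proof (rule wp_conseq[OF right_matrix_correct[OF Cv(4)[OF C2] Cv(2)[OF C2] bd2 E(1)] bd2])
    fix t3 and v3 :: vars and a3 :: arrays
    assume B: "t3 <= t2 + 1 + ?E * 2 & (\<forall>x i. a3 12 x i = (if x = v2 20 & 1 + ?E <= i & i < 1 + ?E + ?E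
      then right_entry a2 g (i - 1 - ?E) else a2 12 x i))"
     and bd3: "bounded v3 a3" and fr3: "frame right_matrix_code v2 a2 v3 a3"
    have fv3: "v3 x = v2 x" if "x ~= 13" for x
     using frame_var[OF fr3, of x] that by (simp add: right_matrix_code_def)
    have fa3: "a3 x = a2 x" if "x ~= 12" for x
     using frame_array[OF fr3, of x] that by (simp add: right_matrix_code_def)
    have r3: "a3 12 x i = (if x = ?r & 1 + ?E <= i & i < 1 + ?E + ?E then ?\<beta> (i - 1 - ?E) else a2 12 x i)" for x i
     using B le(2)[OF C2] Cv(3)[OF C2] by simp
    have C3: "C v3 a3" using C2 bd3 fv3 fa3 by (auto simp: C_def r3 fun_eq_iff)
    let ?v = "v3(21 := length xs)"
    have bd4: "bounded ?v a3" using bd3 E xsl by (intro bounded_asg) auto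
    have W: "a3 12 ?r = (\<lambda>i. if i < length xs then xs ! i else 0)"
     unfolding row[symmetric] fun_eq_iff r3 r2 using z by (auto simp: upd_same)
    have "wp (Call;; product_code;; Asg 20 (Vr 20 [+] Cn 1)) ?P (t3 + 1) ?v a3"
     by (rule s5) (use C3 bd4 W A B tt in \<open>auto simp: C_def\<close>)
    moreover have "val Z (Cn 1 [+] Cn 2 [*] Vr 5 [*] Vr 5) v3 a3 = length xs"
     using Cv(4)[OF C3] xsl by simp
    ultimately show "wp ?c4 ?P t3 v3 a3"
     unfolding wp.simps(6)[of "Asg 21 (Cn 1 [+] Cn 2 [*] Vr 5 [*] Vr 5)"] wp.simps(2)[of 21]
     using E(2) xsl by (simp only: simp_thms)
   qed
   then show "wp (right_matrix_code;; ?c4) ?P t2 v2 a2" by (simp only: wps)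
  qed
  then show ?thesis by (simp only: wps)
 qed
 show ?thesis
  unfolding batch_row_def
  by (rule wp_St_seq[OF _ _ _ E(3) s2[OF order_refl]]) (use sstate_parts(6)[OF p] in simp_all)
qed

definition batches :: "arrays \<Rightarrow> nat" where "batches a = (\<Sum>g<Z. a 13 0 g div (2 * l))"

text \<open>This bounds the number of products: each of them uses up \<open>2 * l\<close>
  memberships, and there are at most \<open>K * (E * E)\<close> memberships in total.\<close>

lemma batches_le: "batches a * (2 * l) <= group_sum a"
 unfolding batches_def group_sum_def sum_distrib_right by (intro sum_mono) simp

text \<open>The head of a part of the string is itself a prefix of the context, hence one of the
  heads at which the anchor was entered into groups.\<close>

lemma hit_in_group:
 assumes p: "sstate k v a" and s: "s < k" and h: "hit s j"
 shows "\<exists>i<a 13 0 (group_of (a 1) s). a 11 (group_of (a 1) s) i = j"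
proof -
 have hh: "j < K" "prefix (left s) (ctx (2 * j))" "prefix (right s) (ctx (2 * j + 1))"
  using h by (auto simp: hit_def)
 have hs: "length (head u) \<in> head_set q & node q (length (head u)) = word_name T0 (head u)"
  if "prefix u (ctx q)" "length u < 2 * l" for u q
 proof -
  have pr: "prefix (head u) (ctx q)" using prefix_head that(1) prefix_order.order_trans by blast
  then have "take (length (head u)) (ctx q) = head u" by (auto simp: prefix_def)
  then show ?thesis
   using prefix_length_le[OF pr] prefix_length_le[OF prefix_head[of u]] that(2)
   by (simp add: head_set_def node_eq)
 qed
 have ln: "cut s < 2 * l" "rest s < 2 * l"
  using rest_pos[OF s] len_less[OF s] by auto
 have "in_group a j (length (head (left s))) (length (head (right s)))"
  using p hh hs[OF hh(2)] hs[OF hh(3)] ln by (simp add: sstate_def pstate_def)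
 then show ?thesis
  using hs[OF hh(2)] hs[OF hh(3)] ln by (simp add: in_group_def Let_def group_of_def)
qed

lemma batch_correct:
 assumes p: "sstate k v a" and bd: "bounded v a"
  and z: "\<And>r i. a 12 r i = 0" and Q: "v 22 = 2 ^ w'" and Zs: "batches a + 1 < Z" "v 6 + 1 < Z"
  and D: "1 + 2 * (2 * l) * (2 * l) < 2 ^ w'"
  and mm: "\<And>\<alpha> \<beta>. (\<forall>i. \<alpha> i <= 1) ==> (\<forall>i. \<beta> i <= 1) ==>
   \<exists>t\<le>Tm. outputs_after w' pr (mm_input (2 * l) \<alpha> \<beta>) (mm_result (2 * l) \<alpha> \<beta>) t"
 shows "wp batch_code (\<lambda>t' v' a'. t' <= t + 2 + (v 6 + 1) * 2 + batches a * (11 + 2 * l * (2 * l) * 17 + Tm) &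
  (\<forall>i. a' 17 0 i = of_bool (\<exists>s<k. \<exists>j. hit s j & i = target s j))) t v a"
proof -
 let ?n = "2 * l"
 define T where "T = 10 + ?n * ?n * 17 + Tm"
 define G where "G g = a 13 0 g div ?n" for g
 define cov where "cov g c a' \<longleftrightarrow> (\<forall>s<k. \<forall>j. hit s j --> group_of (a 1) s = g -->
   (\<forall>i<c * ?n. a 11 g i = j --> a' 17 0 (target s j) ~= 0))" for g c and a' :: arrays
 define I where "I g v' a' \<longleftrightarrow> sstate k v' a' & (\<forall>r\<ge>v' 20. \<forall>i. a' 12 r i = 0) &
  v' 20 <= (\<Sum>h<g. G h) & (\<forall>h<g. cov h (G h) a')" for g and v' :: vars and a' :: arrays
 define J where "J g b v' a' \<longleftrightarrow> sstate k v' a' & (\<forall>r\<ge>v' 20. \<forall>i. a' 12 r i = 0) &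
  v' 20 <= (\<Sum>h<g. G h) + b & (\<forall>h<g. cov h (G h) a') & cov g b a'" for g b and v' :: vars and a' :: arrays
 have z0: "0 < Z" using Zs by linarith
 have l0: "0 < l" if "b < G g" for g b using that by (cases l) (auto simp: G_def)
 let ?v = "v(20 := 0)"
 let ?inner = "For 34 (arr1 13 (Vr 18) [div] Vr 5) batch_row"
 let ?outer = "For 18 (Vr 6 [+] Cn 1) ?inner"
 have part: "(\<Sum>h<g. G h) <= batches a" if "g <= Z" for g
  unfolding batches_def G_def by (rule sum_mono2) (use that in auto)
 have s0: "sstate k ?v a" by (rule sstate_out[OF p]) auto
 have bd0: "bounded ?v a" using bd z0 by (intro bounded_asg)
 have main: "wp ?outer (\<lambda>t' v' a'. t' <= t + 2 + (v 6 + 1) * 2 + batches a * (1 + T) &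
  (\<forall>i. a' 17 0 i = of_bool (\<exists>s<k. \<exists>j. hit s j & i = target s j))) tt ?v a" if tt: "tt <= t + 1" for tt
 proof (rule wp_For[where I = I and n = "v 6 + 1" and T = "\<lambda>g. 1 + G g * (T + 1)"])
  fix g t1 v1 a1
  assume g: "g < v 6 + 1" and I: "I g v1 a1" and bd1: "bounded v1 a1" and fr: "frame ?outer ?v a v1 a1"
  have w: "v1 5 = ?n" "v1 22 = 2 ^ w'" "v1 6 = v 6"
   using frame_var[OF fr, of 5] frame_var[OF fr, of 22] frame_var[OF fr, of 6] Q sstate_parts(6)[OF p]
   by (auto simp: batch_row_def left_matrix_code_def right_matrix_code_def product_code_def)
  have u: "a1 13 = a 13" "a1 11 = a 11" "a1 1 = a 1"
   using frame_array[OF fr, of 13] frame_array[OF fr, of 11] frame_array[OF fr, of 1]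
   by (auto simp: batch_row_def left_matrix_code_def right_matrix_code_def product_code_def)
  let ?v1 = "v1(18 := g)"
  have gZ: "g < Z" "g + 1 <= Z" using g Zs by linarith+
  have bd2: "bounded ?v1 a1" using bd1 gZ by (intro bounded_asg)
  have s1: "sstate k ?v1 a1" by (rule sstate_out[of v1 a1]) (use I in \<open>auto simp: I_def\<close>)
  have "a 13 0 g < Z" using bounded_array[OF bd, of 13 0 g] by simp
  then have GZ: "G g <= Z" using div_le_dividend[of "a 13 0 g" ?n] unfolding G_def by linarith
  have J0: "J g 0 ?v1 a1" using I s1 unfolding J_def I_def cov_def by auto
  have rows: "(\<Sum>h<g. G h) + b < batches a" if "b < G g" for b
  proof -
   have "(\<Sum>h<g. G h) + b < (\<Sum>h<g + 1. G h)" using that by simp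
   also have "\<dots> <= batches a" using part[OF gZ(2)] .
   finally show ?thesis .
  qed
  show "wp ?inner (\<lambda>t' v' a'. t' <= t1 + (1 + G g * (T + 1)) & I (Suc g) v' a') t1 ?v1 a1"
  proof (rule wp_For_const[where I = "J g" and n = "G g" and T = T])
   fix b t2 v2 a2
   assume b: "b < G g" and J: "J g b v2 a2" and bd2: "bounded v2 a2" and fr2: "frame ?inner ?v1 a1 v2 a2"
   have w2: "v2 18 = g" "v2 22 = 2 ^ w'"
    using frame_var[OF fr2, of 18] frame_var[OF fr2, of 22] w
    by (auto simp: batch_row_def left_matrix_code_def right_matrix_code_def product_code_def)
   have u2: "a2 13 = a 13" "a2 11 = a 11" "a2 1 = a 1"
    using frame_array[OF fr2, of 13] frame_array[OF fr2, of 11] frame_array[OF fr2, of 1] u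
    by (auto simp: batch_row_def left_matrix_code_def right_matrix_code_def product_code_def)
   let ?v2 = "v2(34 := b)"
   have s2: "sstate k ?v2 a2" by (rule sstate_out[of v2 a2]) (use J in \<open>auto simp: J_def\<close>)
   have "b < Z" using b GZ by simp
   then have bd3: "bounded ?v2 a2" using bd2 by (intro bounded_asg)
   have r2: "v2 20 + 1 < Z" using J rows[OF b] Zs(1) unfolding J_def by linarith
   show "wp batch_row (\<lambda>t' v' a'. t' <= t2 + T & J g (Suc b) v' a') t2 ?v2 a2"
   proof (rule wp_mono[OF batch_row_correct[OF s2 bd3, where b = b and g = g]])
    show "b < a2 13 0 g div (2 * l)" using b u2 by (simp add: G_def)
    show "\<forall>r\<ge>?v2 20. \<forall>i. a2 12 r i = 0" using J by (simp add: J_def)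
   next
    fix t' and v' :: vars and a' :: arrays
    assume A: "t' <= t2 + (10 + 2 * l * (2 * l) * 17 + Tm) & sstate k v' a' &
     (\<forall>r\<ge>v' 20. \<forall>i. a' 12 r i = 0) & v' 20 = ?v2 20 + 1 & (\<forall>r. a2 17 0 r ~= 0 --> a' 17 0 r ~= 0) &
     (\<forall>s<k. \<forall>j. hit s j --> group_of (a2 1) s = g -->
      (\<forall>d<2 * l. a2 11 g (b * (2 * l) + d) = j --> a' 17 0 (target s j) ~= 0))"
    have mon: "cov h c a2 ==> cov h c a'" for h c using A unfolding cov_def by blast
    have "cov g (Suc b) a'"
     unfolding cov_def
    proof (intro allI impI)
     fix s j i assume h: "s < k" "hit s j" "group_of (a 1) s = g" "i < Suc b * ?n" "a 11 g i = j"
     show "a' 17 0 (target s j) ~= 0"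
     proof (cases "i < b * ?n")
      case True
      then show ?thesis using J mon h unfolding J_def cov_def by blast
     next
      case False
      then have "i - b * ?n < ?n" "b * ?n + (i - b * ?n) = i" using h(4) by auto
      then show ?thesis using A h u2 by metis
     qed
    qed
    then show "t' <= t2 + T & J g (Suc b) v' a'" using A J mon by (simp add: J_def T_def)
   qed (use w2 r2 D mm in auto)
  next
   fix t' v' a'
   assume "t' <= t1 + 1 + G g * (T + 1)" "J g (G g) v' a'"
   then show "t' <= t1 + (1 + G g * (T + 1)) & I (Suc g) v' a'"
    by (auto simp: I_def J_def less_Suc_eq)
  next
   show "val Z (arr1 13 (Vr 18) [div] Vr 5) ?v1 a1 = G g" using u w by (simp add: G_def)
  qed (use J0 bd2 GZ in auto)
 next
  fix t' v' a'
  assume t': "t' <= tt + 1 + (\<Sum>g<v 6 + 1. 1 + G g * (T + 1) + 1)" and I: "I (v 6 + 1) v' a'"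
   and fr: "frame ?outer ?v a v' a'"
  have u: "a' 13 = a 13" "a' 11 = a 11" "a' 1 = a 1"
   using frame_array[OF fr, of 13] frame_array[OF fr, of 11] frame_array[OF fr, of 1]
   by (auto simp: batch_row_def left_matrix_code_def right_matrix_code_def product_code_def)
  have "(\<Sum>g<v 6 + 1. 1 + G g * (T + 1) + 1) = (\<Sum>g<v 6 + 1. 2 + G g * (T + 1))" by simp
  also have "\<dots> = (v 6 + 1) * 2 + (\<Sum>g<v 6 + 1. G g) * (T + 1)"
   unfolding sum.distrib sum_distrib_right by simp
  also have "\<dots> <= (v 6 + 1) * 2 + batches a * (T + 1)"
   using part[of "v 6 + 1"] Zs(2) by (intro add_left_mono mult_le_mono1) simp
  finally have time: "t' <= t + 2 + (v 6 + 1) * 2 + batches a * (1 + T)" using t' tt by simp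
  have ss: "sstate k v' a'" using I by (simp add: I_def)
  have "a' 17 0 i = of_bool (\<exists>s<k. \<exists>j. hit s j & i = target s j)" for i
  proof (cases "\<exists>s<k. \<exists>j. hit s j & i = target s j")
   case True
   then obtain s j where h: "s < k" "hit s j" "i = target s j" by blast
   let ?g = "group_of (a 1) s"
   obtain x where x: "x < a 13 0 ?g" "a 11 ?g x = j" using hit_in_group[OF p h(1,2)] by blast
   have "a' 17 0 i ~= 0"
   \<comment> \<open>The anchor is either in a full batch, covered by the products, or left over and
     marked when the string was processed.\<close>
   proof (cases "x < G ?g * ?n")
    case True
    have "?g < v 6 + 1" using names_le[OF sstate_parts(7)[OF p]] by (simp add: group_of_def less_Suc_eq_le)
    then have "cov ?g (G ?g) a'" using I unfolding I_def by blast
    then show ?thesis using h x True unfolding cov_def by blast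
   next
    case False
    then have "a 13 0 ?g - a 13 0 ?g mod ?n <= x"
     by (simp add: G_def minus_mod_eq_div_mult[symmetric])
    then show ?thesis using ss h x unfolding sstate_def out_rest_def Let_def u by blast
   qed
   then have "a' 17 0 i = 1" using ss unfolding sstate_def out_sound_def by blast
   then show ?thesis using True by simp
  next
   case False
   then have "a' 17 0 i = 0" using ss unfolding sstate_def out_sound_def by blast
   then show ?thesis unfolding of_bool_def if_not_P[OF False] .
  qed
  then show "t' <= t + 2 + (v 6 + 1) * 2 + batches a * (1 + T) &
   (\<forall>i. a' 17 0 i = of_bool (\<exists>s<k. \<exists>j. hit s j & i = target s j))" using time by blast
 next
  show "I 0 ?v a" using s0 z by (simp add: I_def)
 qed (use bd0 Zs in auto)
 have "1 + T = 11 + 2 * l * (2 * l) * 17 + Tm" by (simp add: T_def)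
 then have "wp ?outer (\<lambda>t' v' a'. t' <= t + 2 + (v 6 + 1) * 2 + batches a * (11 + 2 * l * (2 * l) * 17 + Tm) &
   (\<forall>i. a' 17 0 i = of_bool (\<exists>s<k. \<exists>j. hit s j & i = target s j))) (t + 1) ?v a"
  using main[OF order_refl] by (simp only:)
 moreover have "val Z (Cn 0) v a = 0" by simp
 ultimately show ?thesis unfolding batch_code_def wp.simps(2,6) using z0 by (simp only: simp_thms)
qed

end

section \<open>Correctness of the algorithm\<close>

lemma sper_at_cong:
 assumes "\<forall>x<l. f (i + x) = g (j + x)"
 shows "sper_at l f i \<longleftrightarrow> sper_at l g j"
proof -
 have "periodic_at l f i p \<longleftrightarrow> periodic_at l g j p" for p
 proof -
  have "f (i + x) = f (i + x + p) \<longleftrightarrow> g (j + x) = g (j + x + p)" if "x + p < l" for x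
   using assms[rule_format, of x] assms[rule_format, of "x + p"] that by (simp add: add.assoc)
  then show ?thesis by (auto simp: periodic_at_def)
 qed
 then show ?thesis by (simp add: sper_at_def)
qed

section \<open>The pattern has few switches\<close>

lemma periodic_at_shift:
 assumes "periodic_at l f i p" "x + c * p < l"
 shows "f (i + x + c * p) = f (i + x)"
 using assms(2)
proof (induction c)
 case (Suc c)
 have "f (i + x + Suc c * p) = f (i + (x + c * p) + p)" by (rule arg_cong[where f = f]) simp
 also have "\<dots> = f (i + (x + c * p))"
  using assms(1)[unfolded periodic_at_def, rule_format, of "x + c * p"] Suc.prems by simp
 also have "\<dots> = f (i + x + c * p)" by (simp only: add.assoc)
 also have "\<dots> = f (i + x)" using Suc by simp
 finally show ?case .
qed simp

text \<open>
 The overlap of two strongly periodic windows at distance at most half their length is as long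
 as both periods together, so the period of the first window extends to the second one.
\<close>

lemma sper_between:
 assumes "sper_at l f i" "sper_at l f j" "i <= t" "t <= j" "2 * j <= 2 * i + l"
 shows "sper_at l f t"
proof -
 obtain p where p: "1 <= p" "4 * p <= l" "periodic_at l f i p" using assms(1) by (auto simp: sper_at_def)
 obtain q where q: "1 <= q" "4 * q <= l" "periodic_at l f j q" using assms(2) by (auto simp: sper_at_def)
 have ext: "f x = f (x + p)" if x: "i <= x" "x + p < j + l" for x
 proof -
  have A: "f y = f (y + p)" if "i <= y" "y + p < i + l" for y
   using p(3)[unfolded periodic_at_def, rule_format, of "y - i"] that by simp
  show ?thesis
  proof (cases "x + p < i + l")
   case False
   \<comment> \<open>If \<open>x + p\<close> is outside the first window, \<open>x\<close> is moved
     back by multiples of \<open>q\<close> to \<open>j + r\<close> with \<open>r < q\<close>. From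
     there a step by \<open>p\<close> stays inside the first window, because \<open>p + q\<close>
     and \<open>j - i\<close> are each at most half of \<open>l\<close>.\<close>
   then have xj: "j <= x" using p assms(5) by linarith
   define r where "r = (x - j) mod q"
   define c where "c = (x - j) div q"
   have x': "x = j + r + c * q" using xj by (simp add: r_def c_def)
   have r: "r < q" using q(1) by (simp add: r_def)
   have "f (j + r + c * q) = f (j + r)" using x x' by (intro periodic_at_shift[OF q(3)]) simp
   moreover have "f (j + (r + p) + c * q) = f (j + (r + p))"
    using x x' by (intro periodic_at_shift[OF q(3)]) simp
   moreover have "f (j + r) = f (j + r + p)" using r p q assms by (intro A) auto
   ultimately show ?thesis unfolding x' by (simp add: ac_simps)
  qed (use A x in auto)
 qed
 have "periodic_at l f t p"
  unfolding periodic_at_def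
 proof (intro allI impI)
  fix x assume "x + p < l"
  then show "f (t + x) = f (t + x + p)" using assms by (intro ext) auto
 qed
 then show ?thesis using p by (auto simp: sper_at_def)
qed

text \<open>Buckets of width \<open>h = l div 2 + 1\<close> contain at most one element each, which
  leaves room for \<open>m div h + 1\<close> elements; multiplying by \<open>l <= 2 * h\<close>
  gives at most \<open>2 * m + l\<close>.\<close>

lemma card_separated:
 fixes S :: "nat set"
 assumes "S \<subseteq> {..<m}" "\<And>i j. i \<in> S ==> j \<in> S ==> i < j ==> l < 2 * (j - i)" "S ~= {} ==> l <= m"
 shows "card S * l <= 3 * m"
proof (cases "S = {}")
 case False
 define h where "h = l div 2 + 1"
 have h: "0 < h" "l <= 2 * h" "2 * h <= l + 2" by (auto simp: h_def)
 have "inj_on (\<lambda>i. i div h) S"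
 proof (rule linorder_inj_onI')
  fix i j assume ij: "i \<in> S" "j \<in> S" "i < j"
  have "l < 2 * (j - i)" using assms(2) ij by blast
  then have "h <= j - i" by (auto simp: h_def)
  then have "i + h <= j" using ij by simp
  then have "(i + h) div h <= j div h" by (rule div_le_mono)
  then show "i div h ~= j div h" using h(1) by simp
 qed
 moreover have "(\<lambda>i. i div h) ` S \<subseteq> {..m div h}" using assms(1) by (auto intro!: div_le_mono)
 ultimately have "card S <= card {..m div h}" by (intro card_inj_on_le) auto
 then have "card S * l <= (m div h + 1) * l" by (intro mult_le_mono1) simp
 also have "\<dots> <= m div h * (2 * h) + l" using h(2) by simp
 also have "\<dots> <= 3 * m"
 proof -
  have "m div h * (2 * h) = 2 * (m div h * h)" by simp
  then show ?thesis using assms(3)[OF False] div_times_less_eq_dividend[of m h] by linarith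
 qed
 finally show ?thesis .
qed simp

text \<open>Switches out of and into strong periodicity are counted separately. Two of the same kind
  at distance at most \<open>l / 2\<close> would enclose a window that is not strongly periodic
  between two that are, contrary to \<open>sper_between\<close>.\<close>

lemma card_switches:
 "card {i. i + l < m & sper_at l f (c + i) ~= sper_at l f (c + i + 1)} * l <= 6 * m"
proof -
 define A where "A = {i. i + l < m & sper_at l f (c + i) & \<not> sper_at l f (c + i + 1)}"
 define B where "B = {i. i + l < m & \<not> sper_at l f (c + i) & sper_at l f (c + i + 1)}"
 have A: "card A * l <= 3 * m"
 proof (rule card_separated)
  fix i j assume "i \<in> A" "j \<in> A" and ij: "i < j"
  then have A: "sper_at l f (c + i)" "\<not> sper_at l f (c + i + 1)" "sper_at l f (c + j)"
   by (simp_all add: A_def)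
  show "l < 2 * (j - i)"
  proof (rule ccontr)
   assume "\<not> l < 2 * (j - i)"
   then have "sper_at l f (c + i + 1)"
    using ij by (intro sper_between[OF A(1,3)]) auto
   then show False using A(2) by simp
  qed
 next
  show "A \<subseteq> {..<m}" "A ~= {} ==> l <= m" unfolding A_def by fastforce+
 qed
 have B: "card B * l <= 3 * m"
 proof (rule card_separated)
  fix i j assume "i \<in> B" "j \<in> B" and ij: "i < j"
  then have B: "sper_at l f (c + i + 1)" "\<not> sper_at l f (c + j)" "sper_at l f (c + j + 1)"
   by (simp_all add: B_def)
  show "l < 2 * (j - i)"
  proof (rule ccontr)
   assume "\<not> l < 2 * (j - i)"
   then have "sper_at l f (c + j)"
    using ij by (intro sper_between[OF B(1,3)]) auto
   then show False using B(2) by simp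
  qed
 next
  show "B \<subseteq> {..<m}" "B ~= {} ==> l <= m" unfolding B_def by fastforce+
 qed
 have "{i. i + l < m & sper_at l f (c + i) ~= sper_at l f (c + i + 1)} = A \<union> B"
  unfolding A_def B_def by blast
 then have "card {i. i + l < m & sper_at l f (c + i) ~= sper_at l f (c + i + 1)} <= card A + card B"
  using card_Un_le by metis
 then have "card {i. i + l < m & sper_at l f (c + i) ~= sper_at l f (c + i + 1)} * l <= (card A + card B) * l"
  by (rule mult_le_mono1)
 also have "\<dots> = card A * l + card B * l" by (rule distrib_right)
 finally show ?thesis using A B by linarith
qed

lemma prefix_nthI: "length u <= length v ==> (\<And>x. x < length u ==> u ! x = v ! x) ==> prefix u v"
 by (metis nth_take_lemma order_refl take_all take_is_prefix)

lemma prefix_nthD: "prefix u v ==> x < length u ==> u ! x = v ! x"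
 by (auto simp: prefix_def nth_append)

context string_ram
begin

text \<open>From left to right, the two matching contexts are pieced together at the anchor. From
  right to left, an occurrence copies the two windows at the first switch of the string into the
  pattern, which makes their position there an anchor.\<close>

lemma hit_iff:
 assumes s: "s < k" and anc: "\<And>i. i < m ==> is_anchor f i ==> \<exists>j<K. anc j = i"
 shows "(\<exists>j. hit s j & i = target s j) \<longleftrightarrow>
  (\<exists>b\<ge>1. b + len s <= m & ub b ~= 0 & (\<forall>x<len s. f (off s + 1 + x) = f (2 + b + x)) & i + 1 = b + len s)"
proof safe
 fix j assume h: "hit s j"
 have hh: "j < K" "prefix (left s) (ctx (2 * j))" "prefix (right s) (ctx (2 * j + 1))" "ub (anc j - cut s) ~= 0"
  using h by (auto simp: hit_def)
 let ?b = "anc j - cut s"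
 have ln: "cut s <= length (ctx (2 * j))" "rest s <= length (ctx (2 * j + 1))"
  using prefix_length_le[OF hh(2)] prefix_length_le[OF hh(3)] by auto
 then have c: "cut s <= anc j" "rest s <= m - anc j" using length_ctx[of "2 * j"] length_ctx[of "2 * j + 1"] hh(1) by auto
 have cr: "cut s + rest s = len s" "0 < rest s" using rest_pos[OF s] by auto
 have b: "1 <= ?b" using hh(4) ub_0 by (cases "?b") auto
 have eq: "f (off s + 1 + x) = f (2 + ?b + x)" if x: "x < len s" for x
 proof (cases "x < cut s")
  case True
  let ?y = "cut s - 1 - x"
  have "left s ! ?y = ctx (2 * j) ! ?y" using True by (intro prefix_nthD[OF hh(2)]) simp
  moreover have "left s ! ?y = f (off s + 1 + x)" using True by (simp add: left_def Suc_diff_Suc)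
  moreover have "ctx (2 * j) ! ?y = f (2 + ?b + x)"
  proof -
   have "1 + (anc j - ?y) = 2 + ?b + x" using True c by simp
   then show ?thesis using ctx_nth[of "2 * j" ?y] hh(1) True ln by simp
  qed
  ultimately show ?thesis by simp
 next
  case False
  let ?y = "x - cut s"
  have y: "?y < rest s" using False x cr by simp
  have "right s ! ?y = ctx (2 * j + 1) ! ?y" using y by (intro prefix_nthD[OF hh(3)]) simp
  moreover have "right s ! ?y = f (off s + 1 + x)" using False y by (simp add: right_def)
  moreover have "ctx (2 * j + 1) ! ?y = f (2 + ?b + x)"
  proof -
   have "2 + (anc j + ?y) = 2 + ?b + x" using False c by simp
   then show ?thesis using ctx_nth[of "2 * j + 1" ?y] hh(1) y ln by simp
  qed
  ultimately show ?thesis by simp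
 qed
 have "?b + len s <= m" using c cr anc_less[OF hh(1)] by simp
 moreover have "target s j + 1 = ?b + len s" using c cr by (simp add: target_def)
 ultimately show "\<exists>b\<ge>1. b + len s <= m & ub b ~= 0 & (\<forall>x<len s. f (off s + 1 + x) = f (2 + b + x)) &
   target s j + 1 = b + len s" using b hh(4) eq by blast
next
 fix b assume b: "1 <= b" "b + len s <= m" "0 < ub b" "\<forall>x<len s. f (off s + 1 + x) = f (2 + b + x)" "i + 1 = b + len s"
 let ?p = "b + cut s"
 have cr: "cut s + rest s = len s" "0 < rest s" "cut s + l < len s" "len s < 2 * l"
  using rest_pos[OF s] cut_less[OF s] len_less[OF s] by auto
 have "sper_at l f (off s + 1 + cut s) = sper_at l f (2 + ?p)"
  by (rule sper_at_cong) (use b(4) cr in \<open>auto simp: add.assoc\<close>)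
 moreover have "sper_at l f (off s + 1 + cut s + 1) = sper_at l f (3 + ?p)"
 proof (rule sper_at_cong, intro allI impI)
  fix x assume "x < l"
  then have "f (off s + 1 + (cut s + 1 + x)) = f (2 + b + (cut s + 1 + x))"
   using b(4)[rule_format, of "cut s + 1 + x"] cr by simp
  moreover have "off s + 1 + (cut s + 1 + x) = off s + 1 + cut s + 1 + x" "2 + b + (cut s + 1 + x) = 3 + ?p + x"
   by simp_all
  ultimately show "f (off s + 1 + cut s + 1 + x) = f (3 + ?p + x)" by (simp only:)
 qed
 ultimately have an: "is_anchor f ?p"
  using cut_switch[OF s] b cr unfolding is_anchor_def is_switch_def by simp
 have pm: "?p < m" using b cr by simp
 obtain j where j: "j < K" "anc j = ?p" using anc[OF pm an] by blast
 have "prefix (left s) (ctx (2 * j))"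
 proof (rule prefix_nthI)
  show "length (left s) <= length (ctx (2 * j))" using j length_ctx[of "2 * j"] cr by simp
  fix x assume x: "x < length (left s)"
  have "ctx (2 * j) ! x = f (1 + (?p - x))" using ctx_nth[of "2 * j" x] j length_ctx[of "2 * j"] cr x by simp
  moreover have "off s + 1 + (cut s - 1 - x) = off s + cut s - x" "2 + b + (cut s - 1 - x) = 1 + (?p - x)"
   using x by auto
  ultimately show "left s ! x = ctx (2 * j) ! x"
   using b(4)[rule_format, of "cut s - 1 - x"] x cr by (simp add: left_def)
 qed
 moreover have "prefix (right s) (ctx (2 * j + 1))"
 proof (rule prefix_nthI)
  show "length (right s) <= length (ctx (2 * j + 1))" using j length_ctx[of "2 * j + 1"] cr b by simp
  fix x assume x: "x < length (right s)"
  have "ctx (2 * j + 1) ! x = f (2 + (?p + x))"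
   using ctx_nth[of "2 * j + 1" x] j length_ctx[of "2 * j + 1"] cr x b by simp
  then show "right s ! x = ctx (2 * j + 1) ! x"
   using b(4)[rule_format, of "cut s + x"] x cr by (simp add: right_def ac_simps)
 qed
 ultimately have "hit s j" using j b(3) by (simp add: hit_def)
 moreover have "i = target s j" using b(5) j cr by (simp add: target_def)
 ultimately show "\<exists>j. hit s j & i = target s j" by blast
qed

end

text \<open>Computed once, so that later frame arguments need not unfold the code.\<close>

lemma mods [simp]:
 "mod_vars read_code = {2, 3, 4, 5, 6}" "mod_arrays read_code = {}"
 "mod_vars half_code = {10, 11, 13}" "mod_arrays half_code = {}"
 "mod_vars letter_code = {6, 7, 8, 9, 13}" "mod_arrays letter_code = {1, 2, 3, 31}"
 "mod_vars double_code = {6, 7, 8, 9, 10, 13, 14}" "mod_arrays double_code = {1, 3}"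
 "mod_vars sp_code = {7, 13, 14, 16, 31, 32, 33, 34}" "mod_arrays sp_code = {4, 5}"
 "mod_vars anchor_code = {12, 13}" "mod_arrays anchor_code = {6, 7}"
 "mod_vars ctx_code = {6, 7, 8, 9, 15, 16, 30, 33}" "mod_arrays ctx_code = {1, 8}"
 "mod_vars count_code = {7, 15, 16}" "mod_arrays count_code = {9}"
 "mod_vars head_code = {7, 8, 15, 16}" "mod_arrays head_code = {10}"
 "mod_vars group_code = {6, 7, 8, 9, 14, 16, 17}" "mod_arrays group_code = {1, 11, 13, 14, 15}"
 "mod_vars string_code = {6, 7, 8, 9, 13, 14, 15, 16, 17, 24, 25, 26, 27, 28, 29}"
 "mod_arrays string_code = {1, 16, 17}"
 "mod_vars batch_code = {7, 8, 13, 14, 16, 17, 18, 20, 21, 23, 34}" "mod_arrays batch_code = {12, 17}"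
 by (auto simp: read_code_def half_code_def letter_code_def double_code_def name_code_def sp_code_def block_code_def
  anchor_code_def ctx_code_def walk_code_def count_code_def count_row_def head_code_def head_row_def
  group_code_def group_row_def group_inner_def string_code_def string_row_def find_code_def word_code_def
  link_code_def check_code_def batch_code_def batch_row_def left_matrix_code_def right_matrix_code_def
  product_code_def)

lemma mods_pow: "mod_vars (pow_code d) \<subseteq> {13, 22, 33}" "mod_arrays (pow_code d) = {}"
proof -
 have "mod_vars (foldr (\<lambda>_. Sq (Asg x e)) xs Skip) \<subseteq> {x}" "mod_arrays (foldr (\<lambda>_. Sq (Asg x e)) xs Skip) = {}"
  for x e and xs :: "nat list" by (induction xs) auto
 then show "mod_vars (pow_code d) \<subseteq> {13, 22, 33}" "mod_arrays (pow_code d) = {}"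
  by (auto simp: pow_code_def)
qed

section \<open>Assembling the complete program\<close>

definition "tail_code = count_code;; head_code;; group_code;; string_code;; batch_code"

definition "front_code d = read_code;; pow_code d;; half_code;; letter_code;; double_code;; sp_code;; anchor_code"

definition "main_code d = front_code d;; ctx_code;; tail_code"

context word_ram_sub
begin

lemma wp_seq:
 assumes "wp c1 P t v a" "bounded v a"
  "\<And>t' v' a'. P t' v' a' ==> bounded v' a' ==> frame c1 v a v' a' ==> wp c2 Q t' v' a'"
 shows "wp (c1;; c2) Q t v a"
 using wp_conseq[OF assms(1,2), of "wp c2 Q"] assms(3) by simp

end

context string_ram
begin

text \<open>The number \<open>B\<close> of products depends on the groups and is therefore
  existential. For \<open>l = 0\<close> the bound on \<open>B * (2 * l)\<close> says nothing, but
  then there are no batches at all.\<close>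

lemma tail_correct:
 assumes ns: "node_state v a" and bd: "bounded v a"
  and z: "\<forall>i\<in>{9, 12, 13, 16, 17}. \<forall>x y. a i x y = 0"
  and sp: "\<forall>i<L. a 5 0 i = of_bool (sper_at l f i)" and E: "2 * K < 2 ^ E"
  and c: "v 6 + K * (E * E) + L + 1 < Z" "K * (E * E) + 1 < Z" and Q: "v 22 = 2 ^ w'"
  and D: "1 + 2 * (2 * l) * (2 * l) < 2 ^ w'"
  and mm: "\<And>\<alpha> \<beta>. (\<forall>i. \<alpha> i <= 1) ==> (\<forall>i. \<beta> i <= 1) ==>
   \<exists>t\<le>Tm. outputs_after w' pr (mm_input (2 * l) \<alpha> \<beta>) (mm_result (2 * l) \<alpha> \<beta>) t"
 shows "wp tail_code (\<lambda>t' v' a'. v' 3 = m &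
  (\<exists>B. B * (2 * l) <= K * (E * E) & (l = 0 --> B = 0) &
   t' <= t + (1 + 2 * K * (10 + 8 * l)) + (2 + 2 * K * (12 * l + 2)) + (1 + K * (2 + 10 * l + E * (28 * l + 4))) +
    (2 + L * 41) + (2 + (v 6 + K * (E * E) + L + 1) * 2 + B * (11 + 2 * l * (2 * l) * 17 + Tm))) &
  (\<forall>i. a' 17 0 i = of_bool (\<exists>s<k. \<exists>j. hit s j & i = target s j))) t v a"
 unfolding tail_code_def
proof (rule wp_seq[OF count_correct[OF ns bd] bd])
 show "\<And>p. a 9 0 p = 0" using z by simp
 fix t1 :: nat and v1 :: vars and a1 :: arrays
 assume p1: "t1 <= t + 1 + 2 * K * (10 + 8 * l) & (\<forall>p. p ~= 0 --> a1 9 0 p = occurrences p)"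
  and bd1: "bounded v1 a1" and fr1: "frame count_code v a v1 a1"
 have f1: "v1 x = v x" if "x \<notin> {7, 15, 16}" for x using frame_var[OF fr1, of x] that by simp
 have g1: "a1 i = a i" if "i ~= 9" for i using frame_array[OF fr1, of i] that by simp
 have ns1: "node_state v1 a1"
  by (rule node_state_cong[of v a]) (use ns f1 g1 in \<open>auto simp: node_state_def state_def\<close>)
 show "wp (head_code;; group_code;; string_code;; batch_code) (\<lambda>t' v' a'. v' 3 = m &
  (\<exists>B. B * (2 * l) <= K * (E * E) & (l = 0 --> B = 0) &
   t' <= t + (1 + 2 * K * (10 + 8 * l)) + (2 + 2 * K * (12 * l + 2)) + (1 + K * (2 + 10 * l + E * (28 * l + 4))) +
    (2 + L * 41) + (2 + (v 6 + K * (E * E) + L + 1) * 2 + B * (11 + 2 * l * (2 * l) * 17 + Tm))) &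
  (\<forall>i. a' 17 0 i = of_bool (\<exists>s<k. \<exists>j. hit s j & i = target s j))) t1 v1 a1" (is "wp _ ?Q _ _ _")
 proof (rule wp_seq[OF head_correct[OF ns1 bd1] bd1])
  show "\<And>p. p ~= 0 ==> a1 9 0 p = occurrences p" using p1 by simp
  fix t2 :: nat and v2 :: vars and a2 :: arrays
  assume p2: "t2 <= t1 + 2 + 2 * K * (12 * l + 2) & heads_ok {s. \<exists>q<2 * K. prefix s (ctx q)} a2"
   and bd2: "bounded v2 a2" and fr2: "frame head_code v1 a1 v2 a2"
  have f2: "v2 x = v x" if "x \<notin> {7, 8, 15, 16}" for x using frame_var[OF fr2, of x] f1[of x] that by simp
  have g2: "a2 i = a1 i" if "i ~= 10" for i using frame_array[OF fr2, of i] that by simp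
  have ns2: "node_state v2 a2"
   by (rule node_state_cong[of v1 a1]) (use ns1 f1 f2 g2 in \<open>auto simp: node_state_def state_def\<close>)
  have z2: "a2 13 0 g = 0" for g using g1 g2 z by simp
  have gs2: "group_state v2 a2"
   using ns2 p2 z2 by (simp add: group_state_def groups_ok_def)
  \<comment> \<open>There are \<open>2 * K < 2 ^ E\<close> contexts, so each of them meets at most
    \<open>E\<close> heads.\<close>
  have hc: "card (head_set q) <= E" if "q < 2 * K" for q
  proof -
   have "card (head_set q) <= card {x. x <= length (ctx q) & head (take x (ctx q)) = take x (ctx q)}"
    by (rule card_mono) (auto simp: head_set_def)
   also have "\<dots> <= E" by (rule card_heads) (use that E in auto)
   finally show ?thesis .
  qed
  show "wp (group_code;; string_code;; batch_code) ?Q t2 v2 a2"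
  proof (rule wp_seq[OF group_correct[OF gs2 bd2 _ hc] bd2])
   show "v2 6 + K * (E * E) < Z" "K * (E * E) < Z" "\<And>g. a2 13 0 g = 0" using c f2[of 6] z2 by auto
   fix t3 :: nat and v3 :: vars and a3 :: arrays
   assume p3: "t3 <= t2 + 1 + K * (2 + 10 * l + E * (28 * l + 4)) & group_state v3 a3 &
     v3 6 <= v2 6 + K * (E * E) & group_sum a3 <= K * (E * E) &
     (\<forall>j<K. \<forall>x\<in>head_set (2 * j). \<forall>y\<in>head_set (2 * j + 1). in_group a3 j x y)"
    and bd3: "bounded v3 a3" and fr3: "frame group_code v2 a2 v3 a3"
   have g3: "a3 i = a2 i" if "i \<notin> {1, 11, 13, 14, 15}" for i using frame_array[OF fr3, of i] that by simp
   have ps: "pstate v3 a3" unfolding pstate_def using p3 g3 g2 g1 p1 sp by simp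
   have ss: "sstate 0 v3 a3"
    unfolding sstate_def table_sound_def table_complete_def out_sound_def out_rest_def
    using ps g3 g2 g1 z by simp
   have v36: "v3 6 + L < Z" "v3 6 <= v 6 + K * (E * E)" using p3 f2[of 6] c by auto
   show "wp (string_code;; batch_code) ?Q t3 v3 a3"
   proof (rule wp_seq[OF string_correct[OF ss bd3 v36(1)] bd3])
    fix t4 :: nat and v4 :: vars and a4 :: arrays
    assume p4: "t4 <= t3 + 2 + L * 41 & sstate k v4 a4 & v4 6 <= v3 6 + L"
     and bd4: "bounded v4 a4" and fr4: "frame string_code v3 a3 v4 a4"
    have g4: "a4 i = a3 i" if "i \<notin> {1, 16, 17}" for i using frame_array[OF fr4, of i] that by simp
    have v22: "v4 22 = 2 ^ w'" using frame_var[OF fr4, of 22] frame_var[OF fr3, of 22] f2[of 22] Q by simp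
    have gsum: "batches a4 * (2 * l) <= K * (E * E)"
    proof -
     have "batches a4 * (2 * l) <= group_sum a4" by (rule batches_le)
     also have "\<dots> = group_sum a3" using g4 by (simp add: group_sum_def)
     finally show ?thesis using p3 by simp
    qed
    have l0: "l = 0 ==> batches a4 = 0" unfolding batches_def by simp
    have bz: "batches a4 + 1 < Z"
    proof (cases "l = 0")
     case False
     then have "batches a4 * 1 <= batches a4 * (2 * l)" by (intro mult_le_mono2) simp
     then show ?thesis using gsum c(2) by linarith
    qed (use l0 c in simp)
    have z4: "\<And>r i. a4 12 r i = 0" using g4 g3 g2 g1 z by simp
    have v46: "v4 6 + 1 < Z" using p4 v36 c(1) by linarith
    show "wp batch_code ?Q t4 v4 a4"
    proof (rule wp_conseq[OF batch_correct[OF conjunct1[OF conjunct2[OF p4]] bd4 z4 v22 bz v46 D mm] bd4])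
     fix t5 :: nat and v5 :: vars and a5 :: arrays
     assume p5: "t5 <= t4 + 2 + (v4 6 + 1) * 2 + batches a4 * (11 + 2 * l * (2 * l) * 17 + Tm) &
      (\<forall>i. a5 17 0 i = of_bool (\<exists>s<k. \<exists>j. hit s j & i = target s j))"
      and fr5: "frame batch_code v4 a4 v5 a5"
     have "v5 3 = m" using frame_var[OF fr5, of 3] named_state[of k v4 a4] p4
      by (simp add: state_def base_def)
     moreover have "t5 <= t + (1 + 2 * K * (10 + 8 * l)) + (2 + 2 * K * (12 * l + 2)) +
       (1 + K * (2 + 10 * l + E * (28 * l + 4))) + (2 + L * 41) +
       (2 + (v 6 + K * (E * E) + L + 1) * 2 + batches a4 * (11 + 2 * l * (2 * l) * 17 + Tm))"
     proof -
      have "(v4 6 + 1) * 2 <= (v 6 + K * (E * E) + L + 1) * 2" using p4 v36 by (intro mult_le_mono1) simp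
      then show ?thesis using p1 p2 p3 p4 p5 by linarith
     qed
     ultimately show "?Q t5 v5 a5" using p5 gsum l0 by blast
    qed
   qed
  qed
 qed
qed

end

text \<open>Since \<open>K * l <= 6 * m\<close>, all work around the anchors is linear in
  \<open>m\<close> up to factors of \<open>E\<close>, and everything but the products is dominated
  by \<open>L * (E * E)\<close>. The constants 1000 and 5 are generous.\<close>

lemma time_bound:
 fixes K l m L E B Tm d v6 t1 t2 t :: nat
 assumes K: "K * l <= 6 * m" "K <= m" and m: "3 + 2 * m <= L" and E: "1 <= E"
  and B: "B * (2 * l) <= K * (E * E)" "l = 0 --> B = 0" and v6: "v6 <= 1 + 2 * L + E * L + 2 * K * (2 * l)"
  and t1: "t1 <= 30 + d + 82 * L + E * (L * 8 + 3) + m * 7" and t2: "t2 <= t1 + 1 + 2 * K * (2 * l * 12 + 5)"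
  and t: "t <= t2 + (1 + 2 * K * (10 + 8 * l)) + (2 + 2 * K * (12 * l + 2)) +
   (1 + K * (2 + 10 * l + E * (28 * l + 4))) + (2 + L * 41) +
   (2 + (v6 + K * (E * E) + L + 1) * 2 + B * (11 + 2 * l * (2 * l) * 17 + Tm))"
 shows "t <= d + 1000 * (L * (E * E)) + B * Tm & B * (l * l) <= 5 * m * (E * E)"
proof -
 let ?P = "L * (E * E)"
 have EE: "E <= E * E" "1 <= E * E" using E by auto
 have P: "E * L <= ?P" "L <= ?P" "E <= ?P" "1 <= ?P" "2 * (m * (E * E)) <= ?P" "2 * (E * m) <= ?P"
 proof -
  show 1: "E * L <= ?P" using mult_le_mono2[OF EE(1), of L] by (simp add: mult.commute)
  show "L <= ?P" using mult_le_mono2[OF EE(2), of L] by simp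
  have "E * 1 <= E * L" using m by (intro mult_le_mono2) simp
  then show "E <= ?P" using 1 by simp
  then show "1 <= ?P" using E by linarith
  have "2 * m <= L" using m by simp
  then have "2 * m * (E * E) <= ?P" "E * (2 * m) <= E * L" by (intro mult_le_mono1 mult_le_mono2; simp)+
  then have "2 * m * (E * E) <= ?P" "E * (2 * m) <= ?P" using 1 by linarith+
  moreover have "2 * (m * (E * E)) = 2 * m * (E * E)" "2 * (E * m) = E * (2 * m)" by simp_all
  ultimately show "2 * (m * (E * E)) <= ?P" "2 * (E * m) <= ?P" by (simp_all only:)
 qed
 have EK: "E * (K * l) <= 6 * (E * m)" "E * K <= E * m" "K * (E * E) <= m * (E * E)"
  using mult_le_mono2[OF K(1), of E] mult_le_mono2[OF K(2), of E] mult_le_mono1[OF K(2), of "E * E"]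
  by (simp_all add: mult.left_commute)
 have "l * (B * (2 * l)) <= l * (K * (E * E))" using B(1) by (rule mult_le_mono2)
 also have "\<dots> = K * l * (E * E)" by simp
 also have "\<dots> <= 6 * m * (E * E)" using K(1) by (rule mult_le_mono1)
 finally have Bl: "B * (l * l) <= 3 * (m * (E * E))" by (simp add: algebra_simps)
 have B1: "B <= m * (E * E)"
 proof (cases "l = 0")
  case False
  then have "B * 1 <= B * (2 * l)" by (intro mult_le_mono2) simp
  then show ?thesis using B(1) EK(3) by linarith
 qed (use B in simp)
 have c: "2 * K * (2 * l * 12 + 5) = 48 * (K * l) + 10 * K" "2 * K * (10 + 8 * l) = 20 * K + 16 * (K * l)"
  "2 * K * (12 * l + 2) = 24 * (K * l) + 4 * K" "2 * K * (2 * l) = 4 * (K * l)"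
  "K * (2 + 10 * l + E * (28 * l + 4)) = 2 * K + 10 * (K * l) + 28 * (E * (K * l)) + 4 * (E * K)"
  "B * (11 + 2 * l * (2 * l) * 17 + Tm) = 11 * B + 68 * (B * (l * l)) + B * Tm"
  "E * (L * 8 + 3) = 8 * (E * L) + 3 * E"
  "(v6 + K * (E * E) + L + 1) * 2 = 2 * v6 + 2 * (K * (E * E)) + 2 * L + 2"
  by (simp_all add: algebra_simps)
 have "t <= d + 1000 * ?P + B * Tm"
  using t t2 t1 v6 K m P EK Bl B1 unfolding c by linarith
 moreover have "B * (l * l) <= 5 * m * (E * E)" using Bl by simp
 ultimately show ?thesis by blast
qed

text \<open>Periodicity involves letters through their equality only. This transfers it between the
  input words and their names.\<close>

lemma sper_at_pattern:
 assumes "\<forall>x<l. \<forall>y<l. f (i + x) = f (i + y) \<longleftrightarrow> g (i + x) = g (i + y)"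
 shows "sper_at l f i \<longleftrightarrow> sper_at l g i"
proof -
 have "periodic_at l f i p \<longleftrightarrow> periodic_at l g i p" for p
 proof -
  have "f (i + x) = f (i + x + p) \<longleftrightarrow> g (i + x) = g (i + x + p)" if "x + p < l" for x
   using assms[rule_format, of x "x + p"] that by (simp add: add.assoc)
  then show ?thesis by (auto simp: periodic_at_def)
 qed
 then show ?thesis by (simp add: sper_at_def)
qed

text \<open>Identifies the power of 2 found by the program with the \<open>E\<close> that the proof
  has fixed beforehand.\<close>

lemma less_double_unique:
 fixes n e e' :: nat
 assumes "n <= 2 ^ e" "2 ^ e < 2 * n" "n <= 2 ^ e'" "2 ^ e' < 2 * n"
 shows "e = e'"
proof (rule linorder_cases[of e e'])
 have *: False if "x < y" "n <= 2 ^ x" "2 ^ y < 2 * n" for x y :: nat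
 proof -
  have "2 ^ Suc x <= (2 :: nat) ^ y" using that(1) by (intro power_increasing) auto
  then show False using that(2,3) by simp
 qed
 show "e < e' ==> e = e'" using *[of e e'] assms by blast
 show "e' < e ==> e = e'" using *[of e' e] assms by blast
qed

context input_ram
begin

definition arrays0 :: arrays where "arrays0 = (\<lambda>k i j. if k = 0 & i = 0 then X j else 0)"

lemma arrays0: "i ~= 0 ==> arrays0 i x y = 0" "arrays0 0 0 = X"
 by (auto simp: arrays0_def)

definition front_post :: "nat \<Rightarrow> vars \<Rightarrow> arrays \<Rightarrow> bool" where
 "front_post E v a \<longleftrightarrow> base v a & v 22 = 2 ^ w' & v 6 <= 1 + 2 * L + E * L &
  names (a 1) (a 31 0) (v 6) & (\<forall>i<L. a 2 0 i ~= 0) & (\<forall>i\<ge>L. a 2 0 i = 0) &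
  (\<forall>i<L. \<forall>j<L. a 2 0 i = a 2 0 j \<longleftrightarrow> X i = X j) &
  (\<forall>i<L. a 5 0 i = of_bool (sper_at l (a 2 0) i)) & v 12 <= m &
  (\<forall>j<v 12. is_anchor (a 2 0) (a 6 0 j)) & (\<forall>j<v 12. \<forall>j'<j. a 6 0 j' < a 6 0 j) &
  (\<forall>i<m. is_anchor (a 2 0) i --> (\<exists>j<v 12. a 6 0 j = i)) &
  a 7 0 0 = 0 & (\<forall>i<m. a 7 0 (i + 1) = X (2 + m + i)) &
  (\<forall>i\<in>{8, 9, 12, 13, 16, 17}. \<forall>x y. a i x y = 0)"

lemma front_correct:
 assumes pw: "(2 * L + 6) ^ d <= Z" and Q: "(2 :: nat) ^ w' = (2 ^ E) ^ d" and E: "L + 3 <= 2 ^ E" "2 ^ E < 2 * (L + 3)"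
  and U: "\<forall>i<m. X (2 + m + i) <= 1" and bd: "bounded ((\<lambda>_. 0)(0 := L)) arrays0"
 shows "wp (front_code d) (\<lambda>t' v' a'. t' <= 30 + d + 82 * L + E * (L * 8 + 3) + m * 7 & front_post E v' a')
  0 ((\<lambda>_. 0)(0 := L)) arrays0"
 unfolding front_code_def
proof (rule wp_seq[OF read_correct bd])
 let ?v = "(\<lambda>_. 0 :: nat)(0 := L)"
 show "?v 0 = L" "arrays0 0 0 = X" by (simp_all add: arrays0)
 fix t1 :: nat and v1 :: vars and a1 :: arrays
 assume p1: "t1 = 0 + 5 & base v1 a1 & v1 6 = 1 & a1 = arrays0" and bd1: "bounded v1 a1"
  and fr1: "frame read_code ?v arrays0 v1 a1"
 let ?Q = "\<lambda>t' v' a'. t' <= 30 + d + 82 * L + E * (L * 8 + 3) + m * 7 & front_post E v' a'"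
 have z12: "v1 12 = 0" using frame_var[OF fr1, of 12] by simp
 show "wp (pow_code d;; half_code;; letter_code;; double_code;; sp_code;; anchor_code) ?Q t1 v1 a1"
 proof (rule wp_seq[OF pow_correct[OF _ bd1 pw] bd1])
  show "base v1 a1" using p1 by blast
  fix t2 :: nat and v2 :: vars and a2 :: arrays
  assume p2: "t2 <= t1 + 5 * L + d + 10 & a2 = a1 &
   (\<exists>e. L + 3 <= 2 ^ e & 2 ^ e < 2 * L + 6 & v2 22 = (2 ^ e) ^ d)"
   and bd2: "bounded v2 a2" and fr2: "frame (pow_code d) v1 a1 v2 a2"
  have v2: "v2 x = v1 x" if "x \<notin> {13, 22, 33}" for x
   using frame_var[OF fr2, of x] mods_pow(1)[of d] that by blast
  have Q2: "v2 22 = 2 ^ w'"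
  proof -
   obtain e where e: "L + 3 <= 2 ^ e" "2 ^ e < 2 * L + 6" "v2 22 = (2 ^ e) ^ d" using p2 by blast
   have "e = E" by (rule less_double_unique[of "L + 3"]) (use e E in auto)
   then show ?thesis using e Q by simp
  qed
  have b2: "base v2 a2" using p1 p2 v2 by (simp add: base_def arrays0)
  show "wp (half_code;; letter_code;; double_code;; sp_code;; anchor_code) ?Q t2 v2 a2"
  proof (rule wp_seq[OF half_correct[OF b2 bd2] bd2])
   fix t3 :: nat and v3 :: vars and a3 :: arrays
   assume p3: "t3 <= t2 + 5 * L + 10 & a3 = a2 &
    (\<exists>e. v3 11 = e & l < 4 * 2 ^ e & (2 <= l --> 2 * 2 ^ e <= l) & 2 ^ e <= l + 1)"
    and bd3: "bounded v3 a3" and fr3: "frame half_code v2 a2 v3 a3"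
   obtain e where e: "v3 11 = e" "l < 4 * 2 ^ e" "2 <= l --> 2 * 2 ^ e <= l" "2 ^ e <= l + 1" using p3 by blast
   have v3: "v3 x = v2 x" if "x \<notin> {10, 11, 13}" for x using frame_var[OF fr3, of x] that by simp
   have a3: "a3 = arrays0" using p1 p2 p3 by simp
   have b3: "base v3 a3" using b2 p3 v3 by (simp add: base_def arrays0)
   have v36: "v3 6 = 1" using v3 v2 p1 by simp
   have eE: "e <= E"
   proof -
    have "(2 :: nat) ^ e < 2 ^ E" using e(4) E(1) L_ge l_le by linarith
    then show ?thesis by simp
   qed
   have eL: "e <= L" using e(4) less_exp[of e] L_ge l_le by linarith
   show "wp (letter_code;; double_code;; sp_code;; anchor_code) ?Q t3 v3 a3"
   proof (rule wp_seq[OF letter_correct[OF b3 bd3 v36] bd3])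
    show "\<And>i j. a3 1 i j = 0" "\<And>j. a3 31 0 j = 0" "\<And>j. a3 2 0 j = 0" "\<And>j. a3 3 0 j = 0"
     by (simp_all add: a3 arrays0)
    fix t4 :: nat and v4 :: vars and a4 :: arrays
    assume p4: "t4 <= t3 + 1 + L * 12 & names (a4 1) (a4 31 0) (v4 6) &
     v4 6 <= 1 + 2 * L & (\<forall>i<L. a4 2 0 i ~= 0) & (\<forall>i\<ge>L. a4 2 0 i = 0) &
     (\<forall>i<L. \<forall>j<L. a4 2 0 i = a4 2 0 j \<longleftrightarrow> X i = X j) & a4 3 0 = a4 2 0"
     and bd4: "bounded v4 a4" and fr4: "frame letter_code v3 a3 v4 a4"
    have v4: "v4 x = v3 x" if "x \<notin> {6, 7, 8, 9, 13}" for x using frame_var[OF fr4, of x] that by simp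
    have a4: "a4 i = arrays0 i" if "i \<notin> {1, 2, 3, 31}" for i using frame_array[OF fr4, of i] that a3 by simp
    define f where "f = a4 2 0"
    have v40: "v4 0 = L" using v4[of 0] b3 by (simp add: base_def)
    have eLL: "e * L <= L * L" using eL by (rule mult_le_mono1)
    have c4: "v4 6 + e * L < Z" using p4 eLL Z_cube by linarith
    show "wp (double_code;; sp_code;; anchor_code) ?Q t4 v4 a4"
    proof (rule wp_seq[OF double_correct[OF v40 bd4 _ c4 _ _ _ e(4)] bd4])
     show "names (a4 1) (a4 31 0) (v4 6)" "\<forall>i<L. a4 3 0 i ~= 0" "\<forall>i\<ge>L. a4 3 0 i = 0" "v4 11 = e"
      using p4 v4[of 11] e(1) by simp_all
     fix t5 :: nat and v5 :: vars and a5 :: arrays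
     assume p5: "t5 <= t4 + 2 + e * (L * 8 + 3) & names (a5 1) (a5 31 0) (v5 6) &
      v5 6 <= v4 6 + e * L & v5 10 = 2 ^ e & (\<forall>i<L. a5 3 0 i ~= 0) & (\<forall>i\<ge>L. a5 3 0 i = 0) &
      (\<forall>i j. a5 3 0 i = a5 3 0 j \<longleftrightarrow> same_block (2 ^ e) (a4 3 0) i j)"
      and bd5: "bounded v5 a5" and fr5: "frame double_code v4 a4 v5 a5"
     have v5: "v5 x = v4 x" if "x \<notin> {6, 7, 8, 9, 10, 13, 14}" for x using frame_var[OF fr5, of x] that by simp
     have a5: "a5 i = a4 i" if "i \<notin> {1, 3}" for i using frame_array[OF fr5, of i] that by simp
     have v5': "v5 0 = L" "v5 2 = l" "v5 10 = 2 ^ e" using v5 v4 b3 p5 by (simp_all add: base_def)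
     show "wp (sp_code;; anchor_code) ?Q t5 v5 a5"
     proof (rule wp_seq[OF sp_correct[OF v5' bd5 e(3,2), of f] bd5])
      show "\<forall>i j. a5 3 0 i = a5 3 0 j \<longleftrightarrow> same_block (2 ^ e) f i j" "\<forall>i<L. f i ~= 0" "\<forall>i\<ge>L. f i = 0"
       using p5 p4 by (simp_all add: f_def)
      show "\<And>j. a5 4 0 j = 0" "\<And>j. a5 5 0 j = 0" using a5 a4 by (simp_all add: arrays0)
      fix t6 :: nat and v6 :: vars and a6 :: arrays
      assume p6: "t6 <= t5 + 1 + L * 60 & (\<forall>i<L. a6 5 0 i = of_bool (sper_at l f i))"
       and bd6: "bounded v6 a6" and fr6: "frame sp_code v5 a5 v6 a6"
      have v6: "v6 x = v5 x" if "x \<notin> {7, 13, 14, 16, 31, 32, 33, 34}" for x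
       using frame_var[OF fr6, of x] that by simp
      have a6: "a6 i = a5 i" if "i \<notin> {4, 5}" for i using frame_array[OF fr6, of i] that by simp
      have b6: "base v6 a6" using b3 v6 v5 v4 a6 a5 a4 a3 by (simp add: base_def arrays0)
      have z6: "v6 12 = 0" using v6 v5 v4 v3 v2 z12 by simp
      have sp6: "\<forall>i<L. a6 5 0 i = of_bool (sper_at l f i)" using p6 by simp
      have z7: "a6 7 0 j = 0" for j using a6 a5 a4 by (simp add: arrays0)
      show "wp anchor_code ?Q t6 v6 a6"
      proof (rule wp_conseq[OF anchor_correct[OF b6 bd6 z6 sp6 z7 U] bd6])
       fix t7 :: nat and v7 :: vars and a7 :: arrays
       assume p7: "t7 <= t6 + 1 + m * 7 & v7 12 <= m & (\<forall>j<v7 12. is_anchor f (a7 6 0 j)) &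
        (\<forall>j<v7 12. \<forall>j'<j. a7 6 0 j' < a7 6 0 j) &
        (\<forall>i<m. is_anchor f i --> (\<exists>j<v7 12. a7 6 0 j = i)) &
        a7 7 0 0 = 0 & (\<forall>i<m. a7 7 0 (i + 1) = X (2 + m + i))"
        and fr7: "frame anchor_code v6 a6 v7 a7"
       have v7: "v7 x = v6 x" if "x \<notin> {12, 13}" for x using frame_var[OF fr7, of x] that by simp
       have a7: "a7 i = a6 i" if "i \<notin> {6, 7}" for i using frame_array[OF fr7, of i] that by simp
       have f7: "a7 2 0 = f" using a7 a6 a5 by (simp add: f_def)
       have "e * L <= E * L" "e * (L * 8 + 3) <= E * (L * 8 + 3)" using eE by (intro mult_le_mono1; simp)+
       then have c: "v5 6 <= 1 + 2 * L + E * L" "t7 <= 30 + d + 82 * L + E * (L * 8 + 3) + m * 7"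
        using p1 p2 p3 p4 p5 p6 p7 by linarith+
       have "base v7 a7" using b6 v7 a7 by (simp add: base_def)
       moreover have "v7 22 = 2 ^ w'" using v7 v6 v5 v4 v3 Q2 by simp
       moreover have "v7 6 <= 1 + 2 * L + E * L" using v7 v6 c by simp
       moreover have "names (a7 1) (a7 31 0) (v7 6)" using p5 v7 v6 a7 a6 by simp
       moreover have "\<forall>i\<in>{8, 9, 12, 13, 16, 17}. \<forall>x y. a7 i x y = 0"
        using a7 a6 a5 a4 by (simp add: arrays0)
       moreover have "\<forall>i<L. a7 5 0 i = of_bool (sper_at l f i)" using sp6 a7 by simp
       moreover have "(\<forall>i<L. f i ~= 0) & (\<forall>i\<ge>L. f i = 0) & (\<forall>i<L. \<forall>j<L. f i = f j \<longleftrightarrow> X i = X j)"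
        using p4 unfolding f_def by blast
       ultimately show "?Q t7 v7 a7" using p7 c(2) unfolding front_post_def f7 by blast
      qed
     qed
    qed
   qed
  qed
 qed
qed

lemma main_correct:
 fixes off len :: "nat \<Rightarrow> nat"
 assumes pw: "(2 * L + 6) ^ d <= Z" and Q: "(2 :: nat) ^ w' = (2 ^ E) ^ d" and E: "L + 3 <= 2 ^ E" "2 ^ E < 2 * (L + 3)"
  and U: "\<forall>i<m. X (2 + m + i) <= 1" and bd: "bounded ((\<lambda>_. 0)(0 := L)) arrays0"
  and off: "off 0 = 3 + 2 * m" "\<And>s. s < k ==> off (Suc s) = off s + 1 + len s" "off k = L"
  and len: "\<And>s. s < k ==> X (off s) = len s" "\<And>s. s < k ==> len s < 2 * l"
  and sw: "\<And>s. s < k ==> \<exists>i. i + l < len s & sper_at l X (off s + 1 + i) ~= sper_at l X (off s + 1 + i + 1)"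
  and D: "1 + 2 * (2 * l) * (2 * l) < 2 ^ w'"
  and mm: "\<And>\<alpha> \<beta>. (\<forall>i. \<alpha> i <= 1) ==> (\<forall>i. \<beta> i <= 1) ==>
   \<exists>t\<le>Tm. outputs_after w' pr (mm_input (2 * l) \<alpha> \<beta>) (mm_result (2 * l) \<alpha> \<beta>) t"
 shows "wp (main_code d) (\<lambda>t' v' a'. v' 3 = m &
  (\<exists>B. t' <= d + 1000 * (L * (E * E)) + B * Tm & B * (l * l) <= 5 * m * (E * E) & (l = 0 --> B = 0)) &
  (\<forall>i<m. a' 17 0 i = of_bool (\<exists>s<k. \<exists>b\<ge>1. b + len s <= m & X (1 + m + b) ~= 0 &
   (\<forall>x<len s. X (off s + 1 + x) = X (2 + b + x)) & i + 1 = b + len s))) 0 ((\<lambda>_. 0)(0 := L)) arrays0"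
  (is "wp _ ?Q _ _ _")
 unfolding main_code_def
proof (rule wp_seq[OF front_correct[OF pw Q E U bd] bd])
 let ?v = "(\<lambda>_. 0 :: nat)(0 := L)"
 fix t1 :: nat and v1 :: vars and a1 :: arrays
 assume p1: "t1 <= 30 + d + 82 * L + E * (L * 8 + 3) + m * 7 & front_post E v1 a1" and bd1: "bounded v1 a1"
  and fr1: "frame (front_code d) ?v arrays0 v1 a1"
 \<comment> \<open>The parameters of the next locale are read off the state reached after the front
   part, so the interpretation takes place in the middle of the run.\<close>
 define f where "f = a1 2 0"
 define anc where "anc = a1 6 0"
 define K where "K = v1 12"
 define ub where "ub b = (if b = 0 \<or> m < b then 0 else X (1 + m + b))" for b
 have P: "base v1 a1" "v1 22 = 2 ^ w'" "v1 6 <= 1 + 2 * L + E * L" "names (a1 1) (a1 31 0) (v1 6)"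
  "\<forall>i<L. f i ~= 0" "\<forall>i\<ge>L. f i = 0" "\<forall>i<L. \<forall>j<L. f i = f j \<longleftrightarrow> X i = X j"
  "\<forall>i<L. a1 5 0 i = of_bool (sper_at l f i)" "K <= m" "\<forall>j<K. is_anchor f (anc j)"
  "\<forall>j<K. \<forall>j'<j. anc j' < anc j" "\<forall>i<m. is_anchor f i --> (\<exists>j<K. anc j = i)"
  "a1 7 0 0 = 0" "\<forall>i<m. a1 7 0 (i + 1) = X (2 + m + i)"
  "\<forall>i\<in>{8, 9, 12, 13, 16, 17}. \<forall>x y. a1 i x y = 0"
  using p1 unfolding front_post_def f_def anc_def K_def by - (elim conjE, assumption)+
 have anc_m: "anc j + l < m" if "j < K" for j using P(10) that by (simp add: is_anchor_def)
 have ub1: "ub b <= 1" for b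
  using U[rule_format, of "b - 1"] by (cases b) (auto simp: ub_def)
 interpret A: anchored_ram w Z pr w' X L l m k f anc ub K
 proof unfold_locales
  show "f i ~= 0" if "i < L" for i using P(5) that by blast
  show "anc j < m" if "j < K" for j using anc_m[OF that] by simp
 qed (use P(9) ub1 in \<open>auto simp: ub_def\<close>)
 \<comment> \<open>The anchors are listed in increasing order, hence distinct, so the number of
   switches in the pattern bounds their number.\<close>
 have Kl: "K * l <= 6 * m"
 proof -
  let ?S = "{i. i + l < m & sper_at l f (2 + i) ~= sper_at l f (2 + i + 1)}"
  have "inj_on anc {..<K}"
  proof (rule linorder_inj_onI')
   fix i j assume "i \<in> {..<K}" "j \<in> {..<K}" "i < j"
   then have "anc i < anc j" using P(11) by blast
   then show "anc i ~= anc j" by simp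
  qed
  moreover have "anc ` {..<K} \<subseteq> ?S"
  proof -
   have e: "2 + i + 1 = 3 + i" for i :: nat by simp
   have "?S = {i. is_anchor f i}" unfolding is_anchor_def e ..
   then show ?thesis using P(10) by blast
  qed
  moreover have "finite ?S" by (rule finite_subset[of _ "{..<m}"]) auto
  ultimately have "card {..<K} <= card ?S" by (rule card_inj_on_le)
  then have "K * l <= card ?S * l" by (intro mult_le_mono1) simp
  then show ?thesis using card_switches[of l m f 2] by linarith
 qed
 have st: "A.state v1 a1"
  unfolding A.state_def
 proof (intro conjI allI impI)
  fix b assume "b <= m"
  then show "a1 7 0 b = ub b" using P(13) P(14)[rule_format, of "b - 1"] by (cases b) (auto simp: ub_def)
 qed (use P in \<open>simp_all add: f_def anc_def K_def\<close>)
 \<comment> \<open>A crude bound, good enough to keep all counters below \<open>Z\<close>; the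
   running time retains the logarithmic \<open>E\<close>.\<close>
 have EL: "E <= L + 2"
 proof (cases E)
  case (Suc e)
  then have "2 ^ e < L + 3" using E(2) by simp
  then show ?thesis using less_exp[of e] Suc by linarith
 qed simp
 have E1: "1 <= E" using E(1) by (cases E) auto
 have KL: "2 * K <= L" using P(9) L_ge by simp
 have Kc: "2 * K * (2 * l) <= L * L" using KL l_le L_ge by (intro mult_le_mono) auto
 have ELL: "E * L <= (L + 2) * L" using EL by (rule mult_le_mono1)
 have KE: "K * (E * E) <= L * ((L + 2) * (L + 2))" using EL KL by (intro mult_le_mono) auto
 have xp: "(L + 2) * L = L * L + 2 * L" "L * ((L + 2) * (L + 2)) = L * L * L + 4 * (L * L) + 4 * L"
  by (simp_all add: algebra_simps)
 show "wp (ctx_code;; tail_code) ?Q t1 v1 a1"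
 proof (rule wp_seq[OF A.ctx_correct[OF st bd1] bd1])
  show "v1 6 + 2 * K * (2 * l) < Z" using P(3) Kc ELL Z_cube unfolding xp by linarith
  show "\<And>q x. a1 8 q x = 0" using P(15) by simp
  fix t2 :: nat and v2 :: vars and a2 :: arrays
  assume p2: "t2 <= t1 + 1 + 2 * K * (2 * l * 12 + 5) & A.state v2 a2 & ext (a1 1) (a2 1) &
   v2 6 <= v1 6 + 2 * K * (2 * l) &
   (\<forall>q<2 * K. word_name (a2 1) (A.ctx q) ~= 0 & a2 8 q = prefix_names (a2 1) (A.ctx q))"
   and bd2: "bounded v2 a2" and fr2: "frame ctx_code v1 a1 v2 a2"
  have a2: "a2 i = a1 i" if "i \<notin> {1, 8}" for i using frame_array[OF fr2, of i] that by simp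
  have v22: "v2 22 = 2 ^ w'" using frame_var[OF fr2, of 22] P(2) by simp
  have oL: "s < k ==> off s + 1 + len s <= L" for s
  proof -
   have "s <= s' ==> s' <= k ==> off s <= off s'" for s s'
   proof (induction s' rule: dec_induct)
    case (step n)
    then show ?case using off(2)[of n] by simp
   qed simp
   from this[of "Suc s" k] show "s < k ==> ?thesis" using off(2)[of s] off(3) by simp
  qed
  \<comment> \<open>The naming table with all contexts entered takes the role of
    \<open>T0\<close>.\<close>
  interpret S: string_ram w Z pr w' X L l m k f anc ub K "a2 1" "a2 31 0" "v2 6" off len
  proof unfold_locales
   show "names (a2 1) (a2 31 0) (v2 6)" using p2 by (simp add: A.state_def)
   show "q < 2 * K ==> word_name (a2 1) (A.ctx q) ~= 0" for q using p2 by blast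
   show "\<exists>i. i + l < len s & sper_at l f (off s + 1 + i) ~= sper_at l f (off s + 1 + i + 1)" if s: "s < k" for s
   proof -
    obtain i where i: "i + l < len s" "sper_at l X (off s + 1 + i) ~= sper_at l X (off s + 1 + i + 1)"
     using sw[OF s] by blast
    have "sper_at l f (off s + 1 + i) = sper_at l X (off s + 1 + i)"
     "sper_at l f (off s + 1 + i + 1) = sper_at l X (off s + 1 + i + 1)"
     using oL[OF s] i(1) P(7) by (intro sper_at_pattern; simp)+
    then show ?thesis using i by blast
   qed
   show "L <= i ==> f i = 0" for i using P(6) by blast
  qed (use off len in auto)
  have ns: "S.node_state v2 a2" unfolding S.node_state_def S.node_def using p2 by simp
  have z2: "\<forall>i\<in>{9, 12, 13, 16, 17}. \<forall>x y. a2 i x y = 0" using P(15) a2 by simp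
  have sp2: "\<forall>i<L. a2 5 0 i = of_bool (sper_at l f i)" using P(8) a2 by simp
  have K2: "2 * K < 2 ^ E" using KL E(1) by linarith
  have c: "v2 6 + K * (E * E) + L + 1 < Z" "K * (E * E) + 1 < Z"
   using p2 P(3) Kc ELL KE Z_cube unfolding xp by linarith+
  show "wp tail_code ?Q t2 v2 a2"
  proof (rule wp_mono[OF S.tail_correct[OF ns bd2 z2 sp2 K2 c v22 D mm]])
   fix t3 :: nat and v3 :: vars and a3 :: arrays
   assume p3: "v3 3 = m &
    (\<exists>B. B * (2 * l) <= K * (E * E) & (l = 0 --> B = 0) &
     t3 <= t2 + (1 + 2 * K * (10 + 8 * l)) + (2 + 2 * K * (12 * l + 2)) +
      (1 + K * (2 + 10 * l + E * (28 * l + 4))) + (2 + L * 41) +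
      (2 + (v2 6 + K * (E * E) + L + 1) * 2 + B * (11 + 2 * l * (2 * l) * 17 + Tm))) &
    (\<forall>i. a3 17 0 i = of_bool (\<exists>s<k. \<exists>j. S.hit s j & i = S.target s j))"
   then obtain B where B: "B * (2 * l) <= K * (E * E)" "l = 0 --> B = 0"
    "t3 <= t2 + (1 + 2 * K * (10 + 8 * l)) + (2 + 2 * K * (12 * l + 2)) +
      (1 + K * (2 + 10 * l + E * (28 * l + 4))) + (2 + L * 41) +
      (2 + (v2 6 + K * (E * E) + L + 1) * 2 + B * (11 + 2 * l * (2 * l) * 17 + Tm))" by blast
   have "t3 <= d + 1000 * (L * (E * E)) + B * Tm & B * (l * l) <= 5 * m * (E * E)"
   proof (rule time_bound[OF Kl P(9) L_ge E1 B(1,2) _ _ _ B(3)])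
    show "v2 6 <= 1 + 2 * L + E * L + 2 * K * (2 * l)" using p2 P(3) by linarith
   qed (use p1 p2 in auto)
   moreover have "(\<exists>j. S.hit s j & i = S.target s j) \<longleftrightarrow> (\<exists>b\<ge>1. b + len s <= m & X (1 + m + b) ~= 0 &
     (\<forall>x<len s. X (off s + 1 + x) = X (2 + b + x)) & i + 1 = b + len s)" if s: "s < k" for s i
   proof -
    have "f (off s + 1 + x) = f (2 + b + x) \<longleftrightarrow> X (off s + 1 + x) = X (2 + b + x)"
     if "b + len s <= m" "x < len s" for b x
     using P(7) oL[OF s] that L_ge by simp
    then have eq: "b + len s <= m ==> (\<forall>x<len s. f (off s + 1 + x) = f (2 + b + x)) \<longleftrightarrow>
      (\<forall>x<len s. X (off s + 1 + x) = X (2 + b + x))" for b by blast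
    have ubX: "1 <= b ==> b + len s <= m ==> ub b ~= 0 \<longleftrightarrow> X (1 + m + b) ~= 0" for b
     by (auto simp: ub_def)
    have hi: "(\<exists>j. S.hit s j & i = S.target s j) \<longleftrightarrow> (\<exists>b\<ge>1. b + len s <= m & ub b ~= 0 &
      (\<forall>x<len s. f (off s + 1 + x) = f (2 + b + x)) & i + 1 = b + len s)"
     by (rule S.hit_iff[OF s]) (use P(12) in blast)
    show ?thesis
     unfolding hi by (rule arg_cong[where f = Ex], rule ext, intro conj_cong refl ubX eq; assumption)
   qed
   then have "(\<exists>s<k. \<exists>j. S.hit s j & i = S.target s j) \<longleftrightarrow> (\<exists>s<k. \<exists>b\<ge>1. b + len s <= m & X (1 + m + b) ~= 0 &
     (\<forall>x<len s. X (off s + 1 + x) = X (2 + b + x)) & i + 1 = b + len s)" for i by blast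
   ultimately show "?Q t3 v3 a3" using p3 B(2) by (simp only: simp_thms) blast
  qed
 qed
qed

end

lemma wf_main_code: "wf_com (main_code d)"
proof -
 have "wf_com (foldr (\<lambda>_. Sq (Asg 22 (Vr 22 [*] Vr 33))) xs Skip)" for xs :: "nat list"
  by (induction xs) auto
 then show ?thesis
  by (simp add: main_code_def front_code_def tail_code_def read_code_def half_code_def letter_code_def
   double_code_def name_code_def sp_code_def block_code_def pow_code_def
   anchor_code_def ctx_code_def walk_code_def count_code_def count_row_def head_code_def head_row_def
   group_code_def group_row_def group_inner_def string_code_def string_row_def find_code_def word_code_def
   link_code_def check_code_def batch_code_def batch_row_def left_matrix_code_def right_matrix_code_def
   product_code_def)
qed

section \<open>Matrix multiplication exponents\<close>

text \<open>Trades a polylogarithmic factor for an arbitrarily small power in the lower bound on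
  exponents.\<close>

lemma log_power_le:
 assumes "0 < a"
 shows "\<exists>K>0. \<forall>x\<ge>1. log 2 x ^ k <= K * x powr a"
proof (intro exI conjI allI impI)
 define b where "b = a / (real k + 1)"
 have b: "0 < b" using assms by (simp add: b_def)
 show "0 < (1 / (b * ln 2)) ^ k" using b by simp
 fix x :: real assume x: "1 <= x"
 have "log 2 x <= x powr b / (b * ln 2)"
  using divide_right_mono[OF ln_powr_bound[OF x b], of "ln 2"] by (simp add: log_def)
 then have "log 2 x ^ k <= (x powr b / (b * ln 2)) ^ k"
  using x by (intro power_mono) auto
 also have "\<dots> = (1 / (b * ln 2)) ^ k * (x powr b) ^ k" by (simp add: power_divide)
 also have "(x powr b) ^ k = x powr (b * real k)"
  using x by (simp add: powr_realpow[symmetric] powr_powr)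
 also have "x powr (b * real k) <= x powr a"
 proof (rule powr_mono[OF _ x])
  have "b * real k <= b * (real k + 1)" using b by simp
  also have "\<dots> = a" by (simp add: b_def)
  finally show "b * real k <= a" .
 qed
 finally show "log 2 x ^ k <= (1 / (b * ln 2)) ^ k * x powr a" using b by simp
qed

lemma power_eq_powr_log: "real ((L + 2) ^ n) = 2 powr (real n * log 2 (real L + 2))"
proof -
 have "2 powr (real n * log 2 (real L + 2)) = (2 powr log 2 (real L + 2)) powr real n"
  by (simp only: powr_powr mult.commute)
 also have "\<dots> = (real L + 2) ^ n" by (simp add: powr_realpow add_pos_nonneg)
 also have "\<dots> = real ((L + 2) ^ n)" by (simp only: of_nat_power of_nat_add of_nat_numeral)
 finally show ?thesis by (rule sym)
qed

text \<open>Origin of the constant \<open>24 * d + 6\<close>: with \<open>b = L + 2\<close> one has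
  \<open>2 * L + 8 <= b ^ 3\<close> and \<open>64 <= b ^ 6\<close>, so the left-hand side is at most
  \<open>b ^ (24 * d + 6)\<close>.\<close>

lemma word_size:
 assumes "(24 * real d + 6) * log 2 (real L + 2) <= real w"
 shows "64 * ((2 * L + 8) ^ d) ^ 8 <= (2 :: nat) ^ w"
proof -
 let ?b = "L + 2"
 have "2 * 2 * ?b <= ?b * ?b * ?b" by (intro mult_le_mono) auto
 then have 1: "2 * L + 8 <= ?b ^ 3" by (simp add: power3_eq_cube)
 have "(2 :: nat) ^ 6 <= ?b ^ 6" by (intro power_mono) auto
 then have 2: "64 <= ?b ^ 6" by simp
 have "((2 * L + 8) ^ d) ^ 8 <= ((?b ^ 3) ^ d) ^ 8" using 1 by (intro power_mono) auto
 then have "64 * ((2 * L + 8) ^ d) ^ 8 <= ?b ^ 6 * ((?b ^ 3) ^ d) ^ 8" using 2 by (intro mult_le_mono)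
 also have "\<dots> = ?b ^ (24 * d + 6)" by (simp add: power_mult[symmetric] power_add[symmetric] algebra_simps)
 finally have 3: "64 * ((2 * L + 8) ^ d) ^ 8 <= ?b ^ (24 * d + 6)" .
 have "real (?b ^ (24 * d + 6)) = 2 powr (real (24 * d + 6) * log 2 (real L + 2))" by (rule power_eq_powr_log)
 also have "\<dots> <= 2 powr real w" using assms by (intro powr_mono) auto
 also have "\<dots> = real (2 ^ w)" by (simp add: powr_realpow)
 finally have "?b ^ (24 * d + 6) <= 2 ^ w" by (simp only: of_nat_le_iff)
 with 3 show ?thesis by linarith
qed

lemma concat_grid:
 "concat (map (\<lambda>i. map (g i) [0..<n]) [0..<r]) = map (\<lambda>x. g (x div n) (x mod n)) [0..<r * n]"
proof (induction r)
 case (Suc r)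
 have "map (\<lambda>x. g (x div n) (x mod n)) [r * n..<r * n + n] = map (g r) [0..<n]"
  by (rule nth_equalityI) auto
 moreover have "[0..<Suc r * n] = [0..<r * n] @ [r * n..<r * n + n]"
  using upt_add_eq_append[of 0 "r * n" n] by (simp add: add.commute)
 ultimately show ?case using Suc by simp
qed simp

lemma mm_encode_eq:
 assumes "A \<in> carrier_mat n n" "B \<in> carrier_mat n n"
 shows "mm_encode (A, B) = mm_input n (\<lambda>x. A $$ (x div n, x mod n)) (\<lambda>x. B $$ (x div n, x mod n))"
  "mm_output (A, B) = mm_result n (\<lambda>x. A $$ (x div n, x mod n)) (\<lambda>x. B $$ (x div n, x mod n))"
proof -
 have c: "concat (mat_to_list M) = map (\<lambda>x. M $$ (x div n, x mod n)) [0..<n * n]"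
  if "M \<in> carrier_mat n n" for M :: "nat mat"
  using that concat_grid[of "\<lambda>i j. M $$ (i, j)" n n] by (simp add: mat_to_list_def)
 show "mm_encode (A, B) = mm_input n (\<lambda>x. A $$ (x div n, x mod n)) (\<lambda>x. B $$ (x div n, x mod n))"
  using assms by (simp add: mm_encode_def mm_input_def c)
 have AB: "A * B \<in> carrier_mat n n" using assms by simp
 have "(A * B) $$ (x div n, x mod n) =
   (\<Sum>y<n. A $$ ((x div n * n + y) div n, (x div n * n + y) mod n) * B $$ ((y * n + x mod n) div n, (y * n + x mod n) mod n))"
  if x: "x < n * n" for x
 proof -
  have n: "0 < n" using x by (cases n) auto
  have "x div n < n" "x mod n < n" using x n by (auto simp: less_mult_imp_div_less)
  then show ?thesis using assms n by (auto simp: scalar_prod_def atLeast0LessThan intro!: sum.cong)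
 qed
 then show "mm_output (A, B) = mm_result n (\<lambda>x. A $$ (x div n, x mod n)) (\<lambda>x. B $$ (x div n, x mod n))"
  by (simp add: mm_output_def mm_result_def c[OF AB])
qed

lemma mm_instance:
 fixes \<alpha> \<beta> :: "nat \<Rightarrow> nat"
 obtains A B where "(A, B) \<in> mm_instances" "mm_encode (A, B) = mm_input n \<alpha> \<beta>" "mm_output (A, B) = mm_result n \<alpha> \<beta>"
  "dim_row A = n"
proof
 let ?A = "mat n n (\<lambda>(i, j). \<alpha> (i * n + j))" and ?B = "mat n n (\<lambda>(i, j). \<beta> (i * n + j))"
 have c: "?A \<in> carrier_mat n n" "?B \<in> carrier_mat n n" by auto
 then show "(?A, ?B) \<in> mm_instances" unfolding mm_instances_def by blast
 have e: "mat n n (\<lambda>(i, j). \<gamma> (i * n + j)) $$ (x div n, x mod n) = \<gamma> x" if "x < n * n" for \<gamma> :: "nat \<Rightarrow> nat" and x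
 proof -
  have n: "0 < n" using that by (cases n) auto
  then show ?thesis using that by (simp add: less_mult_imp_div_less)
 qed
 have i: "x div n * n + y < n * n" "y * n + x mod n < n * n" if "x < n * n" "y < n" for x y
 proof -
  have n: "0 < n" using that by simp
  have "Suc (x div n) * n <= n * n" "Suc y * n <= n * n"
   using that n by (intro mult_le_mono1; simp add: Suc_le_eq less_mult_imp_div_less)+
  then have "x div n * n + n <= n * n" "y * n + n <= n * n" by simp_all
  then show "x div n * n + y < n * n" "y * n + x mod n < n * n"
   using that(2) mod_less_divisor[OF n, of x] by linarith+
 qed
 show "mm_encode (?A, ?B) = mm_input n \<alpha> \<beta>" unfolding mm_encode_eq(1)[OF c] mm_input_def by (simp add: e)
 show "mm_output (?A, ?B) = mm_result n \<alpha> \<beta>"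
  unfolding mm_encode_eq(2)[OF c] mm_result_def
 proof (intro map_cong sum.cong refl)
  fix x y assume "x \<in> set [0..<n * n]" "y \<in> {..<n}"
  then have xy: "x < n * n" "y < n" by auto
  show "?A $$ ((x div n * n + y) div n, (x div n * n + y) mod n) * ?B $$ ((y * n + x mod n) div n, (y * n + x mod n) mod n) =
    \<alpha> (x div n * n + y) * \<beta> (y * n + x mod n)"
   unfolding e[OF i(1)[OF xy]] e[OF i(2)[OF xy]] ..
 qed
qed simp

lemma mm_result_le: "\<forall>i. \<alpha> i <= 1 ==> \<forall>i. \<beta> i <= 1 ==> y \<in> set (mm_result n \<alpha> \<beta>) ==> y <= n"
proof -
 assume a: "\<forall>i. \<alpha> i <= 1" "\<forall>i. \<beta> i <= 1" and y: "y \<in> set (mm_result n \<alpha> \<beta>)"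
 then obtain i where y: "y = (\<Sum>x<n. \<alpha> (i div n * n + x) * \<beta> (x * n + i mod n))"
  by (auto simp: mm_result_def)
 have "\<alpha> r * \<beta> s <= 1 * 1" for r s using a by (intro mult_le_mono) auto
 then have "y <= (\<Sum>x<n. 1)" unfolding y by (intro sum_mono) simp
 then show "y <= n" by simp
qed

text \<open>A step writes at most one cell. The lower bound on running times rests on this.\<close>

lemma card_changed:
 "(step w pr ^^ t) (pc, R, M) = (pc', R', M') ==> finite {j. M' j ~= M j} & card {j. M' j ~= M j} <= t"
proof (induction t arbitrary: pc' R' M')
 case (Suc t)
 obtain pc1 R1 M1 where s: "(step w pr ^^ t) (pc, R, M) = (pc1, R1, M1)" by (metis prod_cases3)
 have IH: "finite {j. M1 j ~= M j}" "card {j. M1 j ~= M j} <= t" using Suc.IH[OF s] by auto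
 have "step w pr (pc1, R1, M1) = (pc', R', M')" using Suc.prems s by simp
 then have "M' = M1 \<or> (\<exists>x y. M' = M1(x := y))"
  by (cases "pr ! pc1") (auto simp: step_def split: if_splits)
 then have "\<exists>x. {j. M' j ~= M j} \<subseteq> insert x {j. M1 j ~= M j}"
 proof (elim disjE exE)
  fix x y assume "M' = M1(x := y)"
  then show ?thesis by (intro exI[of _ x]) auto
 qed blast
 then obtain x where "{j. M' j ~= M j} \<subseteq> insert x {j. M1 j ~= M j}" by blast
 then have "finite {j. M' j ~= M j}" "card {j. M' j ~= M j} <= card (insert x {j. M1 j ~= M j})"
  using IH by (auto intro: finite_subset card_mono)
 then show ?case using IH card_insert_le_m1[of "Suc t" "{j. M1 j ~= M j}" x] by auto
qed simp

text \<open>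
 The product of two all-ones matrices consists of \<open>n\<^sup>2\<close> copies of \<open>n\<close>, and the input
 contains \<open>n\<close> only once, so nearly all of these cells have to be written.
\<close>

lemma ones_lower_bound:
 assumes n: "2 <= n" and o: "outputs_after w pr (mm_input n (\<lambda>_. 1) (\<lambda>_. 1)) (mm_result n (\<lambda>_. 1) (\<lambda>_. 1)) t"
 shows "n * n <= t + 1"
proof -
 let ?xs = "mm_input n (\<lambda>_. 1) (\<lambda>_. 1)" and ?ys = "mm_result n (\<lambda>_. 1) (\<lambda>_. 1)"
 obtain pc R M where s: "(step w pr ^^ t) (initial_config w ?xs) = (pc, R, M)"
  "\<forall>i<length ?ys. M (R 0 + i) = ?ys ! i" using o unfolding outputs_after_def by blast
 define M0 where "M0 = (\<lambda>a. if a < length ?xs then ?xs ! a else 0)"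
 have Mn: "M j = n" if "j \<in> {R 0..<R 0 + n * n}" for j
 proof -
  have "j - R 0 < n * n" using that by auto
  moreover from this have "M (R 0 + (j - R 0)) = ?ys ! (j - R 0)"
   using s(2) unfolding length_mm_result by blast
  ultimately
  show ?thesis using that by (simp add: mm_result_def)
 qed
 have M0n: "M0 j ~= n" if j0: "j ~= 0" for j
 proof (cases "j < length ?xs")
  case True
  obtain i where j: "j = Suc i" using j0 by (cases j) auto
  have "?xs ! j = tl ?xs ! i" by (simp add: j mm_input_def)
  moreover have "i < length (tl ?xs)" using True j by simp
  ultimately have "?xs ! j \<in> set (tl ?xs)" by (metis nth_mem)
  then have "?xs ! j = 1" by (auto simp: mm_input_def)
  then show ?thesis using n True by (simp add: M0_def)
 qed (use n in \<open>simp add: M0_def\<close>)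
 have "{R 0..<R 0 + n * n} - {0} \<subseteq> {j. M j ~= M0 j}"
 proof
  fix j assume "j \<in> {R 0..<R 0 + n * n} - {0}"
  then have "M j = n" "M0 j ~= n" using Mn M0n by blast+
  then show "j \<in> {j. M j ~= M0 j}" by simp
 qed
 moreover have ch: "finite {j. M j ~= M0 j} & card {j. M j ~= M0 j} <= t"
  using s(1) unfolding initial_config_def M0_def[symmetric] by (rule card_changed)
 ultimately have "card ({R 0..<R 0 + n * n} - {0}) <= t" by (meson card_mono le_trans)
 moreover have "card {R 0..<R 0 + n * n} <= Suc (card ({R 0..<R 0 + n * n} - {0}))"
  by (metis card_Suc_Diff1 Diff_empty Diff_insert0 finite_atLeastLessThan le_SucI order_refl)
 ultimately show ?thesis by simp
qed

text \<open>For all-ones matrices \<open>n * n <= 2 * t\<close>. With an exponent below 2, the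
  polylogarithmic factor could be absorbed into a slightly larger power, which is refuted by a large
  \<open>n\<close>.\<close>

lemma mm_exponents_ge_2:
 assumes "\<tau> \<in> mm_exponents"
 shows "2 <= \<tau>"
proof (rule ccontr)
 assume "\<not> 2 <= \<tau>"
 \<comment> \<open>Raising \<open>\<tau>\<close> to at least 1 allows the summand 1 of the time
   bound to be absorbed by a factor 2.\<close>
 define \<sigma> where "\<sigma> = max \<tau> 1"
 have \<sigma>: "\<tau> <= \<sigma>" "1 <= \<sigma>" "\<sigma> < 2" using \<open>\<not> 2 <= \<tau>\<close> by (auto simp: \<sigma>_def)
 obtain prog c C k where P0: "\<forall>x\<in>mm_instances. \<forall>w. c * log 2 (real (length (mm_encode x)) + 2) <= real w &
   (\<forall>v \<in> set (mm_encode x) \<union> set (mm_output x). v < 2 ^ w) -->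
   (\<exists>t. outputs_after w prog (mm_encode x) (mm_output x) t &
    real t <= C * log 2 (real (length (mm_encode x)) + 2) ^ k * ((case x of (A, B) \<Rightarrow> real (dim_row A) powr \<tau>) + 1))"
  using assms unfolding mm_exponents_def solvable_in_soft_O_def mem_Collect_eq by (elim exE) (rule that)
 \<comment> \<open>Chosen such that \<open>\<sigma> + 4 * a = 2\<close>. The logarithms of an input
   of size about \<open>n * n\<close> cost \<open>n powr (2 * a)\<close>, and another
   \<open>n powr (2 * a)\<close> remains for the contradiction.\<close>
 define a where "a = (2 - \<sigma>) / 4"
 have a: "0 < a" using \<sigma> by (simp add: a_def)
 obtain K where K: "0 < K" "\<And>x. 1 <= x ==> log 2 x ^ k <= K * x powr a" using log_power_le[OF a, of k] by blast
 define D where "D = \<bar>C\<bar> * K * 5 powr a * 4"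
 have main: "real n powr (2 * a) <= D" if n: "2 <= n" for n :: nat
 proof -
  obtain A B where AB: "(A, B) \<in> mm_instances" "mm_encode (A, B) = mm_input n (\<lambda>_. 1) (\<lambda>_. 1)"
   "mm_output (A, B) = mm_result n (\<lambda>_. 1) (\<lambda>_. 1)" "dim_row A = n" using mm_instance by blast
  let ?y = "real (1 + 2 * n * n) + 2"
  \<comment> \<open>Any sufficient word length will do; the summand \<open>n\<close> makes all
    numbers fit, as \<open>n < 2 ^ n\<close>.\<close>
  define w where "w = nat \<lceil>c * log 2 ?y\<rceil> + n"
  have "c * log 2 ?y <= real w" unfolding w_def by linarith
  moreover have "v < 2 ^ w" if "v \<in> set (mm_input n (\<lambda>_. 1) (\<lambda>_. 1)) \<union> set (mm_result n (\<lambda>_. 1) (\<lambda>_. 1))" for v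
  proof -
   have "v <= n" using that mm_result_le[of "\<lambda>_. 1" "\<lambda>_. 1" v n] n by (auto simp: mm_input_def)
   also have "n < 2 ^ n" by (rule less_exp)
   also have "(2 :: nat) ^ n <= 2 ^ w" unfolding w_def by (intro power_increasing) auto
   finally show ?thesis .
  qed
  ultimately obtain t where t: "outputs_after w prog (mm_input n (\<lambda>_. 1) (\<lambda>_. 1)) (mm_result n (\<lambda>_. 1) (\<lambda>_. 1)) t"
   "real t <= C * log 2 ?y ^ k * (real n powr \<tau> + 1)"
   using P0[rule_format, OF AB(1), of w] unfolding AB(2,3) length_mm_input using AB(4) by auto
  have n1: "1 <= real n" using n by simp
  have "2 * 2 <= n * n" using n by (intro mult_le_mono)
  then have nn: "n * n <= 2 * t" using ones_lower_bound[OF n t(1)] by linarith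
  have y1: "1 <= ?y" by simp
  have y: "?y <= 5 * (real n * real n)"
  proof -
   have "real (3 :: nat) <= real (3 * (n * n))" using \<open>2 * 2 <= n * n\<close> by (intro of_nat_mono) linarith
   then show ?thesis by simp
  qed
  have "0 <= log 2 ?y" using y1 by (subst zero_le_log_cancel_iff) linarith+
  then have lg: "0 <= log 2 ?y ^ k" by (rule zero_le_power)
  have "log 2 ?y ^ k <= K * ?y powr a" by (rule K(2)[OF y1])
  also have "\<dots> <= K * (5 * (real n * real n)) powr a" using K(1) y a by (intro mult_left_mono powr_mono2) auto
  also have "\<dots> = K * 5 powr a * real n powr (2 * a)"
   using n by (simp add: powr_mult powr_add[symmetric])
  finally have l: "log 2 ?y ^ k <= K * 5 powr a * real n powr (2 * a)" .
  have p: "real n powr \<tau> + 1 <= 2 * real n powr \<sigma>"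
   using powr_mono[OF \<sigma>(1) n1] ge_one_powr_ge_zero[OF n1, of \<sigma>] \<sigma> by simp
  have "real n powr 2 = real (n * n)" using n by (simp add: power2_eq_square)
  also have "\<dots> <= 2 * real t" using nn by (metis of_nat_le_iff of_nat_mult of_nat_numeral)
  also have "\<dots> <= 2 * (C * log 2 ?y ^ k * (real n powr \<tau> + 1))" using t(2) by simp
  also have "\<dots> <= 2 * (\<bar>C\<bar> * (K * 5 powr a * real n powr (2 * a)) * (2 * real n powr \<sigma>))"
   using l p lg K(1) by (intro mult_left_mono mult_mono) auto
  also have "\<dots> = D * real n powr (2 * a + \<sigma>)" unfolding D_def powr_add by simp
  finally have "real n powr 2 <= D * real n powr (2 * a + \<sigma>)" .
  then have "real n powr 2 * real n powr (- 2 * a - \<sigma>) <= D * real n powr (2 * a + \<sigma>) * real n powr (- 2 * a - \<sigma>)"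
   by (intro mult_right_mono) auto
  also have "\<dots> = D" using n by (simp add: mult.assoc powr_add[symmetric])
  also have "real n powr 2 * real n powr (- 2 * a - \<sigma>) = real n powr (2 * a)"
   unfolding powr_add[symmetric] a_def by (rule arg_cong[where f = "(powr) (real n)"]) (simp add: field_simps)
  finally show ?thesis .
 qed
 have D0: "0 <= D" using K(1) by (simp add: D_def)
 define x where "x = (D + 1) powr (1 / (2 * a))"
 define n where "n = nat \<lceil>x\<rceil> + 2"
 have "x <= real n" unfolding n_def by linarith
 then have "x powr (2 * a) <= real n powr (2 * a)" using a by (intro powr_mono2) (auto simp: x_def)
 moreover have "x powr (2 * a) = D + 1" unfolding x_def powr_powr using a D0 by simp
 ultimately show False using main[of n] by (simp add: n_def)
qed

text \<open>Cubic multiplication with its three loops flattened into one: variable 14 is the output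
  index, variable 15 the summation index. It shows that some exponent is achievable, without which
  the infimum would have no meaning.\<close>

definition "naive_code =
 Asg 2 (Lo (Cn 0));;
 For 13 (Vr 2 [*] Vr 2 [*] Vr 2) (
  Asg 14 (Vr 13 [div] Vr 2);; Asg 15 (Vr 13 [mod] Vr 2);;
  Acc (Vr 14) (Cn 1 [+] Vr 14 [div] Vr 2 [*] Vr 2 [+] Vr 15)
   (Cn 1 [+] Vr 2 [*] Vr 2 [+] (Vr 15 [*] Vr 2 [+] Vr 14 [mod] Vr 2)));;
 Asg 3 (Vr 2 [*] Vr 2)"

lemma (in word_ram_sub) bounded_input:
 assumes "length xs < Z" "\<forall>v\<in>set xs. v < 2 ^ w"
 shows "bounded (input_vars xs) (input_arrays xs)"
proof -
 have "0 < Z" "(0 :: nat) < 2 ^ w" using assms by auto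
 then show ?thesis using assms by (simp add: bounded_def input_vars_def input_arrays_def)
qed

text \<open>Partial sums never exceed the final entry, which fits into a word by assumption; so
  \<open>Acc\<close> does not overflow.\<close>

lemma (in word_ram_sub) naive_correct:
 assumes xs: "xs = mm_input n \<alpha> \<beta>" and w: "\<forall>v\<in>set xs. v < 2 ^ w" "\<forall>v\<in>set (mm_result n \<alpha> \<beta>). v < 2 ^ w"
  and Z: "length xs * length xs < Z"
 shows "wp naive_code (\<lambda>t v a. t <= 4 * (n * n * n) + 4 & v 3 = length (mm_result n \<alpha> \<beta>) &
  (\<forall>i<length (mm_result n \<alpha> \<beta>). a 30 0 i = mm_result n \<alpha> \<beta> ! i)) 0 (input_vars xs) (input_arrays xs)"
proof -
 let ?L = "1 + 2 * n * n"
 have L: "length xs = ?L" by (simp add: xs)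
 define X where "X j = (if j < length xs then xs ! j else 0)" for j
 have X0: "input_arrays xs 0 0 = X" by (auto simp: input_arrays_def X_def)
 have Xs: "X 0 = n" "\<And>i. i < n * n ==> X (1 + i) = \<alpha> i" "\<And>i. i < n * n ==> X (1 + n * n + i) = \<beta> i"
  by (auto simp: X_def xs mm_input_def nth_append)
 define tm where "tm x y = \<alpha> (x div n * n + y) * \<beta> (y * n + x mod n)" for x y
 have res: "mm_result n \<alpha> \<beta> ! x = (\<Sum>y<n. tm x y)" if "x < n * n" for x
  using that by (simp add: mm_result_def tm_def)
 define S where "S q x = (\<Sum>y<n. if x * n + y < q then tm x y else 0)" for q x
 have nL: "n <= ?L" "n * n <= ?L"
 proof -
  show "n <= ?L" by (cases n) auto
 qed simp
 have "?L * 1 <= ?L * ?L" by (intro mult_le_mono2) simp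
 then have "?L * 1 < Z" using Z unfolding L by (rule le_less_trans)
 then have LZ: "?L < Z" by (simp only: mult_1_right)
 have nZ: "n < Z" "n * n < Z" using nL LZ by linarith+
 have "n * (n * n) <= ?L * ?L" using nL by (intro mult_le_mono)
 then have "n * (n * n) < Z" using Z unfolding L by (rule le_less_trans)
 then have n3: "n * n * n < Z" by (simp only: mult.assoc)
 define I where "I q v a \<longleftrightarrow> (\<forall>x<n * n. a 30 0 x = S q x)" for q and v :: vars and a :: arrays
 have bd0: "bounded (input_vars xs) (input_arrays xs)" using bounded_input w(1) LZ L by simp
 let ?v = "(input_vars xs)(2 := n)"
 have bd1: "bounded ?v (input_arrays xs)" using bd0 nZ by (intro bounded_asg)
 let ?body = "Asg 14 (Vr 13 [div] Vr 2);; Asg 15 (Vr 13 [mod] Vr 2);;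
  Acc (Vr 14) (Cn 1 [+] Vr 14 [div] Vr 2 [*] Vr 2 [+] Vr 15)
   (Cn 1 [+] Vr 2 [*] Vr 2 [+] (Vr 15 [*] Vr 2 [+] Vr 14 [mod] Vr 2))"
 let ?Q = "\<lambda>t v a. t <= 4 * (n * n * n) + 4 & v 3 = length (mm_result n \<alpha> \<beta>) &
  (\<forall>i<length (mm_result n \<alpha> \<beta>). a 30 0 i = mm_result n \<alpha> \<beta> ! i)"
 have loop: "wp (For 13 (Vr 2 [*] Vr 2 [*] Vr 2) ?body) (wp (Asg 3 (Vr 2 [*] Vr 2)) ?Q) 1 ?v (input_arrays xs)"
 proof (rule wp_For_const[where I = I and n = "n * n * n" and T = 3])
  fix q t v a
  assume q: "q < n * n * n" and I: "I q v a" and bd: "bounded v a"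
   and fr: "frame (For 13 (Vr 2 [*] Vr 2 [*] Vr 2) ?body) ?v (input_arrays xs) v a"
  have v2: "v 2 = n" using frame_var[OF fr, of 2] by simp
  have a0: "a 0 0 = X" using frame_array[OF fr, of 0] X0 by simp
  have n0: "0 < n" using q by (cases n) auto
  let ?x = "q div n" and ?y = "q mod n"
  have x: "?x < n * n" "?y < n" "?x mod n < n" "?x div n < n" "?x * n + ?y = q"
   using q n0 by (auto simp: less_mult_imp_div_less)
  have ix: "?x div n * n + ?y < n * n" "?y * n + ?x mod n < n * n"
  proof -
   have "Suc (?x div n) * n <= n * n" "Suc ?y * n <= n * n"
    using mult_le_mono1[OF Suc_leI[OF x(4)]] mult_le_mono1[OF Suc_leI[OF x(2)]] by blast+
   then have "?x div n * n + n <= n * n" "?y * n + n <= n * n" by simp_all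
   then show "?x div n * n + ?y < n * n" "?y * n + ?x mod n < n * n" using x(2,3) by linarith+
  qed
  have e: "a 0 0 (1 + ?x div n * n + ?y) = \<alpha> (?x div n * n + ?y)"
   "a 0 0 (1 + n * n + (?y * n + ?x mod n)) = \<beta> (?y * n + ?x mod n)"
   using Xs(2)[OF ix(1)] Xs(3)[OF ix(2)] by (simp_all add: a0)
  have SS: "S (Suc q) z = S q z + (if z = ?x then tm z ?y else 0)" for z
  proof -
   have "S (Suc q) z = (\<Sum>y<n. (if z * n + y < q then tm z y else 0) + (if z * n + y = q then tm z y else 0))"
    unfolding S_def by (intro sum.cong) auto
   also have "\<dots> = S q z + (\<Sum>y<n. if z * n + y = q then tm z y else 0)" by (simp add: sum.distrib S_def)
   also have "(\<Sum>y<n. if z * n + y = q then tm z y else 0) = (\<Sum>y<n. if y = ?y then (if z = ?x then tm z y else 0) else 0)"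
   proof (intro sum.cong refl)
    fix y assume "y \<in> {..<n}"
    then have "z * n + y = q \<longleftrightarrow> y = ?y & z = ?x" using n0 x(5) by auto
    then show "(if z * n + y = q then tm z y else 0) = (if y = ?y then (if z = ?x then tm z y else 0) else 0)" by simp
   qed
   also have "\<dots> = (if z = ?x then tm z ?y else 0)" using x(2) by (subst sum.delta) auto
   finally show ?thesis .
  qed
  have new: "a 30 0 ?x + tm ?x ?y = S (Suc q) ?x" using I x(1) by (simp add: I_def SS)
  have "S (Suc q) ?x <= (\<Sum>y<n. tm ?x y)" unfolding S_def by (intro sum_mono) auto
  also have "\<dots> < 2 ^ w" using w(2) res[OF x(1)] x(1) by (metis length_mm_result nth_mem)
  finally have small: "a 30 0 ?x + tm ?x ?y < 2 ^ w" using new by simp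
  have I': "I (Suc q) v' (upd a 30 0 ?x (a 30 0 ?x + tm ?x ?y))" for v'
   using I new by (auto simp: I_def SS upd_same)
  have xz: "?x < Z" "?y < Z" using x nZ by linarith+
  show "wp ?body (\<lambda>t' v' a'. t' <= t + 3 & I (Suc q) v' a') t (v(13 := q)) a"
   using xz small I' v2 e unfolding tm_def by simp
 next
  fix t' v' a'
  assume t': "t' <= 1 + 1 + n * n * n * (3 + 1)" and I: "I (n * n * n) v' a'"
   and fr: "frame (For 13 (Vr 2 [*] Vr 2 [*] Vr 2) ?body) ?v (input_arrays xs) v' a'"
  have v2: "v' 2 = n" using frame_var[OF fr, of 2] by simp
  have "a' 30 0 x = mm_result n \<alpha> \<beta> ! x" if x: "x < n * n" for x
  proof -
   have "x * n + y < n * n * n" if "y < n" for y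
   proof -
    have "Suc x * n <= n * n * n" using x by (intro mult_le_mono1) simp
    then show ?thesis using that by simp
   qed
   then have "S (n * n * n) x = (\<Sum>y<n. tm x y)" unfolding S_def by (intro sum.cong) auto
   then show ?thesis using I x res[OF x] by (simp add: I_def)
  qed
  then show "wp (Asg 3 (Vr 2 [*] Vr 2)) ?Q t' v' a'" using v2 nZ t' by simp
 next
  show "I 0 ?v (input_arrays xs)" by (simp add: I_def S_def input_arrays_def)
 qed (use bd1 n3 in auto)
 have "X 0 mod Z = n" using Xs(1) nZ by simp
 then show ?thesis unfolding naive_code_def using loop nZ X0
  by (simp only: wp.simps(2,6)) (simp add: X0 Xs(1) del: wp.simps)
qed

text \<open>The exponent 3 is achieved. With \<open>d = 2\<close>, \<open>Z\<close> exceeds the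
  square of the input length, as \<open>naive_correct\<close> requires; the foreign program is
  empty.\<close>

lemma mm_exponents_nonempty: "mm_exponents ~= {}"
proof -
 let ?F = "com_len [] naive_code + 2"
 have "solvable_in_soft_O mm_instances mm_encode mm_output (\<lambda>(A, B). real (dim_row A) powr 3)"
  unfolding solvable_in_soft_O_def
 proof (rule exI[of _ "program 2 [] naive_code 30 3"], rule exI[of _ "24 * real (2 :: nat) + 6"],
   rule exI[of _ "real (4 * ?F + 13)"], rule exI[of _ 0], intro ballI allI impI)
  fix x w
  assume x: "x \<in> mm_instances" and w: "(24 * real (2 :: nat) + 6) * log 2 (real (length (mm_encode x)) + 2) <= real w &
   (\<forall>v\<in>set (mm_encode x) \<union> set (mm_output x). v < 2 ^ w)"
  obtain A B n where AB: "x = (A, B)" "A \<in> carrier_mat n n" "B \<in> carrier_mat n n"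
   using x by (auto simp: mm_instances_def)
  define xs where "xs = mm_encode x"
  define Z where "Z = (2 * length xs + 8) ^ 2"
  have enc: "xs = mm_input n (\<lambda>x. A $$ (x div n, x mod n)) (\<lambda>x. B $$ (x div n, x mod n))"
   "mm_output x = mm_result n (\<lambda>x. A $$ (x div n, x mod n)) (\<lambda>x. B $$ (x div n, x mod n))"
   using mm_encode_eq[OF AB(2,3)] by (simp_all add: xs_def AB(1))
  have Z8: "64 * Z ^ 8 <= 2 ^ w" unfolding Z_def by (rule word_size) (use w xs_def in simp)
  have Z: "length xs * length xs < Z" "16 <= Z" "1 <= Z" by (simp_all add: Z_def power2_eq_square algebra_simps)
  interpret R: word_ram_sub w Z "[]" 0
   by unfold_locales (use Z Z8 in auto)
  have wp: "R.wp naive_code (\<lambda>t v a. t <= 4 * (n * n * n) + 4 & v 3 = length (mm_output x) &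
    (\<forall>i<length (mm_output x). a 30 0 i = mm_output x ! i)) 0 (input_vars xs) (input_arrays xs)"
   unfolding enc(2) by (rule R.naive_correct[OF enc(1)]) (use w enc Z xs_def in auto)
  have "\<exists>t. outputs_after w (program 2 [] naive_code 30 3) xs (mm_output x) t &
    t <= ?F * (4 * (n * n * n) + 4) + (2 + 11)"
   by (rule program_correct[OF R.word_ram_sub_axioms Z_def _ _ _ _ _ wp])
    (use w xs_def in \<open>auto simp: naive_code_def\<close>)
  then obtain t where t: "outputs_after w (program 2 [] naive_code 30 3) xs (mm_output x) t"
   "t <= ?F * (4 * (n * n * n) + 4) + (2 + 11)" by blast
  have "t <= (4 * ?F + 13) * (n * n * n + 1)" using t(2) by (simp add: algebra_simps)
  then have "real t <= real ((4 * ?F + 13) * (n * n * n + 1))" by (simp only: of_nat_le_iff)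
  also have "\<dots> = real (4 * ?F + 13) * (real n powr 3 + 1)"
  proof -
   have p: "real n powr 3 = real (n * n * n)" by (simp add: power3_eq_cube)
   show ?thesis unfolding p by (simp only: of_nat_mult of_nat_add of_nat_1)
  qed
  finally show "\<exists>t. outputs_after w (program 2 [] naive_code 30 3) (mm_encode x) (mm_output x) t &
    real t <= real (4 * ?F + 13) * log 2 (real (length (mm_encode x)) + 2) ^ 0 *
     ((case x of (A, B) \<Rightarrow> real (dim_row A) powr 3) + 1)"
   using t(1) AB xs_def by auto
 qed
 then show ?thesis unfolding mm_exponents_def by blast
qed

section \<open>Instances and their encoding\<close>

text \<open>The least period is small as soon as some period is, so minimality never has to be
  tested.\<close>

lemma strongly_periodic_iff:
 assumes "0 < length W"
 shows "strongly_periodic W \<longleftrightarrow> (\<exists>p\<ge>1. 4 * p <= length W & is_period p W)"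
proof -
 have "is_period (length W) W" using assms by (simp add: is_period_def Suc_le_eq)
 then have per: "is_period (per W) W" unfolding per_def by (rule LeastI)
 have sp: "strongly_periodic W \<longleftrightarrow> 4 * per W <= length W"
 proof -
  have "strongly_periodic W \<longleftrightarrow> real (4 * per W) <= real (length W)"
   by (simp add: strongly_periodic_def field_simps)
  then show ?thesis by (simp only: of_nat_le_iff)
 qed
 show ?thesis
 proof
  assume "strongly_periodic W"
  then show "\<exists>p\<ge>1. 4 * p <= length W & is_period p W"
   using per unfolding sp by (intro exI[of _ "per W"]) (simp add: is_period_def)
 next
  assume "\<exists>p\<ge>1. 4 * p <= length W & is_period p W"
  then obtain p where p: "4 * p <= length W" "is_period p W" by blast
  have "per W <= p" unfolding per_def using p(2) by (rule Least_le)
  then show "strongly_periodic W" unfolding sp using p(1) by linarith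
 qed
qed

lemma sper_at_window:
 assumes i: "i + l <= length S" "0 < l" and g: "\<And>x. x < length S ==> g (c + x) = S ! x"
 shows "sper_at l g (c + i) \<longleftrightarrow> strongly_periodic (take l (drop i S))"
proof -
 let ?W = "take l (drop i S)"
 have len: "length ?W = l" using i by simp
 have W: "?W ! j = g (c + i + j)" if j: "j < l" for j using i g[of "i + j"] j by (simp add: add.assoc)
 have "is_period p ?W \<longleftrightarrow> periodic_at l g (c + i) p" if p: "1 <= p" "4 * p <= l" for p
 proof -
  have pl: "p <= l" using p by linarith
  have "?W ! j = ?W ! (j + p) \<longleftrightarrow> g (c + i + j) = g (c + i + j + p)" if j: "j + p < l" for j
   using W[of j] W[of "j + p"] j by (simp add: add.assoc)
  then show ?thesis using p pl unfolding is_period_def periodic_at_def len by blast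
 qed
 then show ?thesis using strongly_periodic_iff[of ?W] i(2) unfolding sper_at_def len by blast
qed

text \<open>Without a switch every window would agree with the first one by induction, whereas type
  2 provides windows of both kinds.\<close>

lemma type2_switch:
 assumes t: "type2 l S" "0 < l" and g: "\<And>x. x < length S ==> g (c + x) = S ! x"
 shows "\<exists>i. i + l < length S & sper_at l g (c + i) ~= sper_at l g (c + i + 1)"
proof (rule ccontr)
 assume no: "\<not> ?thesis"
 have const: "i + l <= length S ==> sper_at l g (c + i) = sper_at l g c" for i
 proof (induction i)
  case (Suc i)
  then have "i + l < length S" by simp
  then have "sper_at l g (c + i) = sper_at l g (c + i + 1)" using no by blast
  then show ?case using Suc by simp
 qed simp
 have win: "strongly_periodic W \<longleftrightarrow> sper_at l g c" if W: "sublist W S" "length W = l" for W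
 proof -
  obtain ps ss where S: "S = ps @ W @ ss" using W(1) by (auto simp: sublist_def)
  have i: "take l (drop (length ps) S) = W" "length ps + l <= length S" using W(2) by (simp_all add: S)
  show ?thesis using sper_at_window[OF i(2) t(2) g] const[OF i(2)] i(1) by simp
 qed
 show False using t(1) win unfolding type2_def by blast
qed

definition string_pos :: "nat list list \<Rightarrow> nat \<Rightarrow> nat" where
 "string_pos Ss s = length (concat (map (\<lambda>S. length S # S) (take s Ss)))"

lemma string_pos_Suc: "s < length Ss ==> string_pos Ss (Suc s) = string_pos Ss s + 1 + length (Ss ! s)"
 by (simp add: string_pos_def take_Suc_conv_app_nth)

lemma nth_strings:
 assumes "s < length Ss" "j <= length (Ss ! s)"
 shows "concat (map (\<lambda>S. length S # S) Ss) ! (string_pos Ss s + j) = (length (Ss ! s) # Ss ! s) ! j"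
proof -
 let ?F = "\<lambda>S :: nat list. length S # S"
 let ?A = "concat (map ?F (take s Ss))"
 have "concat (map ?F Ss) = concat (map ?F (take s Ss @ Ss ! s # drop (Suc s) Ss))"
  by (rule arg_cong[OF id_take_nth_drop[OF assms(1)], of "\<lambda>T. concat (map ?F T)"])
 also have "\<dots> = ?A @ (?F (Ss ! s) @ concat (map ?F (drop (Suc s) Ss)))" by simp
 finally have "concat (map ?F Ss) ! (length ?A + j) = (?F (Ss ! s) @ concat (map ?F (drop (Suc s) Ss))) ! j"
  by (simp only: nth_append_length_plus)
 also have "\<dots> = ?F (Ss ! s) ! j" using assms(2) by (subst nth_append) simp
 finally show ?thesis by (simp only: string_pos_def)
qed

lemma length_strings: "length (concat (map (\<lambda>S. length S # S) Ss)) = length Ss + total_length Ss"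
 by (induction Ss) (simp_all add: total_length_def)

lemma length_le_total_length: "\<forall>S\<in>set Ss. S ~= [] ==> length Ss <= total_length Ss"
proof (induction Ss)
 case (Cons S Ss)
 then have "1 <= length S" by (cases S) auto
 then show ?case using Cons by (simp add: total_length_def)
qed (simp add: total_length_def)

lemma ap_encode_nth:
 assumes "length U = length P"
 shows "length (ap_encode (l, P, U, Ss)) = 3 + 2 * length P + (length Ss + total_length Ss)"
  "ap_encode (l, P, U, Ss) ! 0 = l" "ap_encode (l, P, U, Ss) ! 1 = length P"
  "i < length P ==> ap_encode (l, P, U, Ss) ! (2 + i) = P ! i"
  "i < length P ==> ap_encode (l, P, U, Ss) ! (2 + length P + i) = of_bool (U ! i)"
  "ap_encode (l, P, U, Ss) ! (2 + 2 * length P) = length Ss"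
  "s < length Ss ==> j <= length (Ss ! s) ==>
   ap_encode (l, P, U, Ss) ! (3 + 2 * length P + string_pos Ss s + j) = (length (Ss ! s) # Ss ! s) ! j"
proof -
 let ?C = "concat (map (\<lambda>S. length S # S) Ss)"
 define A where "A = [l, length P] @ P @ map of_bool U @ [length Ss]"
 have e: "ap_encode (l, P, U, Ss) = A @ ?C" by (simp add: ap_encode_def A_def)
 have lA: "length A = 3 + 2 * length P" using assms by (simp add: A_def)
 show "length (ap_encode (l, P, U, Ss)) = 3 + 2 * length P + (length Ss + total_length Ss)"
  unfolding e length_append lA length_strings ..
 have n: "ap_encode (l, P, U, Ss) ! i = A ! i" if "i < 3 + 2 * length P" for i
  using that by (simp add: e nth_append lA)
 show "ap_encode (l, P, U, Ss) ! 0 = l" "ap_encode (l, P, U, Ss) ! 1 = length P"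
  by (simp_all add: ap_encode_def)
 have A: "A ! (2 + i) = (P @ map of_bool U @ [length Ss]) ! i" for i by (simp add: A_def)
 show "i < length P ==> ap_encode (l, P, U, Ss) ! (2 + i) = P ! i"
  by (subst n) (simp_all only: A, simp_all add: nth_append)
 show "ap_encode (l, P, U, Ss) ! (2 + length P + i) = of_bool (U ! i)" if i: "i < length P"
 proof -
  have "ap_encode (l, P, U, Ss) ! (2 + length P + i) = A ! (2 + (length P + i))"
   using n[of "2 + length P + i"] i by (simp add: add.assoc)
  also have "\<dots> = (map of_bool U @ [length Ss]) ! i" unfolding A by (rule nth_append_length_plus)
  also have "\<dots> = of_bool (U ! i)" using i assms by (simp add: nth_append)
  finally show ?thesis .
 qed
 show "ap_encode (l, P, U, Ss) ! (2 + 2 * length P) = length Ss"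
 proof -
  have "ap_encode (l, P, U, Ss) ! (2 + 2 * length P) = A ! (2 + 2 * length P)" by (rule n) simp
  also have "\<dots> = A ! (2 + (length P + length P))" by (simp only: mult_2)
  also have "\<dots> = (map of_bool U @ [length Ss]) ! length P" unfolding A by (rule nth_append_length_plus)
  also have "\<dots> = length Ss" using assms by (simp add: nth_append)
  finally show ?thesis .
 qed
 assume "s < length Ss" "j <= length (Ss ! s)"
 then have "?C ! (string_pos Ss s + j) = (length (Ss ! s) # Ss ! s) ! j" by (rule nth_strings)
 then show "ap_encode (l, P, U, Ss) ! (3 + 2 * length P + string_pos Ss s + j) = (length (Ss ! s) # Ss ! s) ! j"
  using nth_append_length_plus[of A ?C "string_pos Ss s + j"] by (simp only: e lA add.assoc)
qed

text \<open>\<open>b\<close> is the length of the active prefix and thus also the 0-based start of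
  the occurrence; the output index \<open>i\<close> is one less than the length of the extended
  prefix.\<close>

lemma ap_output_nth:
 assumes "i < length P"
 shows "ap_output (l, P, U, Ss) ! i = of_bool (\<exists>s<length Ss. \<exists>b\<ge>1. b + length (Ss ! s) <= length P &
  U ! (b - 1) & (\<forall>x<length (Ss ! s). Ss ! s ! x = P ! (b + x)) & i + 1 = b + length (Ss ! s))"
proof -
 have eq: "take b P @ S = take (b + length S) P \<longleftrightarrow> (\<forall>x<length S. S ! x = P ! (b + x))"
  if b: "b + length S <= length P" for b S
 proof -
  have "take b P @ S = take (b + length S) P \<longleftrightarrow> S = take (length S) (drop b P)" by (simp add: take_add)
  also have "\<dots> \<longleftrightarrow> (\<forall>x<length S. S ! x = P ! (b + x))"
   using b by (subst list_eq_iff_nth_eq) (auto simp: min_def)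
  finally show ?thesis .
 qed
 have "[1..<length P + 1] ! i = i + 1" using assms by (subst nth_upt) auto
 then have "ap_output (l, P, U, Ss) ! i = of_bool (\<exists>S\<in>set Ss. \<exists>b\<in>{1..length P}. U ! (b - 1) &
   take b P @ S = take (b + length S) P & i + 1 = b + length S)"
  using assms by (simp add: ap_output_def active_prefixes_def del: upt_Suc)
 also have "(\<exists>S\<in>set Ss. \<exists>b\<in>{1..length P}. U ! (b - 1) & take b P @ S = take (b + length S) P & i + 1 = b + length S) \<longleftrightarrow>
   (\<exists>s<length Ss. \<exists>b\<ge>1. b + length (Ss ! s) <= length P &
  U ! (b - 1) & (\<forall>x<length (Ss ! s). Ss ! s ! x = P ! (b + x)) & i + 1 = b + length (Ss ! s))" (is "?L \<longleftrightarrow> ?R")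
 proof
  assume ?L
  then obtain S b where S: "S \<in> set Ss" "1 <= b" "U ! (b - 1)" "take b P @ S = take (b + length S) P" "i + 1 = b + length S"
   by auto
  obtain s where s: "s < length Ss" "Ss ! s = S" using S(1) by (auto simp: in_set_conv_nth)
  have "b + length S <= length P" using S(5) assms by linarith
  then show ?R using S s eq by blast
 next
  assume ?R
  then obtain s b where s: "s < length Ss" "1 <= b" "b + length (Ss ! s) <= length P" "U ! (b - 1)"
   "\<forall>x<length (Ss ! s). Ss ! s ! x = P ! (b + x)" "i + 1 = b + length (Ss ! s)" by blast
  have "b \<in> {1..length P}" "Ss ! s \<in> set Ss" using s by auto
  then show ?L using s eq[OF s(3)] by blast
 qed
 finally show ?thesis .
qed

text \<open>The decisive term is \<open>B * Tm\<close>: \<open>B\<close> is about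
  \<open>m / l^2\<close> and \<open>Tm\<close> about \<open>l powr \<tau>\<close>, so
  \<open>2 <= \<tau>\<close> and \<open>l <= m\<close> bound it by about
  \<open>m * m powr (\<tau> - 2)\<close>. Two logarithms come from \<open>E * E\<close>, the other
  \<open>k\<close> from \<open>Tm\<close>.\<close>

lemma real_time_bound:
 fixes l m L N E d F B Tm t :: nat and C1 lg \<tau> :: real
 assumes t: "t <= F * (d + 1000 * (L * (E * E)) + B * Tm) + (d + 11)"
  and B: "B * (l * l) <= 5 * m * (E * E)" "l = 0 --> B = 0" and lm: "l <= m" and L: "L <= 3 + 2 * m + 2 * N"
  and E: "real E <= 3 * lg" and lg: "1 <= lg" and \<tau>: "2 <= \<tau>" and C1: "0 <= C1"
  and Tm: "real Tm <= C1 * (3 * lg) ^ k * (real (2 * l) powr \<tau> + 1)"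
 shows "real t <= (real F * (real d + 27000 + 360 * (C1 * 3 ^ k * 2 powr (\<tau> - 2))) + real d + 11) *
  lg ^ (k + 2) * (real m powr (\<tau> - 1) + real N + 1)"
proof -
 define G where "G = lg ^ (k + 2)"
 define W where "W = real m powr (\<tau> - 1) + real N + 1"
 define H where "H = C1 * 3 ^ k * 2 powr (\<tau> - 2)"
 have G1: "1 <= G" unfolding G_def using lg by (intro one_le_power)
 have W1: "1 <= W" "real m powr (\<tau> - 1) <= W" by (simp_all add: W_def)
 have H0: "0 <= H" using C1 by (simp add: H_def)
 have lg2: "lg ^ 2 <= G" unfolding G_def using lg by (intro power_increasing) auto
 have mp: "real m <= real m powr (\<tau> - 1)"
 proof (cases "m = 0")
  case False
  then show ?thesis using powr_mono[of 1 "\<tau> - 1" "real m"] \<tau> by simp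
 qed simp
 have LW: "real L <= 3 * W"
 proof -
  have "real L <= real (3 + 2 * m + 2 * N)" using L by (simp only: of_nat_le_iff)
  then show ?thesis using mp unfolding W_def by simp
 qed
 have EE: "real E * real E <= 9 * lg ^ 2"
 proof -
  have "real E * real E <= (3 * lg) * (3 * lg)" using E lg by (intro mult_mono) auto
  then show ?thesis by (simp add: power2_eq_square)
 qed
 have a: "real L * (real E * real E) <= 27 * (G * W)"
 proof -
  have EG: "real E * real E <= 9 * G" using EE lg2 by linarith
  have "real L * (real E * real E) <= (3 * W) * (9 * G)"
   by (rule mult_mono[OF LW EG]) (use W1 in auto)
  then show ?thesis by (simp add: mult.commute)
 qed
 have b: "real B * real Tm <= 360 * H * (G * W)"
 proof (cases "l = 0")
  case True
  then show ?thesis using B(2) H0 G1 W1 by simp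
 next
  case False
  then have m0: "0 < real m" "0 < real l" "1 <= real (2 * l)" using lm by simp_all
  let ?p = "real (2 * l) powr \<tau>"
  have p1: "1 <= ?p" using ge_one_powr_ge_zero[OF m0(3), of \<tau>] \<tau> by simp
  have "?p = real (2 * l) powr 2 * real (2 * l) powr (\<tau> - 2)" unfolding powr_add[symmetric] by simp
  also have "real (2 * l) powr 2 = 4 * (real l * real l)" using m0 by (simp add: power2_eq_square)
  also have "real (2 * l) powr (\<tau> - 2) <= real (2 * m) powr (\<tau> - 2)" using lm \<tau> by (intro powr_mono2) auto
  also have "real (2 * m) powr (\<tau> - 2) = 2 powr (\<tau> - 2) * real m powr (\<tau> - 2)"
   using m0 by (simp add: powr_mult)
  finally have p: "?p <= 4 * (real l * real l) * (2 powr (\<tau> - 2) * real m powr (\<tau> - 2))"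
   using m0 by simp
  have Bl: "real B * (real l * real l) <= 5 * real m * (9 * lg ^ 2)"
  proof -
   have "real (B * (l * l)) <= real (5 * m * (E * E))" using B(1) by (simp only: of_nat_le_iff)
   also have "\<dots> = 5 * real m * (real E * real E)" by simp
   also have "\<dots> <= 5 * real m * (9 * lg ^ 2)" using EE by (intro mult_left_mono) auto
   finally show ?thesis by simp
  qed
  define c where "c = C1 * (3 * lg) ^ k * 2"
  have c0: "0 <= c" using C1 lg by (simp add: c_def)
  have "real Tm <= C1 * (3 * lg) ^ k * (2 * ?p)"
   by (rule order_trans[OF Tm]) (use C1 lg p1 in \<open>auto intro!: mult_left_mono\<close>)
  then have "real Tm <= c * ?p" by (simp add: c_def)
  also have "\<dots> <= c * (4 * (real l * real l) * (2 powr (\<tau> - 2) * real m powr (\<tau> - 2)))"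
   using p c0 by (rule mult_left_mono)
  finally have "real B * real Tm <= real B * (c * (4 * (real l * real l) * (2 powr (\<tau> - 2) * real m powr (\<tau> - 2))))"
   by (rule mult_left_mono) simp
  also have "\<dots> = c * 4 * (2 powr (\<tau> - 2) * real m powr (\<tau> - 2)) * (real B * (real l * real l))" by simp
  also have "\<dots> <= c * 4 * (2 powr (\<tau> - 2) * real m powr (\<tau> - 2)) * (5 * real m * (9 * lg ^ 2))"
   using Bl c0 by (intro mult_left_mono) auto
  also have "\<dots> = 360 * H * (lg ^ k * lg ^ 2) * (real m powr 1 * real m powr (\<tau> - 2))"
   using m0 by (simp add: c_def H_def power_mult_distrib)
  also have "\<dots> = 360 * H * G * real m powr (\<tau> - 1)"
   unfolding powr_add[symmetric] power_add[symmetric] G_def by simp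
  also have "\<dots> <= 360 * H * G * W" using W1 H0 G1 by (intro mult_left_mono) auto
  finally show ?thesis by (simp only: mult.assoc)
 qed
 have GW: "1 <= G * W" using mult_mono[OF G1 W1(1)] G1 by simp
 have "real t <= real (F * (d + 1000 * (L * (E * E)) + B * Tm) + (d + 11))" using t by (simp only: of_nat_le_iff)
 also have "\<dots> = real F * (real d + 1000 * (real L * (real E * real E)) + real B * real Tm) + (real d + 11)" by simp
 also have "\<dots> <= real F * (real d * (G * W) + 1000 * (27 * (G * W)) + 360 * H * (G * W)) + (real d + 11) * (G * W)"
 proof (intro add_mono mult_left_mono)
  have "real d * 1 <= real d * (G * W)" "(real d + 11) * 1 <= (real d + 11) * (G * W)"
   using GW by (intro mult_left_mono; simp)+
  then show "real d <= real d * (G * W)" "real d + 11 <= (real d + 11) * (G * W)" by simp_all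
 qed (use a b in auto)
 also have "\<dots> = (real F * (real d + 27000 + 360 * H) + real d + 11) * G * W" by (simp add: algebra_simps)
 finally show ?thesis unfolding G_def W_def H_def .
qed

lemma ex_power_2:
 assumes "1 <= n"
 shows "\<exists>e. n <= 2 ^ e & 2 ^ e < 2 * (n :: nat)"
 using assms
proof (induction n rule: dec_induct)
 case (step n)
 then obtain e where e: "n <= 2 ^ e" "2 ^ e < 2 * n" by blast
 show ?case
 proof (cases "Suc n <= 2 ^ e")
  case False
  then have "2 ^ Suc e = 2 * n" using e by simp
  then have "Suc n <= 2 ^ Suc e & 2 ^ Suc e < 2 * Suc n" using step(1) by (simp only:) simp
  then show ?thesis by blast
 qed (use e in \<open>intro exI[of _ e]; simp\<close>)
qed (auto intro: exI[of _ 0])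

lemma solvable_mono:
 assumes s: "solvable_in_soft_O I enc out T" and T: "\<And>x. x \<in> I ==> 0 <= T x & T x <= T' x"
 shows "solvable_in_soft_O I enc out T'"
proof -
 obtain prog c C k where P: "\<forall>x\<in>I. \<forall>w. c * log 2 (real (length (enc x)) + 2) <= real w &
   (\<forall>v \<in> set (enc x) \<union> set (out x). v < 2 ^ w) -->
   (\<exists>t. outputs_after w prog (enc x) (out x) t &
    real t <= C * log 2 (real (length (enc x)) + 2) ^ k * (T x + 1))"
  using s unfolding solvable_in_soft_O_def by (elim exE) (rule that)
 have "C * log 2 (real (length (enc x)) + 2) ^ k * (T x + 1) <= \<bar>C\<bar> * log 2 (real (length (enc x)) + 2) ^ k * (T' x + 1)"
  if "x \<in> I" for x
  using T[OF that] by (intro mult_mono) (auto intro!: mult_right_mono)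
 then have "\<forall>x\<in>I. \<forall>w. c * log 2 (real (length (enc x)) + 2) <= real w &
   (\<forall>v \<in> set (enc x) \<union> set (out x). v < 2 ^ w) -->
   (\<exists>t. outputs_after w prog (enc x) (out x) t &
    real t <= \<bar>C\<bar> * log 2 (real (length (enc x)) + 2) ^ k * (T' x + 1))"
  using P by (meson order_trans)
 then show ?thesis unfolding solvable_in_soft_O_def by blast
qed

section \<open>Solving type 2 instances\<close>

lemma type2_solvable:
 assumes \<tau>: "\<tau> \<in> mm_exponents" "2 <= \<tau>"
 shows "solvable_in_soft_O type2_instances ap_encode ap_output
  (\<lambda>(l, P, U, Ss). real (length P) powr (\<tau> - 1) + real (total_length Ss))"
proof -
 obtain pr c0 C0 k0 where P0: "\<forall>x\<in>mm_instances. \<forall>w. c0 * log 2 (real (length (mm_encode x)) + 2) <= real w &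
   (\<forall>v \<in> set (mm_encode x) \<union> set (mm_output x). v < 2 ^ w) -->
   (\<exists>t. outputs_after w pr (mm_encode x) (mm_output x) t &
    real t <= C0 * log 2 (real (length (mm_encode x)) + 2) ^ k0 * ((case x of (A, B) \<Rightarrow> real (dim_row A) powr \<tau>) + 1))"
  using \<tau>(1) unfolding mm_exponents_def solvable_in_soft_O_def mem_Collect_eq by (elim exE) (rule that)
 \<comment> \<open>The summand 4 makes \<open>Z\<close> at least \<open>64 * (L + 4) ^ 3\<close> and
   \<open>2 ^ w'\<close> larger than the length of a matrix input. The other summand makes
   \<open>w' = E * d\<close> at least \<open>c0\<close> times the logarithm of that input size,
   which is at most \<open>3 * E\<close>.\<close>
 define d where "d = 4 + nat \<lceil>3 * \<bar>c0\<bar>\<rceil>"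
 have d: "4 <= d" "3 * \<bar>c0\<bar> <= real d" unfolding d_def by linarith+
 define F where "F = com_len pr (main_code d) + 2"
 define C1 where "C1 = \<bar>C0\<bar>"
 have C1: "0 <= C1" by (simp add: C1_def)
 show ?thesis
  unfolding solvable_in_soft_O_def
 proof (rule exI[of _ "program d pr (main_code d) 17 3"], rule exI[of _ "24 * real d + 6"],
   rule exI[of _ "real F * (real d + 27000 + 360 * (C1 * 3 ^ k0 * 2 powr (\<tau> - 2))) + real d + 11"],
   rule exI[of _ "k0 + 2"], intro ballI allI impI)
  fix x w
  assume x: "x \<in> type2_instances"
   and w: "(24 * real d + 6) * log 2 (real (length (ap_encode x)) + 2) <= real w &
    (\<forall>v\<in>set (ap_encode x) \<union> set (ap_output x). v < 2 ^ w)"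
  obtain l P U Ss where xeq: "x = (l, P, U, Ss)" by (metis prod_cases4)
  define m where "m = length P"
  have I: "l <= m" "length U = length P" and SI: "\<forall>S\<in>set Ss. 9 / 8 * real l <= real (length S) &
    real (length S) < 5 / 4 * real l & type2 l S"
   using x by (auto simp: type2_instances_def xeq m_def)
  define xs where "xs = ap_encode x"
  define ys where "ys = ap_output x"
  define L where "L = length xs"
  define k where "k = length Ss"
  define N where "N = total_length Ss"
  define off where "off s = 3 + 2 * m + string_pos Ss s" for s
  define len where "len s = length (Ss ! s)" for s
  have str: "0 < l" "length S < 2 * l" "S ~= []" "type2 l S" if "S \<in> set Ss" for S
  proof -
   have S: "9 / 8 * real l <= real (length S)" "real (length S) < 5 / 4 * real l" "type2 l S" using SI that by auto
   then show l: "0 < l" and "type2 l S" by (cases "l = 0"; simp)+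
   then show "S ~= []" using S(1) by auto
   have "real (length S) < real (2 * l)" using S(2) by simp
   then show "length S < 2 * l" by (simp only: of_nat_less_iff)
  qed
  note nth = ap_encode_nth[OF I(2), where l = l and Ss = Ss, folded xeq, folded xs_def m_def, folded k_def N_def]
  have Leq: "L = 3 + 2 * m + (k + N)" unfolding L_def by (rule nth(1))
  have kN: "k <= N" unfolding k_def N_def by (rule length_le_total_length) (use str in blast)
  have len_ys: "length ys = m" by (simp add: ys_def ap_output_def active_prefixes_def xeq m_def del: upt_Suc)
  obtain E where E: "L + 3 <= 2 ^ E" "2 ^ E < 2 * (L + 3)" using ex_power_2[of "L + 3"] by auto
  define Z where "Z = (2 * L + 8) ^ d"
  define w' where "w' = E * d"
  have QE: "(2 :: nat) ^ w' = (2 ^ E) ^ d" by (simp add: w'_def power_mult)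
  have pw: "(2 * L + 6) ^ d <= Z" unfolding Z_def by (intro power_mono) auto
  have "((2 :: nat) ^ E) ^ d <= (2 * L + 6) ^ d" using E(2) by (intro power_mono) auto
  then have QZ: "(2 :: nat) ^ w' <= Z" using pw QE by linarith
  have Z8: "64 * Z ^ 8 <= 2 ^ w" unfolding Z_def by (rule word_size) (use w in \<open>simp add: L_def xs_def\<close>)
  have Zbig: "64 * (L + 4) ^ 3 <= Z"
  proof -
   have "64 * (L + 4) ^ 3 = 16 * (4 * (L + 4) ^ 3)" by simp
   also have "\<dots> <= 16 * ((L + 4) * (L + 4) ^ 3)" by (intro mult_le_mono) auto
   also have "\<dots> = 2 ^ 4 * (L + 4) ^ 4" by (simp add: power_eq_if)
   also have "\<dots> = (2 * L + 8) ^ 4" unfolding power_mult_distrib[symmetric] by simp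
   also have "\<dots> <= Z" unfolding Z_def using d(1) by (intro power_increasing) auto
   finally show ?thesis .
  qed
  have "1 <= (L + 4) ^ 3" by simp
  then have Z16: "16 <= Z" "1 <= Z" using Zbig by linarith+
  have Zw: "Z <= 2 ^ w"
  proof -
   have "Z <= Z ^ 8" using Z16 by (intro self_le_power) auto
   then show ?thesis using Z8 by linarith
  qed
  have w'w: "w' <= w"
  proof -
   have "(2 :: nat) ^ w' <= 2 ^ w" using QZ Zw by linarith
   then show ?thesis by simp
  qed
  define X where "X j = (if j < L then xs ! j else 0)" for j
  have xsw: "\<forall>v\<in>set xs. v < 2 ^ w" using w by (simp add: xs_def)
  have X0: "X 0 = l" "X 1 = m" "X (2 + 2 * m) = k" using nth(2,3,6) by (simp_all add: X_def Leq)
  have XP: "X (2 + i) = P ! i" if "i < m" for i using nth(4)[OF that] that by (simp add: X_def Leq)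
  have XU: "X (2 + m + i) = of_bool (U ! i)" if "i < m" for i using nth(5)[OF that] that by (simp add: X_def Leq)
  have off: "off 0 = 3 + 2 * m" "\<And>s. s < k ==> off (Suc s) = off s + 1 + len s" "off k = L"
   using string_pos_Suc[of _ Ss] length_strings[of Ss]
   by (simp_all add: off_def len_def k_def Leq N_def string_pos_def)
  have offL: "off s + 1 + len s <= L" if s: "s < k" for s
  proof -
   have "r <= r' ==> r' <= k ==> off r <= off r'" for r r'
   proof (induction r' rule: dec_induct)
    case (step n)
    then show ?case using off(2)[of n] by simp
   qed simp
   from this[of "Suc s" k] show ?thesis using off(2)[OF s] off(3) s by simp
  qed
  have XS: "X (off s + j) = (len s # Ss ! s) ! j" if s: "s < k" and j: "j <= len s" for s j
  proof -
   have "off s + j < L" using offL[OF s] j by simp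
   then have "X (off s + j) = xs ! (3 + 2 * m + string_pos Ss s + j)" by (simp only: X_def off_def if_True)
   also have "\<dots> = (len s # Ss ! s) ! j" using nth(7)[of s j] s j by (simp only: len_def)
   finally show ?thesis .
  qed
  have XL: "X (off s) = len s" if s: "s < k" for s using XS[OF s, of 0] by simp
  have XC: "X (off s + 1 + i) = Ss ! s ! i" if s: "s < k" and i: "i < len s" for s i
   using XS[OF s, of "1 + i"] i by simp
  have mem: "Ss ! s \<in> set Ss" if "s < k" for s using that by (simp add: k_def)
  have sw: "\<exists>i. i + l < len s & sper_at l X (off s + 1 + i) ~= sper_at l X (off s + 1 + i + 1)" if s: "s < k" for s
   unfolding len_def
   by (rule type2_switch[OF str(4)[OF mem[OF s]] str(1)[OF mem[OF s]]]) (use XC[OF s] in \<open>simp add: len_def\<close>)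
  interpret R: input_ram w Z pr w' X L l m k
  proof unfold_locales
   show "X j < 2 ^ w" for j using xsw Zw Z16 by (auto simp: X_def L_def)
  qed (use Z16 Z8 w'w QZ Zbig Leq I(1) X0 in \<open>auto simp: X_def\<close>)
  have arr: "R.arrays0 = input_arrays xs"
   by (auto simp: R.arrays0_def input_arrays_def X_def L_def fun_eq_iff)
  have var: "(\<lambda>_. 0)(0 := L) = input_vars xs" by (simp add: input_vars_def L_def)
  have LZ: "L < Z" using R.Z_lin by linarith
  have bd: "R.bounded ((\<lambda>_. 0)(0 := L)) R.arrays0"
   unfolding arr var by (rule R.bounded_input) (use LZ xsw L_def in auto)
  have lL: "2 * l <= L" "3 <= L" using I(1) Leq by linarith+
  have LL: "(2 * l) * (2 * l) <= L * L" using lL by (intro mult_le_mono)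
  have D: "1 + 2 * (2 * l) * (2 * l) < 2 ^ w'"
  proof -
   have "1 + 2 * ((2 * l) * (2 * l)) <= 1 + 2 * (L * L)" using LL by linarith
   also have "1 + 2 * (L * L) < (L + 3) ^ 4"
   proof -
    have "1 + 2 * (L * L) < 9 * ((L + 3) * (L + 3))" by (simp add: algebra_simps)
    also have "9 * ((L + 3) * (L + 3)) <= ((L + 3) * (L + 3)) * ((L + 3) * (L + 3))"
    proof (rule mult_le_mono1)
     have "3 * 3 <= (L + 3) * (L + 3)" by (intro mult_le_mono) auto
     then show "9 <= (L + 3) * (L + 3)" by simp
    qed
    also have "\<dots> = (L + 3) ^ 4" by (simp add: power_eq_if mult.assoc)
    finally show ?thesis .
   qed
   also have "\<dots> <= (2 ^ E) ^ 4" using E(1) by (intro power_mono) auto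
   also have "\<dots> <= (2 ^ E) ^ d" using d(1) by (intro power_increasing) auto
   finally show ?thesis unfolding QE by (simp only: mult.assoc)
  qed
  define lg where "lg = log 2 (real L + 2)"
  have lg1: "1 <= lg"
  proof -
   have "log 2 2 <= log 2 (real L + 2)" by (subst log_le_cancel_iff) auto
   then show ?thesis by (simp add: lg_def)
  qed
  have Elg: "real E <= 3 * lg"
  proof -
   have "(2 :: nat) ^ E <= 4 * (L + 2)" using E(2) by simp
   then have "real (2 ^ E) <= real (4 * (L + 2))" by (simp only: of_nat_le_iff)
   then have "log 2 (2 ^ E) <= log 2 (4 * (real L + 2))" by (subst log_le_cancel_iff) auto
   also have "\<dots> = log 2 (2 ^ 2) + lg" unfolding lg_def by (subst log_mult) auto
   also have "log 2 (2 ^ 2) = (2 :: real)" by (subst log_nat_power) auto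
   finally have "real E <= 2 + lg" by (simp add: log_nat_power)
   then show ?thesis using lg1 by linarith
  qed
  let ?y = "real (1 + 2 * (2 * l) * (2 * l)) + 2"
  have y1: "1 <= ?y" by simp
  have y3: "1 + 2 * (2 * l) * (2 * l) + 2 <= (L + 2) ^ 3"
  proof -
   have "(L + 2) ^ 3 = L * L * L + 6 * (L * L) + 12 * L + 8" by (simp add: power3_eq_cube algebra_simps)
   moreover have "2 * (2 * l) * (2 * l) = 2 * ((2 * l) * (2 * l))" by (simp only: mult.assoc)
   ultimately show ?thesis using LL by linarith
  qed
  have y_lg: "log 2 ?y <= 3 * lg"
  proof -
   have "real (1 + 2 * (2 * l) * (2 * l) + 2) <= real ((L + 2) ^ 3)" using y3 by (simp only: of_nat_le_iff)
   then have "?y <= (real L + 2) ^ 3" by (simp only: of_nat_add of_nat_power of_nat_numeral)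
   then have "log 2 ?y <= log 2 ((real L + 2) ^ 3)"
    using y1 by (subst log_le_cancel_iff) (linarith | simp)+
   also have "\<dots> = 3 * lg" unfolding lg_def by (subst log_nat_power) auto
   finally show ?thesis .
  qed
  have y_E: "log 2 ?y <= 3 * real E"
  proof -
   have "(L + 2) ^ 3 <= (2 ^ E) ^ 3" using E(1) by (intro power_mono) auto
   then have "1 + 2 * (2 * l) * (2 * l) + 2 <= (2 ^ E) ^ 3" using y3 by linarith
   then have "real (1 + 2 * (2 * l) * (2 * l) + 2) <= real ((2 ^ E) ^ 3)" by (simp only: of_nat_le_iff)
   then have "?y <= 2 ^ (E * 3)" by (simp only: of_nat_add of_nat_power of_nat_numeral power_mult)
   then have "log 2 ?y <= log 2 (2 ^ (E * 3))"
    using y1 by (subst log_le_cancel_iff) (linarith | simp)+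
   also have "\<dots> = 3 * real E" by (subst log_nat_power) auto
   finally show ?thesis .
  qed
  have y_0: "0 <= log 2 ?y" using y1 by (subst zero_le_log_cancel_iff) linarith+
  \<comment> \<open>One bound for all products: their logarithms are replaced by
    \<open>3 * lg\<close>, the constant by its absolute value, and the result is rounded down to a
    number of steps.\<close>
  define Tr where "Tr = C1 * (3 * lg) ^ k0 * (real (2 * l) powr \<tau> + 1)"
  define Tm where "Tm = nat \<lfloor>Tr\<rfloor>"
  have Tr0: "0 <= Tr" using C1 lg1 by (simp add: Tr_def)
  have TmTr: "real Tm <= Tr" unfolding Tm_def using Tr0 by linarith
  have mm: "\<exists>t\<le>Tm. outputs_after w' pr (mm_input (2 * l) \<alpha> \<beta>) (mm_result (2 * l) \<alpha> \<beta>) t"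
   if ab: "\<forall>i. \<alpha> i <= 1" "\<forall>i. \<beta> i <= 1" for \<alpha> \<beta> :: "nat \<Rightarrow> nat"
  proof -
   obtain A B where AB: "(A, B) \<in> mm_instances" "mm_encode (A, B) = mm_input (2 * l) \<alpha> \<beta>"
    "mm_output (A, B) = mm_result (2 * l) \<alpha> \<beta>" "dim_row A = 2 * l" using mm_instance by blast
   have "c0 * log 2 ?y <= \<bar>c0\<bar> * (3 * real E)" using y_E y_0 by (intro mult_mono) auto
   also have "\<dots> = 3 * \<bar>c0\<bar> * real E" by simp
   also have "\<dots> <= real d * real E" using d(2) by (rule mult_right_mono) simp
   finally have c: "c0 * log 2 ?y <= real w'" by (simp add: w'_def mult.commute)
   have l2: "max (2 * l) 1 < 2 ^ w'"
   proof -
    have "2 * l <= 2 * (2 * l) * (2 * l)" by (cases l) auto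
    then show ?thesis using D by linarith
   qed
   have v: "v < 2 ^ w'" if "v \<in> set (mm_input (2 * l) \<alpha> \<beta>) \<union> set (mm_result (2 * l) \<alpha> \<beta>)" for v
   proof -
    have "v <= max (2 * l) 1"
     using that mm_result_le[OF ab, of v "2 * l"] ab by (auto simp: mm_input_def le_max_iff_disj)
    then show ?thesis using l2 by linarith
   qed
   obtain t where t: "outputs_after w' pr (mm_input (2 * l) \<alpha> \<beta>) (mm_result (2 * l) \<alpha> \<beta>) t"
    "real t <= C0 * log 2 ?y ^ k0 * (real (2 * l) powr \<tau> + 1)"
    using P0[rule_format, OF AB(1), of w'] c v unfolding AB(2,3) length_mm_input prod.case AB(4) by blast
   have "C0 * log 2 ?y ^ k0 * (real (2 * l) powr \<tau> + 1) <= Tr"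
    unfolding Tr_def C1_def using y_lg y_0 lg1 by (intro mult_right_mono mult_mono power_mono) auto
   then have "t <= Tm" unfolding Tm_def using t(2) by (intro le_nat_floor) linarith
   then show ?thesis using t(1) by blast
  qed
  \<comment> \<open>The number of products depends on the run; its largest possible value makes the
    bound on the clock known in advance.\<close>
  define Bx where "Bx = (5 * m * (E * E)) div (l * l)"
  have Bx: "Bx * (l * l) <= 5 * m * (E * E)" "l = 0 --> Bx = 0" by (simp_all add: Bx_def)
  define T where "T = d + 1000 * (L * (E * E)) + Bx * Tm"
  have U1: "\<forall>i<m. X (2 + m + i) <= 1" using XU by simp
  have len2: "s < k ==> len s < 2 * l" for s using str(2)[OF mem] by (simp add: len_def)
  have out: "ys ! i = of_bool (\<exists>s<k. \<exists>b\<ge>1. b + len s <= m & X (1 + m + b) ~= 0 &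
    (\<forall>x<len s. X (off s + 1 + x) = X (2 + b + x)) & i + 1 = b + len s)" if i: "i < m" for i
  proof -
   have Ub: "U ! (b - 1) \<longleftrightarrow> X (1 + m + b) ~= 0" if "1 <= b" "b + len s <= m" for b s
    using XU[of "b - 1"] that by (cases b) auto
   have Pb: "(\<forall>x<len s. Ss ! s ! x = P ! (b + x)) \<longleftrightarrow> (\<forall>x<len s. X (off s + 1 + x) = X (2 + b + x))"
    if "s < k" "b + len s <= m" for b s
   proof -
    have "X (off s + 1 + x) = Ss ! s ! x & X (2 + b + x) = P ! (b + x)" if "x < len s" for x
     using XC[OF \<open>s < k\<close> that] XP[of "b + x"] that \<open>b + len s <= m\<close> by (simp add: add.assoc)
    then show ?thesis by simp
   qed
   have "(\<exists>s<k. \<exists>b\<ge>1. b + len s <= m & U ! (b - 1) & (\<forall>x<len s. Ss ! s ! x = P ! (b + x)) & i + 1 = b + len s) \<longleftrightarrow>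
    (\<exists>s<k. \<exists>b\<ge>1. b + len s <= m & X (1 + m + b) ~= 0 &
    (\<forall>x<len s. X (off s + 1 + x) = X (2 + b + x)) & i + 1 = b + len s)"
    using Ub Pb by (intro arg_cong[where f = Ex] ext conj_cong refl) auto
   then show ?thesis
    using ap_output_nth[of i P l U Ss] i unfolding ys_def xeq k_def len_def m_def by simp
  qed
  have wp: "R.wp (main_code d) (\<lambda>t v a. t <= T & v 3 = length ys & (\<forall>i<length ys. a 17 0 i = ys ! i)) 0
    (input_vars xs) (input_arrays xs)"
  proof (rule R.wp_mono[OF R.main_correct[OF pw QE E U1 bd off XL len2 sw D mm, unfolded arr var]])
   fix t and v :: vars and a :: arrays
   assume A: "v 3 = m &
    (\<exists>B. t <= d + 1000 * (L * (E * E)) + B * Tm & B * (l * l) <= 5 * m * (E * E) & (l = 0 --> B = 0)) &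
    (\<forall>i<m. a 17 0 i = of_bool (\<exists>s<k. \<exists>b\<ge>1. b + len s <= m & X (1 + m + b) ~= 0 &
     (\<forall>x<len s. X (off s + 1 + x) = X (2 + b + x)) & i + 1 = b + len s))"
   then obtain B where B: "t <= d + 1000 * (L * (E * E)) + B * Tm" "B * (l * l) <= 5 * m * (E * E)" "l = 0 --> B = 0"
    by blast
   have "B <= Bx"
   proof (cases "l = 0")
    case False
    then show ?thesis using B(2) by (simp add: Bx_def less_eq_div_iff_mult_less_eq)
   qed (use B in simp)
   then have "B * Tm <= Bx * Tm" by (rule mult_le_mono1)
   then have "t <= T" using B(1) unfolding T_def by linarith
   moreover have "\<forall>i<m. a 17 0 i = ys ! i"
   proof (intro allI impI)
    fix i assume i: "i < m"
    show "a 17 0 i = ys ! i" unfolding out[OF i] using A i by blast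
   qed
   ultimately show "t <= T & v 3 = length ys & (\<forall>i<length ys. a 17 0 i = ys ! i)"
    using A unfolding len_ys by blast
  qed
  have "\<exists>t. outputs_after w (program d pr (main_code d) 17 3) xs ys t & t <= (com_len pr (main_code d) + 2) * T + (d + 11)"
   by (rule program_correct[OF R.word_ram_sub_axioms Z_def[unfolded L_def] _ xsw wf_main_code _ _ wp]) (use d in auto)
  then obtain t where t: "outputs_after w (program d pr (main_code d) 17 3) xs ys t" "t <= F * T + (d + 11)"
   unfolding F_def by blast
  have "real t <= (real F * (real d + 27000 + 360 * (C1 * 3 ^ k0 * 2 powr (\<tau> - 2))) + real d + 11) *
   lg ^ (k0 + 2) * (real m powr (\<tau> - 1) + real N + 1)"
  proof (rule real_time_bound[OF t(2)[unfolded T_def] Bx I(1) _ Elg lg1 \<tau>(2) C1])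
   show "L <= 3 + 2 * m + 2 * N" using Leq kN by linarith
   show "real Tm <= C1 * (3 * lg) ^ k0 * (real (2 * l) powr \<tau> + 1)" using TmTr by (simp only: Tr_def)
  qed
  then show "\<exists>t. outputs_after w (program d pr (main_code d) 17 3) (ap_encode x) (ap_output x) t &
    real t <= (real F * (real d + 27000 + 360 * (C1 * 3 ^ k0 * 2 powr (\<tau> - 2))) + real d + 11) *
     log 2 (real (length (ap_encode x)) + 2) ^ (k0 + 2) *
     ((case x of (l, P, U, Ss) \<Rightarrow> real (length P) powr (\<tau> - 1) + real (total_length Ss)) + 1)"
   using t(1) unfolding xs_def[symmetric] ys_def[symmetric] L_def[symmetric] lg_def[symmetric]
   unfolding xeq prod.case m_def[symmetric] N_def[symmetric] by blast
 qed
qed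

text \<open>The exponent is an infimum that need not be achieved, which is the reason for the two
  parts. In the first, some achievable \<open>\<tau>\<close> lies below
  \<open>mm_exponent + \<epsilon>\<close>, and the algorithm for this \<open>\<tau>\<close> is used;
  in the second, \<open>mm_exponent\<close> itself can be taken.\<close>

theorem theorem5:
 "(\<forall>\<epsilon>>0. solvable_in_soft_O type2_instances ap_encode ap_output
    (\<lambda>(l, P, U, Ss). real (length P) powr (mm_exponent + \<epsilon> - 1) + real (total_length Ss))) &
  (mm_exponent \<in> mm_exponents -->
   solvable_in_soft_O type2_instances ap_encode ap_output
    (\<lambda>(l, P, U, Ss). real (length P) powr (mm_exponent - 1) + real (total_length Ss)))"
proof (intro conjI allI impI)
 fix \<epsilon> :: real assume "0 < \<epsilon>"
 then have "Inf mm_exponents < mm_exponent + \<epsilon>" by (simp add: mm_exponent_def)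
 then obtain \<tau> where \<tau>: "\<tau> \<in> mm_exponents" "\<tau> < mm_exponent + \<epsilon>"
  using cInf_lessD[OF mm_exponents_nonempty] by blast
 show "solvable_in_soft_O type2_instances ap_encode ap_output
    (\<lambda>(l, P, U, Ss). real (length P) powr (mm_exponent + \<epsilon> - 1) + real (total_length Ss))"
 proof (rule solvable_mono[OF type2_solvable[OF \<tau>(1) mm_exponents_ge_2[OF \<tau>(1)]]])
  fix x :: ap_instance
  obtain l P U Ss where x: "x = (l, P, U, Ss)" by (metis prod_cases4)
  have "real (length P) powr (\<tau> - 1) <= real (length P) powr (mm_exponent + \<epsilon> - 1)"
  proof (cases "P = []")
   case False
   then have "1 <= real (length P)" by (simp add: Suc_le_eq)
   then show ?thesis using \<tau>(2) by (intro powr_mono) auto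
  qed simp
  then show "0 <= (case x of (l, P, U, Ss) \<Rightarrow> real (length P) powr (\<tau> - 1) + real (total_length Ss)) &
   (case x of (l, P, U, Ss) \<Rightarrow> real (length P) powr (\<tau> - 1) + real (total_length Ss)) \<le>
   (case x of (l, P, U, Ss) \<Rightarrow> real (length P) powr (mm_exponent + \<epsilon> - 1) + real (total_length Ss))"
   by (simp add: x)
 qed
next
 assume "mm_exponent \<in> mm_exponents"
 then show "solvable_in_soft_O type2_instances ap_encode ap_output
    (\<lambda>(l, P, U, Ss). real (length P) powr (mm_exponent - 1) + real (total_length Ss))"
  using type2_solvable mm_exponents_ge_2 by blast
qed

end
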